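(* Let $p\in\mathbb Z_{>0}$ and $q=e^{i\pi/p}$. Let $\mathsf S\subset\mathbb Z$ be any subset such that the canonical surjection $\mathbb Z\to\mathbb Z_{2p}$ restricts to a bijection $\mathsf S\to\mathbb Z_{2p}$, and let $\zeta_{a,b}\in\mathbb C^\times$ ($a,b\in\mathsf S$) satisfy $\zeta_{a,[\![0]\!]}=1=\zeta_{[\![0]\!],a}$ for all $a\in\mathsf S$, where $[\![x]\!]\in\mathsf S$ denotes the representative of $x\in\mathbb Z$ modulo $2p$. Let $\mathrm{Rep}^{\mathrm{fd}}\,\mathbb C\mathbb Z_{2p}^\omega$ be the ribbon category of finite-dimensional $\mathbb C\mathbb Z_{2p}$-modules with associator, braiding and twist given by $\Phi,R,\boldsymbol v$ (see context), and let $\mathcal M$ be the ribbon category of finitely generated local $\Lambda$-modules in the category $\mathcal H^\oplus$ of $\mathbb C$-graded vector spaces. Then the functor $\mathcal F:\mathrm{Rep}^{\mathrm{fd}}\,\mathbb C\mathbb Z_{2p}^\omega\to\mathcal M$, $M\mapsto\Lambda\otimes_{\mathbb C}M$, $f\mapsto\mathrm{id}_\Lambda\otimes f$, equipped with the isomorphisms $$\mathcal F_{M,N}:\mathcal F(M)\otimes_\Lambda\mathcal F(N)\to\mathcal F(M\otimes N),\quad(1_k\otimes e_am)\otimes_\Lambda(1_l\otimes e_bn)\mapsto(-1)^{al}\zeta_{a,b}\,1_{k+l+\kappa(a,b)}\otimes(e_am\otimes e_bn)$$ ($a,b\in\mathsf S$, $k,l\in\mathbb Z$), is a ribbon equivale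nce.
   Context: $q^z:=e^{i\pi z/p}$, and $\kappa(a,b)=\frac{a+b-[\![a+b]\!]}{2p}\in\mathbb Z$. $\mathcal H^\oplus$: $\mathbb C$-graded vector spaces of at most countable total dimension; $H_V$ denotes the degree map of $V$. It is balanced braided monoidal with trivial associator, braiding $c_{U,V}=\tau_{U,V}\circ e^{\frac{\pi i}{2p}H_U\otimes H_V}$ ($\tau$ the flip) and balancing $\theta_U=e^{\frac{\pi i}{2p}H_U^2}$. Objects with duals are the finite-dimensional ones. $\Lambda=\bigoplus_{k\in\mathbb Z}\mathbb C1_k$ with $1_k$ of degree $2pk$, product $1_k1_l=1_{k+l}$ and unit $1_0$, is a commutative algebra in $\mathcal H^\oplus$. A $\Lambda$-module $(M,\rho)$ in $\mathcal H^\oplus$ is local if $\rho\circ c_{M,\Lambda}\circ c_{\Lambda,M}=\rho$, and finitely generated if there is a surjective $\Lambda$-module morphism $\Lambda\otimes X\to M$ with $X$ finite-dimensional. $\mathcal M$ has tensor product $\otimes_\Lambda$ (right action $\rho\circ c_{M,\Lambda}$) and associator, braiding, twist induced from $\mathcal H^\oplus$. $\mathbb C\mathbb Z_{2p}$ is generated by $K$ with $K^{2p}=\mathbf 1$, with coproduct $\Delta(K)=K\otimes K$, counit $\varepsilon(K)=1$, and idempotents $e_n=\frac1{2p}\sum_{l=0}^{2p-1}q^{-nl}K^l$ ($n$ modulo $2p$), so $Ke_n=q^ne_n$. On $\mathcal F(M)=\Lambda\otimes_{\mathbb C}M$ the degree map is $H(1_k\otimes e_am)=(2pk+[\![a]\!])\,1_k\otimes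 e_am$ and $\Lambda$ acts by left multiplication. The ribbon structure of $\mathrm{Rep}^{\mathrm{fd}}\,\mathbb C\mathbb Z_{2p}^\omega$: tensor product via $\Delta$; associator $U\otimes(V\otimes W)\to(U\otimes V)\otimes W$ given by acting with $$\Phi=\sum_{a,b,c\in\mathsf S}(-1)^{a\kappa(b,c)}\frac{\zeta_{a,b}\,\zeta_{[\![a+b]\!],c}}{\zeta_{b,c}\,\zeta_{a,[\![b+c]\!]}}\,e_a\otimes e_b\otimes e_c;$$ unit isomorphisms those of vector spaces; braiding $\tau\circ R$ with $R=\sum_{a,b\in\mathsf S}q^{\frac12ab}\frac{\zeta_{b,a}}{\zeta_{a,b}}e_a\otimes e_b$; twist $\theta=\boldsymbol v^{-1}.(-)$ with $\boldsymbol v=\sum_{a\in\mathbb Z_{2p}}q^{-\frac12a^2}e_a$.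
   Formalization: It is assumed that 4p divides [[0]]; otherwise (e.g. S={1,…,2p}) the associator Φ with the vector-space unit isomorphisms violates the triangle axiom, so the source is not monoidal. Vector spaces are taken as subspaces of finitely supported complex sequences. *)

theory Defs
  imports "HOL-Analysis.Complex_Transcendental" "HOL-Library.FuncSet" "HOL-Library.Nat_Bijection" "HOL-Library.Poly_Mapping"
begin

section \<open>Ribbon categories and ribbon equivalences\<close>

record ('o, 'm) cat =
  Obj :: "'o set"
  Arr :: "'m set"
  Dom :: "'m \<Rightarrow> 'o"
  Cod :: "'m \<Rightarrow> 'o"
  Id :: "'o \<Rightarrow> 'm"
  Comp :: "'m \<Rightarrow> 'm \<Rightarrow> 'm"  (infixr "\<cdot>\<index>" 55)

record ('o, 'm) moncat = "('o, 'm) cat" +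
  TensO :: "'o \<Rightarrow> 'o \<Rightarrow> 'o"  (infixr "\<otimes>\<index>" 70)
  TensA :: "'m \<Rightarrow> 'm \<Rightarrow> 'm"  (infixr "\<odot>\<index>" 70)
  Unit :: "'o"  ("\<one>\<index>")
  Assoc :: "'o \<Rightarrow> 'o \<Rightarrow> 'o \<Rightarrow> 'm"
  LUnit :: "'o \<Rightarrow> 'm"
  RUnit :: "'o \<Rightarrow> 'm"

record ('o, 'm) balcat = "('o, 'm) moncat" +
  Braid :: "'o \<Rightarrow> 'o \<Rightarrow> 'm"
  Twist :: "'o \<Rightarrow> 'm"

definition cat_hom :: "('o, 'm, 'z) cat_scheme \<Rightarrow> 'o \<Rightarrow> 'o \<Rightarrow> 'm set" where
  "cat_hom C X Y = {f \<in> Arr C. Dom C f = X \<and> Cod C f = Y}"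

definition inverse_arrows :: "('o, 'm, 'z) cat_scheme \<Rightarrow> 'm \<Rightarrow> 'm \<Rightarrow> bool" where
  "inverse_arrows C f g \<longleftrightarrow> f \<in> Arr C \<and> g \<in> cat_hom C (Cod C f) (Dom C f) \<and>
     g \<cdot>\<^bsub>C\<^esub> f = Id C (Dom C f) \<and> f \<cdot>\<^bsub>C\<^esub> g = Id C (Cod C f)"

definition cat_iso :: "('o, 'm, 'z) cat_scheme \<Rightarrow> 'o \<Rightarrow> 'o \<Rightarrow> 'm set" where
  "cat_iso C X Y = {f \<in> cat_hom C X Y. \<exists>g. inverse_arrows C f g}"

definition inv_arrow :: "('o, 'm, 'z) cat_scheme \<Rightarrow> 'm \<Rightarrow> 'm" where
  "inv_arrow C f = (THE g. inverse_arrows C f g)"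

locale category =
  fixes C :: "('o, 'm, 'z) cat_scheme" (structure)
  assumes Dom_Obj: "f \<in> Arr C \<Longrightarrow> Dom C f \<in> Obj C"
    and Cod_Obj: "f \<in> Arr C \<Longrightarrow> Cod C f \<in> Obj C"
    and Id_hom: "X \<in> Obj C \<Longrightarrow> Id C X \<in> cat_hom C X X"
    and Comp_hom: "\<lbrakk>f \<in> cat_hom C X Y; g \<in> cat_hom C Y Z\<rbrakk> \<Longrightarrow> g \<cdot> f \<in> cat_hom C X Z"
    and Comp_Id: "f \<in> cat_hom C X Y \<Longrightarrow> f \<cdot> Id C X = f"
    and Id_Comp: "f \<in> cat_hom C X Y \<Longrightarrow> Id C Y \<cdot> f = f"
    and Comp_assoc: "\<lbrakk>f \<in> cat_hom C X Y; g \<in> cat_hom C Y Z; h \<in> cat_hom C Z W\<rbrakk> \<Longrightarrow> (h \<cdot> g) \<cdot> f = h \<cdot> (g \<cdot> f)"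

text \<open>The associator is oriented as \<open>X \<otimes> (Y \<otimes> Z) \<rightarrow> (X \<otimes> Y) \<otimes> Z\<close> throughout.\<close>

locale monoidal_category = category C
  for C :: "('o, 'm, 'z) moncat_scheme" (structure) +
  assumes TensO_Obj: "\<lbrakk>X \<in> Obj C; Y \<in> Obj C\<rbrakk> \<Longrightarrow> X \<otimes> Y \<in> Obj C"
    and TensA_hom: "\<lbrakk>f \<in> cat_hom C X X'; g \<in> cat_hom C Y Y'\<rbrakk> \<Longrightarrow> f \<odot> g \<in> cat_hom C (X \<otimes> Y) (X' \<otimes> Y')"
    and TensA_Id: "\<lbrakk>X \<in> Obj C; Y \<in> Obj C\<rbrakk> \<Longrightarrow> Id C X \<odot> Id C Y = Id C (X \<otimes> Y)"
    and TensA_Comp: "\<lbrakk>f \<in> cat_hom C X X'; f' \<in> cat_hom C X' X''; g \<in> cat_hom C Y Y'; g' \<in> cat_hom C Y' Y''\<rbrakk>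
          \<Longrightarrow> (f' \<cdot> f) \<odot> (g' \<cdot> g) = (f' \<odot> g') \<cdot> (f \<odot> g)"
    and Unit_Obj: "\<one> \<in> Obj C"
    and Assoc_iso: "\<lbrakk>X \<in> Obj C; Y \<in> Obj C; Z \<in> Obj C\<rbrakk>
          \<Longrightarrow> Assoc C X Y Z \<in> cat_iso C (X \<otimes> (Y \<otimes> Z)) ((X \<otimes> Y) \<otimes> Z)"
    and Assoc_natural: "\<lbrakk>f \<in> cat_hom C X X'; g \<in> cat_hom C Y Y'; h \<in> cat_hom C Z Z'\<rbrakk>
          \<Longrightarrow> Assoc C X' Y' Z' \<cdot> (f \<odot> (g \<odot> h)) = ((f \<odot> g) \<odot> h) \<cdot> Assoc C X Y Z"
    and LUnit_iso: "X \<in> Obj C \<Longrightarrow> LUnit C X \<in> cat_iso C (\<one> \<otimes> X) X"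
    and LUnit_natural: "f \<in> cat_hom C X X' \<Longrightarrow> LUnit C X' \<cdot> (Id C \<one> \<odot> f) = f \<cdot> LUnit C X"
    and RUnit_iso: "X \<in> Obj C \<Longrightarrow> RUnit C X \<in> cat_iso C (X \<otimes> \<one>) X"
    and RUnit_natural: "f \<in> cat_hom C X X' \<Longrightarrow> RUnit C X' \<cdot> (f \<odot> Id C \<one>) = f \<cdot> RUnit C X"
    and pentagon: "\<lbrakk>X \<in> Obj C; Y \<in> Obj C; Z \<in> Obj C; W \<in> Obj C\<rbrakk>
          \<Longrightarrow> Assoc C (X \<otimes> Y) Z W \<cdot> Assoc C X Y (Z \<otimes> W)
            = (Assoc C X Y Z \<odot> Id C W) \<cdot> Assoc C X (Y \<otimes> Z) W \<cdot> (Id C X \<odot> Assoc C Y Z W)"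
    and triangle: "\<lbrakk>X \<in> Obj C; Y \<in> Obj C\<rbrakk>
          \<Longrightarrow> (RUnit C X \<odot> Id C Y) \<cdot> Assoc C X \<one> Y = Id C X \<odot> LUnit C Y"

locale balanced_category = monoidal_category C
  for C :: "('o, 'm, 'z) balcat_scheme" (structure) +
  assumes Braid_iso: "\<lbrakk>X \<in> Obj C; Y \<in> Obj C\<rbrakk> \<Longrightarrow> Braid C X Y \<in> cat_iso C (X \<otimes> Y) (Y \<otimes> X)"
    and Braid_natural: "\<lbrakk>f \<in> cat_hom C X X'; g \<in> cat_hom C Y Y'\<rbrakk>
          \<Longrightarrow> Braid C X' Y' \<cdot> (f \<odot> g) = (g \<odot> f) \<cdot> Braid C X Y"
    and hexagon1: "\<lbrakk>X \<in> Obj C; Y \<in> Obj C; Z \<in> Obj C\<rbrakk>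
          \<Longrightarrow> Braid C X (Y \<otimes> Z) = Assoc C Y Z X \<cdot> (Id C Y \<odot> Braid C X Z)
                \<cdot> inv_arrow C (Assoc C Y X Z) \<cdot> (Braid C X Y \<odot> Id C Z) \<cdot> Assoc C X Y Z"
    and hexagon2: "\<lbrakk>X \<in> Obj C; Y \<in> Obj C; Z \<in> Obj C\<rbrakk>
          \<Longrightarrow> Braid C (X \<otimes> Y) Z = inv_arrow C (Assoc C Z X Y) \<cdot> (Braid C X Z \<odot> Id C Y)
                \<cdot> Assoc C X Z Y \<cdot> (Id C X \<odot> Braid C Y Z) \<cdot> inv_arrow C (Assoc C X Y Z)"
    and Twist_iso: "X \<in> Obj C \<Longrightarrow> Twist C X \<in> cat_iso C X X"
    and Twist_natural: "f \<in> cat_hom C X Y \<Longrightarrow> Twist C Y \<cdot> f = f \<cdot> Twist C X"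
    and Twist_tensor: "\<lbrakk>X \<in> Obj C; Y \<in> Obj C\<rbrakk>
          \<Longrightarrow> Twist C (X \<otimes> Y) = Braid C Y X \<cdot> Braid C X Y \<cdot> (Twist C X \<odot> Twist C Y)"

definition is_dual :: "('o, 'm, 'z) moncat_scheme \<Rightarrow> 'o \<Rightarrow> 'o \<Rightarrow> 'm \<Rightarrow> 'm \<Rightarrow> bool" where
  "is_dual C X D ev coev \<longleftrightarrow> D \<in> Obj C \<and>
     ev \<in> cat_hom C (D \<otimes>\<^bsub>C\<^esub> X) \<one>\<^bsub>C\<^esub> \<and> coev \<in> cat_hom C \<one>\<^bsub>C\<^esub> (X \<otimes>\<^bsub>C\<^esub> D) \<and>
     RUnit C X \<cdot>\<^bsub>C\<^esub> (Id C X \<odot>\<^bsub>C\<^esub> ev) \<cdot>\<^bsub>C\<^esub> inv_arrow C (Assoc C X D X) \<cdot>\<^bsub>C\<^esub> (coev \<odot>\<^bsub>C\<^esub> Id C X) = LUnit C X \<and>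
     LUnit C D \<cdot>\<^bsub>C\<^esub> (ev \<odot>\<^bsub>C\<^esub> Id C D) \<cdot>\<^bsub>C\<^esub> Assoc C D X D \<cdot>\<^bsub>C\<^esub> (Id C D \<odot>\<^bsub>C\<^esub> coev) = RUnit C D"

text \<open>The last equation of \<open>rigid\<close> says that the twist of the dual is the dual of the twist.\<close>

locale ribbon_category = balanced_category C
  for C :: "('o, 'm, 'z) balcat_scheme" (structure) +
  assumes rigid: "X \<in> Obj C \<Longrightarrow> \<exists>D ev coev. is_dual C X D ev coev \<and>
            (Twist C X \<odot> Id C D) \<cdot> coev = (Id C X \<odot> Twist C D) \<cdot> coev"

locale category_functor = C: category C + D: category D
  for C :: "('o, 'm, 'z) cat_scheme" and D :: "('p, 'n, 'y) cat_scheme"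
    and Fo :: "'o \<Rightarrow> 'p" and Fa :: "'m \<Rightarrow> 'n" +
  assumes Fo_Obj: "X \<in> Obj C \<Longrightarrow> Fo X \<in> Obj D"
    and Fa_hom: "f \<in> cat_hom C X Y \<Longrightarrow> Fa f \<in> cat_hom D (Fo X) (Fo Y)"
    and Fa_Id: "X \<in> Obj C \<Longrightarrow> Fa (Id C X) = Id D (Fo X)"
    and Fa_Comp: "\<lbrakk>f \<in> cat_hom C X Y; g \<in> cat_hom C Y Z\<rbrakk> \<Longrightarrow> Fa (g \<cdot>\<^bsub>C\<^esub> f) = Fa g \<cdot>\<^bsub>D\<^esub> Fa f"

definition natural_iso ::
  "('o, 'm, 'z) cat_scheme \<Rightarrow> ('p, 'n, 'y) cat_scheme \<Rightarrow> ('o \<Rightarrow> 'p) \<Rightarrow> ('m \<Rightarrow> 'n) \<Rightarrow>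
   ('o \<Rightarrow> 'p) \<Rightarrow> ('m \<Rightarrow> 'n) \<Rightarrow> ('o \<Rightarrow> 'n) \<Rightarrow> bool" where
  "natural_iso C D Fo Fa Go Ga \<eta> \<longleftrightarrow>
     (\<forall>X \<in> Obj C. \<eta> X \<in> cat_iso D (Fo X) (Go X)) \<and>
     (\<forall>X Y. \<forall>f \<in> cat_hom C X Y. \<eta> Y \<cdot>\<^bsub>D\<^esub> Fa f = Ga f \<cdot>\<^bsub>D\<^esub> \<eta> X)"

locale category_equivalence = category_functor C D Fo Fa
  for C :: "('o, 'm, 'z) cat_scheme" and D :: "('p, 'n, 'y) cat_scheme" and Fo Fa +
  assumes quasi_inverse: "\<exists>Go Ga \<eta> \<epsilon>. category_functor D C Go Ga \<and>
            natural_iso C C (\<lambda>X. X) (\<lambda>f. f) (\<lambda>X. Go (Fo X)) (\<lambda>f. Ga (Fa f)) \<eta> \<and>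
            natural_iso D D (\<lambda>X. Fo (Go X)) (\<lambda>f. Fa (Ga f)) (\<lambda>X. X) (\<lambda>f. f) \<epsilon>"

locale monoidal_functor = C: monoidal_category C + D: monoidal_category D + category_functor C D Fo Fa
  for C :: "('o, 'm, 'z) moncat_scheme" and D :: "('p, 'n, 'y) moncat_scheme" and Fo Fa +
  fixes J :: "'o \<Rightarrow> 'o \<Rightarrow> 'n"
  assumes J_iso: "\<lbrakk>X \<in> Obj C; Y \<in> Obj C\<rbrakk> \<Longrightarrow> J X Y \<in> cat_iso D (Fo X \<otimes>\<^bsub>D\<^esub> Fo Y) (Fo (X \<otimes>\<^bsub>C\<^esub> Y))"
    and J_natural: "\<lbrakk>f \<in> cat_hom C X X'; g \<in> cat_hom C Y Y'\<rbrakk>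
          \<Longrightarrow> J X' Y' \<cdot>\<^bsub>D\<^esub> (Fa f \<odot>\<^bsub>D\<^esub> Fa g) = Fa (f \<odot>\<^bsub>C\<^esub> g) \<cdot>\<^bsub>D\<^esub> J X Y"
    and J_Assoc: "\<lbrakk>X \<in> Obj C; Y \<in> Obj C; Z \<in> Obj C\<rbrakk>
          \<Longrightarrow> Fa (Assoc C X Y Z) \<cdot>\<^bsub>D\<^esub> J X (Y \<otimes>\<^bsub>C\<^esub> Z) \<cdot>\<^bsub>D\<^esub> (Id D (Fo X) \<odot>\<^bsub>D\<^esub> J Y Z)
            = J (X \<otimes>\<^bsub>C\<^esub> Y) Z \<cdot>\<^bsub>D\<^esub> (J X Y \<odot>\<^bsub>D\<^esub> Id D (Fo Z)) \<cdot>\<^bsub>D\<^esub> Assoc D (Fo X) (Fo Y) (Fo Z)"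
    and J_Unit: "\<exists>\<phi> \<in> cat_iso D \<one>\<^bsub>D\<^esub> (Fo \<one>\<^bsub>C\<^esub>). \<forall>X \<in> Obj C.
            Fa (LUnit C X) \<cdot>\<^bsub>D\<^esub> J \<one>\<^bsub>C\<^esub> X \<cdot>\<^bsub>D\<^esub> (\<phi> \<odot>\<^bsub>D\<^esub> Id D (Fo X)) = LUnit D (Fo X) \<and>
            Fa (RUnit C X) \<cdot>\<^bsub>D\<^esub> J X \<one>\<^bsub>C\<^esub> \<cdot>\<^bsub>D\<^esub> (Id D (Fo X) \<odot>\<^bsub>D\<^esub> \<phi>) = RUnit D (Fo X)"

locale ribbon_functor = C: ribbon_category C + D: ribbon_category D + monoidal_functor C D Fo Fa J
  for C :: "('o, 'm, 'z) balcat_scheme" and D :: "('p, 'n, 'y) balcat_scheme" and Fo Fa J +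
  assumes J_Braid: "\<lbrakk>X \<in> Obj C; Y \<in> Obj C\<rbrakk>
          \<Longrightarrow> Fa (Braid C X Y) \<cdot>\<^bsub>D\<^esub> J X Y = J Y X \<cdot>\<^bsub>D\<^esub> Braid D (Fo X) (Fo Y)"
    and Fa_Twist: "X \<in> Obj C \<Longrightarrow> Fa (Twist C X) = Twist D (Fo X)"

locale ribbon_equivalence = ribbon_functor C D Fo Fa J + category_equivalence C D Fo Fa
  for C :: "('o, 'm, 'z) balcat_scheme" and D :: "('p, 'n, 'y) balcat_scheme" and Fo Fa J


section \<open>Local modules over an algebra in a balanced category\<close>

datatype ('o, 'f) arrow = Arrow (src: 'o) (amap: 'f) (tgt: 'o)

record ('o, 'm) alg =
  algO :: "'o"
  algMul :: "'m"
  algUnit :: "'m"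

definition is_module :: "('o, 'm, 'z) moncat_scheme \<Rightarrow> ('o, 'm) alg \<Rightarrow> 'o \<times> 'm \<Rightarrow> bool" where
  "is_module C A M \<longleftrightarrow> fst M \<in> Obj C \<and> snd M \<in> cat_hom C (algO A \<otimes>\<^bsub>C\<^esub> fst M) (fst M) \<and>
     snd M \<cdot>\<^bsub>C\<^esub> (Id C (algO A) \<odot>\<^bsub>C\<^esub> snd M)
       = snd M \<cdot>\<^bsub>C\<^esub> (algMul A \<odot>\<^bsub>C\<^esub> Id C (fst M)) \<cdot>\<^bsub>C\<^esub> Assoc C (algO A) (algO A) (fst M) \<and>
     snd M \<cdot>\<^bsub>C\<^esub> (algUnit A \<odot>\<^bsub>C\<^esub> Id C (fst M)) = LUnit C (fst M)"

definition is_local :: "('o, 'm, 'z) balcat_scheme \<Rightarrow> ('o, 'm) alg \<Rightarrow> 'o \<times> 'm \<Rightarrow> bool" where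
  "is_local C A M \<longleftrightarrow>
     snd M \<cdot>\<^bsub>C\<^esub> Braid C (fst M) (algO A) \<cdot>\<^bsub>C\<^esub> Braid C (algO A) (fst M) = snd M"

definition module_homs :: "('o, 'm, 'z) moncat_scheme \<Rightarrow> ('o, 'm) alg \<Rightarrow> 'o \<times> 'm \<Rightarrow> 'o \<times> 'm \<Rightarrow> 'm set" where
  "module_homs C A M N = {f \<in> cat_hom C (fst M) (fst N).
     f \<cdot>\<^bsub>C\<^esub> snd M = snd N \<cdot>\<^bsub>C\<^esub> (Id C (algO A) \<odot>\<^bsub>C\<^esub> f)}"

definition free_module :: "('o, 'm, 'z) moncat_scheme \<Rightarrow> ('o, 'm) alg \<Rightarrow> 'o \<Rightarrow> 'o \<times> 'm" where
  "free_module C A X = (algO A \<otimes>\<^bsub>C\<^esub> X, (algMul A \<odot>\<^bsub>C\<^esub> Id C X) \<cdot>\<^bsub>C\<^esub> Assoc C (algO A) (algO A) X)"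

definition is_coequalizer :: "('o, 'm, 'z) cat_scheme \<Rightarrow> 'm \<Rightarrow> 'm \<Rightarrow> 'm \<Rightarrow> bool" where
  "is_coequalizer C f g \<pi> \<longleftrightarrow> \<pi> \<in> Arr C \<and> Dom C \<pi> = Cod C f \<and> \<pi> \<cdot>\<^bsub>C\<^esub> f = \<pi> \<cdot>\<^bsub>C\<^esub> g \<and>
     (\<forall>h \<in> Arr C. Dom C h = Cod C f \<and> h \<cdot>\<^bsub>C\<^esub> f = h \<cdot>\<^bsub>C\<^esub> g \<longrightarrow>
        (\<exists>!k. k \<in> cat_hom C (Cod C \<pi>) (Cod C h) \<and> k \<cdot>\<^bsub>C\<^esub> \<pi> = h))"

text \<open>
  The projection \<open>M \<otimes> N \<rightarrow> M \<otimes>\<^sub>A N\<close>: a chosen coequalizer of the two maps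
  \<open>M \<otimes> (A \<otimes> N) \<rightarrow> M \<otimes> N\<close> given by the right action (action after braiding) on \<open>M\<close>
  and by the left action on \<open>N\<close>.
\<close>

definition rt_proj :: "('o, 'm, 'z) balcat_scheme \<Rightarrow> ('o, 'm) alg \<Rightarrow> 'o \<times> 'm \<Rightarrow> 'o \<times> 'm \<Rightarrow> 'm" where
  "rt_proj C A M N = (SOME \<pi>. is_coequalizer C
     (((snd M \<cdot>\<^bsub>C\<^esub> Braid C (fst M) (algO A)) \<odot>\<^bsub>C\<^esub> Id C (fst N)) \<cdot>\<^bsub>C\<^esub> Assoc C (fst M) (algO A) (fst N))
     (Id C (fst M) \<odot>\<^bsub>C\<^esub> snd N) \<pi>)"

definition rt_obj :: "('o, 'm, 'z) balcat_scheme \<Rightarrow> ('o, 'm) alg \<Rightarrow> 'o \<times> 'm \<Rightarrow> 'o \<times> 'm \<Rightarrow> 'o \<times> 'm" where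
  "rt_obj C A M N = (let Q = Cod C (rt_proj C A M N) in
     (Q, THE \<rho>. \<rho> \<in> cat_hom C (algO A \<otimes>\<^bsub>C\<^esub> Q) Q \<and>
           \<rho> \<cdot>\<^bsub>C\<^esub> (Id C (algO A) \<odot>\<^bsub>C\<^esub> rt_proj C A M N)
             = rt_proj C A M N \<cdot>\<^bsub>C\<^esub> (snd M \<odot>\<^bsub>C\<^esub> Id C (fst N)) \<cdot>\<^bsub>C\<^esub> Assoc C (algO A) (fst M) (fst N)))"

definition unit_module :: "('o, 'm) alg \<Rightarrow> 'o \<times> 'm" where
  "unit_module A = (algO A, algMul A)"

text \<open>
  Arrows between modules carry their source and target modules, since an arrow of \<open>C\<close> does not
  determine the module structures. All structure maps are the ones induced from \<open>C\<close> on the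
  quotients \<open>M \<otimes>\<^sub>A N\<close>; the predicate \<open>P\<close> selects a full subcategory of the local modules.
\<close>

definition local_modules ::
  "('o, 'm, 'z) balcat_scheme \<Rightarrow> ('o, 'm) alg \<Rightarrow> ('o \<times> 'm \<Rightarrow> bool) \<Rightarrow>
   ('o \<times> 'm, ('o \<times> 'm, 'm) arrow) balcat" where
  "local_modules C A P =
   (let pr = rt_proj C A;
        the_arrow = (\<lambda>M N Q. Arrow M (THE f. f \<in> cat_hom C (fst M) (fst N) \<and> Q f) N)
    in \<lparr> Obj = {M. is_module C A M \<and> is_local C A M \<and> P M},
         Arr = {f. src f \<in> {M. is_module C A M \<and> is_local C A M \<and> P M} \<and>
                   tgt f \<in> {M. is_module C A M \<and> is_local C A M \<and> P M} \<and>
                   amap f \<in> module_homs C A (src f) (tgt f)},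
         Dom = src,
         Cod = tgt,
         Id = (\<lambda>M. Arrow M (Id C (fst M)) M),
         Comp = (\<lambda>g f. Arrow (src f) (amap g \<cdot>\<^bsub>C\<^esub> amap f) (tgt g)),
         TensO = rt_obj C A,
         TensA = (\<lambda>f g. the_arrow (rt_obj C A (src f) (src g)) (rt_obj C A (tgt f) (tgt g))
            (\<lambda>h. h \<cdot>\<^bsub>C\<^esub> pr (src f) (src g) = pr (tgt f) (tgt g) \<cdot>\<^bsub>C\<^esub> (amap f \<odot>\<^bsub>C\<^esub> amap g))),
         Unit = unit_module A,
         Assoc = (\<lambda>L M N. the_arrow (rt_obj C A L (rt_obj C A M N)) (rt_obj C A (rt_obj C A L M) N)
            (\<lambda>h. h \<cdot>\<^bsub>C\<^esub> pr L (rt_obj C A M N) \<cdot>\<^bsub>C\<^esub> (Id C (fst L) \<odot>\<^bsub>C\<^esub> pr M N)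
                 = pr (rt_obj C A L M) N \<cdot>\<^bsub>C\<^esub> (pr L M \<odot>\<^bsub>C\<^esub> Id C (fst N)) \<cdot>\<^bsub>C\<^esub> Assoc C (fst L) (fst M) (fst N))),
         LUnit = (\<lambda>M. the_arrow (rt_obj C A (unit_module A) M) M
            (\<lambda>h. h \<cdot>\<^bsub>C\<^esub> pr (unit_module A) M = snd M)),
         RUnit = (\<lambda>M. the_arrow (rt_obj C A M (unit_module A)) M
            (\<lambda>h. h \<cdot>\<^bsub>C\<^esub> pr M (unit_module A) = snd M \<cdot>\<^bsub>C\<^esub> Braid C (fst M) (algO A))),
         Braid = (\<lambda>M N. the_arrow (rt_obj C A M N) (rt_obj C A N M)
            (\<lambda>h. h \<cdot>\<^bsub>C\<^esub> pr M N = pr N M \<cdot>\<^bsub>C\<^esub> Braid C (fst M) (fst N))),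
         Twist = (\<lambda>M. Arrow M (Twist C (fst M)) M) \<rparr>)"


section \<open>Vector spaces of at most countable dimension\<close>

text \<open>
  All vector spaces are subspaces of the space \<open>\<complex>\<^bsup>(\<nat>)\<^esup>\<close> of finitely supported sequences. They are
  automatically of at most countable dimension, and every complex vector space of at most countable
  dimension is isomorphic to one of them. The bijection between \<open>\<nat> \<times> \<nat>\<close> and \<open>\<nat>\<close> identifies
  \<open>\<complex>\<^bsup>(\<nat>)\<^esup> \<otimes> \<complex>\<^bsup>(\<nat>)\<^esup>\<close> with \<open>\<complex>\<^bsup>(\<nat>)\<^esup>\<close>, so that the tensor product of two such spaces is again of this kind.
\<close>

type_synonym cvec = "nat \<Rightarrow>\<^sub>0 complex"

definition vscale :: "complex \<Rightarrow> cvec \<Rightarrow> cvec"  (infixr "*\<^sub>C" 75) where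
  "c *\<^sub>C v = Poly_Mapping.map ((*) c) v"

lemma lookup_vscale: "Poly_Mapping.lookup (c *\<^sub>C v) i = c * Poly_Mapping.lookup v i"
  unfolding vscale_def by transfer (simp add: when_def)

global_interpretation cvec: vector_space vscale
  by unfold_locales
    (auto intro!: poly_mapping_eqI simp: lookup_vscale lookup_add algebra_simps)

definition basis_vec :: "nat \<Rightarrow> cvec" where
  "basis_vec i = Poly_Mapping.single i 1"

definition tensor :: "cvec \<Rightarrow> cvec \<Rightarrow> cvec"  (infixr "\<boxtimes>" 80) where
  "v \<boxtimes> w = (\<Sum>i \<in> Poly_Mapping.keys v. \<Sum>j \<in> Poly_Mapping.keys w.
     (Poly_Mapping.lookup v i * Poly_Mapping.lookup w j) *\<^sub>C basis_vec (prod_encode (i, j)))"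

definition tens :: "cvec set \<Rightarrow> cvec set \<Rightarrow> cvec set" where
  "tens V W = cvec.span {v \<boxtimes> w | v w. v \<in> V \<and> w \<in> W}"

definition fin_dim :: "cvec set \<Rightarrow> bool" where
  "fin_dim V \<longleftrightarrow> (\<exists>B. finite B \<and> cvec.span B = V)"

definition lin :: "cvec set \<Rightarrow> cvec set \<Rightarrow> (cvec \<Rightarrow> cvec) set" where
  "lin V W = {f \<in> V \<rightarrow>\<^sub>E W. (\<forall>x \<in> V. \<forall>y \<in> V. f (x + y) = f x + f y) \<and> (\<forall>c. \<forall>x \<in> V. f (c *\<^sub>C x) = c *\<^sub>C f x)}"

definition tmap :: "cvec set \<Rightarrow> cvec set \<Rightarrow> (cvec \<Rightarrow> cvec \<Rightarrow> cvec) \<Rightarrow> cvec \<Rightarrow> cvec" where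
  "tmap V W \<beta> = (THE f. f \<in> lin (tens V W) UNIV \<and> (\<forall>v \<in> V. \<forall>w \<in> W. f (v \<boxtimes> w) = \<beta> v w))"

definition tmap3 :: "cvec set \<Rightarrow> cvec set \<Rightarrow> cvec set \<Rightarrow> (cvec \<Rightarrow> cvec \<Rightarrow> cvec \<Rightarrow> cvec) \<Rightarrow> cvec \<Rightarrow> cvec" where
  "tmap3 U V W \<beta> = (THE f. f \<in> lin (tens U (tens V W)) UNIV \<and>
     (\<forall>u \<in> U. \<forall>v \<in> V. \<forall>w \<in> W. f (u \<boxtimes> (v \<boxtimes> w)) = \<beta> u v w))"

definition unit_space :: "cvec set" where
  "unit_space = cvec.span {basis_vec 0}"


section \<open>Complex-graded vector spaces\<close>

text \<open>A graded space is given by its family of homogeneous components.\<close>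

type_synonym gspace = "complex \<Rightarrow> cvec set"

definition gcar :: "gspace \<Rightarrow> cvec set" where
  "gcar V = cvec.span (\<Union>\<alpha>. V \<alpha>)"

definition graded :: "gspace \<Rightarrow> bool" where
  "graded V \<longleftrightarrow> (\<forall>\<alpha>. cvec.subspace (V \<alpha>)) \<and>
     (\<forall>x. (\<forall>\<alpha>. x \<alpha> \<in> V \<alpha>) \<and> finite {\<alpha>. x \<alpha> \<noteq> 0} \<and> (\<Sum>\<alpha> | x \<alpha> \<noteq> 0. x \<alpha>) = 0 \<longrightarrow> (\<forall>\<alpha>. x \<alpha> = 0))"

definition gtens :: "gspace \<Rightarrow> gspace \<Rightarrow> gspace" where
  "gtens V W \<gamma> = cvec.span {v \<boxtimes> w | v w \<alpha> \<beta>. v \<in> V \<alpha> \<and> w \<in> W \<beta> \<and> \<alpha> + \<beta> = \<gamma>}"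

definition gunit :: gspace where
  "gunit \<alpha> = (if \<alpha> = 0 then unit_space else {0})"

text \<open>
  The degree map of \<open>V\<close> acts on \<open>V \<alpha>\<close> as \<open>\<alpha>\<close>, hence the scalars \<open>exp (\<pi>i/2p \<alpha>\<beta>)\<close> and
  \<open>exp (\<pi>i/2p \<alpha>\<^sup>2)\<close> in the braiding and the twist.
\<close>

definition Hcat :: "nat \<Rightarrow> (gspace, (gspace, cvec \<Rightarrow> cvec) arrow) balcat" where
  "Hcat p =
    \<lparr> Obj = {V. graded V},
      Arr = {f. graded (src f) \<and> graded (tgt f) \<and> amap f \<in> lin (gcar (src f)) (gcar (tgt f)) \<and>
                (\<forall>\<alpha>. amap f ` src f \<alpha> \<subseteq> tgt f \<alpha>)},
      Dom = src,
      Cod = tgt,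
      Id = (\<lambda>V. Arrow V (restrict (\<lambda>x. x) (gcar V)) V),
      Comp = (\<lambda>g f. Arrow (src f) (compose (gcar (src f)) (amap g) (amap f)) (tgt g)),
      TensO = gtens,
      TensA = (\<lambda>f g. Arrow (gtens (src f) (src g))
                 (tmap (gcar (src f)) (gcar (src g)) (\<lambda>v w. amap f v \<boxtimes> amap g w)) (gtens (tgt f) (tgt g))),
      Unit = gunit,
      Assoc = (\<lambda>U V W. Arrow (gtens U (gtens V W))
                 (tmap3 (gcar U) (gcar V) (gcar W) (\<lambda>u v w. (u \<boxtimes> v) \<boxtimes> w)) (gtens (gtens U V) W)),
      LUnit = (\<lambda>V. Arrow (gtens gunit V)
                 (THE f. f \<in> lin (gcar (gtens gunit V)) (gcar V) \<and> (\<forall>v \<in> gcar V. f (basis_vec 0 \<boxtimes> v) = v)) V),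
      RUnit = (\<lambda>V. Arrow (gtens V gunit)
                 (THE f. f \<in> lin (gcar (gtens V gunit)) (gcar V) \<and> (\<forall>v \<in> gcar V. f (v \<boxtimes> basis_vec 0) = v)) V),
      Braid = (\<lambda>U V. Arrow (gtens U V)
                 (THE f. f \<in> lin (gcar (gtens U V)) (gcar (gtens V U)) \<and>
                    (\<forall>\<alpha> \<beta>. \<forall>u \<in> U \<alpha>. \<forall>v \<in> V \<beta>.
                       f (u \<boxtimes> v) = exp (complex_of_real pi * \<i> / (2 * of_nat p) * (\<alpha> * \<beta>)) *\<^sub>C (v \<boxtimes> u)))
                 (gtens V U)),
      Twist = (\<lambda>V. Arrow V
                 (THE f. f \<in> lin (gcar V) (gcar V) \<and>
                    (\<forall>\<alpha>. \<forall>v \<in> V \<alpha>. f v = exp (complex_of_real pi * \<i> / (2 * of_nat p) * \<alpha>\<^sup>2) *\<^sub>C v)) V) \<rparr>"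

definition lam :: "int \<Rightarrow> cvec"  ("\<one>\<^sub>\<Lambda>") where
  "\<one>\<^sub>\<Lambda> k = basis_vec (int_encode k)"

definition Lam :: "nat \<Rightarrow> gspace" where
  "Lam p \<alpha> = cvec.span {\<one>\<^sub>\<Lambda> k | k. \<alpha> = of_int (2 * int p * k)}"

definition LamAlg :: "nat \<Rightarrow> (gspace, (gspace, cvec \<Rightarrow> cvec) arrow) alg" where
  "LamAlg p =
    \<lparr> algO = Lam p,
      algMul = Arrow (gtens (Lam p) (Lam p))
        (THE f. f \<in> lin (gcar (gtens (Lam p) (Lam p))) (gcar (Lam p)) \<and>
                (\<forall>k l. f (\<one>\<^sub>\<Lambda> k \<boxtimes> \<one>\<^sub>\<Lambda> l) = \<one>\<^sub>\<Lambda> (k + l))) (Lam p),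
      algUnit = Arrow gunit
        (THE f. f \<in> lin (gcar gunit) (gcar (Lam p)) \<and> f (basis_vec 0) = \<one>\<^sub>\<Lambda> 0) (Lam p) \<rparr>"

type_synonym lmod = "gspace \<times> (gspace, cvec \<Rightarrow> cvec) arrow"

definition fin_gen :: "nat \<Rightarrow> lmod \<Rightarrow> bool" where
  "fin_gen p M \<longleftrightarrow> (\<exists>X. graded X \<and> fin_dim (gcar X) \<and>
     (\<exists>f \<in> module_homs (Hcat p) (LamAlg p) (free_module (Hcat p) (LamAlg p) X) M.
        amap f ` gcar (gtens (Lam p) X) = gcar (fst M)))"

definition Mcat :: "nat \<Rightarrow> (lmod, (lmod, (gspace, cvec \<Rightarrow> cvec) arrow) arrow) balcat" where
  "Mcat p = local_modules (Hcat p) (LamAlg p) (fin_gen p)"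

text \<open>The element \<open>x \<otimes>\<^sub>\<Lambda> y\<close> of \<open>M \<otimes>\<^sub>\<Lambda> N\<close>.\<close>

definition rt_elem :: "nat \<Rightarrow> lmod \<Rightarrow> lmod \<Rightarrow> cvec \<Rightarrow> cvec \<Rightarrow> cvec" where
  "rt_elem p M N x y = amap (rt_proj (Hcat p) (LamAlg p) M N) (x \<boxtimes> y)"


section \<open>Representations of the cyclic group algebra\<close>

text \<open>
  A module over \<open>\<complex>\<int>\<^bsub>2p\<^esub> = \<complex>[K]/(K\<^bsup>2p\<^esup> - 1)\<close> is a vector space together with the action of \<open>K\<close>.
\<close>

record kmod =
  kcar :: "cvec set"
  kact :: "cvec \<Rightarrow> cvec"

definition is_kmod :: "nat \<Rightarrow> kmod \<Rightarrow> bool" where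
  "is_kmod p V \<longleftrightarrow> cvec.subspace (kcar V) \<and> fin_dim (kcar V) \<and> kact V \<in> lin (kcar V) (kcar V) \<and>
     (\<forall>v \<in> kcar V. (kact V ^^ (2 * p)) v = v)"

definition qpow :: "nat \<Rightarrow> complex \<Rightarrow> complex" where
  "qpow p z = exp (\<i> * complex_of_real pi * z / of_nat p)"

definition kidem :: "nat \<Rightarrow> kmod \<Rightarrow> int \<Rightarrow> cvec \<Rightarrow> cvec" where
  "kidem p V n v = (1 / of_nat (2 * p)) *\<^sub>C (\<Sum>l = 0..2 * p - 1. qpow p (- (of_int n * of_nat l)) *\<^sub>C (kact V ^^ l) v)"

definition rep_mod :: "nat \<Rightarrow> int set \<Rightarrow> int \<Rightarrow> int" where
  "rep_mod p S x = (THE s. s \<in> S \<and> s mod (2 * int p) = x mod (2 * int p))"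

definition kappa :: "nat \<Rightarrow> int set \<Rightarrow> int \<Rightarrow> int \<Rightarrow> int" where
  "kappa p S a b = (a + b - rep_mod p S (a + b)) div (2 * int p)"

definition Phi_coeff :: "nat \<Rightarrow> int set \<Rightarrow> (int \<Rightarrow> int \<Rightarrow> complex) \<Rightarrow> int \<Rightarrow> int \<Rightarrow> int \<Rightarrow> complex" where
  "Phi_coeff p S \<zeta> a b c = (- 1) powi (a * kappa p S b c) *
     (\<zeta> a b * \<zeta> (rep_mod p S (a + b)) c) / (\<zeta> b c * \<zeta> a (rep_mod p S (b + c)))"

definition R_coeff :: "nat \<Rightarrow> (int \<Rightarrow> int \<Rightarrow> complex) \<Rightarrow> int \<Rightarrow> int \<Rightarrow> complex" where
  "R_coeff p \<zeta> a b = qpow p (of_int (a * b) / 2) * (\<zeta> b a / \<zeta> a b)"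

definition ktens :: "kmod \<Rightarrow> kmod \<Rightarrow> kmod" where
  "ktens V W = \<lparr> kcar = tens (kcar V) (kcar W),
                 kact = tmap (kcar V) (kcar W) (\<lambda>v w. kact V v \<boxtimes> kact W w) \<rparr>"

definition kunit :: kmod where
  "kunit = \<lparr> kcar = unit_space, kact = restrict (\<lambda>x. x) unit_space \<rparr>"

text \<open>The action of \<open>\<^bold>v\<close>; the twist is the action of its inverse.\<close>

definition ribbon_elt :: "nat \<Rightarrow> kmod \<Rightarrow> cvec \<Rightarrow> cvec" where
  "ribbon_elt p V x = (\<Sum>a = 0..2 * int p - 1. qpow p (- (of_int (a\<^sup>2) / 2)) *\<^sub>C kidem p V a x)"

definition RepCat :: "nat \<Rightarrow> int set \<Rightarrow> (int \<Rightarrow> int \<Rightarrow> complex) \<Rightarrow> (kmod, (kmod, cvec \<Rightarrow> cvec) arrow) balcat" where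
  "RepCat p S \<zeta> =
    \<lparr> Obj = {V. is_kmod p V},
      Arr = {f. is_kmod p (src f) \<and> is_kmod p (tgt f) \<and> amap f \<in> lin (kcar (src f)) (kcar (tgt f)) \<and>
                (\<forall>v \<in> kcar (src f). amap f (kact (src f) v) = kact (tgt f) (amap f v))},
      Dom = src,
      Cod = tgt,
      Id = (\<lambda>V. Arrow V (restrict (\<lambda>x. x) (kcar V)) V),
      Comp = (\<lambda>g f. Arrow (src f) (compose (kcar (src f)) (amap g) (amap f)) (tgt g)),
      TensO = ktens,
      TensA = (\<lambda>f g. Arrow (ktens (src f) (src g))
                 (tmap (kcar (src f)) (kcar (src g)) (\<lambda>v w. amap f v \<boxtimes> amap g w)) (ktens (tgt f) (tgt g))),
      Unit = kunit,
      Assoc = (\<lambda>U V W. Arrow (ktens U (ktens V W))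
                 (tmap3 (kcar U) (kcar V) (kcar W) (\<lambda>u v w.
                    \<Sum>a\<in>S. \<Sum>b\<in>S. \<Sum>c\<in>S. Phi_coeff p S \<zeta> a b c *\<^sub>C ((kidem p U a u \<boxtimes> kidem p V b v) \<boxtimes> kidem p W c w)))
                 (ktens (ktens U V) W)),
      LUnit = (\<lambda>V. Arrow (ktens kunit V)
                 (THE f. f \<in> lin (kcar (ktens kunit V)) (kcar V) \<and> (\<forall>v \<in> kcar V. f (basis_vec 0 \<boxtimes> v) = v)) V),
      RUnit = (\<lambda>V. Arrow (ktens V kunit)
                 (THE f. f \<in> lin (kcar (ktens V kunit)) (kcar V) \<and> (\<forall>v \<in> kcar V. f (v \<boxtimes> basis_vec 0) = v)) V),
      Braid = (\<lambda>U V. Arrow (ktens U V)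
                 (tmap (kcar U) (kcar V) (\<lambda>u v.
                    \<Sum>a\<in>S. \<Sum>b\<in>S. R_coeff p \<zeta> a b *\<^sub>C (kidem p V b v \<boxtimes> kidem p U a u)))
                 (ktens V U)),
      Twist = (\<lambda>V. Arrow V (restrict (the_inv_into (kcar V) (ribbon_elt p V)) (kcar V)) V) \<rparr>"


section \<open>The functor\<close>

definition Fgr :: "nat \<Rightarrow> int set \<Rightarrow> kmod \<Rightarrow> gspace" where
  "Fgr p S V \<alpha> = cvec.span {\<one>\<^sub>\<Lambda> k \<boxtimes> kidem p V a m | k a m. m \<in> kcar V \<and> \<alpha> = of_int (2 * int p * k + rep_mod p S a)}"

definition FObj :: "nat \<Rightarrow> int set \<Rightarrow> kmod \<Rightarrow> lmod" where
  "FObj p S V = (Fgr p S V,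
     Arrow (gtens (Lam p) (Fgr p S V))
       (THE f. f \<in> lin (gcar (gtens (Lam p) (Fgr p S V))) (gcar (Fgr p S V)) \<and>
          (\<forall>k l. \<forall>m \<in> kcar V. f (\<one>\<^sub>\<Lambda> k \<boxtimes> (\<one>\<^sub>\<Lambda> l \<boxtimes> m)) = \<one>\<^sub>\<Lambda> (k + l) \<boxtimes> m))
       (Fgr p S V))"

definition FArr :: "nat \<Rightarrow> int set \<Rightarrow> (kmod, cvec \<Rightarrow> cvec) arrow \<Rightarrow> (lmod, (gspace, cvec \<Rightarrow> cvec) arrow) arrow" where
  "FArr p S f = Arrow (FObj p S (src f))
     (Arrow (Fgr p S (src f)) (tmap (gcar (Lam p)) (kcar (src f)) (\<lambda>x m. x \<boxtimes> amap f m)) (Fgr p S (tgt f)))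
     (FObj p S (tgt f))"


section \<open>A constraint on the representative of zero\<close>

text \<open>
  Write \<open>[0] = 2pt\<close> for the representative of \<open>0\<close> in \<open>S\<close>. On \<open>e\<^sub>a \<otimes> e\<^bsub>[0]\<^esub> \<otimes> e\<^sub>c\<close> the associator is
  \<open>(-1)\<^bsup>at\<^esup>\<close>, so with the unit isomorphisms of vector spaces the triangle axiom fails for odd \<open>a\<close>
  unless \<open>t\<close> is even (the same sign obstructs the compatibility of the braiding with the unit).
  Hence speaking of the ribbon category \<open>RepCat p S \<zeta>\<close> presupposes that \<open>4p\<close> divides \<open>[0]\<close>,
  as is the case for \<open>[0] = 0\<close>; this is the last lemma below.
\<close>

lemma basis_vec_tensor: "(x *\<^sub>C basis_vec 0) \<boxtimes> (y *\<^sub>C basis_vec 0) = (x * y) *\<^sub>C basis_vec 0"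
proof -
  have k: "c *\<^sub>C basis_vec 0 = Poly_Mapping.single 0 c" for c
    unfolding basis_vec_def by (rule poly_mapping_eqI) (simp add: lookup_vscale lookup_single when_def del: single_one)
  have "prod_encode (0, 0) = 0" by (simp add: prod_encode_def)
  then show ?thesis unfolding tensor_def by (simp add: k)
qed

lemma unit_space_iff: "v \<in> unit_space \<longleftrightarrow> (\<exists>c. v = c *\<^sub>C basis_vec 0)"
  by (auto simp: unit_space_def cvec.span_singleton)

lemma tens_unit: "tens unit_space unit_space = unit_space"
proof -
  have "{v \<boxtimes> w | v w. v \<in> unit_space \<and> w \<in> unit_space} = unit_space" (is "?L = _")
  proof
    show "?L \<subseteq> unit_space" by (auto simp: unit_space_iff basis_vec_tensor)
    show "unit_space \<subseteq> ?L"
    proof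
      fix v assume "v \<in> unit_space"
      then obtain c where "v = c *\<^sub>C basis_vec 0" by (auto simp: unit_space_iff)
      then have "v = (c *\<^sub>C basis_vec 0) \<boxtimes> (1 *\<^sub>C basis_vec 0)" by (simp only: basis_vec_tensor) simp
      then show "v \<in> ?L" unfolding mem_Collect_eq unit_space_iff by blast
    qed
  qed
  then show ?thesis unfolding tens_def by (simp add: unit_space_def cvec.span_span)
qed

lemma lin_unit_eqI:
  assumes "f \<in> lin unit_space W" "g \<in> lin unit_space W'" "f (basis_vec 0) = g (basis_vec 0)"
  shows "f = g"
proof
  fix x
  show "f x = g x"
  proof (cases "x \<in> unit_space")
    case True
    then obtain c where x: "x = c *\<^sub>C basis_vec 0" by (auto simp: unit_space_iff)
    have "basis_vec 0 \<in> unit_space" by (simp add: unit_space_def cvec.span_base)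
    then show ?thesis using assms by (simp add: lin_def x)
  next
    case False then show ?thesis using assms by (auto simp: lin_def PiE_def extensional_def)
  qed
qed

abbreviation (input) e0 :: cvec where "e0 \<equiv> basis_vec 0"

lemma e0: "e0 \<in> unit_space" by (simp add: unit_space_def cvec.span_base)
lemma e0e0: "e0 \<boxtimes> e0 = e0" using basis_vec_tensor[of 1 1] by simp
lemma e0_nz: "c *\<^sub>C e0 = d *\<^sub>C e0 \<longleftrightarrow> c = d"
  using lookup_vscale[of c e0 0] lookup_vscale[of d e0 0] by (auto simp: basis_vec_def)

lemma scal_lin: "restrict (\<lambda>x. c *\<^sub>C x) unit_space \<in> lin unit_space unit_space"
  unfolding lin_def unit_space_def
  by (auto simp: cvec.span_add cvec.span_scale cvec.scale_right_distrib mult.commute)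

lemma scal_lin': "restrict (\<lambda>x. c *\<^sub>C x) unit_space \<in> lin unit_space UNIV"
  using scal_lin[of c] by (auto simp: lin_def PiE_def)

lemma the_lin_unit:
  assumes W: "W = unit_space \<or> W = UNIV"
    and P: "\<And>f. f \<in> lin unit_space W \<Longrightarrow> P f \<longleftrightarrow> f e0 = c *\<^sub>C e0"
  shows "(THE f. f \<in> lin unit_space W \<and> P f) = restrict (\<lambda>x. c *\<^sub>C x) unit_space"
proof (rule the_equality)
  have l: "restrict (\<lambda>x. c *\<^sub>C x) unit_space \<in> lin unit_space W" using W scal_lin scal_lin' by auto
  then show "restrict (\<lambda>x. c *\<^sub>C x) unit_space \<in> lin unit_space W \<and> P (restrict (\<lambda>x. c *\<^sub>C x) unit_space)"
    using P[OF l] e0 by simp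
  show "f = restrict (\<lambda>x. c *\<^sub>C x) unit_space" if "f \<in> lin unit_space W \<and> P f" for f
    using that P[of f] e0 by (intro lin_unit_eqI[of f W _ W]) (use l in auto)
qed

lemma lin_scal: "f \<in> lin unit_space W \<Longrightarrow> f (c *\<^sub>C e0) = c *\<^sub>C f e0"
  using e0 by (simp add: lin_def)

lemma tmap_unit:
  assumes "\<And>x y. \<beta> (x *\<^sub>C e0) (y *\<^sub>C e0) = (c * x * y) *\<^sub>C e0"
  shows "tmap unit_space unit_space \<beta> = restrict (\<lambda>x. c *\<^sub>C x) unit_space"
  unfolding tmap_def tens_unit
proof (rule the_lin_unit)
  fix f assume f: "f \<in> lin unit_space UNIV"
  show "(\<forall>v\<in>unit_space. \<forall>w\<in>unit_space. f (v \<boxtimes> w) = \<beta> v w) \<longleftrightarrow> f e0 = c *\<^sub>C e0"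
  proof
    assume "\<forall>v\<in>unit_space. \<forall>w\<in>unit_space. f (v \<boxtimes> w) = \<beta> v w"
    then have "f (e0 \<boxtimes> e0) = \<beta> e0 e0" using e0 by blast
    then show "f e0 = c *\<^sub>C e0" using assms[of 1 1] by (simp add: e0e0)
  next
    assume "f e0 = c *\<^sub>C e0"
    then show "\<forall>v\<in>unit_space. \<forall>w\<in>unit_space. f (v \<boxtimes> w) = \<beta> v w"
      by (auto simp: unit_space_iff basis_vec_tensor assms lin_scal[OF f] mult_ac)
  qed
qed simp

lemma tmap3_unit:
  assumes "\<And>x y z. \<beta> (x *\<^sub>C e0) (y *\<^sub>C e0) (z *\<^sub>C e0) = (c * x * y * z) *\<^sub>C e0"
  shows "tmap3 unit_space unit_space unit_space \<beta> = restrict (\<lambda>x. c *\<^sub>C x) unit_space"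
  unfolding tmap3_def tens_unit
proof (rule the_lin_unit)
  fix f assume f: "f \<in> lin unit_space UNIV"
  show "(\<forall>u\<in>unit_space. \<forall>v\<in>unit_space. \<forall>w\<in>unit_space. f (u \<boxtimes> (v \<boxtimes> w)) = \<beta> u v w) \<longleftrightarrow> f e0 = c *\<^sub>C e0"
  proof
    assume "\<forall>u\<in>unit_space. \<forall>v\<in>unit_space. \<forall>w\<in>unit_space. f (u \<boxtimes> (v \<boxtimes> w)) = \<beta> u v w"
    then have "f (e0 \<boxtimes> (e0 \<boxtimes> e0)) = \<beta> e0 e0 e0" using e0 by blast
    then show "f e0 = c *\<^sub>C e0" using assms[of 1 1 1] by (simp add: e0e0)
  next
    assume "f e0 = c *\<^sub>C e0"
    then show "\<forall>u\<in>unit_space. \<forall>v\<in>unit_space. \<forall>w\<in>unit_space. f (u \<boxtimes> (v \<boxtimes> w)) = \<beta> u v w"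
      by (auto simp: unit_space_iff basis_vec_tensor assms lin_scal[OF f] mult_ac)
  qed
qed simp

definition simple_kmod :: "nat \<Rightarrow> int \<Rightarrow> kmod" where
  "simple_kmod p n = \<lparr> kcar = unit_space, kact = restrict (\<lambda>x. qpow p (of_int n) *\<^sub>C x) unit_space \<rparr>"

lemma qpow_add: "qpow p (x + y) = qpow p x * qpow p y"
  by (simp add: qpow_def exp_add[symmetric] ring_distribs add_divide_distrib)

lemma qpow_1_iff: "p > 0 \<Longrightarrow> qpow p (of_int n) = 1 \<longleftrightarrow> 2 * int p dvd n"
proof -
  assume p: "p > 0"
  have "qpow p (of_int n) = 1 \<longleftrightarrow> (\<exists>m::int. pi * real_of_int n / real p = real_of_int (2 * m) * pi)"
    unfolding qpow_def by (simp add: exp_eq_1)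
  also have "\<dots> \<longleftrightarrow> (\<exists>m::int. real_of_int n = real_of_int (2 * int p * m))"
    using p by (auto simp: field_simps)
  also have "\<dots> \<longleftrightarrow> 2 * int p dvd n" unfolding of_int_eq_iff dvd_def ..
  finally show ?thesis .
qed

lemma qpow_power: "qpow p z ^ l = qpow p (of_nat l * z)"
  by (simp add: qpow_def exp_of_nat_mult[symmetric] mult_ac)

lemma kact_pow: "(kact (simple_kmod p n) ^^ l) (x *\<^sub>C e0) = (qpow p (of_nat l * of_int n) * x) *\<^sub>C e0"
proof (induction l)
  case (Suc l)
  have "qpow p (of_nat (Suc l) * of_int n) = qpow p (of_int n) * qpow p (of_nat l * of_int n)"
    by (simp add: qpow_add[symmetric] algebra_simps)
  then show ?case using Suc by (simp add: simple_kmod_def unit_space_iff mult_ac)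
qed (simp add: qpow_def)

lemma simple_is_kmod: "p > 0 \<Longrightarrow> is_kmod p (simple_kmod p n)"
proof -
  assume p: "p > 0"
  have "qpow p (of_nat (2 * p) * of_int n) = 1" using qpow_1_iff[OF p, of "2 * int p * n"] by simp
  then show ?thesis
    unfolding is_kmod_def fin_dim_def
    using scal_lin[of "qpow p (of_int n)"] kact_pow[of "2 * p" p n]
    by (auto simp: simple_kmod_def unit_space_iff) (auto simp: unit_space_def)
qed

lemma idem_simple:
  assumes p: "p > 0"
  shows "kidem p (simple_kmod p n) a (x *\<^sub>C e0) = (if a mod (2 * int p) = n mod (2 * int p) then x *\<^sub>C e0 else 0)"
proof -
  define r where "r = qpow p (of_int (n - a))"
  have "kidem p (simple_kmod p n) a (x *\<^sub>C e0)
      = (1 / of_nat (2 * p)) *\<^sub>C (\<Sum>l = 0..2 * p - 1. (r ^ l * x) *\<^sub>C e0)"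
  proof -
    have "qpow p (- (of_int a * of_nat l)) * (qpow p (of_nat l * of_int n) * x) = r ^ l * x" for l
    proof -
      have "of_nat l * complex_of_int (n - a) = - (of_int a * of_nat l) + of_nat l * of_int n"
        by (simp add: algebra_simps)
      then show ?thesis unfolding r_def qpow_power by (simp only: qpow_add mult.assoc)
    qed
    then show ?thesis unfolding kidem_def kact_pow cvec.scale_scale by (simp only:)
  qed
  also have "\<dots> = (1 / of_nat (2 * p) * ((\<Sum>l<2 * p. r ^ l) * x)) *\<^sub>C e0"
  proof -
    have "{0..2 * p - 1} = {..<2 * p}" using p by auto
    then show ?thesis by (simp only: cvec.scale_sum_left[symmetric] sum_distrib_right[symmetric] cvec.scale_scale)
  qed
  also have "\<dots> = (if a mod (2 * int p) = n mod (2 * int p) then x *\<^sub>C e0 else 0)"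
  proof (cases "r = 1")
    case True
    then have "a mod (2 * int p) = n mod (2 * int p)"
      using qpow_1_iff[OF p] mod_eq_dvd_iff[of n "2 * int p" a] unfolding r_def by metis
    then show ?thesis using p True by simp
  next
    case False
    then have n: "a mod (2 * int p) \<noteq> n mod (2 * int p)"
      using qpow_1_iff[OF p] mod_eq_dvd_iff[of n "2 * int p" a] unfolding r_def by metis
    have "r ^ (2 * p) = qpow p (of_int (2 * int p * (n - a)))" by (simp add: r_def qpow_power)
    also have "\<dots> = 1" by (simp only: qpow_1_iff[OF p] dvd_triv_left)
    finally have "(\<Sum>l<2 * p. r ^ l) = 0" using geometric_sum[OF False, of "2 * p"] by simp
    then show ?thesis using n by simp
  qed
  finally show ?thesis .
qed

lemma kunit_simple: "kunit = simple_kmod p 0"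
  by (simp add: kunit_def simple_kmod_def qpow_def)

lemma RepCat_monoidal_imp_4p_dvd:
  assumes p: "p > 0"
    and S_bij: "bij_betw (\<lambda>s. s mod (2 * int p)) S {0..<2 * int p}"
    and zn: "\<And>a. a \<in> S \<Longrightarrow> \<zeta> a (rep_mod p S 0) = 1 \<and> \<zeta> (rep_mod p S 0) a = 1"
    and mon: "monoidal_category (RepCat p S \<zeta>)"
  shows "4 * int p dvd rep_mod p S 0"
proof -
  let ?C = "RepCat p S \<zeta>" and ?m = "2 * int p"
  have ex1: "\<exists>!s. s \<in> S \<and> s mod ?m = x mod ?m" for x
  proof -
    have "x mod ?m \<in> {0..<?m}" using p by simp
    then have "x mod ?m \<in> (\<lambda>s. s mod ?m) ` S" using S_bij by (simp add: bij_betw_def)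
    then obtain s where "s \<in> S" "s mod ?m = x mod ?m" by auto
    then show ?thesis using S_bij by (auto simp: bij_betw_def inj_on_def)
  qed
  have repS: "rep_mod p S x \<in> S" and repm: "rep_mod p S x mod ?m = x mod ?m" for x
    unfolding rep_mod_def using theI'[OF ex1[of x]] by auto
  have rep_eq: "s \<in> S \<Longrightarrow> s mod ?m = x mod ?m \<Longrightarrow> rep_mod p S x = s" for s x
    using ex1[of x] repS[of x] repm[of x] by blast
  have finS: "finite S" using S_bij bij_betw_finite by blast
  define z s where "z = rep_mod p S 0" and "s = rep_mod p S 1"
  have zS: "z \<in> S" "z mod ?m = 0" "s \<in> S" "s mod ?m = 1 mod ?m"
    using repS repm[of 0] repm[of 1] by (auto simp: z_def s_def)
  define X where "X = simple_kmod p 1"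
  have XO: "X \<in> Obj ?C" "kunit \<in> Obj ?C"
    using simple_is_kmod[OF p] by (simp_all add: RepCat_def X_def kunit_simple[of p])
  have kc: "kcar X = unit_space" "kcar kunit = unit_space" "\<And>V W. kcar (ktens V W) = tens (kcar V) (kcar W)"
    by (simp_all add: X_def simple_kmod_def kunit_def ktens_def)
  have iX: "kidem p X a (x *\<^sub>C e0) = (if a = s then x *\<^sub>C e0 else 0)" if "a \<in> S" for a x
  proof -
    have "a mod ?m = 1 mod ?m \<longleftrightarrow> a = s" using that zS rep_eq[of a 1] unfolding s_def by blast
    then show ?thesis unfolding X_def idem_simple[OF p] by simp
  qed
  have iU: "kidem p kunit a (x *\<^sub>C e0) = (if a = z then x *\<^sub>C e0 else 0)" if "a \<in> S" for a x
  proof -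
    have "a mod ?m = 0 mod ?m \<longleftrightarrow> a = z" using that zS rep_eq[of a 0] unfolding z_def by auto
    then show ?thesis unfolding kunit_simple[of p] idem_simple[OF p] by simp
  qed
  have zz: "0 \<boxtimes> w = 0" "v \<boxtimes> 0 = 0" for v w by (simp_all add: tensor_def)
  define c where "c = Phi_coeff p S \<zeta> s z z"
  have "(\<Sum>a\<in>S. \<Sum>b\<in>S. \<Sum>d\<in>S. Phi_coeff p S \<zeta> a b d *\<^sub>C
           ((kidem p X a (x *\<^sub>C e0) \<boxtimes> kidem p kunit b (y *\<^sub>C e0)) \<boxtimes> kidem p kunit d (w *\<^sub>C e0)))
        = (c * x * y * w) *\<^sub>C e0" (is "?S = _") for x y w
  proof -
    have "?S = (\<Sum>a\<in>S. \<Sum>b\<in>S. \<Sum>d\<in>S. if d = z then if b = z then if a = s then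
                   (c * x * y * w) *\<^sub>C e0 else 0 else 0 else 0)"
      by (intro sum.cong refl) (simp add: iX iU zz basis_vec_tensor c_def mult_ac)
    then show ?thesis using zS finS by (simp add: sum.delta)
  qed
  then have A: "amap (Assoc ?C X kunit kunit) = restrict (\<lambda>x. c *\<^sub>C x) unit_space"
    by (simp add: RepCat_def kc tmap3_unit)
  have idl: "restrict (\<lambda>x. x) unit_space = restrict (\<lambda>x. 1 *\<^sub>C x) unit_space" by simp
  have L: "amap (LUnit ?C kunit) = restrict (\<lambda>x. 1 *\<^sub>C x) unit_space"
    unfolding RepCat_def balcat.simps moncat.simps arrow.sel kc tens_unit
  proof (rule the_lin_unit)
    fix f assume f: "f \<in> lin unit_space unit_space"
    show "(\<forall>v\<in>unit_space. f (e0 \<boxtimes> v) = v) \<longleftrightarrow> f e0 = 1 *\<^sub>C e0"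
    proof
      show "f e0 = 1 *\<^sub>C e0" if "\<forall>v\<in>unit_space. f (e0 \<boxtimes> v) = v" using that e0 e0e0 by (metis cvec.scale_one)
      show "\<forall>v\<in>unit_space. f (e0 \<boxtimes> v) = v" if "f e0 = 1 *\<^sub>C e0"
        using that basis_vec_tensor[of 1] lin_scal[OF f] by (auto simp: unit_space_iff)
    qed
  qed simp
  have R: "amap (RUnit ?C X) = restrict (\<lambda>x. 1 *\<^sub>C x) unit_space"
    unfolding RepCat_def balcat.simps moncat.simps arrow.sel kc tens_unit
  proof (rule the_lin_unit)
    fix f assume f: "f \<in> lin unit_space unit_space"
    show "(\<forall>v\<in>unit_space. f (v \<boxtimes> e0) = v) \<longleftrightarrow> f e0 = 1 *\<^sub>C e0"
    proof
      show "f e0 = 1 *\<^sub>C e0" if "\<forall>v\<in>unit_space. f (v \<boxtimes> e0) = v" using that e0 e0e0 by (metis cvec.scale_one)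
      show "\<forall>v\<in>unit_space. f (v \<boxtimes> e0) = v" if "f e0 = 1 *\<^sub>C e0"
        using that basis_vec_tensor[of _ 1] lin_scal[OF f] by (auto simp: unit_space_iff)
    qed
  qed simp
  have srcs: "src (LUnit ?C kunit) = ktens kunit kunit" "src (RUnit ?C X) = ktens X kunit"
      "src (Id ?C V) = V" "amap (Id ?C V) = restrict (\<lambda>x. x) (kcar V)"
      "src (Assoc ?C X kunit kunit) = ktens X (ktens kunit kunit)" for V
    by (simp_all add: RepCat_def)
  have TA: "amap (TensA ?C f g) = tmap (kcar (src f)) (kcar (src g)) (\<lambda>v w. amap f v \<boxtimes> amap g w)" for f g
    by (simp add: RepCat_def)
  have u: "x *\<^sub>C e0 \<in> unit_space" for x by (auto simp: unit_space_iff)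
  have T1: "amap (TensA ?C (Id ?C X) (LUnit ?C kunit)) = restrict (\<lambda>x. 1 *\<^sub>C x) unit_space"
    unfolding TA srcs kc tens_unit L by (rule tmap_unit) (simp add: basis_vec_tensor u)
  have T2: "amap (TensA ?C (RUnit ?C X) (Id ?C kunit)) = restrict (\<lambda>x. 1 *\<^sub>C x) unit_space"
    unfolding TA srcs kc tens_unit R by (rule tmap_unit) (simp add: basis_vec_tensor u)
  have comp: "amap (Comp ?C g f) = compose (kcar (src f)) (amap g) (amap f)" for f g
    by (simp add: RepCat_def)
  interpret monoidal_category ?C by (rule mon)
  have un: "Unit ?C = kunit" by (simp add: RepCat_def)
  have "amap (Comp ?C (TensA ?C (RUnit ?C X) (Id ?C kunit)) (Assoc ?C X kunit kunit)) e0
      = amap (TensA ?C (Id ?C X) (LUnit ?C kunit)) e0"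
    using triangle[OF XO] by (simp add: un)
  then have "c *\<^sub>C e0 = 1 *\<^sub>C e0"
    unfolding comp T1 T2 A srcs kc tens_unit using e0 u by (simp add: compose_def)
  then have c1: "c = 1" by (simp only: e0_nz)
  have z2: "rep_mod p S (z + z) = z" "rep_mod p S (s + z) = s"
    using zS by (auto intro!: rep_eq simp: mod_add_eq[symmetric])
  have "c = (- 1) powi (s * (z div ?m))"
    using zn[OF zS(1)] zn[OF zS(3)] unfolding c_def Phi_coeff_def kappa_def z2 by (simp add: z_def)
  with c1 have "even (s * (z div ?m))" by (auto simp: power_int_minus_left split: if_splits)
  moreover have "odd s"
  proof -
    have "?m dvd s - 1" using zS(4) by (simp add: mod_eq_dvd_iff)
    then have "2 dvd s - 1" by (rule dvd_mult_left)
    then show ?thesis by simp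
  qed
  ultimately have "even (z div ?m)" by simp
  then obtain t where t: "z div ?m = 2 * t" by (auto elim: evenE)
  have "z = ?m * (z div ?m)" using zS(2) by (simp add: mult_div_mod_eq[symmetric] minus_mod_eq_mult_div[symmetric])
  then have "z = 4 * int p * t" by (simp add: t)
  then show ?thesis by (simp add: z_def)
qed

end

theory Submission
 imports Defs
begin

text \<open>
  Both categories consist of vector spaces spanned by homogeneous vectors, with linear maps that respect the
  grading as arrows and with a tensor product spanned by elements that depend bilinearly on the two factors.
  The structural isomorphisms multiply such a product of homogeneous vectors by a scalar that depends on the
  degrees alone. An equation between arrows can therefore be checked on products of homogeneous vectors, where
  it becomes an identity between scalars: \<open>\<Phi>\<close> and \<open>R\<close> form an abelian 3-cocycle, and \<open>\<theta>\<close> is the quadratic form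
  that belongs to it. The locales \<open>concrete_category\<close>, \<open>concrete_tensor\<close> and \<open>graded_balanced\<close> carry out this
  reduction once. Their instances are the modules over \<open>\<complex>\<int>\<^bsub>2p\<^esub>\<close>, graded by \<open>S\<close> with addition
  \<open>(a, b) \<mapsto> [a + b]\<close> (\<open>RC_balanced\<close>), and the local modules, graded by the integers, with trivial associator and
  with braiding \<open>exp (\<pi>i/2p \<alpha>\<beta>)\<close> (\<open>MM_balanced\<close>).

  A module over \<open>\<Lambda>\<close> is a graded space with an invertible operator of degree \<open>2pk\<close> for each \<open>1\<^sub>k\<close>. The double
  braiding with \<open>1\<^sub>k\<close> is multiplication by \<open>exp (2\<pi>ik\<alpha>)\<close> in degree \<open>\<alpha>\<close>, so a module is local iff its degrees
  are integers (\<open>is_local_iff\<close>). The relative tensor product is the quotient by the relations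
  \<open>x \<otimes> 1\<^sub>k y = (-1)\<^bsup>k\<alpha>\<^esup> (1\<^sub>k x \<otimes> y)\<close> for \<open>x\<close> of degree \<open>\<alpha>\<close> (\<open>tt_balanced\<close>), and a bilinear map respecting
  them factors through it (\<open>rt_extend\<close>).

  The sign \<open>(-1)\<^bsup>al\<^esup>\<close> in the monoidal structure \<open>J\<close> of the functor is exactly what these relations demand
  (\<open>J_lin_ex\<close>). Arrows out of \<open>F(M) \<otimes>\<^sub>\<Lambda> F(N)\<close> are determined by their values on the elements
  \<open>(1\<^sub>0 \<otimes> m) \<otimes>\<^sub>\<Lambda> (1\<^sub>0 \<otimes> n)\<close>. There compatibility with the associators says that the failure of \<open>\<zeta>\<close> and
  \<open>\<kappa>\<close> to be compatible with bracketing is \<open>\<Phi>\<close> (\<open>J_assoc\<close>), compatibility with the braidings is the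
  definition of \<open>R\<close> (\<open>J_braid\<close>), and compatibility with the units uses that the representative of \<open>0\<close> is \<open>2pt\<close>
  with \<open>t\<close> even (\<open>J_unit\<close>). A quasi-inverse takes the components whose degrees lie in \<open>S\<close>: the operators
  \<open>1\<^sub>k\<close> identify all other components with these (\<open>eps_ex\<close>).

  Duals are recognized by a criterion (\<open>dual_criterion\<close>): two finite homogeneous families that determine the
  arrows out of an object and out of its candidate dual have to be dual to each other up to scalars that absorb
  the values of the associator. For \<open>\<complex>\<int>\<^bsub>2p\<^esub>\<close> these are a basis of eigenvectors and the dual basis
  (\<open>RC_dual_data\<close>). For a local module \<open>M\<close> they are the images of such families under \<open>F\<close> and the isomorphism
  from \<open>F(G(M))\<close> to \<open>M\<close> (\<open>MM_rigid\<close>).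
\<close>

section \<open>Linear and bilinear maps on subspaces\<close>

notation (input) tensor (infixr "<*>" 80)

global_interpretation cvec_pair: vector_space_pair vscale vscale ..

definition lin_on :: "cvec set => (cvec => cvec) => bool" where
 "lin_on V f \<longleftrightarrow> (ALL x:V. ALL y:V. f (x + y) = f x + f y) & (ALL c. ALL x:V. f (c *\<^sub>C x) = c *\<^sub>C f x)"

definition bilin_on :: "cvec set => cvec set => (cvec => cvec => cvec) => bool" where
 "bilin_on V W be \<longleftrightarrow> (ALL x:V. lin_on W (be x)) & (ALL y:W. lin_on V (%x. be x y))"

lemma lin_onI:
 "[|!!x y. [|x : V; y : V|] ==> f (x + y) = f x + f y; !!c x. x : V ==> f (c *\<^sub>C x) = c *\<^sub>C f x|] ==> lin_on V f"
 by (simp add: lin_on_def)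

lemma lin_on_add: "[|lin_on V f; x : V; y : V|] ==> f (x + y) = f x + f y"
 by (simp add: lin_on_def)

lemma lin_on_scale: "[|lin_on V f; x : V|] ==> f (c *\<^sub>C x) = c *\<^sub>C f x"
 by (simp add: lin_on_def)

lemma lin_on_zero: "[|lin_on V f; 0 : V|] ==> f 0 = 0"
 using lin_on_scale[of V f 0 0] by simp

lemma lin_on_cong: "(!!x. x : V ==> f x = g x) ==> cvec.subspace V ==> lin_on V f \<longleftrightarrow> lin_on V g"
 by (simp add: lin_on_def cvec.subspace_add cvec.subspace_scale)

lemma lin_on_subset: "lin_on V f ==> W <= V ==> lin_on W f"
 unfolding lin_on_def by blast

lemma lin_iff: "f : lin V W \<longleftrightarrow> f : V \<rightarrow>\<^sub>E W & lin_on V f"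
 by (simp add: lin_def lin_on_def)

lemma lin_lin_on: "f : lin V W ==> lin_on V f"
 by (simp add: lin_iff)

lemma lin_mem: "f : lin V W ==> x : V ==> f x : W"
 by (auto simp: lin_iff)

lemma lin_eqI: "[|f : lin V W; g : lin V W'; !!x. x : V ==> f x = g x|] ==> f = g"
 by (auto simp: lin_iff intro: extensionalityI PiE_ext)

lemma lin_range: "f : lin V W' ==> (!!x. x : V ==> f x : W) ==> f : lin V W"
 by (auto simp: lin_iff)

lemma restrict_lin:
 "cvec.subspace V ==> lin_on V f ==> (!!x. x : V ==> f x : W) ==> restrict f V : lin V W"
 by (auto simp: lin_iff lin_on_def cvec.subspace_add cvec.subspace_scale)

lemma lin_on_sum:
 assumes "cvec.subspace V" "lin_on V f" "!!i. i : I ==> x i : V"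
 shows "f (SUM i:I. x i) = (SUM i:I. f (x i))"
 using assms(3)
proof (induction I rule: infinite_finite_induct)
 case (insert i I)
 have "x i : V" "sum x I : V" using insert by (auto intro: cvec.subspace_sum[OF assms(1)])
 then show ?case using lin_on_add[OF assms(2), of "x i" "sum x I"] insert by simp
qed (use assms lin_on_zero cvec.subspace_0 in simp_all)

lemma lin_on_diff:
 assumes "cvec.subspace V" "lin_on V f" "x : V" "y : V"
 shows "f (x - y) = f x - f y"
 using lin_on_add[OF assms(2), of "x - y" y] cvec.subspace_diff[OF assms(1,3,4)] assms by simp

lemma lin_on_span_eq:
 assumes f: "lin_on (cvec.span B) f" "lin_on (cvec.span B) g" and e: "!!b. b : B ==> f b = g b"
  and x: "x : cvec.span B"
 shows "f x = g x"
proof -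
 have "x : cvec.span B & f x = g x" using x
 proof (induction rule: cvec.span_induct_alt)
  case base then show ?case using f lin_on_zero cvec.span_zero by metis
 next
  case (step c b y)
  have "c *\<^sub>C b : cvec.span B" "b : cvec.span B" using step by (auto simp: cvec.span_base cvec.span_scale)
  then show ?case using step e lin_on_add[OF f(1)] lin_on_add[OF f(2)] lin_on_scale[OF f(1)] lin_on_scale[OF f(2)]
   by (simp add: cvec.span_add)
 qed
 then show ?thesis ..
qed

lemma lin_on_span_mem:
 assumes f: "lin_on (cvec.span B) f" and W: "cvec.subspace W" and e: "!!b. b : B ==> f b : W"
  and x: "x : cvec.span B"
 shows "f x : W"
proof -
 have "x : cvec.span B & f x : W" using x
 proof (induction rule: cvec.span_induct_alt)
  case base then show ?case using f W lin_on_zero cvec.span_zero cvec.subspace_0 by metis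
 next
  case (step c b y)
  have "c *\<^sub>C b : cvec.span B" "b : cvec.span B" using step by (auto simp: cvec.span_base cvec.span_scale)
  then show ?case using step e lin_on_add[OF f] lin_on_scale[OF f]
   by (simp add: cvec.span_add cvec.subspace_add[OF W] cvec.subspace_scale[OF W])
 qed
 then show ?thesis ..
qed

lemma subspace_lin_image:
 assumes "cvec.subspace V" "lin_on V f"
 shows "cvec.subspace (f ` V)"
 unfolding cvec.subspace_def
proof (intro conjI ballI allI)
 show "0 : f ` V" using lin_on_zero[OF assms(2)] cvec.subspace_0[OF assms(1)] by (metis imageI)
 fix x y assume "x : f ` V" "y : f ` V"
 then obtain a b where "x = f a" "y = f b" "a : V" "b : V" by auto
 then show "x + y : f ` V" using lin_on_add[OF assms(2), of a b] cvec.subspace_add[OF assms(1), of a b] by (metis imageI)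
next
 fix c x assume "x : f ` V"
 then obtain a where "x = f a" "a : V" by auto
 then show "c *\<^sub>C x : f ` V" using lin_on_scale[OF assms(2), of a c] cvec.subspace_scale[OF assms(1), of a c] by (metis imageI)
qed

lemma lin_span_eqI:
 assumes "f : lin (cvec.span B) W" "g : lin (cvec.span B) W'" "!!b. b : B ==> f b = g b"
 shows "f = g"
 using assms by (intro lin_eqI[OF assms(1,2)]) (auto intro: lin_on_span_eq lin_lin_on)

named_theorems lin_intros

lemma lin_on_id [lin_intros]: "lin_on V (%x. x)" by (simp add: lin_on_def)
lemma lin_on_0 [lin_intros]: "lin_on V (%x. 0)" by (simp add: lin_on_def)
lemma lin_on_comp_scale [lin_intros]: "lin_on V f ==> lin_on V (%x. c *\<^sub>C f x)"
 by (simp add: lin_on_def cvec.scale_right_distrib mult.commute)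
lemma lin_on_comp_add [lin_intros]: "lin_on V f ==> lin_on V g ==> lin_on V (%x. f x + g x)"
 by (simp add: lin_on_def cvec.scale_right_distrib algebra_simps)
lemma lin_on_comp_diff [lin_intros]: "lin_on V f ==> lin_on V g ==> lin_on V (%x. f x - g x)"
 by (simp add: lin_on_def cvec.scale_right_diff_distrib algebra_simps)
lemma lin_on_comp_sum [lin_intros]: "(!!i. i : I ==> lin_on V (f i)) ==> lin_on V (%x. SUM i:I. f i x)"
 by (simp add: lin_on_def cvec.scale_sum_right sum.distrib)

lemma lin_on_compose: "lin_on W g ==> lin_on V f ==> (!!x. x : V ==> f x : W) ==> lin_on V (%x. g (f x))"
 by (simp add: lin_on_def)

lemma bilin_onI:
 "(!!x. x : V ==> lin_on W (be x)) ==> (!!y. y : W ==> lin_on V (%x. be x y)) ==> bilin_on V W be"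
 by (simp add: bilin_on_def)

lemma bilin_onD1: "bilin_on V W be ==> x : V ==> lin_on W (be x)" by (simp add: bilin_on_def)
lemma bilin_onD2: "bilin_on V W be ==> y : W ==> lin_on V (%x. be x y)" by (simp add: bilin_on_def)

lemma bilin_on_flip: "bilin_on V W be ==> bilin_on W V (%y x. be x y)"
 by (simp add: bilin_on_def)

lemma bilin_on_span_mem:
 assumes b: "bilin_on (cvec.span A) (cvec.span B) be" and W: "cvec.subspace W"
  and e: "!!x y. x : A ==> y : B ==> be x y : W" and x: "x : cvec.span A" and y: "y : cvec.span B"
 shows "be x y : W"
proof -
 have "be a y : W" if "a : A" for a
  using lin_on_span_mem[OF bilin_onD1[OF b] W _ y] e that by (auto simp: cvec.span_base)
 then show ?thesis using lin_on_span_mem[OF bilin_onD2[OF b y] W _ x] by auto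
qed

lemma bilin_on_span_eq:
 assumes b: "bilin_on (cvec.span A) (cvec.span B) be" "bilin_on (cvec.span A) (cvec.span B) ga"
  and e: "!!x y. x : A ==> y : B ==> be x y = ga x y" and x: "x : cvec.span A" and y: "y : cvec.span B"
 shows "be x y = ga x y"
proof -
 have "be a y = ga a y" if "a : A" for a
  using lin_on_span_eq[OF bilin_onD1[OF b(1)] bilin_onD1[OF b(2)] _ y] e that by (auto simp: cvec.span_base)
 then show ?thesis using lin_on_span_eq[OF bilin_onD2[OF b(1) y] bilin_onD2[OF b(2) y] _ x] by auto
qed

text \<open>
  Linearity in the first argument need only be known at the generators of the second factor, since the set of
  all \<open>y\<close> at which it holds is a subspace.
\<close>

lemma bilin_on_of_generators:
 assumes "!!u. u : U ==> lin_on (cvec.span G) (f u)" and g: "!!g. g : G ==> lin_on U (%u. f u g)"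
  and U: "cvec.subspace U"
 shows "bilin_on U (cvec.span G) f"
proof (intro bilin_onI lin_onI)
 fix y u v assume y: "y : cvec.span G" and u: "u : U" "v : U"
 have uv: "u + v : U" using u U by (simp add: cvec.subspace_add)
 show "f (u + v) y = f u y + f v y"
  by (rule lin_on_span_eq[OF assms(1)[OF uv] lin_on_comp_add[OF assms(1)[OF u(1)] assms(1)[OF u(2)]] _ y])
   (rule lin_on_add[OF g u])
next
 fix y u c assume y: "y : cvec.span G" and u: "u : U"
 have cu: "c *\<^sub>C u : U" using u U by (simp add: cvec.subspace_scale)
 show "f (c *\<^sub>C u) y = c *\<^sub>C f u y"
  by (rule lin_on_span_eq[OF assms(1)[OF cu] lin_on_comp_scale[OF assms(1)[OF u]] _ y])
   (rule lin_on_scale[OF g u])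
qed (use assms in "auto simp: lin_on_def")

text \<open>
  Every subspace has a complement. Projections reduce the construction of linear maps on subspaces to the
  whole space, where the basis vectors are at hand.
\<close>

lemma subspace_projection:
 assumes "cvec.subspace V"
 obtains P where "lin_on UNIV P" "!!x. P x : V" "!!x. x : V ==> P x = x"
proof -
 have "Vector_Spaces.linear vscale vscale (%x. x)" by (simp add: cvec.linear_ident)
 from cvec_pair.linear_exists_left_inverse_on[OF this assms] obtain g
  where g: "g ` UNIV <= V" "Vector_Spaces.linear vscale vscale g" "ALL v:V. g v = v" by auto
 have "lin_on UNIV g" using g(2) by (auto simp: lin_on_def cvec_pair.linear_add cvec_pair.linear_scale)
 with g show ?thesis by (intro that[of g]) auto
qed

section \<open>The tensor product of subspaces\<close>

lemma lookup_tensor: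
 "Poly_Mapping.lookup (v <*> w) n
   = Poly_Mapping.lookup v (fst (prod_decode n)) * Poly_Mapping.lookup w (snd (prod_decode n))"
proof -
 obtain a b where n: "prod_decode n = (a, b)" by fastforce
 then have n': "n = prod_encode (a, b)" by (metis prod_decode_inverse)
 have *: "Poly_Mapping.lookup ((Poly_Mapping.lookup v i * Poly_Mapping.lookup w j) *\<^sub>C basis_vec (prod_encode (i, j))) n
   = (if j = b then if i = a then Poly_Mapping.lookup v i * Poly_Mapping.lookup w j else 0 else 0)" for i j
  unfolding n' by (auto simp: lookup_vscale basis_vec_def lookup_single when_def simp del: single_one)
 show ?thesis
  unfolding tensor_def lookup_sum * n fst_conv snd_conv
  by (cases "b : Poly_Mapping.keys w") (auto simp: sum.delta in_keys_iff)
qed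

lemma tensor_add_left: "(x + y) <*> z = x <*> z + y <*> z"
 and tensor_add_right: "z <*> (x + y) = z <*> x + z <*> y"
 and tensor_scale_left: "(c *\<^sub>C x) <*> z = c *\<^sub>C (x <*> z)"
 and tensor_scale_right: "z <*> (c *\<^sub>C x) = c *\<^sub>C (z <*> x)"
 by (rule poly_mapping_eqI; simp add: lookup_tensor lookup_add lookup_vscale algebra_simps)+

lemma tensor_zero [simp]: "0 <*> x = 0" "x <*> 0 = 0"
 by (rule poly_mapping_eqI; simp add: lookup_tensor)+

lemma lin_on_tensor_left [lin_intros]: "lin_on V f ==> lin_on V (%x. f x <*> y)"
 by (simp add: lin_on_def tensor_add_left tensor_scale_left)
lemma lin_on_tensor_right [lin_intros]: "lin_on V f ==> lin_on V (%x. y <*> f x)"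
 by (simp add: lin_on_def tensor_add_right tensor_scale_right)

lemma bilin_on_tensor: "bilin_on V W (<*>)"
 by (intro bilin_onI lin_intros)

lemma tensor_sum_right: "x <*> (SUM i:I. f i) = (SUM i:I. x <*> f i)"
 by (rule lin_on_sum[where V = UNIV and f = "%y. x <*> y"]) (auto intro: lin_intros)

lemma basis_vec_expand: "v = (SUM i:Poly_Mapping.keys v. Poly_Mapping.lookup v i *\<^sub>C basis_vec i)"
proof (rule poly_mapping_eqI)
 fix n
 have "Poly_Mapping.lookup (Poly_Mapping.lookup v i *\<^sub>C basis_vec i) n = (if i = n then Poly_Mapping.lookup v i else 0)" for i
  by (auto simp: lookup_vscale basis_vec_def lookup_single when_def simp del: single_one)
 then show "Poly_Mapping.lookup v n = Poly_Mapping.lookup (SUM i:Poly_Mapping.keys v. Poly_Mapping.lookup v i *\<^sub>C basis_vec i) n"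
  by (simp add: lookup_sum sum.delta in_keys_iff)
qed

lemma span_basis_vec: "cvec.span (range basis_vec) = UNIV"
proof -
 have "v : cvec.span (range basis_vec)" for v
  by (subst basis_vec_expand) (intro cvec.span_sum cvec.span_scale cvec.span_base rangeI)
 then show ?thesis by auto
qed

text \<open>The basis vectors are independent, so prescribing values on them is harmless.\<close>

lemma basis_vec_extend: "EX f. lin_on UNIV f & (ALL i. f (basis_vec i) = g i)"
proof -
 let ?f = "%v. SUM i:Poly_Mapping.keys v. Poly_Mapping.lookup v i *\<^sub>C g i"
 have f: "?f v = (SUM i:I. Poly_Mapping.lookup v i *\<^sub>C g i)" if "finite I" "Poly_Mapping.keys v <= I" for v I
  by (rule sum.mono_neutral_left) (use that in "auto simp: in_keys_iff")
 have "lin_on UNIV ?f"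
 proof (rule lin_onI)
  fix x y :: cvec
  let ?I = "Poly_Mapping.keys x \<union> Poly_Mapping.keys y"
  have "?f (x + y) = (SUM i:?I. Poly_Mapping.lookup (x + y) i *\<^sub>C g i)"
   by (rule f) (auto dest: subsetD[OF Poly_Mapping.keys_add])
  also have "... = ?f x + ?f y"
   by (simp add: f[of ?I x] f[of ?I y] lookup_add cvec.scale_left_distrib sum.distrib)
  finally show "?f (x + y) = ?f x + ?f y" .
 next
  fix c :: complex and x :: cvec
  have "?f (c *\<^sub>C x) = (SUM i:Poly_Mapping.keys x. Poly_Mapping.lookup (c *\<^sub>C x) i *\<^sub>C g i)"
   by (rule f) (auto simp: in_keys_iff lookup_vscale)
  then show "?f (c *\<^sub>C x) = c *\<^sub>C ?f x" by (simp add: lookup_vscale cvec.scale_sum_right)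
 qed
 moreover have "?f (basis_vec i) = g i" for i
  by (simp add: basis_vec_def)
 ultimately show ?thesis by blast
qed

lemma basis_vec_tensor_basis_vec: "basis_vec i <*> basis_vec j = basis_vec (prod_encode (i, j))"
 by (rule poly_mapping_eqI)
  (auto simp: lookup_tensor basis_vec_def lookup_single when_def prod.expand prod_decode_inverse simp del: single_one,
   (metis prod_encode_inverse prod_decode_inverse fst_conv snd_conv prod.collapse)+)

text \<open>
  On the whole space the tensors of basis vectors are again basis vectors, so a bilinear map may be prescribed
  there. For subspaces, precompose with projections onto them.
\<close>

lemma tensor_extend:
 assumes V: "cvec.subspace V" and W: "cvec.subspace W" and b: "bilin_on V W be"
 shows "EX f. lin_on UNIV f & (ALL v:V. ALL w:W. f (v <*> w) = be v w)"
proof -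
 obtain P where P: "lin_on UNIV P" "!!x. P x : V" "!!x. x : V ==> P x = x"
  using subspace_projection[OF V] by blast
 obtain Q where Q: "lin_on UNIV Q" "!!x. Q x : W" "!!x. x : W ==> Q x = x"
  using subspace_projection[OF W] by blast
 define ga where "ga = (%x y. be (P x) (Q y))"
 have g: "bilin_on UNIV UNIV ga"
  unfolding ga_def
  by (intro bilin_onI lin_on_compose[OF bilin_onD1[OF b]] lin_on_compose[OF bilin_onD2[OF b]] P Q)
 obtain f where f: "lin_on UNIV f" "!!n. f (basis_vec n) = ga (basis_vec (fst (prod_decode n))) (basis_vec (snd (prod_decode n)))"
  using basis_vec_extend[of "%n. ga (basis_vec (fst (prod_decode n))) (basis_vec (snd (prod_decode n)))"] by auto
 have "f (x <*> y) = ga x y" for x y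
 proof (rule bilin_on_span_eq[of "range basis_vec" "range basis_vec" "%x y. f (x <*> y)" ga])
  show "bilin_on (cvec.span (range basis_vec)) (cvec.span (range basis_vec)) (%x y. f (x <*> y))"
   by (intro bilin_onI lin_on_compose[OF f(1)] lin_intros) auto
 qed (use g f in "auto simp: span_basis_vec basis_vec_tensor_basis_vec")
 with f(1) P(3) Q(3) show ?thesis unfolding ga_def by auto
qed

lemma subspace_tens [simp]: "cvec.subspace (tens V W)" by (simp add: tens_def)

lemma tens_mem: "v : V ==> w : W ==> v <*> w : tens V W"
 unfolding tens_def by (rule cvec.span_base) auto

lemma tens_lin_eqI:
 assumes "f : lin (tens V W) X" "g : lin (tens V W) Y" "!!v w. v : V ==> w : W ==> f (v <*> w) = g (v <*> w)"
 shows "f = g"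
 using assms unfolding tens_def by (auto intro!: lin_span_eqI)

lemma tmap_ex:
 assumes "cvec.subspace V" "cvec.subspace W" "bilin_on V W be"
 shows "EX f. f : lin (tens V W) UNIV & (ALL v:V. ALL w:W. f (v <*> w) = be v w)"
proof -
 obtain f where "lin_on UNIV f" "ALL v:V. ALL w:W. f (v <*> w) = be v w" using tensor_extend[OF assms] by auto
 then show ?thesis
  by (intro exI[of _ "restrict f (tens V W)"]) (auto intro!: restrict_lin lin_on_subset[of UNIV f] simp: tens_mem)
qed

lemma tmap:
 assumes "cvec.subspace V" "cvec.subspace W" "bilin_on V W be"
 shows tmap_lin: "tmap V W be : lin (tens V W) UNIV"
  and tmap_tensor: "!!v w. v : V ==> w : W ==> tmap V W be (v <*> w) = be v w"
proof -
 obtain f where f: "f : lin (tens V W) UNIV" "ALL v:V. ALL w:W. f (v <*> w) = be v w" using tmap_ex[OF assms] by auto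
 have "tmap V W be = f" unfolding tmap_def
  by (rule the_equality) (use f in "auto intro: tens_lin_eqI")
 then show "tmap V W be : lin (tens V W) UNIV" "!!v w. v : V ==> w : W ==> tmap V W be (v <*> w) = be v w"
  using f by auto
qed

lemma tens_lin_range:
 assumes "f : lin (tens V W) Y" "cvec.subspace X" "!!v w. v : V ==> w : W ==> f (v <*> w) : X"
 shows "f : lin (tens V W) X"
proof (rule lin_range[OF assms(1)])
 fix x assume x: "x : tens V W"
 show "f x : X"
  by (rule lin_on_span_mem[of "{v <*> w | v w. v : V & w : W}"])
   (use assms x in "auto simp: tens_def dest: lin_lin_on")
qed

lemma tens_tens_lin_eqI:
 assumes U: "cvec.subspace U"
  and f: "f : lin (tens U (tens V W)) X" "g : lin (tens U (tens V W)) Y"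
  and e: "!!u v w. u : U ==> v : V ==> w : W ==> f (u <*> (v <*> w)) = g (u <*> (v <*> w))"
 shows "f = g"
proof (rule tens_lin_eqI[OF f])
 fix u x assume u: "u : U" and x: "x : tens V W"
 show "f (u <*> x) = g (u <*> x)"
  by (rule lin_on_span_eq[OF _ _ _ x[unfolded tens_def], of "%x. f (u <*> x)" "%x. g (u <*> x)"])
   (use f u e in "auto intro!: lin_on_compose[OF lin_lin_on[OF f(1)]] lin_on_compose[OF lin_lin_on[OF f(2)]] lin_intros
     simp: tens_mem simp flip: tens_def")
qed

lemma tmap3:
 assumes U: "cvec.subspace U" and V: "cvec.subspace V" and W: "cvec.subspace W"
  and b: "!!u. u : U ==> bilin_on V W (be u)" and l: "!!v w. v : V ==> w : W ==> lin_on U (%u. be u v w)"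
 shows tmap3_lin: "tmap3 U V W be : lin (tens U (tens V W)) UNIV"
  and tmap3_tensor: "!!u v w. u : U ==> v : V ==> w : W ==> tmap3 U V W be (u <*> (v <*> w)) = be u v w"
proof -
 have t: "bilin_on U (tens V W) (%u. tmap V W (be u))"
  unfolding tens_def
 proof (rule bilin_on_of_generators[OF _ _ U])
  show "u : U ==> lin_on (cvec.span {v <*> w |v w. v : V & w : W}) (tmap V W (be u))" for u
   using tmap_lin[OF V W b] unfolding tens_def by (auto intro: lin_lin_on)
  fix g assume "g : {v <*> w |v w. v : V & w : W}"
  then obtain v w where g: "g = v <*> w" "v : V" "w : W" by auto
  then show "lin_on U (%u. tmap V W (be u) g)"
   using l[of v w] by (subst lin_on_cong[OF _ U]) (auto simp: tmap_tensor[OF V W b])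
 qed
 obtain f where f: "f : lin (tens U (tens V W)) UNIV" "ALL u:U. ALL x:tens V W. f (u <*> x) = tmap V W (be u) x"
  using tmap_ex[OF U subspace_tens t] by auto
 then have f': "ALL u:U. ALL v:V. ALL w:W. f (u <*> (v <*> w)) = be u v w"
  by (simp add: tens_mem tmap_tensor[OF V W b])
 have "tmap3 U V W be = f" unfolding tmap3_def
  by (rule the_equality) (use f f' in "auto intro: tens_tens_lin_eqI[OF U]")
 then show "tmap3 U V W be : lin (tens U (tens V W)) UNIV"
  "!!u v w. u : U ==> v : V ==> w : W ==> tmap3 U V W be (u <*> (v <*> w)) = be u v w"
  using f f' by auto
qed

section \<open>Balanced categories of graded spaces\<close>

lemma (in category) Comp_Arr [simp]:
 assumes "f : Arr C" "g : Arr C" "Cod C f = Dom C g"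
 shows "g \<cdot> f : Arr C" "Dom C (g \<cdot> f) = Dom C f" "Cod C (g \<cdot> f) = Cod C g"
 using Comp_hom[of f "Dom C f" "Dom C g" g "Cod C g"] assms by (auto simp: cat_hom_def)

lemma (in category) Id_Arr [simp]:
 assumes "X : Obj C"
 shows "Id C X : Arr C" "Dom C (Id C X) = X" "Cod C (Id C X) = X"
 using Id_hom[OF assms] by (auto simp: cat_hom_def)

declare (in category) Dom_Obj [simp] Cod_Obj [simp]

lemma (in category) inv_arrow_eq:
 assumes "inverse_arrows C f g"
 shows "inv_arrow C f = g"
 unfolding inv_arrow_def
proof (rule the_equality)
 fix h assume h: "inverse_arrows C f h"
 have f: "f : cat_hom C (Dom C f) (Cod C f)" and g: "g : cat_hom C (Cod C f) (Dom C f)"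
  and h': "h : cat_hom C (Cod C f) (Dom C f)"
  using assms h by (auto simp: inverse_arrows_def cat_hom_def)
 have "h = h \<cdot> (f \<cdot> g)" using Comp_Id[OF h'] assms by (simp add: inverse_arrows_def)
 also have "... = (h \<cdot> f) \<cdot> g" using Comp_assoc[OF g f h'] by simp
 also have "... = g" using Id_Comp[OF g] h by (simp add: inverse_arrows_def)
 finally show "h = g" .
qed (rule assms)

lemma (in category) cat_iso_inv:
 assumes "f : cat_iso C X Y"
 shows "f : Arr C" "Dom C f = X" "Cod C f = Y"
  "inv_arrow C f : Arr C" "Dom C (inv_arrow C f) = Y" "Cod C (inv_arrow C f) = X"
  "inv_arrow C f \<cdot> f = Id C X" "f \<cdot> inv_arrow C f = Id C Y"
proof -
 obtain g where "inverse_arrows C f g" using assms by (auto simp: cat_iso_def)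
 with inv_arrow_eq[OF this] assms
 show "f : Arr C" "Dom C f = X" "Cod C f = Y" "inv_arrow C f : Arr C" "Dom C (inv_arrow C f) = Y" "Cod C (inv_arrow C f) = X"
  "inv_arrow C f \<cdot> f = Id C X" "f \<cdot> inv_arrow C f = Id C Y"
  by (auto simp: cat_iso_def inverse_arrows_def cat_hom_def)
qed

text \<open>
  A category of vector spaces with extra structure, each spanned by homogeneous vectors that all
  arrows respect: its arrows are determined by the linear maps \<open>el f\<close> that underlie them.
\<close>

locale concrete_category = category C
 for C :: "('o, 'm, 'z) cat_scheme" (structure) +
 fixes car :: "'o => cvec set" and hg :: "'o => 'i => cvec set" and el :: "'m => cvec => cvec" and Ix :: "'i set"
 assumes car_span: "X : Obj C ==> car X = cvec.span (UN i:Ix. hg X i)"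
  and el_lin: "f : Arr C ==> el f : lin (car (Dom C f)) (car (Cod C f))"
  and el_hg: "[|f : Arr C; i : Ix; x : hg (Dom C f) i|] ==> el f x : hg (Cod C f) i"
  and hom_inj: "[|f : Arr C; g : Arr C; Dom C f = Dom C g; Cod C f = Cod C g; el f = el g|] ==> f = g"
  and el_Id [simp]: "[|X : Obj C; x : car X|] ==> el (Id C X) x = x"
  and el_Comp [simp]: "[|f : Arr C; g : Arr C; Cod C f = Dom C g; x : car (Dom C f)|] ==> el (g \<cdot> f) x = el g (el f x)"
  and inverse_hom: "[|f : Arr C; bij_betw (el f) (car (Dom C f)) (car (Cod C f))|]
     ==> EX g:cat_hom C (Cod C f) (Dom C f). ALL y:car (Cod C f). el f (el g y) = y"
begin

definition gen :: "'o => cvec set => bool" where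
 "gen X A \<longleftrightarrow> X : Obj C & car X = cvec.span A"

text \<open>
  Weaker than \<open>gen\<close>: a module over \<open>\<Lambda>\<close> is infinite-dimensional, but finitely
  many vectors suffice to tell its arrows apart.
\<close>

definition determined :: "'o => cvec set => bool" where
 "determined X A \<longleftrightarrow> X : Obj C & A <= car X & (ALL f g. f : Arr C \<longrightarrow> g : Arr C \<longrightarrow> Dom C f = X \<longrightarrow> Dom C g = X \<longrightarrow>
   Cod C f = Cod C g \<longrightarrow> (ALL a:A. el f a = el g a) \<longrightarrow> f = g)"

lemma car_subspace [simp]: "X : Obj C ==> cvec.subspace (car X)"
 by (simp add: car_span)

lemma hg_car: "[|X : Obj C; i : Ix; x : hg X i|] ==> x : car X"
 by (auto simp: car_span intro: cvec.span_base)

lemma el_car [simp]: "f : Arr C ==> x : car (Dom C f) ==> el f x : car (Cod C f)"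
 by (rule lin_mem[OF el_lin])

lemma el_scale: "f : Arr C ==> x : car (Dom C f) ==> el f (c *\<^sub>C x) = c *\<^sub>C el f x"
 by (rule lin_on_scale[OF lin_lin_on[OF el_lin]])

lemma el_sum: "f : Arr C ==> (!!i. i : I ==> x i : car (Dom C f)) ==> el f (SUM i:I. x i) = (SUM i:I. el f (x i))"
 by (rule lin_on_sum[OF _ lin_lin_on[OF el_lin]]) auto

lemma el_zero: "f : Arr C ==> el f 0 = 0"
 using lin_on_zero[OF lin_lin_on[OF el_lin]] cvec.subspace_0[OF car_subspace] by simp

lemma gen_hg: "X : Obj C ==> gen X (UN i:Ix. hg X i)"
 by (simp add: gen_def car_span)

lemma gen_car: "X : Obj C ==> gen X (car X)"
 unfolding gen_def car_span by (simp add: cvec.span_span)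

lemma gen_mem: "gen X A ==> a : A ==> a : car X"
 by (simp add: gen_def cvec.span_base)

lemma gen_determined: "gen X A ==> determined X A"
 unfolding determined_def
proof (intro conjI allI impI)
 assume g: "gen X A"
 show "X : Obj C" using g by (simp add: gen_def)
 show "A <= car X" using g gen_mem by auto
 fix f h assume fh: "f : Arr C" "h : Arr C" "Dom C f = X" "Dom C h = X" "Cod C f = Cod C h" "ALL a:A. el f a = el h a"
 have "el f = el h"
  by (rule lin_span_eqI[where B = A]) (use g el_lin[OF fh(1)] el_lin[OF fh(2)] fh in "auto simp: gen_def")
 with fh show "f = h" by (intro hom_inj) auto
qed

lemma hom_eqI:
 "[|determined X A; f : Arr C; g : Arr C; Dom C f = X; Dom C g = X; Cod C f = Cod C g; !!a. a : A ==> el f a = el g a|] ==> f = g"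
 unfolding determined_def by blast

lemmas hom_eqI_gen = hom_eqI[OF gen_determined]

lemma inverse_arrowsI:
 assumes "f : Arr C" "g : Arr C" "Dom C f = Cod C g" "Cod C f = Dom C g"
  and "determined (Dom C f) A" "determined (Dom C g) B"
  and "!!x. x : A ==> el g (el f x) = x" "!!y. y : B ==> el f (el g y) = y"
 shows "inverse_arrows C f g"
proof -
 have A: "A <= car (Dom C f)" "B <= car (Dom C g)" using assms by (auto simp: determined_def)
 have O: "Dom C f : Obj C" "Cod C f : Obj C" using assms(1) by simp_all
 have "g \<cdot> f = Id C (Dom C f)"
  by (rule hom_eqI[OF assms(5)]) (use assms A O in "auto simp: subset_iff")
 moreover have "f \<cdot> g = Id C (Cod C f)"
  by (rule hom_eqI[OF assms(6)]) (use assms A O in "auto simp: subset_iff")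
 ultimately show ?thesis using assms by (simp add: inverse_arrows_def cat_hom_def)
qed

lemma iso_of_bij:
 assumes f: "f : Arr C" and b: "bij_betw (el f) (car (Dom C f)) (car (Cod C f))"
 shows "f : cat_iso C (Dom C f) (Cod C f)"
proof -
 obtain g where g: "g : Arr C" "Dom C g = Cod C f" "Cod C g = Dom C f" "!!y. y : car (Cod C f) ==> el f (el g y) = y"
  using inverse_hom[OF assms] by (auto simp: cat_hom_def)
 have "el g (el f x) = x" if x: "x : car (Dom C f)" for x
 proof -
  have "el g (el f x) : car (Dom C f)" using el_car[OF g(1), of "el f x"] g f x by simp
  moreover have "el f (el g (el f x)) = el f x" using g f x by simp
  ultimately show ?thesis using b x by (auto simp: bij_betw_def inj_on_def)
 qed
 then have "inverse_arrows C f g"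
  using inverse_arrowsI[OF f g(1) _ _ gen_determined[OF gen_car] gen_determined[OF gen_car]] f g by auto
 then show ?thesis using f by (auto simp: cat_iso_def cat_hom_def)
qed

text \<open>The left inverse need not be an arrow, only linear, so it can be prescribed on a basis.\<close>

lemma iso_of_generators:
 assumes f: "f : Arr C" and A: "gen (Dom C f) A" and B: "gen (Cod C f) B" and g: "lin_on (car (Cod C f)) g"
  and l: "!!a. a : A ==> g (el f a) = a" and r: "!!b. b : B ==> b : el f ` car (Dom C f)"
 shows "f : cat_iso C (Dom C f) (Cod C f)"
proof (rule iso_of_bij[OF f])
 note el = lin_lin_on[OF el_lin[OF f]]
 have sA: "car (Dom C f) = cvec.span A" and sB: "car (Cod C f) = cvec.span B" using A B by (simp_all add: gen_def)
 have "lin_on (car (Dom C f)) (%x. g (el f x))" by (rule lin_on_compose[OF g el el_car[OF f]])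
 then have "g (el f x) = x" if "x : car (Dom C f)" for x
  using lin_on_span_eq[of A "%x. g (el f x)" "%x. x" x, OF _ lin_on_id l] that by (simp add: sA)
 then have "inj_on (el f) (car (Dom C f))" by (rule inj_on_inverseI)
 moreover have "el f ` car (Dom C f) = car (Cod C f)"
 proof
  show "el f ` car (Dom C f) <= car (Cod C f)" using f by auto
  show "car (Cod C f) <= el f ` car (Dom C f)"
   unfolding sB by (intro cvec.span_minimal subspace_lin_image[OF car_subspace el] subsetI r Dom_Obj f)
 qed
 ultimately show "bij_betw (el f) (car (Dom C f)) (car (Cod C f))" by (simp add: bij_betw_def)
qed

lemma iso_bij:
 assumes "f : cat_iso C X Y"
 shows "bij_betw (el f) (car X) (car Y)"
proof (rule bij_betw_byWitness[where f' = "el (inv_arrow C f)"])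
 note i [simp] = cat_iso_inv[OF assms]
 have X: "X : Obj C" "Y : Obj C" using Dom_Obj[OF i(1)] Cod_Obj[OF i(1)] by simp_all
 show "ALL x:car X. el (inv_arrow C f) (el f x) = x"
 proof
  fix x assume "x : car X"
  then have "el (inv_arrow C f) (el f x) = el (inv_arrow C f \<cdot> f) x" by (subst el_Comp) auto
  then show "el (inv_arrow C f) (el f x) = x" using X \<open>x : car X\<close> by simp
 qed
 show "ALL x:car Y. el f (el (inv_arrow C f) x) = x"
 proof
  fix x assume "x : car Y"
  then have "el f (el (inv_arrow C f) x) = el (f \<cdot> inv_arrow C f) x" by (subst el_Comp) auto
  then show "el f (el (inv_arrow C f) x) = x" using X \<open>x : car Y\<close> by simp
 qed
 show "el f ` car X <= car Y" using el_car[OF i(1)] by auto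
 show "el (inv_arrow C f) ` car Y <= car X" using el_car[OF i(4)] by auto
qed

lemma el_inv:
 assumes "f : cat_iso C X Y" "x : car X"
 shows "el (inv_arrow C f) (el f x) = x"
proof -
 note i [simp] = cat_iso_inv[OF assms(1)]
 have "X : Obj C" using Dom_Obj[OF i(1)] by simp
 have "el (inv_arrow C f) (el f x) = el (inv_arrow C f \<cdot> f) x" using assms by (subst el_Comp) auto
 then show ?thesis using assms \<open>X : Obj C\<close> by simp
qed

end

text \<open>
  Such a category with a tensor product \<open>X \<otimes> Y\<close> that is spanned by elements \<open>t X Y x y\<close>
  depending bilinearly on \<open>x\<close> and \<open>y\<close>.
\<close>

locale concrete_tensor = concrete_category C car hg el Ix
 for C :: "('o, 'm, 'z) moncat_scheme" (structure) and car and hg :: "'o => 'i => cvec set" and el and Ix +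
 fixes t :: "'o => 'o => cvec => cvec => cvec" and add :: "'i => 'i => 'i"
 assumes TensO_Obj' [simp]: "[|X : Obj C; Y : Obj C|] ==> X \<otimes> Y : Obj C"
  and add_Ix: "[|i : Ix; j : Ix|] ==> add i j : Ix"
  and t_bilin: "[|X : Obj C; Y : Obj C|] ==> bilin_on (car X) (car Y) (t X Y)"
  and t_hg: "[|X : Obj C; Y : Obj C; i : Ix; j : Ix; x : hg X i; y : hg Y j|] ==> t X Y x y : hg (X \<otimes> Y) (add i j)"
  and car_tens: "[|X : Obj C; Y : Obj C|] ==> car (X \<otimes> Y) = cvec.span {t X Y x y | x y. x : car X & y : car Y}"
  and TensA_Arr [simp]: "[|f : Arr C; g : Arr C|] ==> f \<odot> g : Arr C"
   "[|f : Arr C; g : Arr C|] ==> Dom C (f \<odot> g) = Dom C f \<otimes> Dom C g"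
   "[|f : Arr C; g : Arr C|] ==> Cod C (f \<odot> g) = Cod C f \<otimes> Cod C g"
  and el_TensA: "[|f : Arr C; g : Arr C; x : car (Dom C f); y : car (Dom C g)|]
     ==> el (f \<odot> g) (t (Dom C f) (Dom C g) x y) = t (Cod C f) (Cod C g) (el f x) (el g y)"
begin

lemma el_TensA' [simp]:
 "[|f : Arr C; g : Arr C; Dom C f = X; Dom C g = Y; x : car X; y : car Y|]
     ==> el (f \<odot> g) (t X Y x y) = t (Cod C f) (Cod C g) (el f x) (el g y)"
 using el_TensA by blast

lemma t_car [simp]: "[|X : Obj C; Y : Obj C; x : car X; y : car Y|] ==> t X Y x y : car (X \<otimes> Y)"
 by (subst car_tens) (auto intro: cvec.span_base)

lemma t_scale_left: "[|X : Obj C; Y : Obj C; x : car X; y : car Y|] ==> t X Y (c *\<^sub>C x) y = c *\<^sub>C t X Y x y"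
 by (rule lin_on_scale[OF bilin_onD2[OF t_bilin]])
lemma t_scale_right: "[|X : Obj C; Y : Obj C; x : car X; y : car Y|] ==> t X Y x (c *\<^sub>C y) = c *\<^sub>C t X Y x y"
 by (rule lin_on_scale[OF bilin_onD1[OF t_bilin]])
lemma t_sum_left: "[|X : Obj C; Y : Obj C; !!i. i : I ==> x i : car X; y : car Y|] ==> t X Y (SUM i:I. x i) y = (SUM i:I. t X Y (x i) y)"
 by (rule lin_on_sum[OF car_subspace bilin_onD2[OF t_bilin]])
lemma t_sum_right: "[|X : Obj C; Y : Obj C; !!i. i : I ==> y i : car Y; x : car X|] ==> t X Y x (SUM i:I. y i) = (SUM i:I. t X Y x (y i))"
 by (rule lin_on_sum[OF car_subspace bilin_onD1[OF t_bilin]])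
lemma t_zero: "[|X : Obj C; Y : Obj C; x : car X|] ==> t X Y x 0 = 0"
 using lin_on_zero[OF bilin_onD1[OF t_bilin]] cvec.subspace_0[OF car_subspace] by simp

lemma t_zero_left: "[|X : Obj C; Y : Obj C; y : car Y|] ==> t X Y 0 y = 0"
 using lin_on_zero[OF bilin_onD2[OF t_bilin]] cvec.subspace_0[OF car_subspace] by simp

lemma gen_tens:
 assumes "gen X A" "gen Y B"
 shows "gen (X \<otimes> Y) {t X Y a b | a b. a : A & b : B}"
proof -
 have X: "X : Obj C" "Y : Obj C" "car X = cvec.span A" "car Y = cvec.span B" using assms by (auto simp: gen_def)
 let ?G = "{t X Y a b | a b. a : A & b : B}"
 have "t X Y x y : cvec.span ?G" if "x : car X" "y : car Y" for x y
  by (rule bilin_on_span_mem[of A B]) (use X t_bilin[OF X(1,2)] that in "auto intro: cvec.span_base")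
 then have "cvec.span {t X Y x y | x y. x : car X & y : car Y} <= cvec.span ?G"
  by (intro cvec.span_minimal) auto
 moreover have "cvec.span ?G <= cvec.span {t X Y x y | x y. x : car X & y : car Y}"
  using X by (intro cvec.span_mono) (auto intro: cvec.span_base)
 ultimately show ?thesis using X by (simp add: gen_def car_tens)
qed

lemma TensA_Id_eq: "[|X : Obj C; Y : Obj C|] ==> Id C X \<odot> Id C Y = Id C (X \<otimes> Y)"
 by (rule hom_eqI_gen[OF gen_tens[OF gen_car gen_car]]) auto

lemma TensA_Comp_eq:
 assumes "f : Arr C" "f' : Arr C" "g : Arr C" "g' : Arr C" "Cod C f = Dom C f'" "Cod C g = Dom C g'"
 shows "(f' \<cdot> f) \<odot> (g' \<cdot> g) = (f' \<odot> g') \<cdot> (f \<odot> g)"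
proof (rule hom_eqI_gen[OF gen_tens[OF gen_car gen_car]])
 fix a assume "a : {t (Dom C f) (Dom C g) a b |a b. a : car (Dom C f) & b : car (Dom C g)}"
 then obtain x y where a: "a = t (Dom C f) (Dom C g) x y" "x : car (Dom C f)" "y : car (Dom C g)" by auto
 have "el f x : car (Dom C f')" "el g y : car (Dom C g')" using el_car[of f x] el_car[of g y] assms a by simp_all
 then show "el ((f' \<cdot> f) \<odot> (g' \<cdot> g)) a = el ((f' \<odot> g') \<cdot> (f \<odot> g)) a" using assms a by simp
qed (use assms in auto)

end

locale graded_balanced = concrete_tensor C car hg el Ix t add
 for C :: "('o, 'm, 'z) balcat_scheme" (structure) and car and hg :: "'o => 'i => cvec set" and el and Ix and t and add +
 fixes \<Phi> :: "'i => 'i => 'i => complex" and R :: "'i => 'i => complex" and \<theta> :: "'i => complex"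
  and i0 :: 'i and u0 :: cvec
 assumes Unit_Obj' [simp]: "\<one> : Obj C" and i0: "i0 : Ix" and u0: "u0 : hg \<one> i0"
  and Assoc_Arr: "[|X : Obj C; Y : Obj C; Z : Obj C|] ==> Assoc C X Y Z : cat_hom C (X \<otimes> (Y \<otimes> Z)) ((X \<otimes> Y) \<otimes> Z)"
  and el_Assoc: "[|X : Obj C; Y : Obj C; Z : Obj C; i : Ix; j : Ix; k : Ix; x : hg X i; y : hg Y j; z : hg Z k|]
     ==> el (Assoc C X Y Z) (t X (Y \<otimes> Z) x (t Y Z y z)) = \<Phi> i j k *\<^sub>C t (X \<otimes> Y) Z (t X Y x y) z"
  and Braid_Arr: "[|X : Obj C; Y : Obj C|] ==> Braid C X Y : cat_hom C (X \<otimes> Y) (Y \<otimes> X)"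
  and el_Braid: "[|X : Obj C; Y : Obj C; i : Ix; j : Ix; x : hg X i; y : hg Y j|]
     ==> el (Braid C X Y) (t X Y x y) = R i j *\<^sub>C t Y X y x"
  and Twist_iso': "X : Obj C ==> Twist C X : cat_iso C X X"
  and el_Twist: "[|X : Obj C; i : Ix; x : hg X i|] ==> el (Twist C X) x = \<theta> i *\<^sub>C x"
  and LUnit_Arr: "X : Obj C ==> LUnit C X : cat_hom C (\<one> \<otimes> X) X"
  and el_LUnit: "[|X : Obj C; x : car X|] ==> el (LUnit C X) (t \<one> X u0 x) = x"
  and car_LUnit: "X : Obj C ==> car (\<one> \<otimes> X) <= t \<one> X u0 ` car X"
  and RUnit_Arr: "X : Obj C ==> RUnit C X : cat_hom C (X \<otimes> \<one>) X"
  and el_RUnit: "[|X : Obj C; x : car X|] ==> el (RUnit C X) (t X \<one> x u0) = x"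
  and car_RUnit: "X : Obj C ==> car (X \<otimes> \<one>) <= (%x. t X \<one> x u0) ` car X"
  and \<Phi>_nz: "[|i : Ix; j : Ix; k : Ix|] ==> \<Phi> i j k ~= 0"
  and \<Phi>_unit: "[|i : Ix; k : Ix|] ==> \<Phi> i i0 k = 1"
  and \<Phi>_cocycle: "[|i : Ix; j : Ix; k : Ix; l : Ix|]
     ==> \<Phi> (add i j) k l * \<Phi> i j (add k l) = \<Phi> i j k * \<Phi> i (add j k) l * \<Phi> j k l"
  and R_nz: "[|i : Ix; j : Ix|] ==> R i j ~= 0"
  and add_commute: "[|i : Ix; j : Ix|] ==> add i j = add j i"
  and R_hexagon1: "[|i : Ix; j : Ix; k : Ix|]
     ==> R i (add j k) * \<Phi> j i k = \<Phi> j k i * R i k * R i j * \<Phi> i j k"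
  and R_hexagon2: "[|i : Ix; j : Ix; k : Ix|]
     ==> R (add i j) k * \<Phi> k i j * \<Phi> i j k = R i k * \<Phi> i k j * R j k"
  and \<theta>_add: "[|i : Ix; j : Ix|] ==> \<theta> (add i j) = R j i * R i j * \<theta> i * \<theta> j"
begin

lemma structure_Arr [simp]:
 "[|X : Obj C; Y : Obj C; Z : Obj C|] ==> Assoc C X Y Z : Arr C"
 "[|X : Obj C; Y : Obj C; Z : Obj C|] ==> Dom C (Assoc C X Y Z) = X \<otimes> (Y \<otimes> Z)"
 "[|X : Obj C; Y : Obj C; Z : Obj C|] ==> Cod C (Assoc C X Y Z) = (X \<otimes> Y) \<otimes> Z"
 "[|X : Obj C; Y : Obj C|] ==> Braid C X Y : Arr C"
 "[|X : Obj C; Y : Obj C|] ==> Dom C (Braid C X Y) = X \<otimes> Y"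
 "[|X : Obj C; Y : Obj C|] ==> Cod C (Braid C X Y) = Y \<otimes> X"
 "X : Obj C ==> LUnit C X : Arr C" "X : Obj C ==> Dom C (LUnit C X) = \<one> \<otimes> X" "X : Obj C ==> Cod C (LUnit C X) = X"
 "X : Obj C ==> RUnit C X : Arr C" "X : Obj C ==> Dom C (RUnit C X) = X \<otimes> \<one>" "X : Obj C ==> Cod C (RUnit C X) = X"
 "X : Obj C ==> Twist C X : Arr C" "X : Obj C ==> Dom C (Twist C X) = X" "X : Obj C ==> Cod C (Twist C X) = X"
 using Assoc_Arr[of X Y Z] Braid_Arr[of X Y] LUnit_Arr[of X] RUnit_Arr[of X] Twist_iso'[of X]
 by (auto simp: cat_hom_def cat_iso_def)

lemma u0_car [simp]: "u0 : car \<one>" using hg_car[OF _ i0 u0] by simp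

lemma gen_LUnit: "gen X A ==> gen (\<one> \<otimes> X) {t \<one> X u0 a | a. a : A}"
proof -
 assume g: "gen X A"
 then have X [simp]: "X : Obj C" "car X = cvec.span A" by (auto simp: gen_def)
 let ?G = "{t \<one> X u0 a | a. a : A}"
 have "t \<one> X u0 x : cvec.span ?G" if "x : car X" for x
  by (rule lin_on_span_mem[of A]) (use bilin_onD1[OF t_bilin u0_car, of X] that in "auto intro: cvec.span_base")
 then have "car (\<one> \<otimes> X) <= cvec.span ?G" using car_LUnit[of X] by auto
 moreover have "cvec.span ?G <= car (\<one> \<otimes> X)"
  by (intro cvec.span_minimal) (auto simp: cvec.span_base intro!: t_car)
 ultimately show ?thesis by (simp add: gen_def)
qed

lemma gen_RUnit: "gen X A ==> gen (X \<otimes> \<one>) {t X \<one> a u0 | a. a : A}"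
proof -
 assume g: "gen X A"
 then have X [simp]: "X : Obj C" "car X = cvec.span A" by (auto simp: gen_def)
 let ?G = "{t X \<one> a u0 | a. a : A}"
 have "t X \<one> x u0 : cvec.span ?G" if "x : car X" for x
  by (rule lin_on_span_mem[of A]) (use bilin_onD2[OF t_bilin u0_car, of X] that in "auto intro: cvec.span_base")
 then have "car (X \<otimes> \<one>) <= cvec.span ?G" using car_RUnit[of X] by auto
 moreover have "cvec.span ?G <= car (X \<otimes> \<one>)"
  by (intro cvec.span_minimal) (auto simp: cvec.span_base intro!: t_car)
 ultimately show ?thesis by (simp add: gen_def)
qed

lemma LUnit_iso': "X : Obj C ==> LUnit C X : cat_iso C (\<one> \<otimes> X) X"
proof -
 assume X [simp]: "X : Obj C"
 have "bij_betw (el (LUnit C X)) (car (\<one> \<otimes> X)) (car X)"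
  by (rule bij_betw_byWitness[where f' = "t \<one> X u0"])
   (use car_LUnit[OF X] el_car[of "LUnit C X"] in "auto simp: el_LUnit")
 then show ?thesis using iso_of_bij[of "LUnit C X"] by simp
qed

lemma RUnit_iso': "X : Obj C ==> RUnit C X : cat_iso C (X \<otimes> \<one>) X"
proof -
 assume X [simp]: "X : Obj C"
 have "bij_betw (el (RUnit C X)) (car (X \<otimes> \<one>)) (car X)"
  by (rule bij_betw_byWitness[where f' = "%x. t X \<one> x u0"])
   (use car_RUnit[OF X] el_car[of "RUnit C X"] in "auto simp: el_RUnit")
 then show ?thesis using iso_of_bij[of "RUnit C X"] by simp
qed

lemma gen3:
 assumes "X : Obj C" "Y : Obj C" "Z : Obj C"
 shows "gen (X \<otimes> (Y \<otimes> Z)) {t X (Y \<otimes> Z) x (t Y Z y z) | x y z. x : (UN i:Ix. hg X i) & y : (UN i:Ix. hg Y i) & z : (UN i:Ix. hg Z i)}"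
  (is "gen _ ?A")
  and "gen ((X \<otimes> Y) \<otimes> Z) {t (X \<otimes> Y) Z (t X Y x y) z | x y z. x : (UN i:Ix. hg X i) & y : (UN i:Ix. hg Y i) & z : (UN i:Ix. hg Z i)}"
  (is "gen _ ?B")
proof -
 note g = gen_hg[OF assms(1)] gen_hg[OF assms(2)] gen_hg[OF assms(3)]
 have "?A = {t X (Y \<otimes> Z) a b |a b. a : (UN i:Ix. hg X i) & b : {t Y Z a b |a b. a : (UN i:Ix. hg Y i) & b : (UN i:Ix. hg Z i)}}"
  by blast
 then show "gen (X \<otimes> (Y \<otimes> Z)) ?A" using gen_tens[OF g(1) gen_tens[OF g(2,3)]] by simp
 have "?B = {t (X \<otimes> Y) Z a b |a b. a : {t X Y a b |a b. a : (UN i:Ix. hg X i) & b : (UN i:Ix. hg Y i)} & b : (UN i:Ix. hg Z i)}"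
  by blast
 then show "gen ((X \<otimes> Y) \<otimes> Z) ?B" using gen_tens[OF gen_tens[OF g(1,2)] g(3)] by simp
qed

lemma Twist_tensor':
 assumes [simp]: "X : Obj C" "Y : Obj C"
 shows "Twist C (X \<otimes> Y) = Braid C Y X \<cdot> Braid C X Y \<cdot> (Twist C X \<odot> Twist C Y)"
proof (rule hom_eqI_gen[OF gen_tens[OF gen_hg[OF assms(1)] gen_hg[OF assms(2)]]])
 fix a assume "a : {t X Y a b |a b. a : (UN i:Ix. hg X i) & b : (UN i:Ix. hg Y i)}"
 then obtain i j x y where h: "i : Ix" "j : Ix" "x : hg X i" "y : hg Y j" and a: "a = t X Y x y" by auto
 then have [simp]: "x : car X" "y : car Y" using hg_car by auto
 show "el (Twist C (X \<otimes> Y)) a = el (Braid C Y X \<cdot> Braid C X Y \<cdot> (Twist C X \<odot> Twist C Y)) a"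
  using h unfolding a
  by (simp add: el_Twist[OF _ add_Ix[OF h(1,2)] t_hg[OF _ _ h]] el_Twist[OF _ h(1,3)] el_Twist[OF _ h(2,4)]
    t_scale_left t_scale_right el_scale cvec.subspace_scale el_Braid[OF _ _ h(1,2)] el_Braid[OF _ _ h(2,1)] \<theta>_add mult_ac)
qed auto

text \<open>
  By \<open>\<theta>_add\<close> the double braiding followed by the two twists is the twist of the product,
  which is invertible.
\<close>

lemma Braid_inverse:
 assumes [simp]: "X : Obj C" "Y : Obj C"
 shows Braid_iso': "Braid C X Y : cat_iso C (X \<otimes> Y) (Y \<otimes> X)"
  and el_inv_Braid: "!!i j x y. [|i : Ix; j : Ix; x : hg X i; y : hg Y j|] ==> 
   el (inv_arrow C (Braid C X Y)) (t Y X y x) = inverse (R i j) *\<^sub>C t X Y x y"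
proof -
 let ?T = "Twist C (X \<otimes> Y)"
 let ?g = "inv_arrow C ?T \<cdot> (Twist C X \<odot> Twist C Y) \<cdot> Braid C Y X"
 have [simp]: "inv_arrow C ?T : Arr C" "Dom C (inv_arrow C ?T) = X \<otimes> Y" "Cod C (inv_arrow C ?T) = X \<otimes> Y"
  using cat_iso_inv[OF Twist_iso'[of "X \<otimes> Y"]] by simp_all
 have "Braid C X Y : cat_iso C (Dom C (Braid C X Y)) (Cod C (Braid C X Y))"
 proof (rule iso_of_generators)
  show "gen (Dom C (Braid C X Y)) {t X Y a b |a b. a : (UN i:Ix. hg X i) & b : (UN i:Ix. hg Y i)}"
   "gen (Cod C (Braid C X Y)) {t Y X a b |a b. a : (UN i:Ix. hg Y i) & b : (UN i:Ix. hg X i)}"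
   using gen_tens[OF gen_hg[OF assms(1)] gen_hg[OF assms(2)]] gen_tens[OF gen_hg[OF assms(2)] gen_hg[OF assms(1)]] by simp_all
  show "lin_on (car (Cod C (Braid C X Y))) (el ?g)" using lin_lin_on[OF el_lin[of ?g]] by simp
 next
  fix a assume "a : {t X Y a b |a b. a : (UN i:Ix. hg X i) & b : (UN i:Ix. hg Y i)}"
  then obtain i j x y where h: "i : Ix" "j : Ix" "x : hg X i" "y : hg Y j" and a: "a = t X Y x y" by auto
  then have [simp]: "x : car X" "y : car Y" using hg_car by auto
  have "el (inv_arrow C ?T) (\<theta> (add i j) *\<^sub>C t X Y x y) = t X Y x y"
   using el_inv[OF Twist_iso'[of "X \<otimes> Y"], of "t X Y x y"] el_Twist[OF _ add_Ix[OF h(1,2)] t_hg[OF _ _ h]] by simp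
  then show "el ?g (el (Braid C X Y) a) = a"
   by (simp add: a el_Braid[OF _ _ h] el_Braid[OF _ _ h(2,1,4,3)] el_Twist[OF _ h(1,3)] el_Twist[OF _ h(2,4)]
    t_scale_left t_scale_right el_scale cvec.subspace_scale \<theta>_add[OF h(1,2)] mult_ac)
 next
  fix b assume "b : {t Y X a b |a b. a : (UN i:Ix. hg Y i) & b : (UN i:Ix. hg X i)}"
  then obtain i j x y where h: "i : Ix" "j : Ix" "x : hg X i" "y : hg Y j" and b: "b = t Y X y x" by auto
  then have c [simp]: "x : car X" "y : car Y" using hg_car by auto
  have "b = el (Braid C X Y) (inverse (R i j) *\<^sub>C t X Y x y)"
   using R_nz[OF h(1,2)] by (simp add: b el_scale el_Braid[OF _ _ h])
  then show "b : el (Braid C X Y) ` car (Dom C (Braid C X Y))" by (intro image_eqI) (auto simp: cvec.subspace_scale)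
 qed simp
 then show iso: "Braid C X Y : cat_iso C (X \<otimes> Y) (Y \<otimes> X)" by simp
 fix i j x y assume h: "i : Ix" "j : Ix" "x : hg X i" "y : hg Y j"
 then have [simp]: "x : car X" "y : car Y" using hg_car by auto
 show "el (inv_arrow C (Braid C X Y)) (t Y X y x) = inverse (R i j) *\<^sub>C t X Y x y"
  using el_inv[OF iso, of "t X Y x y"] el_scale[of "inv_arrow C (Braid C X Y)" "t Y X y x" "R i j"] cat_iso_inv(4-6)[OF iso] R_nz[OF h(1,2)]
  by (simp add: el_Braid[OF _ _ h] flip: cvec.scale_scale) (metis R_nz h(1,2) cvec.scale_scale cvec.scale_one left_inverse)
qed

text \<open>
  Comparing the first hexagon for \<open>i, j, k\<close> and for \<open>i, k, j\<close> shows that the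
  antisymmetrization of \<open>\<Phi>\<close> is trivial.
\<close>

lemma Phi_inverse:
 assumes h: "i : Ix" "j : Ix" "k : Ix"
 shows "R (add i j) k * R i j * \<Phi> k j i * inverse (R i (add k j)) * inverse (R j k) = inverse (\<Phi> i j k)"
proof -
 note h' = h(1,3,2)
 have c: "R i (add k j) = R i (add j k)" using add_commute[OF h(2,3)] by simp
 note nz = R_nz[OF h(1,2)] R_nz[OF h(2,3)] R_nz[OF h(1,3)] R_nz[OF h(1) add_Ix[OF h(2,3)]] \<Phi>_nz[OF h] \<Phi>_nz[OF h(2,1,3)] \<Phi>_nz[OF h(3,1,2)]
  \<Phi>_nz[OF h(2,3,1)] \<Phi>_nz[OF h(1,3,2)] \<Phi>_nz[OF h(3,2,1)]
 note e1 = R_hexagon1[OF h] and e2 = R_hexagon1[OF h', unfolded c] and e3 = R_hexagon2[OF h]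
 have "(R (add i j) k * R i j * \<Phi> k j i * \<Phi> i j k) * \<Phi> k i j = R i k * \<Phi> i k j * R j k * R i j * \<Phi> k j i"
  using e3 by (simp add: mult_ac)
 also have "... = (R i (add j k) * R j k) * \<Phi> k i j" using e2 by (simp add: mult_ac)
 finally have "R (add i j) k * R i j * \<Phi> k j i * \<Phi> i j k = R i (add j k) * R j k" using nz(7) by simp
 then show ?thesis using nz unfolding c by (simp add: field_simps)
qed

text \<open>
  The associator is inverted by moving \<open>Z\<close> to the left, swapping \<open>X\<close> and \<open>Y\<close>, reassociating the reversed
  product and braiding everything back; the hexagons make the scalar come out right.
\<close>

lemma Assoc_inverse:
 assumes [simp]: "X : Obj C" "Y : Obj C" "Z : Obj C"
 shows Assoc_iso': "Assoc C X Y Z : cat_iso C (X \<otimes> (Y \<otimes> Z)) ((X \<otimes> Y) \<otimes> Z)"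
  and el_inv_Assoc: "!!i j k x y z. [|i : Ix; j : Ix; k : Ix; x : hg X i; y : hg Y j; z : hg Z k|] ==> 
   el (inv_arrow C (Assoc C X Y Z)) (t (X \<otimes> Y) Z (t X Y x y) z) = inverse (\<Phi> i j k) *\<^sub>C t X (Y \<otimes> Z) x (t Y Z y z)"
proof -
 let ?b = "inv_arrow C (Braid C Y Z)" and ?b' = "inv_arrow C (Braid C X (Z \<otimes> Y))"
 let ?g = "(Id C X \<odot> ?b) \<cdot> ?b' \<cdot> Assoc C Z Y X \<cdot> (Id C Z \<odot> Braid C X Y) \<cdot> Braid C (X \<otimes> Y) Z"
 note [simp] = cat_iso_inv(4-6)[OF Braid_iso'[of Y Z]] cat_iso_inv(4-6)[OF Braid_iso'[of X "Z \<otimes> Y"]]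
 have g: "?g : Arr C" "Dom C ?g = (X \<otimes> Y) \<otimes> Z" "Cod C ?g = X \<otimes> (Y \<otimes> Z)" by simp_all
 have el_g: "el ?g (t (X \<otimes> Y) Z (t X Y x y) z) = inverse (\<Phi> i j k) *\<^sub>C t X (Y \<otimes> Z) x (t Y Z y z)"
  if h: "i : Ix" "j : Ix" "k : Ix" "x : hg X i" "y : hg Y j" "z : hg Z k" for i j k x y z
 proof -
  have [simp]: "x : car X" "y : car Y" "z : car Z" using h hg_car by auto
  note xy = t_hg[OF assms(1,2) h(1,2,4,5)] and zy = t_hg[OF assms(3,2) h(3,2,6,5)]
  note sc = el_scale t_scale_left t_scale_right cvec.subspace_scale
  show ?thesis
   using Phi_inverse[OF h(1-3)]
   by (simp add: sc el_Braid[OF _ _ add_Ix[OF h(1,2)] h(3) xy h(6)] el_Braid[OF _ _ h(1,2,4,5)] el_Assoc[OF _ _ _ h(3,2,1,6,5,4)]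
    el_inv_Braid[OF _ _ h(1) add_Ix[OF h(3,2)] h(4) zy] el_inv_Braid[OF _ _ h(2,3,5,6)] mult_ac)
 qed
 have 1: "el ?g (el (Assoc C X Y Z) (t X (Y \<otimes> Z) x (t Y Z y z))) = t X (Y \<otimes> Z) x (t Y Z y z)"
  and 2: "el (Assoc C X Y Z) (el ?g (t (X \<otimes> Y) Z (t X Y x y) z)) = t (X \<otimes> Y) Z (t X Y x y) z"
  if h: "i : Ix" "j : Ix" "k : Ix" "x : hg X i" "y : hg Y j" "z : hg Z k" for i j k x y z
 proof -
  have c: "t (X \<otimes> Y) Z (t X Y x y) z : car ((X \<otimes> Y) \<otimes> Z)" "t X (Y \<otimes> Z) x (t Y Z y z) : car (X \<otimes> (Y \<otimes> Z))" using h hg_car by auto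
  show "el ?g (el (Assoc C X Y Z) (t X (Y \<otimes> Z) x (t Y Z y z))) = t X (Y \<otimes> Z) x (t Y Z y z)"
   unfolding el_Assoc[OF assms h] el_scale[OF g(1), unfolded g(2), OF c(1)] el_g[OF h] using \<Phi>_nz[OF h(1,2,3)] by simp
  show "el (Assoc C X Y Z) (el ?g (t (X \<otimes> Y) Z (t X Y x y) z)) = t (X \<otimes> Y) Z (t X Y x y) z"
   unfolding el_g[OF h] using \<Phi>_nz[OF h(1,2,3)] c el_Assoc[OF assms h] by (simp add: el_scale)
 qed
 have inv: "inverse_arrows C (Assoc C X Y Z) ?g"
  by (rule inverse_arrowsI) (use 1 2 g gen_determined[OF gen3(1)[OF assms]] gen_determined[OF gen3(2)[OF assms]] in "auto simp del: el_Comp")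
 show "Assoc C X Y Z : cat_iso C (X \<otimes> (Y \<otimes> Z)) ((X \<otimes> Y) \<otimes> Z)"
  using inv by (auto simp: cat_iso_def cat_hom_def)
 show "!!i j k x y z. [|i : Ix; j : Ix; k : Ix; x : hg X i; y : hg Y j; z : hg Z k|] ==> 
   el (inv_arrow C (Assoc C X Y Z)) (t (X \<otimes> Y) Z (t X Y x y) z) = inverse (\<Phi> i j k) *\<^sub>C t X (Y \<otimes> Z) x (t Y Z y z)"
  unfolding inv_arrow_eq[OF inv] by (rule el_g)
qed

lemma inv_Assoc_Arr [simp]:
 "[|X : Obj C; Y : Obj C; Z : Obj C|] ==> inv_arrow C (Assoc C X Y Z) : Arr C"
 "[|X : Obj C; Y : Obj C; Z : Obj C|] ==> Dom C (inv_arrow C (Assoc C X Y Z)) = (X \<otimes> Y) \<otimes> Z"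
 "[|X : Obj C; Y : Obj C; Z : Obj C|] ==> Cod C (inv_arrow C (Assoc C X Y Z)) = X \<otimes> (Y \<otimes> Z)"
 using cat_iso_inv[OF Assoc_iso'] by auto

lemma pentagon':
 assumes [simp]: "X : Obj C" "Y : Obj C" "Z : Obj C" "W : Obj C"
 shows "Assoc C (X \<otimes> Y) Z W \<cdot> Assoc C X Y (Z \<otimes> W)
      = (Assoc C X Y Z \<odot> Id C W) \<cdot> Assoc C X (Y \<otimes> Z) W \<cdot> (Id C X \<odot> Assoc C Y Z W)"
proof (rule hom_eqI_gen[OF gen_tens[OF gen_hg[OF assms(1)] gen3(1)[OF assms(2,3,4)]]])
 fix a assume "a : {t X (Y \<otimes> Z \<otimes> W) a b |a b. a : (UN i:Ix. hg X i) &
    b : {t Y (Z \<otimes> W) x (t Z W y z) |x y z. x : (UN i:Ix. hg Y i) & y : (UN i:Ix. hg Z i) & z : (UN i:Ix. hg W i)}}"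
 then obtain i j k l x y z w where h: "i : Ix" "j : Ix" "k : Ix" "l : Ix" "x : hg X i" "y : hg Y j" "z : hg Z k" "w : hg W l"
  and a: "a = t X (Y \<otimes> Z \<otimes> W) x (t Y (Z \<otimes> W) y (t Z W z w))" by auto
 have [simp]: "x : car X" "y : car Y" "z : car Z" "w : car W" using h hg_car by auto
 note xy = t_hg[OF assms(1,2) h(1,2,5,6)] and yz = t_hg[OF assms(2,3) h(2,3,6,7)] and zw = t_hg[OF assms(3,4) h(3,4,7,8)]
 show "el (Assoc C (X \<otimes> Y) Z W \<cdot> Assoc C X Y (Z \<otimes> W)) a
      = el ((Assoc C X Y Z \<odot> Id C W) \<cdot> Assoc C X (Y \<otimes> Z) W \<cdot> (Id C X \<odot> Assoc C Y Z W)) a"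
  unfolding a using \<Phi>_cocycle[OF h(1-4)]
  by (simp add: el_Assoc[OF _ _ _ h(1,2) add_Ix[OF h(3,4)] h(5,6) zw] el_Assoc[OF _ _ _ add_Ix[OF h(1,2)] h(3,4) xy h(7,8)]
   el_Assoc[OF _ _ _ h(2,3,4,6,7,8)] el_Assoc[OF _ _ _ h(1) add_Ix[OF h(2,3)] h(4,5) yz h(8)] el_Assoc[OF _ _ _ h(1,2,3,5,6,7)]
   el_scale t_scale_left t_scale_right cvec.subspace_scale mult_ac)
qed auto

lemma triangle':
 assumes [simp]: "X : Obj C" "Y : Obj C"
 shows "(RUnit C X \<odot> Id C Y) \<cdot> Assoc C X \<one> Y = Id C X \<odot> LUnit C Y"
proof (rule hom_eqI_gen[OF gen_tens[OF gen_hg[OF assms(1)] gen_LUnit[OF gen_hg[OF assms(2)]]]])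
 fix a assume "a : {t X (\<one> \<otimes> Y) a b |a b. a : (UN i:Ix. hg X i) & b : {t \<one> Y u0 a |a. a : (UN i:Ix. hg Y i)}}"
 then obtain i j x y where h: "i : Ix" "j : Ix" "x : hg X i" "y : hg Y j" and a: "a = t X (\<one> \<otimes> Y) x (t \<one> Y u0 y)" by auto
 have [simp]: "x : car X" "y : car Y" using h hg_car by auto
 show "el ((RUnit C X \<odot> Id C Y) \<cdot> Assoc C X \<one> Y) a = el (Id C X \<odot> LUnit C Y) a"
  unfolding a by (simp add: el_Assoc[OF _ _ _ h(1) i0 h(2,3) u0 h(4)] \<Phi>_unit h el_RUnit el_LUnit)
qed auto

lemma hexagon1':
 assumes [simp]: "X : Obj C" "Y : Obj C" "Z : Obj C"
 shows "Braid C X (Y \<otimes> Z) = Assoc C Y Z X \<cdot> (Id C Y \<odot> Braid C X Z)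
        \<cdot> inv_arrow C (Assoc C Y X Z) \<cdot> (Braid C X Y \<odot> Id C Z) \<cdot> Assoc C X Y Z" (is "?L = ?R")
proof (rule hom_eqI_gen[OF gen3(1)[OF assms]])
 fix a assume "a : {t X (Y \<otimes> Z) x (t Y Z y z) |x y z.
       x : (UN i:Ix. hg X i) & y : (UN i:Ix. hg Y i) & z : (UN i:Ix. hg Z i)}"
 then obtain i j k x y z where h: "i : Ix" "j : Ix" "k : Ix" "x : hg X i" "y : hg Y j" "z : hg Z k"
  and a: "a = t X (Y \<otimes> Z) x (t Y Z y z)" by auto
 have [simp]: "x : car X" "y : car Y" "z : car Z" using h hg_car by auto
 have "R i (add j k) = \<Phi> j k i * R i k * inverse (\<Phi> j i k) * R i j * \<Phi> i j k"
  using R_hexagon1[OF h(1-3)] \<Phi>_nz[OF h(2,1,3)] by (simp add: field_simps)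
 then show "el ?L a = el ?R a"
  unfolding a
  by (simp add: el_Braid[OF _ _ h(1) add_Ix[OF h(2,3)] h(4) t_hg[OF _ _ h(2,3,5,6)]]
   el_Assoc[OF _ _ _ h(1,2,3,4,5,6)] el_Braid[OF _ _ h(1,2,4,5)] el_inv_Assoc[OF _ _ _ h(2,1,3,5,4,6)] el_Braid[OF _ _ h(1,3,4,6)]
   el_Assoc[OF _ _ _ h(2,3,1,5,6,4)] el_scale t_scale_left t_scale_right cvec.subspace_scale mult_ac)
qed auto

lemma hexagon2':
 assumes [simp]: "X : Obj C" "Y : Obj C" "Z : Obj C"
 shows "Braid C (X \<otimes> Y) Z = inv_arrow C (Assoc C Z X Y) \<cdot> (Braid C X Z \<odot> Id C Y)
        \<cdot> Assoc C X Z Y \<cdot> (Id C X \<odot> Braid C Y Z) \<cdot> inv_arrow C (Assoc C X Y Z)" (is "?L = ?R")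
proof (rule hom_eqI_gen[OF gen3(2)[OF assms]])
 fix a assume "a : {t (X \<otimes> Y) Z (t X Y x y) z |x y z.
       x : (UN i:Ix. hg X i) & y : (UN i:Ix. hg Y i) & z : (UN i:Ix. hg Z i)}"
 then obtain i j k x y z where h: "i : Ix" "j : Ix" "k : Ix" "x : hg X i" "y : hg Y j" "z : hg Z k"
  and a: "a = t (X \<otimes> Y) Z (t X Y x y) z" by auto
 have [simp]: "x : car X" "y : car Y" "z : car Z" using h hg_car by auto
 have "R (add i j) k = inverse (\<Phi> k i j) * R i k * \<Phi> i k j * R j k * inverse (\<Phi> i j k)"
  using R_hexagon2[OF h(1-3)] \<Phi>_nz[OF h(1,2,3)] \<Phi>_nz[OF h(3,1,2)] by (simp add: field_simps)
 then show "el ?L a = el ?R a"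
  unfolding a
  by (simp add: el_Braid[OF _ _ add_Ix[OF h(1,2)] h(3) t_hg[OF _ _ h(1,2,4,5)] h(6)]
   el_inv_Assoc[OF _ _ _ h(1,2,3,4,5,6)] el_Braid[OF _ _ h(2,3,5,6)] el_Assoc[OF _ _ _ h(1,3,2,4,6,5)] el_Braid[OF _ _ h(1,3,4,6)]
   el_inv_Assoc[OF _ _ _ h(3,1,2,6,4,5)] el_scale t_scale_left t_scale_right cvec.subspace_scale mult_ac)
qed auto

lemma Assoc_natural':
 assumes f: "f : Arr C" "g : Arr C" "h : Arr C"
 shows "Assoc C (Cod C f) (Cod C g) (Cod C h) \<cdot> (f \<odot> (g \<odot> h)) = ((f \<odot> g) \<odot> h) \<cdot> Assoc C (Dom C f) (Dom C g) (Dom C h)" (is "?L = ?R")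
proof (rule hom_eqI_gen[OF gen3(1)[of "Dom C f" "Dom C g" "Dom C h"]])
 fix a assume "a : {t (Dom C f) (Dom C g \<otimes> Dom C h) x (t (Dom C g) (Dom C h) y z) |x y z.
       x : (UN i:Ix. hg (Dom C f) i) & y : (UN i:Ix. hg (Dom C g) i) & z : (UN i:Ix. hg (Dom C h) i)}"
 then obtain i j k x y z where h: "i : Ix" "j : Ix" "k : Ix" "x : hg (Dom C f) i" "y : hg (Dom C g) j" "z : hg (Dom C h) k"
  and a: "a = t (Dom C f) (Dom C g \<otimes> Dom C h) x (t (Dom C g) (Dom C h) y z)" by auto
 have [simp]: "x : car (Dom C f)" "y : car (Dom C g)" "z : car (Dom C h)" using f h hg_car Dom_Obj by blast+
 show "el ?L a = el ?R a"
  unfolding a using f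
  by (simp add: el_Assoc[OF _ _ _ h] el_scale el_Assoc[OF _ _ _ h(1-3) el_hg[OF f(1) h(1,4)] el_hg[OF f(2) h(2,5)] el_hg[OF f(3) h(3,6)]])
qed (use f in auto)

lemma Braid_natural':
 assumes f: "f : Arr C" "g : Arr C"
 shows "Braid C (Cod C f) (Cod C g) \<cdot> (f \<odot> g) = (g \<odot> f) \<cdot> Braid C (Dom C f) (Dom C g)" (is "?L = ?R")
proof (rule hom_eqI_gen[OF gen_tens[OF gen_hg[of "Dom C f"] gen_hg[of "Dom C g"]]])
 fix a assume "a : {t (Dom C f) (Dom C g) a b |a b. a : (UN i:Ix. hg (Dom C f) i) & b : (UN i:Ix. hg (Dom C g) i)}"
 then obtain i j x y where h: "i : Ix" "j : Ix" "x : hg (Dom C f) i" "y : hg (Dom C g) j" and a: "a = t (Dom C f) (Dom C g) x y" by auto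
 have [simp]: "x : car (Dom C f)" "y : car (Dom C g)" using f h hg_car Dom_Obj by blast+
 show "el ?L a = el ?R a"
  unfolding a using f
  by (simp add: el_Braid[OF _ _ h] el_scale el_Braid[OF _ _ h(1-2) el_hg[OF f(1) h(1,3)] el_hg[OF f(2) h(2,4)]])
qed (use f in auto)

lemma Twist_natural':
 assumes f: "f : Arr C"
 shows "Twist C (Cod C f) \<cdot> f = f \<cdot> Twist C (Dom C f)" (is "?L = ?R")
proof (rule hom_eqI_gen[OF gen_hg[of "Dom C f"]])
 fix x assume "x : (UN i:Ix. hg (Dom C f) i)"
 then obtain i where h: "i : Ix" "x : hg (Dom C f) i" by auto
 have [simp]: "x : car (Dom C f)" using f h hg_car Dom_Obj by blast
 show "el ?L x = el ?R x"
  using f by (simp add: el_Twist[OF _ h] el_Twist[OF _ h(1) el_hg[OF f h]] el_scale)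
qed (use f in auto)

lemma LUnit_natural':
 assumes f: "f : Arr C"
 shows "LUnit C (Cod C f) \<cdot> (Id C \<one> \<odot> f) = f \<cdot> LUnit C (Dom C f)" (is "?L = ?R")
proof (rule hom_eqI_gen[OF gen_LUnit[OF gen_car[of "Dom C f"]]])
 fix x assume "x : {t \<one> (Dom C f) u0 a |a. a : car (Dom C f)}"
 then show "el ?L x = el ?R x"
  using f by (auto simp: el_LUnit)
qed (use f in auto)

lemma RUnit_natural':
 assumes f: "f : Arr C"
 shows "RUnit C (Cod C f) \<cdot> (f \<odot> Id C \<one>) = f \<cdot> RUnit C (Dom C f)" (is "?L = ?R")
proof (rule hom_eqI_gen[OF gen_RUnit[OF gen_car[of "Dom C f"]]])
 fix x assume "x : {t (Dom C f) \<one> a u0 |a. a : car (Dom C f)}"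
 then show "el ?L x = el ?R x"
  using f by (auto simp: el_RUnit)
qed (use f in auto)

lemma balanced: "balanced_category C"
proof unfold_locales
 show "!!f X X' g Y Y'. f : cat_hom C X X' ==> g : cat_hom C Y Y' ==> f \<odot> g : cat_hom C (X \<otimes> Y) (X' \<otimes> Y')"
  by (simp add: cat_hom_def)
 show "!!f X X' f' X'' g Y Y' g' Y''. [|f : cat_hom C X X'; f' : cat_hom C X' X''; g : cat_hom C Y Y'; g' : cat_hom C Y' Y''|]
     ==> (f' \<cdot> f) \<odot> (g' \<cdot> g) = (f' \<odot> g') \<cdot> (f \<odot> g)"
  by (rule TensA_Comp_eq) (auto simp: cat_hom_def)
 show "!!f X X' g Y Y' h Z Z'. [|f : cat_hom C X X'; g : cat_hom C Y Y'; h : cat_hom C Z Z'|]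
     ==> Assoc C X' Y' Z' \<cdot> (f \<odot> (g \<odot> h)) = ((f \<odot> g) \<odot> h) \<cdot> Assoc C X Y Z"
  using Assoc_natural' by (auto simp: cat_hom_def)
 show "!!f X X'. f : cat_hom C X X' ==> LUnit C X' \<cdot> (Id C \<one> \<odot> f) = f \<cdot> LUnit C X"
  using LUnit_natural' by (auto simp: cat_hom_def)
 show "!!f X X'. f : cat_hom C X X' ==> RUnit C X' \<cdot> (f \<odot> Id C \<one>) = f \<cdot> RUnit C X"
  using RUnit_natural' by (auto simp: cat_hom_def)
 show "!!f X X' g Y Y'. [|f : cat_hom C X X'; g : cat_hom C Y Y'|]
     ==> Braid C X' Y' \<cdot> (f \<odot> g) = (g \<odot> f) \<cdot> Braid C X Y"
  using Braid_natural' by (auto simp: cat_hom_def)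
 show "!!f X Y. f : cat_hom C X Y ==> Twist C Y \<cdot> f = f \<cdot> Twist C X"
  using Twist_natural' by (auto simp: cat_hom_def)
qed (fact TensO_Obj' TensA_Id_eq Unit_Obj' Assoc_iso' LUnit_iso' RUnit_iso' pentagon' triangle' Braid_iso' hexagon1' hexagon2' Twist_iso' Twist_tensor')+

end

sublocale graded_balanced \<subseteq> balanced_category C by (rule balanced)

section \<open>A criterion for duals\<close>

lemma (in concrete_category) determined_iso:
 assumes f: "f : cat_iso C X Y" and d: "determined X A"
 shows "determined Y (el f ` A)"
 unfolding determined_def
proof (intro conjI allI impI)
 note i [simp] = cat_iso_inv[OF f]
 have A: "A <= car X" using d by (simp add: determined_def)
 show "Y : Obj C" using Cod_Obj[OF i(1)] by simp
 show "el f ` A <= car Y" using A el_car[OF i(1)] by auto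
 fix g h assume gh: "g : Arr C" "h : Arr C" "Dom C g = Y" "Dom C h = Y" "Cod C g = Cod C h" "ALL a:el f ` A. el g a = el h a"
 have eq: "g \<cdot> f = h \<cdot> f" by (rule hom_eqI[OF d]) (use gh A in "auto simp: subset_iff")
 have kk: "k = (k \<cdot> f) \<cdot> inv_arrow C f" if k: "k : Arr C" "Dom C k = Y" for k
 proof -
  have "(k \<cdot> f) \<cdot> inv_arrow C f = k \<cdot> (f \<cdot> inv_arrow C f)"
   by (rule Comp_assoc) (use k in "auto simp: cat_hom_def")
  then show ?thesis using Comp_Id[of k Y "Cod C k"] k by (simp add: cat_hom_def)
 qed
 show "g = h" by (subst kk[OF gh(1,3)], subst kk[OF gh(2,4)], simp only: eq)
qed

lemma (in category) inverse_iso: "f : cat_iso C X Y ==> inv_arrow C f : cat_iso C Y X"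
proof -
 assume "f : cat_iso C X Y"
 note i = cat_iso_inv[OF this]
 have "inverse_arrows C (inv_arrow C f) f" using i by (simp add: inverse_arrows_def cat_hom_def)
 then show "inv_arrow C f : cat_iso C Y X" using i(4-6) unfolding cat_iso_def cat_hom_def by blast
qed

text \<open>
  The families in the duality criterion need not generate as vector spaces, so it matters that
  \<open>determined\<close> is transported along isomorphisms.
\<close>

lemma (in graded_balanced) determined_LUnit:
 assumes X: "determined X A"
 shows "determined (\<one> \<otimes> X) {t \<one> X u0 a | a. a : A}"
proof -
 have O [simp]: "X : Obj C" and A: "A <= car X" using X by (auto simp: determined_def)
 have "el (inv_arrow C (LUnit C X)) a = t \<one> X u0 a" if "a : A" for a
  using el_inv[OF LUnit_iso[OF O], of "t \<one> X u0 a"] that A by (auto simp: el_LUnit)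
 then have "el (inv_arrow C (LUnit C X)) ` A = {t \<one> X u0 a | a. a : A}" by force
 then show ?thesis using determined_iso[OF inverse_iso[OF LUnit_iso[OF O]] X] by simp
qed

lemma (in graded_balanced) determined_RUnit:
 assumes X: "determined X A"
 shows "determined (X \<otimes> \<one>) {t X \<one> a u0 | a. a : A}"
proof -
 have O [simp]: "X : Obj C" and A: "A <= car X" using X by (auto simp: determined_def)
 have "el (inv_arrow C (RUnit C X)) a = t X \<one> a u0" if "a : A" for a
  using el_inv[OF RUnit_iso[OF O], of "t X \<one> a u0"] that A by (auto simp: el_RUnit)
 then have "el (inv_arrow C (RUnit C X)) ` A = {t X \<one> a u0 | a. a : A}" by force
 then show ?thesis using determined_iso[OF inverse_iso[OF RUnit_iso[OF O]] X] by simp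
qed

text \<open>
  Two finite families \<open>x\<close> and \<open>d\<close> of homogeneous vectors that determine all arrows out of \<open>X\<close> and \<open>D\<close>
  exhibit \<open>D\<close> as a dual of \<open>X\<close> as soon as they are dual bases up to scalars, and these scalars make up
  for the two values of the associator that occur in the zigzag equations.
\<close>

lemma (in graded_balanced) dual_criterion:
 assumes N: "finite N" and x: "!!n. n : N ==> i n : Ix & x n : hg X (i n)" and d: "!!n. n : N ==> j n : Ix & d n : hg D (j n)"
  and X: "determined X (x ` N)" and D: "determined D (d ` N)" and U: "determined \<one> {u0}"
  and ev: "ev : cat_hom C (D \<otimes> X) \<one>" and coev: "coev : cat_hom C \<one> (X \<otimes> D)"
  and el_ev: "!!n m. [|n : N; m : N|] ==> el ev (t D X (d n) (x m)) = (if n = m then e n *\<^sub>C u0 else 0)"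
  and el_coev: "el coev u0 = (SUM n:N. c n *\<^sub>C t X D (x n) (d n))"
  and ce: "!!n. n : N ==> c n * e n = \<Phi> (i n) (j n) (i n)" "!!n. n : N ==> c n * e n * \<Phi> (j n) (i n) (j n) = 1"
  and th: "!!n. n : N ==> \<theta> (i n) = \<theta> (j n)"
 shows "is_dual C X D ev coev & (Twist C X \<odot> Id C D) \<cdot> coev = (Id C X \<odot> Twist C D) \<cdot> coev"
proof -
 have O [simp]: "X : Obj C" "D : Obj C" using X D by (auto simp: determined_def)
 have [simp]: "ev : Arr C" "Dom C ev = D \<otimes> X" "Cod C ev = \<one>" "coev : Arr C" "Dom C coev = \<one>" "Cod C coev = X \<otimes> D"
  using ev coev by (auto simp: cat_hom_def)
 have xc [simp]: "n : N ==> x n : car X" and dc [simp]: "n : N ==> d n : car D" for n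
  using x[of n] d[of n] hg_car O by blast+
 have sub: "cvec.subspace (car (X \<otimes> D))" "cvec.subspace (car X)" "cvec.subspace (car D)" "cvec.subspace (car \<one>)"
  "cvec.subspace (car (X \<otimes> (D \<otimes> X)))" "cvec.subspace (car ((X \<otimes> D) \<otimes> X))"
  "cvec.subspace (car (D \<otimes> (X \<otimes> D)))" "cvec.subspace (car ((D \<otimes> X) \<otimes> D))" "cvec.subspace (car (\<one> \<otimes> D))" by simp_all
 have mem: "n : N ==> a *\<^sub>C t X D (x n) (d n) : car (X \<otimes> D)" for n a
  by (intro cvec.subspace_scale[OF sub(1)] t_car) auto
 have "RUnit C X \<cdot> (Id C X \<odot> ev) \<cdot> inv_arrow C (Assoc C X D X) \<cdot> (coev \<odot> Id C X) = LUnit C X" (is "?Z = _")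
 proof (rule hom_eqI[OF determined_LUnit[OF X]])
  fix a assume "a : {t \<one> X u0 a |a. a : x ` N}"
  then obtain m where m [simp]: "m : N" and a: "a = t \<one> X u0 (x m)" by auto
  have 1: "el (coev \<odot> Id C X) a = (SUM n:N. c n *\<^sub>C t (X \<otimes> D) X (t X D (x n) (d n)) (x m))"
   by (simp add: a el_coev t_sum_left mem t_scale_left)
  have 2: "el (inv_arrow C (Assoc C X D X)) (el (coev \<odot> Id C X) a)
   = (SUM n:N. (c n * inverse (\<Phi> (i n) (j n) (i m))) *\<^sub>C t X (D \<otimes> X) (x n) (t D X (d n) (x m)))"
  proof -
   have "el (inv_arrow C (Assoc C X D X)) (t (X \<otimes> D) X (t X D (x n) (d n)) (x m))
     = inverse (\<Phi> (i n) (j n) (i m)) *\<^sub>C t X (D \<otimes> X) (x n) (t D X (d n) (x m))" if "n : N" for n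
    by (rule el_inv_Assoc) (use x d that m in auto)
   then show ?thesis unfolding 1 by (subst el_sum) (auto simp: el_scale cvec.subspace_scale[OF sub(6)])
  qed
  have 3: "el (Id C X \<odot> ev) (el (inv_arrow C (Assoc C X D X)) (el (coev \<odot> Id C X) a)) = t X \<one> (x m) u0"
  proof -
   have "el (Id C X \<odot> ev) (el (inv_arrow C (Assoc C X D X)) (el (coev \<odot> Id C X) a))
    = (SUM n:N. (c n * inverse (\<Phi> (i n) (j n) (i m))) *\<^sub>C t X \<one> (x n) (if n = m then e n *\<^sub>C u0 else 0))"
    unfolding 2 by (subst el_sum) (auto simp: el_scale el_ev cvec.subspace_scale[OF sub(5)])
   also have "... = (SUM n:N. if n = m then (c m * e m * inverse (\<Phi> (i m) (j m) (i m))) *\<^sub>C t X \<one> (x m) u0 else 0)"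
    by (intro sum.cong refl) (auto simp: t_scale_right t_zero mult_ac)
   also have "... = t X \<one> (x m) u0"
    using N ce(1)[OF m] \<Phi>_nz[of "i m" "j m" "i m"] x[OF m] d[OF m] by (simp add: sum.delta)
   finally show ?thesis .
  qed
  have ac [simp]: "a : car (\<one> \<otimes> X)" by (simp add: a)
  have "el (coev \<odot> Id C X) a : car ((X \<otimes> D) \<otimes> X)" using el_car[of "coev \<odot> Id C X" a] by simp
  moreover have "el (inv_arrow C (Assoc C X D X)) (el (coev \<odot> Id C X) a) : car (X \<otimes> (D \<otimes> X))"
   using el_car[of "inv_arrow C (Assoc C X D X)" "el (coev \<odot> Id C X) a"] calculation by simp
  ultimately have "el ?Z a = el (RUnit C X) (t X \<one> (x m) u0)"
   using 3 by simp
  then show "el ?Z a = el (LUnit C X) a" by (simp add: a el_LUnit el_RUnit)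
 qed auto
 moreover have "LUnit C D \<cdot> (ev \<odot> Id C D) \<cdot> Assoc C D X D \<cdot> (Id C D \<odot> coev) = RUnit C D" (is "?Z = _")
 proof (rule hom_eqI[OF determined_RUnit[OF D]])
  fix a assume "a : {t D \<one> a u0 |a. a : d ` N}"
  then obtain m where m [simp]: "m : N" and a: "a = t D \<one> (d m) u0" by auto
  have 1: "el (Id C D \<odot> coev) a = (SUM n:N. c n *\<^sub>C t D (X \<otimes> D) (d m) (t X D (x n) (d n)))"
   by (simp add: a el_coev t_sum_right mem t_scale_right)
  have 2: "el (Assoc C D X D) (el (Id C D \<odot> coev) a)
   = (SUM n:N. (c n * \<Phi> (j m) (i n) (j n)) *\<^sub>C t (D \<otimes> X) D (t D X (d m) (x n)) (d n))"
  proof -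
   have "el (Assoc C D X D) (t D (X \<otimes> D) (d m) (t X D (x n) (d n)))
     = \<Phi> (j m) (i n) (j n) *\<^sub>C t (D \<otimes> X) D (t D X (d m) (x n)) (d n)" if "n : N" for n
    by (rule el_Assoc) (use x d that m in auto)
   then show ?thesis unfolding 1 by (subst el_sum) (auto simp: el_scale cvec.subspace_scale[OF sub(7)])
  qed
  have 3: "el (ev \<odot> Id C D) (el (Assoc C D X D) (el (Id C D \<odot> coev) a)) = t \<one> D u0 (d m)"
  proof -
   have "el (ev \<odot> Id C D) (el (Assoc C D X D) (el (Id C D \<odot> coev) a))
    = (SUM n:N. (c n * \<Phi> (j m) (i n) (j n)) *\<^sub>C t \<one> D (if m = n then e m *\<^sub>C u0 else 0) (d n))"
    unfolding 2 by (subst el_sum) (auto simp: el_scale el_ev cvec.subspace_scale[OF sub(8)])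
   also have "... = (SUM n:N. if n = m then (c m * e m * \<Phi> (j m) (i m) (j m)) *\<^sub>C t \<one> D u0 (d m) else 0)"
    by (intro sum.cong refl) (auto simp: t_scale_left t_zero_left mult_ac)
   also have "... = t \<one> D u0 (d m)"
    using N ce(2)[OF m] by (simp add: sum.delta)
   finally show ?thesis .
  qed
  have ac [simp]: "a : car (D \<otimes> \<one>)" by (simp add: a)
  have "el (Id C D \<odot> coev) a : car (D \<otimes> (X \<otimes> D))" using el_car[of "Id C D \<odot> coev" a] by simp
  moreover have "el (Assoc C D X D) (el (Id C D \<odot> coev) a) : car ((D \<otimes> X) \<otimes> D)"
   using el_car[of "Assoc C D X D" "el (Id C D \<odot> coev) a"] calculation by simp
  ultimately have "el ?Z a = el (LUnit C D) (t \<one> D u0 (d m))"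
   using 3 by simp
  then show "el ?Z a = el (RUnit C D) a" by (simp add: a el_LUnit el_RUnit)
 qed auto
 moreover have "(Twist C X \<odot> Id C D) \<cdot> coev = (Id C X \<odot> Twist C D) \<cdot> coev"
 proof (rule hom_eqI[OF U])
  fix a assume "a : {u0}"
  then have a: "a = u0" by simp
  have 1: "el (Twist C X \<odot> Id C D) (el coev u0) = (SUM n:N. (c n * \<theta> (i n)) *\<^sub>C t X D (x n) (d n))"
  proof -
   have "el (Twist C X) (x n) = \<theta> (i n) *\<^sub>C x n" if "n : N" for n by (rule el_Twist) (use x that in auto)
   then show ?thesis unfolding el_coev using mem by (subst el_sum) (auto simp: el_scale t_scale_left)
  qed
  have 2: "el (Id C X \<odot> Twist C D) (el coev u0) = (SUM n:N. (c n * \<theta> (j n)) *\<^sub>C t X D (x n) (d n))"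
  proof -
   have "el (Twist C D) (d n) = \<theta> (j n) *\<^sub>C d n" if "n : N" for n by (rule el_Twist) (use d that in auto)
   then show ?thesis unfolding el_coev using mem by (subst el_sum) (auto simp: el_scale t_scale_right)
  qed
  show "el ((Twist C X \<odot> Id C D) \<cdot> coev) a = el ((Id C X \<odot> Twist C D) \<cdot> coev) a"
   unfolding a by (simp add: 1 2 th)
 qed auto
 ultimately show ?thesis using ev coev by (simp add: is_dual_def)
qed

lemma tens_span:
 assumes "cvec.span A = V" "cvec.span B = W"
 shows "tens V W = cvec.span {a <*> b | a b. a : A & b : B}"
proof
 show "tens V W <= cvec.span {a <*> b | a b. a : A & b : B}"
  unfolding tens_def
 proof (rule cvec.span_minimal)
  have "v <*> w : cvec.span {a <*> b | a b. a : A & b : B}" if "v : V" "w : W" for v w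
   by (rule bilin_on_span_mem[of A B "(<*>)"]) (use assms that in "auto intro: bilin_on_tensor cvec.span_base")
  then show "{v <*> w |v w. v : V & w : W} <= cvec.span {a <*> b | a b. a : A & b : B}" by auto
 qed simp
 show "cvec.span {a <*> b | a b. a : A & b : B} <= tens V W"
  unfolding tens_def by (rule cvec.span_mono) (use assms in "auto intro: cvec.span_base")
qed

lemma fin_dim_tens:
 assumes "fin_dim V" "fin_dim W"
 shows "fin_dim (tens V W)"
proof -
 obtain A B where AB: "finite A" "cvec.span A = V" "finite B" "cvec.span B = W" using assms by (auto simp: fin_dim_def)
 have "{a <*> b | a b. a : A & b : B} = (%(a, b). a <*> b) ` (A \<times> B)" by auto
 then have "finite {a <*> b | a b. a : A & b : B}" using AB(1,3) by (simp only: finite_imageI finite_cartesian_product)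
 then show ?thesis unfolding fin_dim_def by (intro exI conjI) (auto simp: tens_span[OF AB(2,4)])
qed

lemma lin_inverse:
 assumes V: "cvec.subspace V" and f: "f : lin V W" and b: "bij_betw f V W"
 shows "restrict (the_inv_into V f) W : lin W V"
proof -
 have i: "inj_on f V" "f ` V = W" using b by (auto simp: bij_betw_def)
 have W: "y : W ==> the_inv_into V f y : V & f (the_inv_into V f y) = y" for y
  using i the_inv_into_into[OF i(1), of y V] f_the_inv_into_f[OF i(1), of y] by auto
 have inv: "y : W ==> x : V ==> f x = y ==> the_inv_into V f y = x" for x y
  using the_inv_into_f_f[OF i(1)] by auto
 have fl: "lin_on V f" using f by (rule lin_lin_on)
 have add: "f (the_inv_into V f x + the_inv_into V f y) = x + y" if "x : W" "y : W" for x y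
  using lin_on_add[OF fl] W that by simp
 have scale: "f (c *\<^sub>C the_inv_into V f x) = c *\<^sub>C x" if "x : W" for x c
  using lin_on_scale[OF fl] W that by simp
 have WW: "x + y : W" "c *\<^sub>C x : W" if "x : W" "y : W" for x y c
  using add[OF that] scale[OF that(1), of c] W that lin_mem[OF f] V
  by (metis cvec.subspace_add, metis cvec.subspace_scale)
 show ?thesis
  unfolding lin_iff
 proof
  show "restrict (the_inv_into V f) W : W \<rightarrow>\<^sub>E V" using W by auto
  show "lin_on W (restrict (the_inv_into V f) W)"
  proof (rule lin_onI)
   fix x y assume xy: "x : W" "y : W"
   have "the_inv_into V f (x + y) = the_inv_into V f x + the_inv_into V f y"
    by (rule inv) (use xy WW add W V in "auto simp: cvec.subspace_add")
   then show "restrict (the_inv_into V f) W (x + y) = restrict (the_inv_into V f) W x + restrict (the_inv_into V f) W y"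
    using xy WW by simp
  next
   fix x c assume xy: "x : W"
   have "the_inv_into V f (c *\<^sub>C x) = c *\<^sub>C the_inv_into V f x"
    by (rule inv) (use xy WW scale W V in "auto simp: cvec.subspace_scale")
   then show "restrict (the_inv_into V f) W (c *\<^sub>C x) = c *\<^sub>C restrict (the_inv_into V f) W x"
    using xy WW by simp
  qed
 qed
qed

lemma lin_on_lookup [lin_intros]: "lin_on V (%x. Poly_Mapping.lookup x n *\<^sub>C y)"
 by (auto intro!: lin_onI simp: lookup_add lookup_vscale cvec.scale_left_distrib)

lemma lookup_basis_vec: "Poly_Mapping.lookup (basis_vec i) j = (if i = j then 1 else 0)"
 by (simp add: basis_vec_def lookup_single when_def del: single_one)

lemma subspace_unit_space [simp]: "cvec.subspace unit_space" by (simp add: unit_space_def)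

lemma tens_unit_left: "cvec.subspace V ==> tens unit_space V = cvec.span {e0 <*> v | v. v : V}"
 and tens_unit_right: "cvec.subspace V ==> tens V unit_space = cvec.span {v <*> e0 | v. v : V}"
 using tens_span[of "{e0}" unit_space V V] tens_span[of V V "{e0}" unit_space]
 by (simp_all add: unit_space_def cvec.span_eq_iff)

lemma tens_unit_left_mem:
 assumes V: "cvec.subspace V" and x: "x : tens unit_space V" shows "EX v:V. x = e0 <*> v"
proof -
 have "tens unit_space V <= {e0 <*> v | v. v : V}"
  unfolding tens_unit_left[OF V]
 proof (rule cvec.span_minimal)
  show "cvec.subspace {e0 <*> v |v. v : V}"
   unfolding cvec.subspace_def
   using cvec.subspace_0[OF V] cvec.subspace_add[OF V] cvec.subspace_scale[OF V]
   by (auto simp flip: tensor_add_right tensor_scale_right) (metis tensor_zero(2))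
 qed simp
 with x show ?thesis by auto
qed

lemma tens_unit_right_mem:
 assumes V: "cvec.subspace V" and x: "x : tens V unit_space" shows "EX v:V. x = v <*> e0"
proof -
 have "tens V unit_space <= {v <*> e0 | v. v : V}"
  unfolding tens_unit_right[OF V]
 proof (rule cvec.span_minimal)
  show "cvec.subspace {v <*> e0 |v. v : V}"
   unfolding cvec.subspace_def
   using cvec.subspace_0[OF V] cvec.subspace_add[OF V] cvec.subspace_scale[OF V]
   by (auto simp flip: tensor_add_left tensor_scale_left) (metis tensor_zero(1))
 qed simp
 with x show ?thesis by auto
qed

lemma left_unit_map:
 fixes V
 defines "f \<equiv> THE f. f : lin (tens unit_space V) V & (ALL v:V. f (e0 <*> v) = v)"
 assumes V: "cvec.subspace V"
 shows "f : lin (tens unit_space V) V" "!!v. v : V ==> f (e0 <*> v) = v"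
proof -
 obtain g where g: "g : lin (tens unit_space V) UNIV"
  "ALL x:unit_space. ALL v:V. g (x <*> v) = Poly_Mapping.lookup x 0 *\<^sub>C v"
  using tmap_ex[OF subspace_unit_space V bilin_onI[OF lin_on_comp_scale[OF lin_on_id] lin_on_lookup]] by blast
 have g1: "ALL v:V. g (e0 <*> v) = v" using g(2) by (simp add: unit_space_def cvec.span_base lookup_basis_vec)
 have g2: "g : lin (tens unit_space V) V"
  by (rule tens_lin_range[OF g(1) V]) (use g(2) cvec.subspace_scale[OF V] in auto)
 have "f = g" unfolding f_def
 proof (rule the_equality)
  show "h = g" if "h : lin (tens unit_space V) V & (ALL v:V. h (e0 <*> v) = v)" for h
   by (rule lin_span_eqI[of h "{e0 <*> v | v. v : V}" V g V])
    (use that g1 g2 in "auto simp flip: tens_unit_left[OF V]")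
 qed (use g1 g2 in auto)
 then show "f : lin (tens unit_space V) V" "!!v. v : V ==> f (e0 <*> v) = v" using g1 g2 by auto
qed

lemma right_unit_map:
 fixes V
 defines "f \<equiv> THE f. f : lin (tens V unit_space) V & (ALL v:V. f (v <*> e0) = v)"
 assumes V: "cvec.subspace V"
 shows "f : lin (tens V unit_space) V" "!!v. v : V ==> f (v <*> e0) = v"
proof -
 obtain g where g: "g : lin (tens V unit_space) UNIV"
  "ALL v:V. ALL x:unit_space. g (v <*> x) = Poly_Mapping.lookup x 0 *\<^sub>C v"
  using tmap_ex[OF V subspace_unit_space bilin_onI[OF lin_on_lookup lin_on_comp_scale[OF lin_on_id]]] by blast
 have g1: "ALL v:V. g (v <*> e0) = v" using g(2) by (simp add: unit_space_def cvec.span_base lookup_basis_vec)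
 have g2: "g : lin (tens V unit_space) V"
  by (rule tens_lin_range[OF g(1) V]) (use g(2) cvec.subspace_scale[OF V] in auto)
 have "f = g" unfolding f_def
 proof (rule the_equality)
  show "h = g" if "h : lin (tens V unit_space) V & (ALL v:V. h (v <*> e0) = v)" for h
   by (rule lin_span_eqI[of h "{v <*> e0 | v. v : V}" V g V])
    (use that g1 g2 in "auto simp flip: tens_unit_right[OF V]")
 qed (use g1 g2 in auto)
 then show "f : lin (tens V unit_space) V" "!!v. v : V ==> f (v <*> e0) = v" using g1 g2 by auto
qed

lemma funpow_lin:
 assumes "f : lin V V"
 shows "lin_on V (f ^^ n)" "x : V ==> (f ^^ n) x : V"
proof -
 have m: "(f ^^ n) x : V" if "x : V" for n x
  by (induction n) (use that lin_mem[OF assms] in auto)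
 then show "x : V ==> (f ^^ n) x : V" .
 show "lin_on V (f ^^ n)"
  by (induction n) (use m lin_lin_on[OF assms] in "auto simp: lin_on_def")
qed

section \<open>Modules over the cyclic group algebra as graded spaces\<close>

lemma qpow_nz [simp]: "qpow p x ~= 0" by (simp add: qpow_def)
lemma qpow_0 [simp]: "qpow p 0 = 1" by (simp add: qpow_def)

lemma qpow_eq:
 assumes p: "p > 0" and "2 * int p dvd (x - y)"
 shows "qpow p (of_int x) = qpow p (of_int y)"
proof -
 have "qpow p (of_int x) = qpow p (of_int y) * qpow p (of_int (x - y))" by (simp flip: qpow_add)
 then show ?thesis using qpow_1_iff[OF p, of "x - y"] assms by simp
qed

definition eig :: "nat => kmod => int => cvec set" where
 "eig p V a = {v : kcar V. kact V v = qpow p (of_int a) *\<^sub>C v}"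

lemma eig_kcar: "v : eig p V a ==> v : kcar V" by (simp add: eig_def)

lemma eig_cong: "p > 0 ==> 2 * int p dvd (a - b) ==> eig p V a = eig p V b"
 using qpow_eq by (simp add: eig_def)

lemma kmodD:
 assumes "is_kmod p V"
 shows kmod_subspace: "cvec.subspace (kcar V)" and kmod_fin_dim: "fin_dim (kcar V)" and kmod_lin: "kact V : lin (kcar V) (kcar V)"
  and kmod_period: "!!v. v : kcar V ==> (kact V ^^ (2 * p)) v = v"
 using assms by (auto simp: is_kmod_def)

lemma eig_subspace: "is_kmod p V ==> cvec.subspace (eig p V a)"
 using kmod_subspace[of p V] lin_lin_on[OF kmod_lin[of p V]] lin_on_zero[OF lin_lin_on[OF kmod_lin[of p V]]]
 by (auto simp: cvec.subspace_def eig_def lin_on_def cvec.scale_right_distrib mult.commute)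

lemma kidem_lin: "is_kmod p V ==> lin_on (kcar V) (kidem p V a)"
 unfolding kidem_def by (intro lin_intros funpow_lin(1)[OF kmod_lin])

text \<open>
  Applying \<open>K\<close> shifts the summation index, which is cyclic because of \<open>K\<^bsup>2p\<^esup>
  = 1\<close>.
\<close>

lemma kidem_eig: 
 assumes p: "p > 0" and V: "is_kmod p V" and v: "v : kcar V"
 shows "kidem p V a v : eig p V a"
proof -
 note s = kmod_subspace[OF V] and l = lin_lin_on[OF kmod_lin[OF V]]
 let ?q = "%l. qpow p (- (of_int a * of_nat l))"
 let ?h = "%l. ?q l *\<^sub>C (kact V ^^ l) v"
 have pw: "(kact V ^^ n) v : kcar V" for n using funpow_lin(2)[OF kmod_lin[OF V] v] .
 have hm: "?h n : kcar V" for n by (rule cvec.subspace_scale[OF s pw])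
 have sm: "(SUM l<2*p. ?h l) : kcar V" by (rule cvec.subspace_sum[OF s]) (rule hm)
 have step: "kact V (?h n) = qpow p (of_int a) *\<^sub>C ?h (Suc n)" for n
 proof -
  have "qpow p (of_int a) * ?q (Suc n) = ?q n" by (simp flip: qpow_add add: algebra_simps)
  then show ?thesis using lin_on_scale[OF l pw] by simp
 qed
 have per: "?h (2 * p) = ?h 0"
 proof -
  have "?q (2 * p) = qpow p (of_int (- (2 * int p * a)))" by (simp add: mult_ac)
  also have "... = 1" by (subst qpow_1_iff[OF p]) simp
  finally show ?thesis using kmod_period[OF V v] by simp
 qed
 have "(SUM l<2*p. ?h (Suc l)) = (SUM l<2*p. ?h l)"
 proof -
  have "(SUM l<2*p. ?h (Suc l)) + ?h 0 = (SUM l<2*p. ?h l) + ?h (2 * p)"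
   using sum.lessThan_Suc_shift[of ?h "2*p"] by (simp add: add.commute)
  then show ?thesis unfolding per by simp
 qed
 then have "kact V (SUM l<2*p. ?h l) = qpow p (of_int a) *\<^sub>C (SUM l<2*p. ?h l)"
 proof -
  have "kact V (SUM l<2*p. ?h l) = (SUM l<2*p. kact V (?h l))" by (rule lin_on_sum[OF s l]) (rule hm)
  also have "... = (SUM l<2*p. qpow p (of_int a) *\<^sub>C ?h (Suc l))" by (simp only: step)
  also have "... = qpow p (of_int a) *\<^sub>C (SUM l<2*p. ?h (Suc l))" by (simp only: cvec.scale_sum_right)
  finally show ?thesis using \<open>(SUM l<2*p. ?h (Suc l)) = (SUM l<2*p. ?h l)\<close> by simp
 qed
 moreover have "{0..2 * p - 1} = {..<2 * p}" using p by auto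
 ultimately show ?thesis
  unfolding eig_def kidem_def using sm lin_on_scale[OF l sm, of "1 / of_nat (2 * p)"] cvec.subspace_scale[OF s sm, of "1 / of_nat (2 * p)"]
  by (simp add: mult.commute)
qed

lemma kidem_on_eig:
 assumes p: "p > 0" and v: "v : eig p V b" and V: "is_kmod p V"
 shows "kidem p V a v = (if 2 * int p dvd (b - a) then v else 0)"
proof -
 note s = kmod_subspace[OF V] and l = lin_lin_on[OF kmod_lin[OF V]]
 have pw: "(kact V ^^ n) v = qpow p (of_nat n * of_int b) *\<^sub>C v" for n
 proof (induction n)
  case (Suc n)
  have "qpow p (of_nat (Suc n) * of_int b) = qpow p (of_nat n * of_int b) * qpow p (of_int b)"
   by (simp add: qpow_add[symmetric] algebra_simps)
  then show ?case using Suc v lin_on_scale[OF l eig_kcar[OF v]] by (simp add: eig_def)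
 qed simp
 define r where "r = qpow p (of_int (b - a))"
 have rl: "qpow p (- (of_int a * of_nat n)) * qpow p (of_nat n * of_int b) = r ^ n" for n
  unfolding r_def qpow_power qpow_add[symmetric] by (simp add: algebra_simps)
 have "{0..2 * p - 1} = {..<2 * p}" using p by auto
 then have "kidem p V a v = (1 / of_nat (2 * p) * (SUM n<2*p. r ^ n)) *\<^sub>C v"
  unfolding kidem_def pw cvec.scale_scale rl by (simp only: cvec.scale_sum_left[symmetric] cvec.scale_scale)
 moreover have "(SUM n<2*p. r ^ n) = (if 2 * int p dvd (b - a) then of_nat (2 * p) else 0)"
 proof (cases "r = 1")
  case True then show ?thesis using qpow_1_iff[OF p, of "b - a"] by (simp add: r_def)
 next
  case False
  have "r ^ (2 * p) = qpow p (of_int (2 * int p * (b - a)))" by (simp add: r_def qpow_power)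
  also have "... = 1" by (simp only: qpow_1_iff[OF p] dvd_triv_left)
  finally show ?thesis using geometric_sum[OF False, of "2 * p"] False qpow_1_iff[OF p, of "b - a"] by (simp add: r_def)
 qed
 ultimately show ?thesis using p by simp
qed

lemma kidem_sum:
 assumes p: "p > 0" and V: "is_kmod p V" and v: "v : kcar V"
 shows "(SUM a:{0..<2 * int p}. kidem p V a v) = v"
proof -
 have "(SUM a:{0..<2 * int p}. qpow p (- (of_int a * of_nat l))) = (if l = 0 then of_nat (2 * p) else 0)"
  if l: "l < 2 * p" for l
 proof -
  define r where "r = qpow p (of_int (- int l))"
  have "(SUM a:{0..<2 * int p}. qpow p (- (of_int a * of_nat l))) = (SUM n<2*p. r ^ n)"
  proof (rule sum.reindex_bij_witness[of _ int nat])
   fix a assume a: "a : {0..<2 * int p}"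
   then have "of_nat (nat a) = (of_int a :: complex)" by simp
   then show "r ^ nat a = qpow p (- (of_int a * of_nat l))" unfolding r_def qpow_power by simp
  qed auto
  also have "... = (if l = 0 then of_nat (2 * p) else 0)"
  proof (cases "l = 0")
   case False
   have "r ~= 1" unfolding r_def qpow_1_iff[OF p] using False l by (auto dest: zdvd_imp_le)
   moreover have "r ^ (2 * p) = 1"
   proof -
    have "r ^ (2 * p) = qpow p (of_int (2 * int p * (- int l)))" by (simp add: r_def qpow_power)
    then show ?thesis by (simp only: qpow_1_iff[OF p] dvd_triv_left)
   qed
   ultimately show ?thesis using geometric_sum[of r "2 * p"] False by simp
  qed (simp add: r_def)
  finally show ?thesis .
 qed
 then have *: "(SUM l<2*p. (SUM a:{0..<2 * int p}. qpow p (- (of_int a * of_nat l))) *\<^sub>C (kact V ^^ l) v)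
   = (SUM l<2*p. if l = 0 then of_nat (2 * p) *\<^sub>C v else 0)"
  by (intro sum.cong refl) auto
 have i: "{0..2 * p - 1} = {..<2 * p}" using p by auto
 have "(SUM a:{0..<2 * int p}. kidem p V a v)
   = (1 / of_nat (2 * p)) *\<^sub>C (SUM l<2*p. (SUM a:{0..<2 * int p}. qpow p (- (of_int a * of_nat l))) *\<^sub>C (kact V ^^ l) v)"
  unfolding kidem_def i cvec.scale_sum_right[symmetric] cvec.scale_sum_left by (subst sum.swap) simp
 also have "... = v" unfolding * using p by (simp add: sum.delta)
 finally show ?thesis .
qed

text \<open>Every arrow condition is checked on common eigenvectors.\<close>

lemma commutes_on_eigenvectors:
 assumes V: "is_kmod p V" and W: "is_kmod p W" and f: "f : lin (kcar V) (kcar W)" and G: "kcar V = cvec.span G"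
  and e: "!!g. g : G ==> EX c. kact V g = c *\<^sub>C g & kact W (f g) = c *\<^sub>C f g" and v: "v : kcar V"
 shows "f (kact V v) = kact W (f v)"
proof (rule lin_on_span_eq[of G "%v. f (kact V v)" "%v. kact W (f v)"])
 note fl = lin_lin_on[OF f] and Vl = lin_lin_on[OF kmod_lin[OF V]] and Wl = lin_lin_on[OF kmod_lin[OF W]]
 show "lin_on (cvec.span G) (%v. f (kact V v))"
  unfolding G[symmetric] by (rule lin_on_compose[OF fl Vl lin_mem[OF kmod_lin[OF V]]])
 show "lin_on (cvec.span G) (%v. kact W (f v))"
  unfolding G[symmetric] by (rule lin_on_compose[OF Wl fl lin_mem[OF f]])
 fix g assume g: "g : G"
 then obtain c where c: "kact V g = c *\<^sub>C g" "kact W (f g) = c *\<^sub>C f g" using e by auto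
 then show "f (kact V g) = kact W (f g)" using lin_on_scale[OF fl, of g c] g G by (simp add: cvec.span_base)
qed (use v G in auto)

lemma is_kmod_ktens:
 assumes V: "is_kmod p V" and W: "is_kmod p W"
 shows "is_kmod p (ktens V W)"
  and "!!v w. [|v : kcar V; w : kcar W|] ==> kact (ktens V W) (v <*> w) = kact V v <*> kact W w"
proof -
 note s = kmod_subspace[OF V] kmod_subspace[OF W]
 have b: "bilin_on (kcar V) (kcar W) (%v w. kact V v <*> kact W w)"
  by (intro bilin_onI lin_intros lin_lin_on[OF kmod_lin[OF V]] lin_lin_on[OF kmod_lin[OF W]])
 show K: "!!v w. [|v : kcar V; w : kcar W|] ==> kact (ktens V W) (v <*> w) = kact V v <*> kact W w"
  by (simp add: ktens_def tmap_tensor[OF s b])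
 have l: "kact (ktens V W) : lin (tens (kcar V) (kcar W)) (tens (kcar V) (kcar W))"
  by (rule tens_lin_range[of _ _ _ UNIV])
   (use tmap_lin[OF s b] K lin_mem[OF kmod_lin[OF V]] lin_mem[OF kmod_lin[OF W]] in "auto simp: ktens_def tens_mem")
 have pw: "(kact (ktens V W) ^^ n) (v <*> w) = (kact V ^^ n) v <*> (kact W ^^ n) w" if "v : kcar V" "w : kcar W" for n v w
  by (induction n) (use that K funpow_lin(2)[OF kmod_lin[OF V]] funpow_lin(2)[OF kmod_lin[OF W]] in auto)
 have "(kact (ktens V W) ^^ (2 * p)) x = x" if x: "x : tens (kcar V) (kcar W)" for x
  by (rule lin_on_span_eq[OF _ lin_on_id _ x[unfolded tens_def]])
   (use funpow_lin(1)[OF l] pw kmod_period[OF V] kmod_period[OF W] in "auto simp: tens_def")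
 then show "is_kmod p (ktens V W)"
  using l kmod_fin_dim[OF V] kmod_fin_dim[OF W] unfolding is_kmod_def by (simp add: ktens_def fin_dim_tens)
qed

lemma kcar_ktens [simp]: "kcar (ktens V W) = tens (kcar V) (kcar W)" by (simp add: ktens_def)

lemma eig_ktens:
 assumes "is_kmod p V" "is_kmod p W" "v : eig p V a" "w : eig p W b"
 shows "v <*> w : eig p (ktens V W) (a + b)"
 using is_kmod_ktens[OF assms(1,2)] assms(3,4)
 by (auto simp: eig_def tens_mem qpow_add tensor_scale_left tensor_scale_right mult.commute)

lemma kunit_kmod: "p > 0 ==> is_kmod p kunit"
 using simple_is_kmod[of p 0] kunit_simple[of p] by simp

lemma kcar_kunit [simp]: "kcar kunit = unit_space" by (simp add: kunit_def)

locale rep_data =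
 fixes p :: nat and S :: "int set" and \<zeta> :: "int => int => complex"
 assumes p_pos: "p > 0"
  and S_bij: "bij_betw (%s. s mod (2 * int p)) S {0..<2 * int p}"
  and S_zero: "4 * int p dvd rep_mod p S 0"
  and zeta_nonzero: "[|a : S; b : S|] ==> \<zeta> a b ~= 0"
  and zeta_normalized: "a : S ==> \<zeta> a (rep_mod p S 0) = 1 & \<zeta> (rep_mod p S 0) a = 1"
begin

abbreviation rep :: "int => int" where "rep \<equiv> rep_mod p S"
abbreviation \<kappa> :: "int => int => int" where "\<kappa> \<equiv> kappa p S"

lemma rep_ex1: "EX!s. s : S & s mod (2 * int p) = x mod (2 * int p)"
proof -
 have "x mod (2 * int p) : {0..<2 * int p}" using p_pos by simp
 then have "x mod (2 * int p) : (%s. s mod (2 * int p)) ` S" using S_bij by (simp add: bij_betw_def)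
 then obtain s where "s : S" "s mod (2 * int p) = x mod (2 * int p)" by auto
 then show ?thesis using S_bij by (auto simp: bij_betw_def inj_on_def)
qed

lemma rep_S [simp]: "rep x : S" and rep_mod: "rep x mod (2 * int p) = x mod (2 * int p)"
 unfolding rep_mod_def using theI'[OF rep_ex1[of x]] by auto

lemma rep_dvd: "2 * int p dvd (x - rep x)"
 using rep_mod[of x] by (metis mod_eq_dvd_iff)

lemma rep_eqI: "s : S ==> 2 * int p dvd (s - x) ==> rep x = s"
 using rep_ex1[of x] rep_S[of x] rep_mod[of x] by (metis mod_eq_dvd_iff)

lemma rep_cong: "2 * int p dvd (x - y) ==> rep x = rep y"
proof -
 assume "2 * int p dvd (x - y)"
 then have "2 * int p dvd ((x - y) + (y - rep y))" using rep_dvd[of y] by (rule dvd_add)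
 then show "rep x = rep y" by (intro rep_eqI) (simp_all add: dvd_diff_commute)
qed

lemma rep_self [simp]: "a : S ==> rep a = a"
 by (rule rep_eqI) auto

lemma rep_uniq: "[|a : S; b : S; 2 * int p dvd (a - b)|] ==> a = b"
 using rep_cong[of a b] by simp

lemma finite_S: "finite S" using S_bij bij_betw_finite by blast

lemma kappa_eq: "2 * int p * \<kappa> a b = a + b - rep (a + b)"
 unfolding kappa_def using rep_dvd[of "a + b"] by simp

lemma rep_add_left: "rep (rep a + b) = rep (a + b)" and rep_add_right: "rep (a + rep b) = rep (a + b)"
 by (rule rep_cong, use rep_dvd[of a] rep_dvd[of b] in "simp add: dvd_diff_commute")+

lemma rep_even: "even (rep x) \<longleftrightarrow> even x"
proof -
 have "2 dvd (x - rep x)" using dvd_mult_left[OF rep_dvd] .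
 then show ?thesis by simp
qed

definition tz :: int where "tz = rep 0 div (2 * int p)"

text \<open>
  This is where the hypothesis on the representative of \<open>0\<close> enters: the sign \<open>(-1)\<^bsup>a
  tz\<^esup>\<close> is trivial for all \<open>a\<close>.
\<close>

lemma tz: "rep 0 = 2 * int p * tz" "even tz"
proof -
 obtain k where k: "rep 0 = 4 * int p * k" using S_zero by (auto simp: dvd_def)
 then have "tz = 2 * k" using p_pos unfolding tz_def by simp
 then show "rep 0 = 2 * int p * tz" "even tz" using k by simp_all
qed

lemma kappa_zero: "a : S ==> \<kappa> (rep 0) a = tz" "a : S ==> \<kappa> a (rep 0) = tz"
proof -
 assume a: "a : S"
 have "2 * int p * \<kappa> (rep 0) a = 2 * int p * tz"
  unfolding kappa_eq rep_add_left using a by (simp add: tz(1)[symmetric])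
 then show "\<kappa> (rep 0) a = tz" using p_pos by simp
next
 assume a: "a : S"
 have "2 * int p * \<kappa> a (rep 0) = 2 * int p * tz"
  unfolding kappa_eq rep_add_right using a by (simp add: tz(1)[symmetric])
 then show "\<kappa> a (rep 0) = tz" using p_pos by simp
qed

lemma kappa_commute: "\<kappa> a b = \<kappa> b a"
 by (simp add: kappa_def add.commute)

text \<open>
  Both sides count how often \<open>2p\<close> has to be subtracted to bring \<open>a + b + c\<close> back to
  \<open>S\<close>.
\<close>

lemma kappa_assoc: "\<kappa> b c + \<kappa> a (rep (b + c)) = \<kappa> a b + \<kappa> (rep (a + b)) c"
proof -
 have "2 * int p * (\<kappa> b c + \<kappa> a (rep (b + c))) = 2 * int p * (\<kappa> a b + \<kappa> (rep (a + b)) c)"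
  unfolding distrib_left kappa_eq by (simp add: rep_add_left rep_add_right add.assoc)
 then show ?thesis using p_pos by simp
qed

definition \<theta> :: "int => complex" where "\<theta> a = qpow p (of_int (a\<^sup>2) / 2)"

lemma sign_powi: "(-1 :: complex) powi n = (if even n then 1 else -1)"
 by (simp add: power_int_minus_left)

lemma theta_dvd: 
 assumes "2 * int p dvd (a - b)"
 shows "\<theta> a = \<theta> b"
proof -
 obtain k where "a - b = 2 * int p * k" using assms by (auto simp: dvd_def)
 then have a: "a = b + 2 * int p * k" by simp
 have sq: "a\<^sup>2 = b\<^sup>2 + 2 * (2 * int p * (k * b + int p * (k * k)))" unfolding a by (simp add: power2_eq_square algebra_simps)
 have "complex_of_int (a\<^sup>2) / 2 = of_int (b\<^sup>2) / 2 + of_int (2 * int p * (k * b + int p * (k * k)))"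
  unfolding sq by (simp add: field_simps)
 moreover have "qpow p (of_int (2 * int p * (k * b + int p * (k * k)))) = 1"
  by (simp only: qpow_1_iff[OF p_pos] dvd_triv_left)
 ultimately show ?thesis unfolding \<theta>_def by (simp only: qpow_add mult_1_right)
qed

lemma theta_rep: "\<theta> (rep a) = \<theta> a"
 using theta_dvd[of a "rep a"] rep_dvd by simp

lemma theta_nz [simp]: "\<theta> a ~= 0" by (simp add: \<theta>_def)

lemma qpow_p: "qpow p (of_int (int p * n)) = (-1) powi n"
proof -
 have "\<i> * complex_of_real pi * of_int (int p * n) / of_nat p = of_int n * (\<i> * complex_of_real pi)"
  using p_pos by (simp add: field_simps)
 then have e: "qpow p (of_int (int p * n)) = exp (of_int n * (\<i> * complex_of_real pi))" by (simp only: qpow_def)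
 show ?thesis
 proof (cases "even n")
  case True
  then obtain m where "n = 2 * m" by auto
  then have "exp (of_int n * (\<i> * complex_of_real pi)) = exp (complex_of_int m * (2 * (\<i> * complex_of_real pi)))"
   by (simp add: mult_ac)
  also have "... = 1" using exp_integer_2pi[of "of_int m"] by (simp add: mult_ac)
  finally show ?thesis using e True by (simp add: sign_powi)
 next
  case False
  then obtain m where n: "n = 2 * m + 1" by (auto elim: oddE)
  have "exp (of_int n * (\<i> * complex_of_real pi)) = exp (complex_of_int m * (2 * (\<i> * complex_of_real pi))) * exp (\<i> * complex_of_real pi)"
   unfolding n by (simp add: algebra_simps flip: exp_add)
  also have "... = - 1" using exp_integer_2pi[of "of_int m"] exp_pi_i by (simp add: mult_ac)
  finally show ?thesis using e False by (simp add: sign_powi)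
 qed
qed

abbreviation \<Phi> :: "int => int => int => complex" where "\<Phi> \<equiv> Phi_coeff p S \<zeta>"
abbreviation R :: "int => int => complex" where "R \<equiv> R_coeff p \<zeta>"

lemma Phi_nz: "[|a : S; b : S; c : S|] ==> \<Phi> a b c ~= 0"
 by (simp add: Phi_coeff_def zeta_nonzero sign_powi)

lemma sign_add: "(-1 :: complex) powi (m + n) = (-1) powi m * (-1) powi n"
 by (simp add: power_int_add)

lemma sign_sq: "(-1 :: complex) powi m * (-1) powi m = 1"
 by (simp add: sign_powi)

lemma Phi_unit: "a : S ==> c : S ==> \<Phi> a (rep 0) c = 1"
proof -
 assume ac: "a : S" "c : S"
 have "\<Phi> a (rep 0) c = (-1) powi (a * tz) * (\<zeta> a (rep 0) * \<zeta> a c) / (\<zeta> (rep 0) c * \<zeta> a c)"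
  unfolding Phi_coeff_def rep_add_left rep_add_right using ac by (simp add: kappa_zero)
 also have "... = 1" using ac zeta_normalized[OF ac(1)] zeta_normalized[OF ac(2)] tz(2) zeta_nonzero by (simp add: sign_powi)
 finally show ?thesis .
qed

text \<open>
  The factors \<open>\<zeta>\<close> form a coboundary and cancel. What remains is a comparison of signs,
  which follows from \<open>kappa_assoc\<close> because \<open>[a + b]\<close> and \<open>a + b\<close> have
  the same parity.
\<close>

lemma Phi_cocycle:
 assumes "a : S" "b : S" "c : S" "d : S"
 shows "\<Phi> (rep (a + b)) c d * \<Phi> a b (rep (c + d)) = \<Phi> a b c * \<Phi> a (rep (b + c)) d * \<Phi> b c d"
proof -
 have e: "even (rep (a + b) * \<kappa> c d + a * \<kappa> b (rep (c + d))) \<longleftrightarrow> even (a * \<kappa> b c + a * \<kappa> (rep (b + c)) d + b * \<kappa> c d)"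
 proof -
  have "even (rep (a + b) * \<kappa> c d + a * \<kappa> b (rep (c + d))) \<longleftrightarrow> even ((a + b) * \<kappa> c d + a * \<kappa> b (rep (c + d)))"
   by (simp add: rep_even)
  also have "(a + b) * \<kappa> c d + a * \<kappa> b (rep (c + d)) = a * (\<kappa> c d + \<kappa> b (rep (c + d))) + b * \<kappa> c d"
   by (simp add: algebra_simps)
  also have "... = a * \<kappa> b c + a * \<kappa> (rep (b + c)) d + b * \<kappa> c d"
   unfolding kappa_assoc by (simp add: algebra_simps)
  finally show ?thesis .
 qed
 define s1 s2 where "s1 = (-1 :: complex) powi (rep (a + b) * \<kappa> c d) * (-1) powi (a * \<kappa> b (rep (c + d)))"
  and "s2 = (-1 :: complex) powi (a * \<kappa> b c) * (-1) powi (a * \<kappa> (rep (b + c)) d) * (-1) powi (b * \<kappa> c d)"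
 have s: "s1 = s2" unfolding s1_def s2_def sign_add[symmetric] unfolding sign_powi e ..
 have r: "rep (rep (a + b) + c) = rep (a + b + c)" "rep (a + rep (b + c)) = rep (a + b + c)"
   "rep (rep (a + b) + rep (c + d)) = rep (a + b + c + d)" "rep (b + rep (c + d)) = rep (b + c + d)"
   "rep (rep (b + c) + d) = rep (b + c + d)"
  by (simp_all add: rep_add_left rep_add_right add.assoc)
 have "\<Phi> (rep (a + b)) c d * \<Phi> a b (rep (c + d))
   = s1 * (\<zeta> (rep (a + b)) c * \<zeta> (rep (a + b + c)) d / (\<zeta> c d * \<zeta> (rep (a + b)) (rep (c + d)))
     * (\<zeta> a b * \<zeta> (rep (a + b)) (rep (c + d)) / (\<zeta> b (rep (c + d)) * \<zeta> a (rep (b + c + d)))))"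
  unfolding Phi_coeff_def s1_def by (simp add: r mult_ac)
 also have "... = s2 * (\<zeta> a b * \<zeta> (rep (a + b)) c / (\<zeta> b c * \<zeta> a (rep (b + c)))
    * (\<zeta> a (rep (b + c)) * \<zeta> (rep (a + b + c)) d / (\<zeta> (rep (b + c)) d * \<zeta> a (rep (b + c + d))))
    * (\<zeta> b c * \<zeta> (rep (b + c)) d / (\<zeta> c d * \<zeta> b (rep (c + d)))))"
  unfolding s using assms by (simp add: zeta_nonzero field_simps)
 also have "... = \<Phi> a b c * \<Phi> a (rep (b + c)) d * \<Phi> b c d"
  unfolding Phi_coeff_def s2_def by (simp add: r mult_ac)
 finally show ?thesis .
qed

text \<open>
  Passing from \<open>b + c\<close> to its representative changes the exponent by \<open>p a \<kappa>(b,
  c)\<close>, and \<open>q\<^sup>p = -1\<close>.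
\<close>

lemma qpow_rep: "qpow p (of_int (a * b) / 2) * qpow p (of_int (a * c) / 2) = (-1) powi (a * \<kappa> b c) * qpow p (of_int (a * rep (b + c)) / 2)"
proof -
 have "a * b + a * c = 2 * (int p * (a * \<kappa> b c)) + a * rep (b + c)"
  using kappa_eq[of b c] by (simp add: algebra_simps flip: distrib_left)
 then have "complex_of_int (a * b + a * c) = of_int (2 * (int p * (a * \<kappa> b c)) + a * rep (b + c))" by (simp only:)
 then have "complex_of_int (a * b) / 2 + of_int (a * c) / 2 = of_int (int p * (a * \<kappa> b c)) + of_int (a * rep (b + c)) / 2"
  by (simp add: field_simps)
 then show ?thesis unfolding qpow_p[of "a * \<kappa> b c", symmetric] qpow_add[symmetric] by (simp only:)
qed

lemma R_hex1:
 assumes "a : S" "b : S" "c : S"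
 shows "R a (rep (b + c)) * \<Phi> b a c = \<Phi> b c a * R a c * R a b * \<Phi> a b c"
proof -
 let ?q = "qpow p (of_int (a * rep (b + c)) / 2)"
 let ?s = "(-1 :: complex) powi (a * \<kappa> b c)" and ?t = "(-1 :: complex) powi (b * \<kappa> a c)"
 have q: "qpow p (of_int (a * c) / 2) * qpow p (of_int (a * b) / 2) = ?s * ?q"
  using qpow_rep[of a b c] by (simp only: mult.commute)
 have "\<Phi> b c a * R a c * R a b * \<Phi> a b c
  = ?t * ?s * (qpow p (of_int (a * c) / 2) * qpow p (of_int (a * b) / 2)) *
    ((\<zeta> b c * \<zeta> (rep (b + c)) a) / (\<zeta> c a * \<zeta> b (rep (a + c))) * (\<zeta> c a / \<zeta> a c) * (\<zeta> b a / \<zeta> a b) *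
    ((\<zeta> a b * \<zeta> (rep (a + b)) c) / (\<zeta> b c * \<zeta> a (rep (b + c)))))"
  unfolding Phi_coeff_def R_coeff_def kappa_commute[of c a] add.commute[of c a] by (simp add: mult_ac)
 also have "... = ?t * ?q * ((\<zeta> b c * \<zeta> (rep (b + c)) a) / (\<zeta> c a * \<zeta> b (rep (a + c))) * (\<zeta> c a / \<zeta> a c) * (\<zeta> b a / \<zeta> a b) *
    ((\<zeta> a b * \<zeta> (rep (a + b)) c) / (\<zeta> b c * \<zeta> a (rep (b + c)))))"
  unfolding q using sign_sq[of "a * \<kappa> b c"] by (simp add: mult_ac)
 also have "... = ?t * ?q * ((\<zeta> (rep (b + c)) a / \<zeta> a (rep (b + c))) * ((\<zeta> b a * \<zeta> (rep (a + b)) c) / (\<zeta> a c * \<zeta> b (rep (a + c)))))"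
  using assms by (simp add: zeta_nonzero field_simps)
 also have "... = R a (rep (b + c)) * \<Phi> b a c"
  unfolding Phi_coeff_def R_coeff_def add.commute[of b a] by (simp add: mult_ac)
 finally show ?thesis by simp
qed

lemma R_hex2:
 assumes "a : S" "b : S" "c : S"
 shows "R (rep (a + b)) c * \<Phi> c a b * \<Phi> a b c = R a c * \<Phi> a c b * R b c"
proof -
 let ?q = "qpow p (of_int (c * rep (a + b)) / 2)"
 let ?s = "(-1 :: complex) powi (c * \<kappa> a b)" and ?t = "(-1 :: complex) powi (a * \<kappa> b c)"
 have q: "qpow p (of_int (c * a) / 2) * qpow p (of_int (c * b) / 2) = ?s * ?q"
  using qpow_rep[of c a b] .
 have "R a c * \<Phi> a c b * R b c
  = ?t * (qpow p (of_int (c * a) / 2) * qpow p (of_int (c * b) / 2)) *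
    ((\<zeta> c a / \<zeta> a c) * (\<zeta> a c * \<zeta> (rep (a + c)) b / (\<zeta> c b * \<zeta> a (rep (b + c)))) * (\<zeta> c b / \<zeta> b c))"
  unfolding Phi_coeff_def R_coeff_def kappa_commute[of c b] add.commute[of c b] mult.commute[of a c] mult.commute[of b c] by (simp add: mult_ac)
 also have "... = ?s * ?q * ?t * (\<zeta> c a * \<zeta> (rep (a + c)) b / (\<zeta> b c * \<zeta> a (rep (b + c))))"
  unfolding q using assms by (simp add: zeta_nonzero field_simps)
 also have "... = ?q * (\<zeta> c (rep (a + b)) / \<zeta> (rep (a + b)) c) *
   (?s * (\<zeta> c a * \<zeta> (rep (a + c)) b / (\<zeta> a b * \<zeta> c (rep (a + b))))) * (?t * (\<zeta> a b * \<zeta> (rep (a + b)) c / (\<zeta> b c * \<zeta> a (rep (b + c)))))"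
  using assms by (simp add: zeta_nonzero field_simps)
 also have "... = R (rep (a + b)) c * \<Phi> c a b * \<Phi> a b c"
  unfolding Phi_coeff_def R_coeff_def add.commute[of c a] mult.commute[of "rep (a + b)" c] by (simp add: mult_ac)
 finally show ?thesis by simp
qed

lemma theta_R:
 assumes "a : S" "b : S"
 shows "\<theta> (rep (a + b)) = R b a * R a b * \<theta> a * \<theta> b"
proof -
 have "\<theta> (rep (a + b)) = \<theta> (a + b)" by (rule theta_rep)
 also have "... = qpow p (of_int (b * a) / 2) * qpow p (of_int (a * b) / 2) * \<theta> a * \<theta> b"
  unfolding \<theta>_def qpow_add[symmetric] by (rule arg_cong[of _ _ "qpow p"]) (simp add: power2_eq_square field_simps)
 also have "... = R b a * R a b * \<theta> a * \<theta> b"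
  unfolding R_coeff_def using assms by (simp add: zeta_nonzero)
 finally show ?thesis .
qed

text \<open>
  The two values of \<open>\<Phi>\<close> in the zigzag equations are inverse to each other, so that a single
  choice of scalars satisfies both equations.
\<close>

lemma Phi_dual:
 assumes a: "a : S"
 shows "\<Phi> a (rep (- a)) a * \<Phi> (rep (- a)) a (rep (- a)) = 1"
proof -
 let ?b = "rep (- a)"
 have r: "rep (a + ?b) = rep 0" "rep (?b + a) = rep 0"
  by (simp_all add: rep_add_left rep_add_right)
 have "even (a * \<kappa> ?b a + ?b * \<kappa> a ?b)"
  unfolding kappa_commute[of ?b a] using rep_even[of "- a"] by auto
 then have s: "(-1 :: complex) powi (a * \<kappa> ?b a) * (-1) powi (?b * \<kappa> a ?b) = 1"
  unfolding sign_add[symmetric] by (simp add: sign_powi)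
 have "\<Phi> a ?b a * \<Phi> ?b a ?b = ((-1) powi (a * \<kappa> ?b a) * (-1) powi (?b * \<kappa> a ?b)) * ((\<zeta> a ?b / \<zeta> ?b a) * (\<zeta> ?b a / \<zeta> a ?b))"
  unfolding Phi_coeff_def r using zeta_normalized[OF a] zeta_normalized[of ?b] by simp
 then show ?thesis unfolding s using a by (simp add: zeta_nonzero)
qed

section \<open>The ribbon category of modules over the cyclic group algebra\<close>

abbreviation hgr :: "kmod => int => cvec set" where "hgr \<equiv> eig p"

lemma kidem_rep: "kidem p V (rep a) = kidem p V a"
proof
 fix v
 have "qpow p (- (of_int (rep a) * of_nat l)) = qpow p (- (of_int a * of_nat l))" for l
  using qpow_eq[OF p_pos, of "- (rep a * int l)" "- (a * int l)"] rep_dvd[of a]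
  by (simp flip: left_diff_distrib)
 then show "kidem p V (rep a) v = kidem p V a v" by (simp add: kidem_def)
qed

lemma kidem_sum_S:
 assumes "is_kmod p V" "v : kcar V"
 shows "(SUM a:S. kidem p V a v) = v"
proof -
 have "(SUM a:S. kidem p V a v) = (SUM a:S. kidem p V (a mod (2 * int p)) v)"
 proof (rule sum.cong[OF refl])
  fix a assume "a : S"
  then have "rep (a mod (2 * int p)) = a"
   by (intro rep_eqI) (auto simp: minus_mod_eq_mult_div)
  then show "kidem p V a v = kidem p V (a mod (2 * int p)) v" using kidem_rep[of V "a mod (2 * int p)"] by simp
 qed
 also have "... = (SUM a:{0..<2 * int p}. kidem p V a v)"
  by (rule sum.reindex_bij_betw[OF S_bij])
 also have "... = v" by (rule kidem_sum[OF p_pos assms])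
 finally show ?thesis .
qed

text \<open>
  The idempotents decompose a module into eigenspaces of \<open>K\<close>, which are the homogeneous
  components.
\<close>

lemma kcar_span: 
 assumes V: "is_kmod p V"
 shows "kcar V = cvec.span (UN a:S. hgr V a)"
proof
 show "kcar V <= cvec.span (UN a:S. hgr V a)"
 proof
  fix v assume v: "v : kcar V"
  have "(SUM a:S. kidem p V a v) : cvec.span (UN a:S. hgr V a)"
   using kidem_eig[OF p_pos V v] by (intro cvec.span_sum cvec.span_base) auto
  then show "v : cvec.span (UN a:S. hgr V a)" by (simp add: kidem_sum_S[OF V v])
 qed
 show "cvec.span (UN a:S. hgr V a) <= kcar V"
  by (intro cvec.span_minimal kmod_subspace[OF V]) (auto dest: eig_kcar)
qed

lemma kidem_hgr: "[|is_kmod p V; v : hgr V b; a : S; b : S|] ==> kidem p V a v = (if a = b then v else 0)"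
 using kidem_on_eig[OF p_pos, of v V b a] rep_uniq[of b a] by auto

lemma hgr_rep: "hgr V (rep a) = hgr V a"
 using eig_cong[OF p_pos rep_dvd[of a]] by simp

abbreviation RC :: "(kmod, (kmod, cvec => cvec) arrow) balcat" where "RC \<equiv> RepCat p S \<zeta>"

lemma RC_simps [simp]:
 "Obj RC = {V. is_kmod p V}" "Dom RC = src" "Cod RC = tgt" "TensO RC = ktens" "Unit RC = kunit"
 "Id RC V = Arrow V (restrict (%x. x) (kcar V)) V"
 "Comp RC g f = Arrow (src f) (compose (kcar (src f)) (amap g) (amap f)) (tgt g)"
 "TensA RC f g = Arrow (ktens (src f) (src g))
         (tmap (kcar (src f)) (kcar (src g)) (%v w. amap f v <*> amap g w)) (ktens (tgt f) (tgt g))"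
 by (simp_all add: RepCat_def)

lemma RC_Arr: "f : Arr RC \<longleftrightarrow> is_kmod p (src f) & is_kmod p (tgt f) & amap f : lin (kcar (src f)) (kcar (tgt f)) &
        (ALL v:kcar (src f). amap f (kact (src f) v) = kact (tgt f) (amap f v))"
 by (simp add: RepCat_def)

lemma RC_ArrI:
 assumes "is_kmod p V" "is_kmod p W" "f : lin (kcar V) (kcar W)" "kcar V = cvec.span G"
  and "!!g. g : G ==> EX a. g : hgr V a & f g : hgr W a"
 shows "Arrow V f W : Arr RC"
proof -
 have "f (kact V v) = kact W (f v)" if v: "v : kcar V" for v
 proof (rule commutes_on_eigenvectors[OF assms(1,2,3,4) _ v])
  fix g assume "g : G"
  then obtain a where "g : hgr V a" "f g : hgr W a" using assms(5) by blast
  then show "EX c. kact V g = c *\<^sub>C g & kact W (f g) = c *\<^sub>C f g" by (auto simp: eig_def)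
 qed
 with assms show ?thesis by (simp add: RC_Arr)
qed

lemma RC_Arr_eig: "f : Arr RC ==> v : hgr (src f) a ==> amap f v : hgr (tgt f) a"
 by (auto simp: RC_Arr eig_def lin_mem lin_on_scale[OF lin_lin_on])

lemma RC_category: "category RC"
proof (unfold_locales, goal_cases)
 case (3 X) then show ?case using kmod_subspace[of p X] lin_mem[OF kmod_lin[of p X]]
  by (auto simp: cat_hom_def RC_Arr intro!: restrict_lin lin_intros)
next
 case (4 f X Y g Z)
 then have f: "is_kmod p X" "is_kmod p Y" "is_kmod p Z" "amap f : lin (kcar X) (kcar Y)" "amap g : lin (kcar Y) (kcar Z)"
  "ALL v:kcar X. amap f (kact X v) = kact Y (amap f v)" "ALL v:kcar Y. amap g (kact Y v) = kact Z (amap g v)" "src f = X" "tgt g = Z"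
  by (auto simp: cat_hom_def RC_Arr)
 have "compose (kcar X) (amap g) (amap f) : lin (kcar X) (kcar Z)"
  unfolding compose_def
  by (intro restrict_lin kmod_subspace[OF f(1)] lin_on_compose[OF lin_lin_on[OF f(5)] lin_lin_on[OF f(4)]] lin_mem[OF f(5)] lin_mem[OF f(4)])
 with f show ?case using lin_mem[OF kmod_lin[OF f(1)]] lin_mem[OF f(4)] by (auto simp: cat_hom_def RC_Arr compose_def)
next
 case (5 f X Y) then show ?case
  by (cases f) (auto simp: cat_hom_def RC_Arr compose_def lin_iff restrict_def extensional_def fun_eq_iff PiE_def)
next
 case (6 f X Y) then show ?case
  by (cases f) (auto simp: cat_hom_def RC_Arr compose_def lin_iff restrict_def extensional_def fun_eq_iff PiE_def Pi_def)
next
 case (7 f X Y g Z h W) then show ?case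
  by (auto simp: cat_hom_def RC_Arr compose_def lin_iff restrict_def fun_eq_iff)
qed (auto simp: RC_Arr)

lemma RC_concrete: "concrete_category RC kcar hgr amap S"
proof (intro concrete_category.intro[OF RC_category] concrete_category_axioms.intro, goal_cases)
 case (1 X) then show ?case by (simp add: kcar_span)
next
 case (4 f g) then show ?case by (cases f; cases g) simp
next
 case (7 f)
 then have f: "is_kmod p (src f)" "is_kmod p (tgt f)" "amap f : lin (kcar (src f)) (kcar (tgt f))"
   "ALL v:kcar (src f). amap f (kact (src f) v) = kact (tgt f) (amap f v)" by (auto simp: RC_Arr)
 have b: "bij_betw (amap f) (kcar (src f)) (kcar (tgt f))" using 7 by simp
 have i: "inj_on (amap f) (kcar (src f))" "amap f ` kcar (src f) = kcar (tgt f)" using b by (auto simp: bij_betw_def)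
 let ?h = "restrict (the_inv_into (kcar (src f)) (amap f)) (kcar (tgt f))"
 have h: "?h : lin (kcar (tgt f)) (kcar (src f))" by (rule lin_inverse[OF kmod_subspace[OF f(1)] f(3) b])
 have fh: "amap f (?h y) = y" if "y : kcar (tgt f)" for y using that f_the_inv_into_f[OF i(1)] i(2) by simp
 have "?h (kact (tgt f) y) = kact (src f) (?h y)" if y: "y : kcar (tgt f)" for y
 proof (rule inj_onD[OF i(1)])
  have Ky: "kact (tgt f) y : kcar (tgt f)" using lin_mem[OF kmod_lin[OF f(2)] y] .
  have hy: "?h y : kcar (src f)" using lin_mem[OF h y] .
  show "amap f (?h (kact (tgt f) y)) = amap f (kact (src f) (?h y))"
   using fh[OF Ky] fh[OF y] f(4) hy by simp
  show "?h (kact (tgt f) y) : kcar (src f)" using lin_mem[OF h Ky] .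
  show "kact (src f) (?h y) : kcar (src f)" using lin_mem[OF kmod_lin[OF f(1)] hy] .
 qed
 then have "Arrow (tgt f) ?h (src f) : cat_hom RC (Cod RC f) (Dom RC f)" using f h by (simp add: cat_hom_def RC_Arr)
 then show ?case using fh by (intro bexI[of _ "Arrow (tgt f) ?h (src f)"]) auto
qed (use RC_Arr_eig in "auto simp: RC_Arr compose_def")

lemma RC_tensor: "concrete_tensor RC kcar hgr amap S (%_ _. (<*>)) (%a b. rep (a + b))"
proof (intro concrete_tensor.intro[OF RC_concrete] concrete_tensor_axioms.intro, goal_cases)
 case (1 X Y) then show ?case using is_kmod_ktens(1) by simp
next
 case (4 X Y a b x y) then show ?case using eig_ktens by (simp add: hgr_rep)
next
 case (5 X Y) then show ?case by (simp add: tens_def)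
next
 case (6 f g)
 then have f: "is_kmod p (src f)" "is_kmod p (tgt f)" "amap f : lin (kcar (src f)) (kcar (tgt f))"
  and g: "is_kmod p (src g)" "is_kmod p (tgt g)" "amap g : lin (kcar (src g)) (kcar (tgt g))" by (auto simp: RC_Arr)
 note s = kmod_subspace[OF f(1)] kmod_subspace[OF g(1)]
 have b: "bilin_on (kcar (src f)) (kcar (src g)) (%v w. amap f v <*> amap g w)"
  by (intro bilin_onI lin_intros lin_lin_on[OF f(3)] lin_lin_on[OF g(3)])
 have "tmap (kcar (src f)) (kcar (src g)) (%v w. amap f v <*> amap g w) : lin (tens (kcar (src f)) (kcar (src g))) (tens (kcar (tgt f)) (kcar (tgt g)))"
  by (rule tens_lin_range[OF tmap_lin[OF s b]]) (auto simp: tmap_tensor[OF s b] intro!: tens_mem lin_mem[OF f(3)] lin_mem[OF g(3)])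
 then show ?case unfolding RC_simps
 proof (intro RC_ArrI[OF is_kmod_ktens(1)[OF f(1) g(1)] is_kmod_ktens(1)[OF f(2) g(2)]])
  show "kcar (ktens (src f) (src g)) = cvec.span {v <*> w | v w. v : (UN a:S. hgr (src f) a) & w : (UN a:S. hgr (src g) a)}"
   using tens_span[OF kcar_span[OF f(1), symmetric] kcar_span[OF g(1), symmetric]] by simp
  fix x assume "x : {v <*> w | v w. v : (UN a:S. hgr (src f) a) & w : (UN a:S. hgr (src g) a)}"
  then obtain v w a b where x: "x = v <*> w" "v : hgr (src f) a" "w : hgr (src g) b" by auto
  show "EX a. x : hgr (ktens (src f) (src g)) a & tmap (kcar (src f)) (kcar (src g)) (%v w. amap f v <*> amap g w) x : hgr (ktens (tgt f) (tgt g)) a"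
   using eig_ktens[OF f(1) g(1) x(2,3)] eig_ktens[OF f(2) g(2) RC_Arr_eig[OF 6(1) x(2)] RC_Arr_eig[OF 6(2) x(3)]]
    tmap_tensor[OF s b eig_kcar[OF x(2)] eig_kcar[OF x(3)]] x(1) by auto
 qed auto
next
 case (9 f g x y)
 then have f: "is_kmod p (src f)" "amap f : lin (kcar (src f)) (kcar (tgt f))"
  and g: "is_kmod p (src g)" "amap g : lin (kcar (src g)) (kcar (tgt g))" by (auto simp: RC_Arr)
 have b: "bilin_on (kcar (src f)) (kcar (src g)) (%v w. amap f v <*> amap g w)"
  by (intro bilin_onI lin_intros lin_lin_on[OF f(2)] lin_lin_on[OF g(2)])
 show ?case using 9 by (simp add: tmap_tensor[OF kmod_subspace[OF f(1)] kmod_subspace[OF g(1)] b])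
qed (auto intro: bilin_on_tensor)

end

context rep_data
begin

lemma kidem_triple_sum:
 assumes K: "is_kmod p U" "is_kmod p V" "is_kmod p W" and abc: "a : S" "b : S" "c : S"
  and u: "u : hgr U a" and v: "v : hgr V b" and w: "w : hgr W c"
  and z: "!!a b c x y. f a b c 0 x y = 0" "!!a b c x y. f a b c x 0 y = 0" "!!a b c x y. f a b c x y 0 = (0 :: cvec)"
 shows "(SUM a:S. SUM b:S. SUM c:S. f a b c (kidem p U a u) (kidem p V b v) (kidem p W c w)) = f a b c u v w"
proof -
 have "(SUM a:S. SUM b:S. SUM c:S. f a b c (kidem p U a u) (kidem p V b v) (kidem p W c w))
  = (SUM a':S. SUM b':S. SUM c':S. if c' = c then if b' = b then if a' = a then f a b c u v w else 0 else 0 else 0)"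
  by (intro sum.cong refl)
   (simp add: kidem_hgr[OF K(1) u _ abc(1)] kidem_hgr[OF K(2) v _ abc(2)] kidem_hgr[OF K(3) w _ abc(3)] z)
 also have "... = f a b c u v w" using abc finite_S by (simp add: sum.delta)
 finally show ?thesis .
qed

lemma kidem_double_sum:
 assumes K: "is_kmod p U" "is_kmod p V" and ab: "a : S" "b : S"
  and u: "u : hgr U a" and v: "v : hgr V b"
  and z: "!!a b y. f a b 0 y = 0" "!!a b x. f a b x 0 = (0 :: cvec)"
 shows "(SUM a:S. SUM b:S. f a b (kidem p U a u) (kidem p V b v)) = f a b u v"
proof -
 have "(SUM a:S. SUM b:S. f a b (kidem p U a u) (kidem p V b v))
  = (SUM a':S. SUM b':S. if b' = b then if a' = a then f a b u v else 0 else 0)"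
  by (intro sum.cong refl)
   (simp add: kidem_hgr[OF K(1) u _ ab(1)] kidem_hgr[OF K(2) v _ ab(2)] z)
 also have "... = f a b u v" using ab finite_S by (simp add: sum.delta)
 finally show ?thesis .
qed

lemma kidem_kcar: "is_kmod p V ==> v : kcar V ==> kidem p V a v : kcar V"
 using kidem_eig[OF p_pos] eig_kcar by blast

definition homog :: "kmod => cvec set" where "homog V = (UN a:S. hgr V a)"

lemma kcar_ktens3_span:
 assumes K: "is_kmod p U" "is_kmod p V" "is_kmod p W"
 shows "tens (kcar U) (tens (kcar V) (kcar W)) = cvec.span {u <*> (v <*> w) | u v w. u : homog U & v : homog V & w : homog W}"
  and "tens (tens (kcar U) (kcar V)) (kcar W) = cvec.span {(u <*> v) <*> w | u v w. u : homog U & v : homog V & w : homog W}"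
proof -
 note s = kcar_span[OF K(1), symmetric] kcar_span[OF K(2), symmetric] kcar_span[OF K(3), symmetric]
 have "{u <*> x | u x. u : homog U & x : {v <*> w | v w. v : homog V & w : homog W}}
   = {u <*> (v <*> w) | u v w. u : homog U & v : homog V & w : homog W}" by blast
 then show "tens (kcar U) (tens (kcar V) (kcar W)) = cvec.span {u <*> (v <*> w) | u v w. u : homog U & v : homog V & w : homog W}"
  using tens_span[OF s(1) tens_span[OF s(2,3), symmetric]] by (simp add: homog_def)
 have "{x <*> w | x w. x : {u <*> v | u v. u : homog U & v : homog V} & w : homog W}
   = {(u <*> v) <*> w | u v w. u : homog U & v : homog V & w : homog W}" by blast
 then show "tens (tens (kcar U) (kcar V)) (kcar W) = cvec.span {(u <*> v) <*> w | u v w. u : homog U & v : homog V & w : homog W}"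
  using tens_span[OF tens_span[OF s(1,2), symmetric] s(3)] by (simp add: homog_def)
qed

lemma lin_on_kidem: "is_kmod p V ==> lin_on (kcar V) (%v. kidem p V a v)"
 using kidem_lin by simp

lemma RC_Assoc:
 assumes K: "is_kmod p U" "is_kmod p V" "is_kmod p W"
 shows RC_Assoc_Arr: "Assoc RC U V W : cat_hom RC (ktens U (ktens V W)) (ktens (ktens U V) W)"
  and RC_el_Assoc: "!!a b c u v w. [|a : S; b : S; c : S; u : hgr U a; v : hgr V b; w : hgr W c|]
   ==> amap (Assoc RC U V W) (u <*> (v <*> w)) = \<Phi> a b c *\<^sub>C ((u <*> v) <*> w)"
proof -
 note s = kmod_subspace[OF K(1)] kmod_subspace[OF K(2)] kmod_subspace[OF K(3)]
 let ?be = "%u v w. SUM a:S. SUM b:S. SUM c:S. \<Phi> a b c *\<^sub>C ((kidem p U a u <*> kidem p V b v) <*> kidem p W c w)"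
 have b: "bilin_on (kcar V) (kcar W) (?be u)" for u
  by (intro bilin_onI lin_intros lin_on_kidem K)
 have l: "lin_on (kcar U) (%u. ?be u v w)" for v w
  by (intro lin_intros lin_on_kidem K)
 let ?f = "tmap3 (kcar U) (kcar V) (kcar W) ?be"
 have A: "Assoc RC U V W = Arrow (ktens U (ktens V W)) ?f (ktens (ktens U V) W)" by (simp add: RepCat_def)
 note t = tmap3_lin[of "kcar U" "kcar V" "kcar W" ?be, OF s b l] tmap3_tensor[of "kcar U" "kcar V" "kcar W" ?be, OF s b l]
 have el: "?f (u <*> (v <*> w)) = \<Phi> a b c *\<^sub>C ((u <*> v) <*> w)"
  if "a : S" "b : S" "c : S" "u : hgr U a" "v : hgr V b" "w : hgr W c" for a b c u v w
  using kidem_triple_sum[OF K that, of "%a b c u v w. \<Phi> a b c *\<^sub>C ((u <*> v) <*> w)"] that by (simp add: t(2) eig_kcar)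
 then show "!!a b c u v w. [|a : S; b : S; c : S; u : hgr U a; v : hgr V b; w : hgr W c|]
   ==> amap (Assoc RC U V W) (u <*> (v <*> w)) = \<Phi> a b c *\<^sub>C ((u <*> v) <*> w)" by (simp add: A)
 note T = is_kmod_ktens(1)[OF K(1) is_kmod_ktens(1)[OF K(2,3)]] is_kmod_ktens(1)[OF is_kmod_ktens(1)[OF K(1,2)] K(3)]
 have tl: "?f : lin (kcar (ktens U (ktens V W))) (kcar (ktens (ktens U V) W))"
 proof (rule lin_range)
  show "?f : lin (kcar (ktens U (ktens V W))) UNIV" using t(1) by simp
  fix x assume "x : kcar (ktens U (ktens V W))"
  then show "?f x : kcar (ktens (ktens U V) W)"
   unfolding kcar_ktens kcar_ktens3_span(1)[OF K]
  proof (rule lin_on_span_mem[rotated 3])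
   show "lin_on (cvec.span {u <*> v <*> w |u v w. u : homog U & v : homog V & w : homog W}) ?f"
    using lin_lin_on[OF t(1)] unfolding kcar_ktens3_span(1)[OF K] .
  qed (auto simp: homog_def el cvec.subspace_scale[OF subspace_tens] tens_mem eig_kcar)
 qed
 have "Assoc RC U V W : Arr RC" unfolding A
 proof (rule RC_ArrI[OF T tl])
  show "kcar (ktens U (ktens V W)) = cvec.span {u <*> v <*> w |u v w. u : homog U & v : homog V & w : homog W}"
   using kcar_ktens3_span(1)[OF K] by simp
  fix x assume "x : {u <*> v <*> w |u v w. u : homog U & v : homog V & w : homog W}"
  then obtain u v w a b c where h: "x = u <*> v <*> w" "a : S" "b : S" "c : S" "u : hgr U a" "v : hgr V b" "w : hgr W c"
   by (auto simp: homog_def)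
  have "x : hgr (ktens U (ktens V W)) (a + (b + c))"
   unfolding h(1) by (intro eig_ktens K is_kmod_ktens h)
  moreover have "(u <*> v) <*> w : hgr (ktens (ktens U V) W) (a + (b + c))"
   unfolding add.assoc[symmetric] by (intro eig_ktens K is_kmod_ktens h)
  ultimately show "EX a. x : hgr (ktens U (ktens V W)) a & ?f x : hgr (ktens (ktens U V) W) a"
   using el[OF h(2-)] h(1) cvec.subspace_scale[OF eig_subspace[OF T(2)]] by auto
 qed
 then show "Assoc RC U V W : cat_hom RC (ktens U (ktens V W)) (ktens (ktens U V) W)" by (simp add: cat_hom_def A)
qed

lemma RC_Braid:
 assumes K: "is_kmod p U" "is_kmod p V"
 shows RC_Braid_Arr: "Braid RC U V : cat_hom RC (ktens U V) (ktens V U)"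
  and RC_el_Braid: "!!a b u v. [|a : S; b : S; u : hgr U a; v : hgr V b|]
   ==> amap (Braid RC U V) (u <*> v) = R a b *\<^sub>C (v <*> u)"
proof -
 note s = kmod_subspace[OF K(1)] kmod_subspace[OF K(2)]
 let ?be = "%u v. SUM a:S. SUM b:S. R a b *\<^sub>C (kidem p V b v <*> kidem p U a u)"
 have b: "bilin_on (kcar U) (kcar V) ?be"
  by (intro bilin_onI lin_intros lin_on_kidem K)
 let ?f = "tmap (kcar U) (kcar V) ?be"
 have A: "Braid RC U V = Arrow (ktens U V) ?f (ktens V U)" by (simp add: RepCat_def)
 note t = tmap_lin[OF s b] tmap_tensor[OF s b]
 have el: "?f (u <*> v) = R a b *\<^sub>C (v <*> u)"
  if "a : S" "b : S" "u : hgr U a" "v : hgr V b" for a b u v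
  using kidem_double_sum[OF K that, of "%a b u v. R a b *\<^sub>C (v <*> u)"] that by (simp add: t(2) eig_kcar)
 then show "!!a b u v. [|a : S; b : S; u : hgr U a; v : hgr V b|]
   ==> amap (Braid RC U V) (u <*> v) = R a b *\<^sub>C (v <*> u)" by (simp add: A)
 note T = is_kmod_ktens(1)[OF K] is_kmod_ktens(1)[OF K(2,1)]
 have sp: "kcar (ktens U V) = cvec.span {u <*> v |u v. u : homog U & v : homog V}"
  using tens_span[OF kcar_span[OF K(1), symmetric] kcar_span[OF K(2), symmetric]] by (simp add: homog_def)
 have tl: "?f : lin (kcar (ktens U V)) (kcar (ktens V U))"
 proof (rule lin_range)
  show "?f : lin (kcar (ktens U V)) UNIV" using t(1) by simp
  fix x assume "x : kcar (ktens U V)"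
  then show "?f x : kcar (ktens V U)"
   unfolding sp
  proof (rule lin_on_span_mem[rotated 3])
   show "lin_on (cvec.span {u <*> v |u v. u : homog U & v : homog V}) ?f"
    using lin_lin_on[OF t(1)] unfolding sp[symmetric] by simp
  qed (auto simp: homog_def el cvec.subspace_scale[OF subspace_tens] tens_mem eig_kcar)
 qed
 have "Braid RC U V : Arr RC" unfolding A
 proof (rule RC_ArrI[OF T tl sp])
  fix x assume "x : {u <*> v |u v. u : homog U & v : homog V}"
  then obtain u v a b where h: "x = u <*> v" "a : S" "b : S" "u : hgr U a" "v : hgr V b"
   by (auto simp: homog_def)
  have "x : hgr (ktens U V) (a + b)"
   unfolding h(1) by (intro eig_ktens K is_kmod_ktens h)
  moreover have "v <*> u : hgr (ktens V U) (a + b)"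
   unfolding add.commute[of a] by (intro eig_ktens K is_kmod_ktens h)
  ultimately show "EX a. x : hgr (ktens U V) a & ?f x : hgr (ktens V U) a"
   using el[OF h(2-)] h(1) cvec.subspace_scale[OF eig_subspace[OF T(2)]] by auto
 qed
 then show "Braid RC U V : cat_hom RC (ktens U V) (ktens V U)" by (simp add: cat_hom_def A)
qed

lemma ribbon_elt_hgr:
 assumes V: "is_kmod p V" and v: "v : hgr V a"
 shows "ribbon_elt p V v = inverse (\<theta> a) *\<^sub>C v"
proof -
 let ?n = "2 * int p"
 have d: "?n dvd (a - b) \<longleftrightarrow> b = a mod ?n" if "b : {0..?n - 1}" for b
  using that p_pos by (auto simp: mod_eq_dvd_iff[symmetric])
 have "ribbon_elt p V v = (SUM b = 0..?n - 1. if b = a mod ?n then qpow p (- (of_int (b\<^sup>2) / 2)) *\<^sub>C v else 0)"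
  unfolding ribbon_elt_def
  by (intro sum.cong refl) (simp add: kidem_on_eig[OF p_pos v V] d)
 also have "... = qpow p (- (of_int ((a mod ?n)\<^sup>2) / 2)) *\<^sub>C v"
  using p_pos by (simp add: sum.delta)
 also have "qpow p (- (of_int ((a mod ?n)\<^sup>2) / 2)) = inverse (\<theta> (a mod ?n))"
  unfolding \<theta>_def qpow_def by (simp add: exp_minus)
 also have "\<theta> (a mod ?n) = \<theta> a"
  by (rule theta_dvd) (simp add: dvd_diff_commute minus_mod_eq_mult_div)
 finally show ?thesis .
qed

lemma ribbon_lin: "is_kmod p V ==> lin_on (kcar V) (ribbon_elt p V)"
 unfolding ribbon_elt_def by (intro lin_intros lin_on_kidem)

lemma kcar_eqI:
 assumes V: "is_kmod p V" and "lin_on (kcar V) f" "lin_on (kcar V) g" "!!a v. [|a : S; v : hgr V a|] ==> f v = g v" "v : kcar V"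
 shows "f v = g v"
 using lin_on_span_eq[of "UN a:S. hgr V a" f g v] assms unfolding kcar_span[OF V] by auto

lemma RC_Twist:
 assumes V: "is_kmod p V"
 shows "Twist RC V : cat_iso RC V V" and "!!a v. [|a : S; v : hgr V a|] ==> amap (Twist RC V) v = \<theta> a *\<^sub>C v"
proof -
 interpret concrete_category RC kcar hgr amap S by (rule RC_concrete)
 note s = kmod_subspace[OF V]
 define T where "T = (%v. SUM a:S. \<theta> a *\<^sub>C kidem p V a v)"
 have Tl: "lin_on (kcar V) T" unfolding T_def by (intro lin_intros lin_on_kidem V)
 have Th: "T v = \<theta> a *\<^sub>C v" if "a : S" "v : hgr V a" for a v
 proof -
  have "T v = (SUM b:S. if b = a then \<theta> a *\<^sub>C v else 0)"
   unfolding T_def by (intro sum.cong refl) (simp add: kidem_hgr[OF V that(2) _ that(1)])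
  then show ?thesis using that finite_S by (simp add: sum.delta)
 qed
 have Tc: "T v : kcar V" if "v : kcar V" for v
  unfolding T_def by (intro cvec.subspace_sum[OF s] cvec.subspace_scale[OF s] kidem_kcar V that)
 have Rc: "ribbon_elt p V v : kcar V" if "v : kcar V" for v
  unfolding ribbon_elt_def by (intro cvec.subspace_sum[OF s] cvec.subspace_scale[OF s] kidem_kcar V that)
 have TR: "T (ribbon_elt p V v) = v" if v: "v : kcar V" for v
 proof (rule kcar_eqI[OF V lin_on_compose[OF Tl ribbon_lin[OF V] Rc] lin_on_id _ v])
  fix a v assume av: "a : S" "v : hgr V a"
  show "T (ribbon_elt p V v) = v"
   unfolding ribbon_elt_hgr[OF V av(2)] lin_on_scale[OF Tl eig_kcar[OF av(2)]] Th[OF av] by simp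
 qed
 have RT: "ribbon_elt p V (T v) = v" if v: "v : kcar V" for v
 proof (rule kcar_eqI[OF V lin_on_compose[OF ribbon_lin[OF V] Tl Tc] lin_on_id _ v])
  fix a v assume av: "a : S" "v : hgr V a"
  show "ribbon_elt p V (T v) = v"
   unfolding Th[OF av] lin_on_scale[OF ribbon_lin[OF V] eig_kcar[OF av(2)]] ribbon_elt_hgr[OF V av(2)] by simp
 qed
 have inj: "inj_on (ribbon_elt p V) (kcar V)" by (rule inj_on_inverseI[of _ T]) (rule TR)
 have "the_inv_into (kcar V) (ribbon_elt p V) v = T v" if "v : kcar V" for v
  by (rule the_inv_into_f_eq[OF inj RT Tc]) (use that in auto)
 then have tw: "Twist RC V = Arrow V (restrict T (kcar V)) V" by (auto simp: RepCat_def restrict_def)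
 show el: "!!a v. [|a : S; v : hgr V a|] ==> amap (Twist RC V) v = \<theta> a *\<^sub>C v"
  using Th eig_kcar by (auto simp: tw)
 have arr: "Twist RC V : Arr RC"
  unfolding tw
 proof (rule RC_ArrI[OF V V restrict_lin[OF s Tl Tc] kcar_span[OF V]])
  fix v assume "v : (UN a:S. hgr V a)"
  then obtain a where "a : S" "v : hgr V a" by auto
  then show "EX a. v : hgr V a & restrict T (kcar V) v : hgr V a"
   using Th eig_kcar[of v] cvec.subspace_scale[OF eig_subspace[OF V]] by auto
 qed
 have "bij_betw (restrict T (kcar V)) (kcar V) (kcar V)"
  by (rule bij_betw_byWitness[where f' = "ribbon_elt p V"]) (use TR RT Tc Rc in auto)
 then show "Twist RC V : cat_iso RC V V" using iso_of_bij[OF arr] by (simp add: tw)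
qed

lemma kunit_hgr: "kunit_basis : unit_space ==> kunit_basis : hgr kunit (rep 0)"
 unfolding hgr_rep by (simp add: eig_def kunit_def)

lemma basis0_unit [simp]: "e0 : unit_space" by (simp add: unit_space_def cvec.span_base)

lemma RC_balanced: "graded_balanced RC kcar hgr amap S (%_ _. (<*>)) (%a b. rep (a + b)) \<Phi> R \<theta> (rep 0) (e0)"
proof (intro graded_balanced.intro[OF RC_tensor] graded_balanced_axioms.intro, goal_cases)
 case 1 then show ?case using kunit_kmod[OF p_pos] by simp
next
 case 3 then show ?case using kunit_hgr[OF basis0_unit] by simp
next
 case (4 X Y Z) then show ?case using RC_Assoc_Arr by simp
next
 case (5 X Y Z) then show ?case using RC_el_Assoc by simp
next
 case (6 X Y) then show ?case using RC_Braid_Arr by simp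
next
 case (7 X Y) then show ?case using RC_el_Braid by simp
next
 case (8 X) then show ?case using RC_Twist(1) by simp
next
 case (9 X) then show ?case using RC_Twist(2) by simp
next
 case (10 X)
 then have X: "is_kmod p X" by simp
 note s = kmod_subspace[OF X] and U = kunit_kmod[OF p_pos]
 have L: "LUnit RC X = Arrow (ktens kunit X) (THE f. f : lin (tens unit_space (kcar X)) (kcar X) & (ALL v:kcar X. f (e0 <*> v) = v)) X"
  by (simp add: RepCat_def)
 have "LUnit RC X : Arr RC"
  unfolding L
 proof (rule RC_ArrI[OF is_kmod_ktens(1)[OF U X] X])
  show "kcar (ktens kunit X) = cvec.span {v <*> w | v w. v : {e0} & w : (UN a:S. hgr X a)}"
   using tens_span[of "{e0}" unit_space, OF _ kcar_span[OF X, symmetric]] by (simp add: unit_space_def)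
  fix x assume "x : {v <*> w | v w. v : {e0} & w : (UN a:S. hgr X a)}"
  then obtain a v where v: "x = e0 <*> v" "v : hgr X a" by auto
  have "x : hgr (ktens kunit X) (0 + a)" unfolding v(1)
   by (rule eig_ktens[OF U X _ v(2)]) (simp add: eig_def kunit_def)
  then show "EX a. x : hgr (ktens kunit X) a & (THE f. f : lin (tens unit_space (kcar X)) (kcar X) & (ALL v:kcar X. f (e0 <*> v) = v)) x : hgr X a"
   using left_unit_map(2)[OF s eig_kcar[OF v(2)]] v by auto
 qed (use left_unit_map(1)[OF s] in simp)
 then show ?case by (simp add: cat_hom_def L)
next
 case (11 X x) then show ?case using left_unit_map(2)[OF kmod_subspace[of p X]] by (simp add: RepCat_def)
next
 case (12 X) then show ?case using tens_unit_left_mem[OF kmod_subspace[of p X]] by auto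
next
 case (13 X)
 then have X: "is_kmod p X" by simp
 note s = kmod_subspace[OF X] and U = kunit_kmod[OF p_pos]
 have L: "RUnit RC X = Arrow (ktens X kunit) (THE f. f : lin (tens (kcar X) unit_space) (kcar X) & (ALL v:kcar X. f (v <*> e0) = v)) X"
  by (simp add: RepCat_def)
 have "RUnit RC X : Arr RC"
  unfolding L
 proof (rule RC_ArrI[OF is_kmod_ktens(1)[OF X U] X])
  show "kcar (ktens X kunit) = cvec.span {v <*> w | v w. v : (UN a:S. hgr X a) & w : {e0}}"
   using tens_span[of _ _ "{e0}" unit_space, OF kcar_span[OF X, symmetric]] by (simp add: unit_space_def)
  fix x assume "x : {v <*> w | v w. v : (UN a:S. hgr X a) & w : {e0}}"
  then obtain a v where v: "x = v <*> e0" "v : hgr X a" by auto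
  have "x : hgr (ktens X kunit) (a + 0)" unfolding v(1)
   by (rule eig_ktens[OF X U v(2)]) (simp add: eig_def kunit_def)
  then show "EX a. x : hgr (ktens X kunit) a & (THE f. f : lin (tens (kcar X) unit_space) (kcar X) & (ALL v:kcar X. f (v <*> e0) = v)) x : hgr X a"
   using right_unit_map(2)[OF s eig_kcar[OF v(2)]] v by auto
 qed (use right_unit_map(1)[OF s] in simp)
 then show ?case by (simp add: cat_hom_def L)
next
 case (14 X x) then show ?case using right_unit_map(2)[OF kmod_subspace[of p X]] by (simp add: RepCat_def)
next
 case (15 X) then show ?case using tens_unit_right_mem[OF kmod_subspace[of p X]] by auto
next
 case (19 a b) then show ?case by (simp add: R_coeff_def zeta_nonzero)
next
 case (20 a b) then show ?case by (simp add: add.commute)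
qed (auto simp: Phi_nz intro: Phi_unit Phi_cocycle R_hex1 R_hex2 theta_R)

sublocale RC: graded_balanced RC kcar hgr amap S "%_ _. (<*>)" "%a b. rep (a + b)" \<Phi> R \<theta> "rep 0" "e0"
 by (rule RC_balanced)

end

context rep_data
begin

lemma homogeneous_basis:
 assumes V: "is_kmod p V"
 obtains n i x where "!!k. k < n ==> i k : S & x k : hgr V (i k)" "kcar V = cvec.span (x ` {..<n :: nat})"
  "inj_on x {..<n}" "cvec.independent (x ` {..<n})"
proof -
 obtain B where B: "B <= (UN a:S. hgr V a)" "cvec.independent B" "(UN a:S. hgr V a) <= cvec.span B"
  using cvec.maximal_independent_subset by blast
 obtain T where T: "finite T" "cvec.span T = kcar V" using kmod_fin_dim[OF V] by (auto simp: fin_dim_def)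
 have "B <= cvec.span T" using B(1) eig_kcar T(2) by blast
 then have "finite B" using cvec.independent_span_bound[OF T(1) B(2)] by blast
 then obtain n x where x: "B = x ` {k. k < (n :: nat)}" "inj_on x {k. k < n}"
  using finite_imp_nat_seg_image_inj_on by metis
 have "ALL k. EX a. k < n \<longrightarrow> a : S & x k : hgr V a" using B(1) x(1) by auto
 then obtain i where i: "!!k. k < n ==> i k : S & x k : hgr V (i k)" by metis
 have "kcar V = cvec.span B"
  unfolding kcar_span[OF V] using B by (intro antisym cvec.span_minimal cvec.span_mono) auto
 then show ?thesis using that[of n i x] i x B(2) by (simp add: lessThan_def)
qed

text \<open>
  The dual carries the inverse action on the dual basis; the values of \<open>\<Phi>\<close> are put into the
  evaluation.
\<close>

lemma RC_dual_data:
 assumes V: "is_kmod p V"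
 obtains n i x d D ev coev where
  "is_kmod p D" "!!k. k < n ==> i k : S & x k : hgr V (i k)" "!!k. k < n ==> d k : hgr D (rep (- i k))"
  "kcar V = cvec.span (x ` {..<n :: nat})" "kcar D = cvec.span (d ` {..<n})"
  "ev : cat_hom RC (ktens D V) kunit" "coev : cat_hom RC kunit (ktens V D)"
  "!!k l. [|k < n; l < n|] ==> amap ev (d k <*> x l) = (if k = l then \<Phi> (i k) (rep (- i k)) (i k) *\<^sub>C e0 else 0)"
  "amap coev (e0) = (SUM k<n. x k <*> d k)"
proof -
 obtain n i x where x: "!!k. k < n ==> i k : S & x k : hgr V (i k)" and sp: "kcar V = cvec.span (x ` {..<n :: nat})"
  and inj: "inj_on x {..<n}" and ind: "cvec.independent (x ` {..<n})"
  using homogeneous_basis[OF V] by blast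
 obtain \<kappa> where k: "lin_on UNIV \<kappa>" "!!k. \<kappa> (basis_vec k) = qpow p (of_int (- i k)) *\<^sub>C basis_vec k"
  using basis_vec_extend[of "%k. qpow p (of_int (- i k)) *\<^sub>C basis_vec k"] by auto
 let ?B = "basis_vec ` {..<n}"
 define D where "D = \<lparr> kcar = cvec.span ?B, kact = restrict \<kappa> (cvec.span ?B) \<rparr>"
 have D_act: "kact D (basis_vec k) = qpow p (of_int (- i k)) *\<^sub>C basis_vec k" if "k < n" for k
  using that k(2) by (auto simp: D_def intro: cvec.span_base)
 have Dl: "kact D : lin (kcar D) (kcar D)"
  unfolding D_def kmod.simps
 proof (rule restrict_lin)
  show "lin_on (cvec.span ?B) \<kappa>" using k(1) lin_on_subset by blast
  then show "\<kappa> x : cvec.span ?B" if "x : cvec.span ?B" for x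
   by (rule lin_on_span_mem[OF _ _ _ that]) (auto simp: k(2) cvec.span_base intro!: cvec.span_scale)
 qed simp
 have pw: "(kact D ^^ l) (basis_vec k) = qpow p (of_nat l * of_int (- i k)) *\<^sub>C basis_vec k" if kn: "k < n" for k l
 proof (induction l)
  case (Suc l)
  have m: "basis_vec k : kcar D" using kn by (auto simp: D_def intro: cvec.span_base)
  have "qpow p (of_nat (Suc l) * of_int (- i k)) = qpow p (of_nat l * of_int (- i k)) * qpow p (of_int (- i k))"
   by (simp only: qpow_add[symmetric]) (simp add: algebra_simps)
  then show ?case using Suc lin_on_scale[OF lin_lin_on[OF Dl] m] D_act[OF kn] by simp
 qed simp
 have per: "qpow p (of_nat (2 * p) * of_int (- i k)) = 1" for k
  using qpow_1_iff[OF p_pos, of "2 * int p * (- i k)"] by simp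
 have D: "is_kmod p D"
  unfolding is_kmod_def
 proof (intro conjI ballI Dl)
  show "cvec.subspace (kcar D)" by (simp add: D_def)
  show "fin_dim (kcar D)" unfolding fin_dim_def by (rule exI[of _ ?B]) (simp add: D_def)
  fix v assume "v : kcar D"
  then have v: "v : cvec.span ?B" by (simp add: D_def)
  show "(kact D ^^ (2 * p)) v = v"
  proof (rule lin_on_span_eq[OF _ lin_on_id _ v])
   have "kcar D = cvec.span ?B" by (simp add: D_def)
   then show "lin_on (cvec.span ?B) (kact D ^^ (2 * p))" using funpow_lin(1)[OF Dl] by metis
   show "(kact D ^^ (2 * p)) b = b" if "b : ?B" for b using that pw[of _ "2 * p"] per by auto
  qed
 qed
 have d: "basis_vec k : hgr D (rep (- i k))" if "k < n" for k
  unfolding hgr_rep unfolding eig_def using D_act[OF that] that by (auto simp: D_def intro: cvec.span_base)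
 have "EX g. Vector_Spaces.linear vscale vscale g & (ALL y:x ` {..<n}. g y = basis_vec (the_inv_into {..<n} x y))"
  using cvec_pair.linear_independent_extend[OF ind] by auto
 then obtain \<phi> where phi: "Vector_Spaces.linear vscale vscale \<phi>" "!!k. k < n ==> \<phi> (x k) = basis_vec k"
  by (auto simp: the_inv_into_f_f[OF inj])
 have phil: "lin_on X \<phi>" for X using phi(1) by (auto simp: lin_on_def cvec_pair.linear_add cvec_pair.linear_scale)
 let ?be = "%y v. SUM k<n. (\<Phi> (i k) (rep (- i k)) (i k) * (Poly_Mapping.lookup y k * Poly_Mapping.lookup (\<phi> v) k)) *\<^sub>C e0"
 have b: "bilin_on (kcar D) (kcar V) ?be"
  by (intro bilin_onI lin_on_comp_sum; intro lin_onI)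
   (auto simp: lookup_add lookup_vscale ring_distribs cvec.scale_left_distrib lin_on_add[OF phil] lin_on_scale[OF phil] mult_ac)
 note s = kmod_subspace[OF D] kmod_subspace[OF V]
 let ?ev = "tmap (kcar D) (kcar V) ?be"
 note t = tmap_lin[OF s b] tmap_tensor[OF s b]
 have dm: "k < n ==> basis_vec k : kcar D" and xm: "k < n ==> x k : kcar V" for k
  using d[of k] x[of k] eig_kcar by blast+
 have ev: "?ev (basis_vec k <*> x l) = (if k = l then \<Phi> (i k) (rep (- i k)) (i k) *\<^sub>C e0 else 0)" if "k < n" "l < n" for k l
 proof -
  have "?ev (basis_vec k <*> x l) = (SUM m<n. if m = k then (if k = l then \<Phi> (i k) (rep (- i k)) (i k) *\<^sub>C e0 else 0) else 0)"
   unfolding t(2)[OF dm[OF that(1)] xm[OF that(2)]] phi(2)[OF that(2)] lookup_basis_vec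
   by (intro sum.cong refl) auto
  then show ?thesis using that by (simp add: sum.delta)
 qed
 have "Arrow (ktens D V) ?ev kunit : Arr RC"
 proof (rule RC_ArrI[OF is_kmod_ktens(1)[OF D V] kunit_kmod[OF p_pos]])
  show "kcar (ktens D V) = cvec.span {y <*> v | y v. y : ?B & v : x ` {..<n}}"
   using tens_span[of ?B "kcar D" "x ` {..<n}" "kcar V"] sp by (simp add: D_def)
  show "?ev : lin (kcar (ktens D V)) (kcar kunit)"
   unfolding kcar_ktens kcar_kunit
  proof (rule tens_lin_range[OF t(1) subspace_unit_space])
   show "?ev (y <*> v) : unit_space" if "y : kcar D" "v : kcar V" for y v
    unfolding t(2)[OF that] by (intro cvec.subspace_sum[OF subspace_unit_space] cvec.subspace_scale[OF subspace_unit_space]) simp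
  qed
  fix g assume "g : {y <*> v | y v. y : ?B & v : x ` {..<n}}"
  then obtain k l where g: "g = basis_vec k <*> x l" "k < n" "l < n" by auto
  have gm: "g : hgr (ktens D V) (rep (- i k) + i l)"
   unfolding g(1) by (rule eig_ktens[OF D V d[OF g(2)]]) (use x g in simp)
  show "EX a. g : hgr (ktens D V) a & ?ev g : hgr kunit a"
  proof (cases "k = l")
   case True
   have "hgr (ktens D V) (rep (- i k) + i l) = hgr (ktens D V) (rep 0)"
    using hgr_rep[of "ktens D V" "rep (- i k) + i l"] True by (simp add: rep_add_left)
   moreover have "?ev g : hgr kunit (rep 0)"
    by (rule kunit_hgr) (use ev[OF g(2,3)] g True cvec.subspace_scale[OF subspace_unit_space] in auto)
   ultimately show ?thesis using gm by blast
  next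
   case False
   then have "?ev g = 0" using ev[OF g(2,3)] g by simp
   then show ?thesis using gm cvec.subspace_0[OF eig_subspace[OF kunit_kmod[OF p_pos]]] by auto
  qed
 qed
 then have evh: "Arrow (ktens D V) ?ev kunit : cat_hom RC (ktens D V) kunit" by (simp add: cat_hom_def)
 let ?z = "SUM k<n. x k <*> basis_vec k"
 let ?co = "restrict (%y. Poly_Mapping.lookup y 0 *\<^sub>C ?z) unit_space"
 have zh: "?z : hgr (ktens V D) (rep 0)"
 proof (rule cvec.subspace_sum[OF eig_subspace[OF is_kmod_ktens(1)[OF V D]]])
  fix k assume "k : {..<n}"
  then have "x k <*> basis_vec k : hgr (ktens V D) (i k + rep (- i k))"
   using x by (intro eig_ktens[OF V D] d) auto
  then show "x k <*> basis_vec k : hgr (ktens V D) (rep 0)"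
   using hgr_rep[of "ktens V D" "i k + rep (- i k)"] by (simp add: rep_add_right)
 qed
 have coe: "?co (e0) = ?z" by (simp add: lookup_basis_vec)
 have "Arrow kunit ?co (ktens V D) : Arr RC"
 proof (rule RC_ArrI[OF kunit_kmod[OF p_pos] is_kmod_ktens(1)[OF V D], of _ "{e0}"])
  show "?co : lin (kcar kunit) (kcar (ktens V D))"
   unfolding kcar_kunit
   by (intro restrict_lin subspace_unit_space lin_intros)
    (use eig_kcar[OF zh] in "auto simp: cvec.subspace_scale[OF subspace_tens]")
  fix g assume "g : {e0}"
  then show "EX a. g : hgr kunit a & ?co g : hgr (ktens V D) a" using zh coe kunit_hgr[OF basis0_unit] by auto
 qed (simp add: unit_space_def)
 then have coh: "Arrow kunit ?co (ktens V D) : cat_hom RC kunit (ktens V D)" by (simp add: cat_hom_def)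
 show ?thesis
 proof (rule that[of D n i x basis_vec "Arrow (ktens D V) ?ev kunit" "Arrow kunit ?co (ktens V D)"])
  show "!!k l. [|k < n; l < n|] ==> amap (Arrow (ktens D V) ?ev kunit) (basis_vec k <*> x l) = (if k = l then \<Phi> (i k) (rep (- i k)) (i k) *\<^sub>C e0 else 0)"
   using ev by simp
  show "amap (Arrow kunit ?co (ktens V D)) (e0) = ?z" using coe by simp
  show "kcar D = cvec.span ?B" by (simp add: D_def)
 qed (fact D x d sp evh coh)+
qed

lemma RC_ribbon: "ribbon_category RC"
proof (intro ribbon_category.intro[OF RC.balanced] ribbon_category_axioms.intro)
 fix V assume "V : Obj RC"
 then have V: "is_kmod p V" by simp
 obtain n i x d D ev coev where D: "is_kmod p D" and x: "!!k. k < n ==> i k : S & x k : hgr V (i k)"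
  and d: "!!k. k < n ==> d k : hgr D (rep (- i k))"
  and sp: "kcar V = cvec.span (x ` {..<n :: nat})" "kcar D = cvec.span (d ` {..<n})"
  and h: "ev : cat_hom RC (ktens D V) kunit" "coev : cat_hom RC kunit (ktens V D)"
  and ev: "!!k l. [|k < n; l < n|] ==> amap ev (d k <*> x l) = (if k = l then \<Phi> (i k) (rep (- i k)) (i k) *\<^sub>C e0 else 0)"
  and coev: "amap coev (e0) = (SUM k<n. x k <*> d k)"
  by (rule RC_dual_data[OF V]) (rule that)
 have "is_dual RC V D ev coev & Comp RC (TensA RC (Twist RC V) (Id RC D)) coev = Comp RC (TensA RC (Id RC V) (Twist RC D)) coev"
 proof (rule RC.dual_criterion[of "{..<n}" i x V "%k. rep (- i k)" d D ev coev "%k. \<Phi> (i k) (rep (- i k)) (i k)" "%_. 1"])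
  show "RC.determined V (x ` {..<n})" "RC.determined D (d ` {..<n})"
   using V D sp by (auto intro!: RC.gen_determined simp: RC.gen_def)
  show "RC.determined (Unit RC) {e0}"
   by (rule RC.gen_determined) (simp add: RC.gen_def kunit_kmod[OF p_pos] unit_space_def)
  show "\<theta> (i k) = \<theta> (rep (- i k))" if "k : {..<n}" for k by (simp add: theta_rep) (simp add: \<theta>_def)
 qed (use x d h ev coev Phi_dual in auto)
 then show "EX D ev coev. is_dual RC V D ev coev & Comp RC (TensA RC (Twist RC V) (Id RC D)) coev = Comp RC (TensA RC (Id RC V) (Twist RC D)) coev"
  by blast
qed

end

section \<open>Complex-graded spaces\<close>

definition decomposes :: "gspace => (complex => cvec) => cvec => bool" where
 "decomposes V c x \<longleftrightarrow> (ALL al. c al : V al) & finite {al. c al ~= 0} & (SUM al | c al ~= 0. c al) = x"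

lemma sum_support:
 fixes g :: "complex => cvec => cvec"
 assumes "finite A" "{al. c al ~= 0} <= A" "!!al. g al 0 = 0"
 shows "(SUM al | c al ~= 0. g al (c al)) = (SUM al:A. g al (c al))"
 by (rule sum.mono_neutral_left) (use assms in auto)

lemma graded_subspace: "graded V ==> cvec.subspace (V al)"
 by (simp add: graded_def)

lemma gcar_mem: "x : V al ==> x : gcar V"
 unfolding gcar_def by (intro cvec.span_base) blast

lemma subspace_gcar [simp]: "cvec.subspace (gcar V)" by (simp add: gcar_def)

lemma decomposes_add:
 assumes V: "graded V" and c: "decomposes V c x" and d: "decomposes V d y"
 shows "decomposes V (%al. c al + d al) (x + y)"
proof -
 let ?A = "{al. c al ~= 0} \<union> {al. d al ~= 0}"
 have A: "finite ?A" using c d by (simp add: decomposes_def)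
 have s: "{al. c al + d al ~= 0} <= ?A" by auto
 have "(SUM al | c al + d al ~= 0. c al + d al) = (SUM al:?A. c al + d al)"
  using sum_support[OF A s, of "%_ x. x"] by simp
 also have "... = (SUM al:?A. c al) + (SUM al:?A. d al)" by (rule sum.distrib)
 also have "(SUM al:?A. c al) = x" using sum_support[OF A, of c "%_ x. x"] c by (simp add: decomposes_def)
 also have "(SUM al:?A. d al) = y" using sum_support[OF A, of d "%_ x. x"] d by (simp add: decomposes_def)
 finally show ?thesis
  using c d graded_subspace[OF V] finite_subset[OF s A] by (simp add: decomposes_def cvec.subspace_add)
qed

lemma decomposes_scale:
 assumes V: "graded V" and c: "decomposes V c x"
 shows "decomposes V (%al. a *\<^sub>C c al) (a *\<^sub>C x)"
proof -
 let ?A = "{al. c al ~= 0}"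
 have A: "finite ?A" using c by (simp add: decomposes_def)
 have s: "{al. a *\<^sub>C c al ~= 0} <= ?A" by auto
 have "(SUM al | a *\<^sub>C c al ~= 0. a *\<^sub>C c al) = (SUM al:?A. a *\<^sub>C c al)"
  using sum_support[OF A s, of "%_ x. x"] by simp
 also have "... = a *\<^sub>C x" using c by (simp add: decomposes_def flip: cvec.scale_sum_right)
 finally show ?thesis
  using c graded_subspace[OF V] finite_subset[OF s A] by (simp add: decomposes_def cvec.subspace_scale)
qed

lemma decomposes_unique:
 assumes V: "graded V" and c: "decomposes V c x" and d: "decomposes V d x"
 shows "c = d"
proof -
 have "decomposes V (%al. c al + (-1) *\<^sub>C d al) (x + (-1) *\<^sub>C x)"
  by (intro decomposes_add decomposes_scale V c d)
 then have e: "decomposes V (%al. c al - d al) 0" by (simp add: cvec.scale_minus_left)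
 have "ALL x. (ALL al. x al : V al) & finite {al. x al ~= 0} & (SUM al | x al ~= 0. x al) = 0 \<longrightarrow> (ALL al. x al = 0)"
  using V unfolding graded_def by (rule conjunct2)
 from mp[OF spec[OF this, of "%al. c al - d al"] e[unfolded decomposes_def]] have "ALL al. c al - d al = 0" .
 then show ?thesis by auto
qed

lemma decomposes_single: "graded V ==> x : V al ==> decomposes V (%be. if be = al then x else 0) x"
proof -
 assume V: "graded V" and x: "x : V al"
 let ?c = "%be. if be = al then x else 0"
 have "(SUM be | ?c be ~= 0. ?c be) = (SUM be:{al}. ?c be)"
  using sum_support[of "{al}" ?c "%_ x. x"] by auto
 moreover have "finite {be. ?c be ~= 0}" by (rule finite_subset[of _ "{al}"]) auto
 ultimately show ?thesis using x graded_subspace[OF V] by (auto simp: decomposes_def cvec.subspace_0)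
qed

lemma decomposes_ex:
 assumes V: "graded V" and x: "x : gcar V"
 shows "EX c. decomposes V c x"
 using x unfolding gcar_def
proof (induction rule: cvec.span_induct_alt)
 case base
 have "decomposes V (%al. 0) 0" using graded_subspace[OF V] by (simp add: decomposes_def cvec.subspace_0)
 then show ?case by blast
next
 case (step c b y)
 then obtain al d where "b : V al" "decomposes V d y" by auto
 then show ?case using decomposes_add[OF V decomposes_scale[OF V decomposes_single[OF V]]] by blast
qed

text \<open>
  The decomposition of a vector into homogeneous components is unique, so the components of a chosen
  decomposition are additive in the vector.
\<close>

lemma graded_extend:
 assumes V: "graded V" and \<phi>: "!!al. lin_on (V al) (\<phi> al)"
 shows "EX f. f : lin (gcar V) UNIV & (ALL al. ALL x:V al. f x = \<phi> al x)"
proof -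
 define D where "D x = (SOME c. decomposes V c x)" for x
 have D: "decomposes V (D x) x" if "x : gcar V" for x
  unfolding D_def by (rule someI_ex[OF decomposes_ex[OF V that]])
 have Deq: "D x = c" if "decomposes V c x" "x : gcar V" for c x
  using decomposes_unique[OF V D[OF that(2)] that(1)] .
 have z: "\<phi> al 0 = 0" for al using lin_on_zero[OF \<phi>] cvec.subspace_0[OF graded_subspace[OF V]] by blast
 define f where "f x = (SUM al | D x al ~= 0. \<phi> al (D x al))" for x
 have fA: "f x = (SUM al:A. \<phi> al (D x al))" if "finite A" "{al. D x al ~= 0} <= A" for x A
  unfolding f_def by (rule sum_support[where c = "D x" and g = \<phi>, OF that z])
 have fin: "finite {al. D x al ~= 0}" and Dm: "D x al : V al" if "x : gcar V" for x al
  using D[OF that] by (auto simp: decomposes_def)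
 have "lin_on (gcar V) f"
 proof (rule lin_onI)
  fix x y assume x: "x : gcar V" and y: "y : gcar V"
  let ?A = "{al. D x al ~= 0} \<union> {al. D y al ~= 0}"
  have A: "finite ?A" using fin x y by simp
  have e: "D (x + y) = (%al. D x al + D y al)"
   by (rule Deq[OF decomposes_add[OF V D[OF x] D[OF y]]]) (use x y in "simp add: cvec.subspace_add[OF subspace_gcar]")
  have "f (x + y) = (SUM al:?A. \<phi> al (D x al + D y al))" by (rule fA[OF A, of "x + y", unfolded e]) auto
  also have "... = (SUM al:?A. \<phi> al (D x al) + \<phi> al (D y al))"
   by (rule sum.cong[OF refl]) (rule lin_on_add[OF \<phi> Dm[OF x] Dm[OF y]])
  also have "... = f x + f y" using fA[OF A, of x] fA[OF A, of y] by (simp add: sum.distrib)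
  finally show "f (x + y) = f x + f y" .
 next
  fix x a assume x: "x : gcar V"
  let ?A = "{al. D x al ~= 0}"
  have e: "D (a *\<^sub>C x) = (%al. a *\<^sub>C D x al)"
   by (rule Deq[OF decomposes_scale[OF V D[OF x]]]) (use x in "simp add: cvec.subspace_scale[OF subspace_gcar]")
  have "f (a *\<^sub>C x) = (SUM al:?A. \<phi> al (a *\<^sub>C D x al))" by (rule fA[OF fin[OF x], of "a *\<^sub>C x", unfolded e]) auto
  also have "... = (SUM al:?A. a *\<^sub>C \<phi> al (D x al))"
   by (rule sum.cong[OF refl]) (rule lin_on_scale[OF \<phi> Dm[OF x]])
  also have "... = a *\<^sub>C f x" by (simp add: f_def cvec.scale_sum_right)
  finally show "f (a *\<^sub>C x) = a *\<^sub>C f x" .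
 qed
 then have "restrict f (gcar V) : lin (gcar V) UNIV" by (intro restrict_lin) auto
 moreover have "restrict f (gcar V) x = \<phi> al x" if x: "x : V al" for al x
 proof -
  have Dx: "D x = (%be. if be = al then x else 0)" by (rule Deq[OF decomposes_single[OF V x] gcar_mem[of _ V, OF x]])
  have "f x = (SUM be:{al}. \<phi> be (D x be))" by (rule fA) (auto simp: Dx)
  then have "f x = \<phi> al x" by (simp add: Dx)
  then show ?thesis using gcar_mem[of _ V, OF x] by simp
 qed
 ultimately show ?thesis by blast
qed

lemma gradedI:
 assumes s: "!!al. cvec.subspace (V al)"
  and P: "!!ga. EX f. lin_on (gcar V) f & (ALL al. ALL x:V al. f x = (if al = ga then x else 0))"
 shows "graded V"
 unfolding graded_def
proof (intro conjI allI impI s)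
 fix x ga assume x: "(ALL al. x al : V al) & finite {al. x al ~= 0} & (SUM al | x al ~= 0. x al) = (0 :: cvec)"
 obtain f where f: "lin_on (gcar V) f" "!!al x. x : V al ==> f x = (if al = ga then x else 0)" using P by metis
 have "f (SUM al | x al ~= 0. x al) = (SUM al | x al ~= 0. f (x al))"
  by (rule lin_on_sum[OF subspace_gcar f(1)]) (use x gcar_mem in blast)
 also have "... = (SUM al | x al ~= 0. if al = ga then x ga else 0)"
 proof (rule sum.cong[OF refl])
  fix de
  have "x de : V de" using x by blast
  from f(2)[OF this] show "f (x de) = (if de = ga then x ga else 0)" by auto
 qed
 also have "... = x ga" using x by (simp add: sum.delta)
 finally show "x ga = 0" using x lin_on_zero[OF f(1) cvec.subspace_0[OF subspace_gcar]] by simp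
qed

lemma graded_subfamily:
 assumes V: "graded V" and "!!al. cvec.subspace (W al)" "!!al. W al <= V al"
 shows "graded W"
 using assms unfolding graded_def by blast

lemma gcar_mono: "(!!al. W al <= V al) ==> gcar W <= gcar V"
 unfolding gcar_def by (intro cvec.span_mono) blast

lemma gcar_of_spans: "(!!al. V al = cvec.span (G al)) ==> gcar V = cvec.span (UN al. G al)"
 unfolding gcar_def
 by (intro antisym cvec.span_minimal) (auto intro: cvec.span_base cvec.span_mono[THEN subsetD, rotated])

lemma gcar_linE:
 assumes "f : lin (gcar V) X" "g : lin (gcar V) Y" "!!al x. x : V al ==> f x = g x"
 shows "f = g"
 using assms unfolding gcar_def by (auto intro: lin_span_eqI)

lemma gtens_spans:
 assumes "!!al. U al = cvec.span (A al)" "!!al. V al = cvec.span (B al)"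
 shows "gtens U V ga = cvec.span {a <*> b | a b al be. a : A al & b : B be & al + be = ga}" (is "_ = cvec.span ?G")
proof
 have "u <*> v : cvec.span ?G" if uv: "u : U al" "v : V be" "al + be = ga" for u v al be
 proof (rule bilin_on_span_mem[OF bilin_on_tensor _ _ uv(1)[unfolded assms(1)] uv(2)[unfolded assms(2)]])
  show "a <*> b : cvec.span ?G" if "a : A al" "b : B be" for a b
   by (rule cvec.span_base) (use that uv(3) in blast)
 qed simp
 then show "gtens U V ga <= cvec.span ?G" unfolding gtens_def by (intro cvec.span_minimal) auto
 have AB: "a : A al ==> a : U al" "b : B al ==> b : V al" for a b al unfolding assms by (rule cvec.span_base, assumption)+
 show "cvec.span ?G <= gtens U V ga" unfolding gtens_def
 proof (rule cvec.span_mono, rule subsetI)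
  fix x assume "x : ?G"
  then obtain a b al be where x: "x = a <*> b" "a : A al" "b : B be" "al + be = ga" by auto
  then show "x : {v <*> w |v w al be. v : U al & w : V be & al + be = ga}"
   using AB(1)[OF x(2)] AB(2)[OF x(3)] by blast
 qed
qed

lemma gtens_mem: "u : U al ==> v : V be ==> u <*> v : gtens U V (al + be)"
 unfolding gtens_def by (rule cvec.span_base) blast

lemma subspace_gtens [simp]: "cvec.subspace (gtens U V ga)" by (simp add: gtens_def)

lemma gcar_gtens: "gcar (gtens U V) = tens (gcar U) (gcar V)"
proof -
 have "gcar (gtens U V) = cvec.span (UN ga. {u <*> v | u v al be. u : U al & v : V be & al + be = ga})"
  by (rule gcar_of_spans) (simp add: gtens_def)
 also have "(UN ga. {u <*> v | u v al be. u : U al & v : V be & al + be = ga}) = {u <*> v | u v. u : (UN al. U al) & v : (UN al. V al)}"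
  by blast
 also have "cvec.span ... = tens (gcar U) (gcar V)"
  by (rule tens_span[symmetric]) (simp_all add: gcar_def)
 finally show ?thesis .
qed

lemma gtens_extend:
 assumes U: "graded U" and V: "graded V" and b: "!!al be. bilin_on (U al) (V be) (\<phi> al be)"
 shows "EX f. f : lin (tens (gcar U) (gcar V)) UNIV & (ALL al be. ALL u:U al. ALL v:V be. f (u <*> v) = \<phi> al be u v)"
proof -
 define g where "g al u = (SOME f. f : lin (gcar V) UNIV & (ALL be. ALL v:V be. f v = \<phi> al be u v))" for al u
 have "g al u : lin (gcar V) UNIV & (ALL be. ALL v:V be. g al u v = \<phi> al be u v)" if "u : U al" for al u
  unfolding g_def by (rule someI_ex[OF graded_extend[OF V bilin_onD1[OF b that]]])
 then have g: "!!al u. u : U al ==> g al u : lin (gcar V) UNIV"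
  "!!al be u v. u : U al ==> v : V be ==> g al u v = \<phi> al be u v" by simp_all
 have gb: "bilin_on (U al) (gcar V) (g al)" for al
  unfolding gcar_def
 proof (rule bilin_on_of_generators[OF _ _ graded_subspace[OF U]])
  show "u : U al ==> lin_on (cvec.span (\<Union> (range V))) (g al u)" for u
   using lin_lin_on[OF g(1)] by (simp add: gcar_def)
  fix v assume "v : \<Union> (range V)"
  then obtain be where v: "v : V be" by auto
  show "lin_on (U al) (%u. g al u v)"
   using bilin_onD2[OF b v, of al] g(2)[OF _ v] lin_on_cong[OF _ graded_subspace[OF U], of al "%u. g al u v" "%u. \<phi> al be u v"] by blast
 qed
 define h where "h v = (SOME f. f : lin (gcar U) UNIV & (ALL al. ALL u:U al. f u = g al u v))" for v
 have "h v : lin (gcar U) UNIV & (ALL al. ALL u:U al. h v u = g al u v)" if "v : gcar V" for v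
  unfolding h_def by (rule someI_ex[OF graded_extend[OF U bilin_onD2[OF gb that]]])
 then have h: "!!v. v : gcar V ==> h v : lin (gcar U) UNIV"
  "!!al u v. u : U al ==> v : gcar V ==> h v u = g al u v" by simp_all
 have "bilin_on (gcar V) (gcar U) h"
  unfolding gcar_def[of U]
 proof (rule bilin_on_of_generators[OF _ _ subspace_gcar])
  show "v : gcar V ==> lin_on (cvec.span (\<Union> (range U))) (h v)" for v
   using lin_lin_on[OF h(1)] by (simp add: gcar_def)
  fix u assume "u : \<Union> (range U)"
  then obtain al where u: "u : U al" by auto
  show "lin_on (gcar V) (%v. h v u)"
   using bilin_onD1[OF gb u] h(2)[OF u] lin_on_cong[OF _ subspace_gcar, of V "%v. h v u" "g al u"] by blast
 qed
 from tmap_ex[OF subspace_gcar subspace_gcar bilin_on_flip[OF this]] obtain f where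
  f: "f : lin (tens (gcar U) (gcar V)) UNIV" "!!u v. u : gcar U ==> v : gcar V ==> f (u <*> v) = h v u" by blast
 have "f (u <*> v) = \<phi> al be u v" if uv: "u : U al" "v : V be" for al be u v
  using f(2)[OF gcar_mem[of _ U, OF uv(1)] gcar_mem[of _ V, OF uv(2)]] h(2)[OF uv(1) gcar_mem[of _ V, OF uv(2)]] g(2)[OF uv] by simp
 with f(1) show ?thesis by blast
qed

lemma graded_gtens:
 assumes U: "graded U" and V: "graded V"
 shows "graded (gtens U V)"
proof (rule gradedI)
 fix ga
 have "EX f. f : lin (tens (gcar U) (gcar V)) UNIV & (ALL al be. ALL u:U al. ALL v:V be. f (u <*> v) = (if al + be = ga then u <*> v else 0))"
  by (rule gtens_extend[OF U V, of "%al be u v. if al + be = ga then u <*> v else 0"])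
   (intro bilin_onI lin_onI; simp add: tensor_add_left tensor_add_right tensor_scale_left tensor_scale_right)
 then obtain f where f: "f : lin (tens (gcar U) (gcar V)) UNIV"
  "!!al be u v. u : U al ==> v : V be ==> f (u <*> v) = (if al + be = ga then u <*> v else 0)" by blast
 have l: "lin_on (gcar (gtens U V)) f" using lin_lin_on[OF f(1)] by (simp add: gcar_gtens)
 have "f x = (if de = ga then x else 0)" if x: "x : gtens U V de" for de x
 proof (rule lin_on_span_eq[OF _ _ _ x[unfolded gtens_def]])
  have "gtens U V de <= gcar (gtens U V)" using gcar_mem by blast
  then show "lin_on (cvec.span {v <*> w |v w al be. v : U al & w : V be & al + be = de}) f"
   using lin_on_subset[OF l] by (simp add: gtens_def)
  show "lin_on (cvec.span {v <*> w |v w al be. v : U al & w : V be & al + be = de}) (%x. if de = ga then x else 0)"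
   by (cases "de = ga") (simp_all add: lin_intros)
 qed (use f(2) in auto)
 with l show "EX f. lin_on (gcar (gtens U V)) f & (ALL al. ALL x:gtens U V al. f x = (if al = ga then x else 0))" by blast
qed simp

lemma lin_graded_of_gens:
 assumes f: "lin_on (gcar V) f" and V: "!!al. V al = cvec.span (G al)" and W: "graded W"
  and e: "!!al x. x : G al ==> f x : W al" and x: "x : V al"
 shows "f x : W al"
proof (rule lin_on_span_mem[OF _ graded_subspace[OF W] e x[unfolded V]])
 have "V al <= gcar V" using gcar_mem by blast
 then show "lin_on (cvec.span (G al)) f" unfolding V[symmetric] using lin_on_subset[OF f] by blast
qed

lemma graded_range:
 assumes f: "f : lin (gcar V) X" and e: "!!al x. x : V al ==> f x : W al"
 shows "f : lin (gcar V) (gcar W)"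
proof (rule lin_range[OF f])
 fix x assume "x : gcar V"
 then show "f x : gcar W" unfolding gcar_def[of V]
  by (rule lin_on_span_mem[rotated 3]) (use lin_lin_on[OF f] e in "auto simp: gcar_def[of V] intro: gcar_mem")
qed

section \<open>The category of graded spaces\<close>

lemma H_simps [simp]:
 "Obj (Hcat p) = {V. graded V}" "Dom (Hcat p) = src" "Cod (Hcat p) = tgt" "TensO (Hcat p) = gtens" "Unit (Hcat p) = gunit"
 "Id (Hcat p) V = Arrow V (restrict (%x. x) (gcar V)) V"
 "Comp (Hcat p) g f = Arrow (src f) (compose (gcar (src f)) (amap g) (amap f)) (tgt g)"
 "TensA (Hcat p) f g = Arrow (gtens (src f) (src g))
         (tmap (gcar (src f)) (gcar (src g)) (%v w. amap f v <*> amap g w)) (gtens (tgt f) (tgt g))"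
 by (simp_all add: Hcat_def)

lemma H_Arr: "f : Arr (Hcat p) \<longleftrightarrow> graded (src f) & graded (tgt f) & amap f : lin (gcar (src f)) (gcar (tgt f)) &
        (ALL al. amap f ` src f al <= tgt f al)"
 by (simp add: Hcat_def)

lemma H_ArrD:
 assumes "f : Arr (Hcat p)"
 shows "graded (src f)" "graded (tgt f)" "amap f : lin (gcar (src f)) (gcar (tgt f))" "!!al x. x : src f al ==> amap f x : tgt f al"
 using assms by (auto simp: H_Arr)

lemma H_ArrI:
 assumes "graded V" "graded W" "f : lin (gcar V) X" "!!al. V al = cvec.span (G al)" "!!al x. x : G al ==> f x : W al"
 shows "Arrow V f W : Arr (Hcat p)"
proof -
 have "f x : W al" if "x : V al" for x al
  by (rule lin_graded_of_gens[OF lin_lin_on[OF assms(3)] assms(4,2,5) that])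
 then show ?thesis using assms graded_range[OF assms(3)] by (auto simp: H_Arr)
qed

lemma H_hom: "cat_hom (Hcat p) V W = {f : Arr (Hcat p). src f = V & tgt f = W}"
 by (simp add: cat_hom_def)

lemma span_graded: "graded V ==> V al = cvec.span (V al)"
 by (metis cvec.span_eq_iff graded_subspace)

lemma H_category: "category (Hcat p)"
proof (unfold_locales, goal_cases)
 case (3 X) then show ?case
  by (auto simp: H_hom H_Arr gcar_mem[of _ X] intro!: restrict_lin lin_intros)
next
 case (4 f X Y g Z)
 then have f: "graded X" "graded Z" "amap f : lin (gcar X) (gcar Y)" "amap g : lin (gcar Y) (gcar Z)"
  "!!al x. x : X al ==> amap f x : Y al" "!!al x. x : Y al ==> amap g x : Z al" "src f = X" "tgt g = Z"
  using H_ArrD[of f p] H_ArrD[of g p] by (auto simp: H_hom)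
 have "compose (gcar X) (amap g) (amap f) : lin (gcar X) (gcar Z)"
  unfolding compose_def
  by (intro restrict_lin subspace_gcar lin_on_compose[OF lin_lin_on[OF f(4)] lin_lin_on[OF f(3)]] lin_mem[OF f(4)] lin_mem[OF f(3)])
 with f show ?case by (auto simp: H_hom H_Arr compose_def gcar_mem[of _ X])
next
 case (5 f X Y) then show ?case
  by (cases f) (auto simp: H_hom H_Arr compose_def lin_iff restrict_def extensional_def PiE_def intro!: ext)
next
 case (6 f X Y) then show ?case
  by (cases f) (auto simp: H_hom H_Arr compose_def lin_iff restrict_def extensional_def PiE_def Pi_def intro!: ext)
next
 case (7 f X Y g Z h W) then show ?case
  by (auto simp: H_hom H_Arr compose_def lin_iff restrict_def intro!: ext)
qed (auto simp: H_Arr)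

lemma graded_inverse:
 assumes V: "graded V" and W: "graded W" and f: "f : lin (gcar V) (gcar W)" and g: "!!al x. x : V al ==> f x : W al"
  and b: "bij_betw f (gcar V) (gcar W)" and y: "y : W al"
 shows "the_inv_into (gcar V) f y : V al"
proof -
 have i: "inj_on f (gcar V)" "f ` gcar V = gcar W" using b by (auto simp: bij_betw_def)
 let ?x = "the_inv_into (gcar V) f y"
 have x: "?x : gcar V" "f ?x = y"
  using i gcar_mem[of _ W, OF y] the_inv_into_into[OF i(1), of y "gcar V"] f_the_inv_into_f[OF i(1), of y] by auto
 obtain c where c: "decomposes V c ?x" using decomposes_ex[OF V x(1)] by blast
 have cm: "c be : V be" "c be : gcar V" for be using c gcar_mem by (auto simp: decomposes_def)
 have z: "f v = 0 ==> v : gcar V ==> v = 0" for v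
  using i(1) lin_on_zero[OF lin_lin_on[OF f] cvec.subspace_0[OF subspace_gcar]] cvec.subspace_0[OF subspace_gcar]
  by (auto simp: inj_on_def)
 have sup: "{be. f (c be) ~= 0} = {be. c be ~= 0}"
  using z[OF _ cm(2)] lin_on_zero[OF lin_lin_on[OF f] cvec.subspace_0[OF subspace_gcar]] by auto
 have "(SUM be | c be ~= 0. f (c be)) = f (SUM be | c be ~= 0. c be)"
  by (rule lin_on_sum[OF subspace_gcar lin_lin_on[OF f] cm(2), symmetric])
 also have "... = y" using c x(2) by (simp add: decomposes_def)
 finally have "decomposes W (%be. f (c be)) y"
  using c g[OF cm(1)] unfolding decomposes_def sup by auto
 then have "(%be. f (c be)) = (%be. if be = al then y else 0)"
  using decomposes_unique[OF W _ decomposes_single[OF W y]] by blast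
 then have "f (c al) = y" by (auto dest: fun_cong[of _ _ al])
 then have "?x = c al" using i(1) x cm(2) by (metis inj_onD)
 then show ?thesis using cm by simp
qed

lemma H_concrete: "concrete_category (Hcat p) gcar (%V. V) amap UNIV"
proof (intro concrete_category.intro[OF H_category] concrete_category_axioms.intro, goal_cases)
 case (4 f g) then show ?case by (cases f; cases g) simp
next
 case (7 f)
 then have f: "graded (src f)" "graded (tgt f)" "amap f : lin (gcar (src f)) (gcar (tgt f))"
   "!!al x. x : src f al ==> amap f x : tgt f al" by (auto simp: H_Arr)
 have b: "bij_betw (amap f) (gcar (src f)) (gcar (tgt f))" using 7 by simp
 have i: "inj_on (amap f) (gcar (src f))" "amap f ` gcar (src f) = gcar (tgt f)" using b by (auto simp: bij_betw_def)
 let ?h = "restrict (the_inv_into (gcar (src f)) (amap f)) (gcar (tgt f))"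
 have h: "?h : lin (gcar (tgt f)) (gcar (src f))" by (rule lin_inverse[OF subspace_gcar f(3) b])
 have fh: "amap f (?h y) = y" if "y : gcar (tgt f)" for y using that f_the_inv_into_f[OF i(1)] i(2) by simp
 have "Arrow (tgt f) ?h (src f) : cat_hom (Hcat p) (Cod (Hcat p) f) (Dom (Hcat p) f)"
  using f h graded_inverse[OF f b] by (auto simp: H_hom H_Arr gcar_mem[of _ "tgt f"])
 then show ?case using fh by (intro bexI[of _ "Arrow (tgt f) ?h (src f)"]) auto
qed (auto simp: H_Arr compose_def gcar_def)

lemma H_tensor: "concrete_tensor (Hcat p) gcar (%V. V) amap UNIV (%_ _. (<*>)) (+)"
proof (intro concrete_tensor.intro[OF H_concrete] concrete_tensor_axioms.intro, goal_cases)
 case (1 X Y) then show ?case using graded_gtens by simp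
next
 case (4 X Y a b x y) then show ?case using gtens_mem by simp
next
 case (5 X Y) then show ?case by (simp add: gcar_gtens tens_def)
next
 case (6 f g)
 then have f: "graded (src f)" "graded (tgt f)" "amap f : lin (gcar (src f)) (gcar (tgt f))" "!!al x. x : src f al ==> amap f x : tgt f al"
  and g: "graded (src g)" "graded (tgt g)" "amap g : lin (gcar (src g)) (gcar (tgt g))" "!!al x. x : src g al ==> amap g x : tgt g al"
  using H_ArrD by blast+
 have b: "bilin_on (gcar (src f)) (gcar (src g)) (%v w. amap f v <*> amap g w)"
  by (intro bilin_onI lin_intros lin_lin_on[OF f(3)] lin_lin_on[OF g(3)])
 note t = tmap_lin[OF subspace_gcar subspace_gcar b, folded gcar_gtens] tmap_tensor[OF subspace_gcar subspace_gcar b]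
 show ?case unfolding H_simps
 proof (rule H_ArrI[OF graded_gtens[OF f(1) g(1)] graded_gtens[OF f(2) g(2)] t(1)])
  show "gtens (src f) (src g) al = cvec.span {v <*> w |v w be ga. v : src f be & w : src g ga & be + ga = al}" for al
   by (simp add: gtens_def)
  fix al x assume "x : {v <*> w |v w be ga. v : src f be & w : src g ga & be + ga = al}"
  then obtain v w be ga where x: "x = v <*> w" "v : src f be" "w : src g ga" "al = be + ga" by auto
  show "tmap (gcar (src f)) (gcar (src g)) (%v w. amap f v <*> amap g w) x : gtens (tgt f) (tgt g) al"
   unfolding x(1,4) t(2)[OF gcar_mem[of _ "src f", OF x(2)] gcar_mem[of _ "src g", OF x(3)]]
   by (rule gtens_mem[of "amap f v" "tgt f" be "amap g w" "tgt g" ga, OF f(4)[OF x(2)] g(4)[OF x(3)]])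
 qed
next
 case (9 f g x y)
 then have f: "amap f : lin (gcar (src f)) (gcar (tgt f))"
  and g: "amap g : lin (gcar (src g)) (gcar (tgt g))" by (auto simp: H_Arr)
 have b: "bilin_on (gcar (src f)) (gcar (src g)) (%v w. amap f v <*> amap g w)"
  by (intro bilin_onI lin_intros lin_lin_on[OF f] lin_lin_on[OF g])
 show ?case using 9 by (simp add: tmap_tensor[OF subspace_gcar subspace_gcar b])
qed (auto intro: bilin_on_tensor)

global_interpretation H: concrete_tensor "Hcat p" gcar "%V. V" amap UNIV "%_ _. (<*>)" "(+)" for p
 by (rule H_tensor)

definition hexp :: "nat => complex => complex" where
 "hexp p z = exp (complex_of_real pi * \<i> / (2 * of_nat p) * z)"

lemma hexp_nz [simp]: "hexp p z ~= 0" by (simp add: hexp_def)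
lemma hexp_add: "hexp p (x + y) = hexp p x * hexp p y" by (simp add: hexp_def ring_distribs exp_add)

lemma H_Assoc:
 assumes "graded U" "graded V" "graded W"
 shows "Assoc (Hcat p) U V W : cat_hom (Hcat p) (gtens U (gtens V W)) (gtens (gtens U V) W)"
  and "!!u v w. [|u : gcar U; v : gcar V; w : gcar W|] ==> amap (Assoc (Hcat p) U V W) (u <*> (v <*> w)) = (u <*> v) <*> w"
proof -
 let ?f = "tmap3 (gcar U) (gcar V) (gcar W) (%u v w. (u <*> v) <*> w)"
 have b: "bilin_on (gcar V) (gcar W) (%v w. (u <*> v) <*> w)" for u by (intro bilin_onI lin_intros)
 have l: "lin_on (gcar U) (%u. (u <*> v) <*> w)" for v w by (intro lin_intros)
 note t = tmap3_lin[of "gcar U" "gcar V" "gcar W" "%u v w. (u <*> v) <*> w", OF subspace_gcar subspace_gcar subspace_gcar b l]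
  tmap3_tensor[of "gcar U" "gcar V" "gcar W" "%u v w. (u <*> v) <*> w", OF subspace_gcar subspace_gcar subspace_gcar b l]
 have A: "Assoc (Hcat p) U V W = Arrow (gtens U (gtens V W)) ?f (gtens (gtens U V) W)" by (simp add: Hcat_def)
 then show "!!u v w. [|u : gcar U; v : gcar V; w : gcar W|] ==> amap (Assoc (Hcat p) U V W) (u <*> (v <*> w)) = (u <*> v) <*> w"
  using t(2) by simp
 have "Arrow (gtens U (gtens V W)) ?f (gtens (gtens U V) W) : Arr (Hcat p)"
 proof (rule H_ArrI[OF graded_gtens[OF assms(1) graded_gtens[OF assms(2,3)]] graded_gtens[OF graded_gtens[OF assms(1,2)] assms(3)]])
  show "?f : lin (gcar (gtens U (gtens V W))) UNIV" using t(1) by (simp add: gcar_gtens)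
  show "gtens U (gtens V W) al = cvec.span {a <*> b |a b be ga. a : U be & b : {v <*> w |v w al be. v : V al & w : W be & al + be = ga} & be + ga = al}" for al
   by (rule gtens_spans) (auto simp: gtens_def span_graded[OF assms(1), symmetric])
  fix al x assume "x : {a <*> b |a b be ga. a : U be & b : {v <*> w |v w al be. v : V al & w : W be & al + be = ga} & be + ga = al}"
  then obtain u v w be ga de where x: "x = u <*> (v <*> w)" "al = (be + ga) + de" "u : U be" "v : V ga" "w : W de"
   by (auto simp: add.assoc)
  show "?f x : gtens (gtens U V) W al"
   unfolding x(1,2) t(2)[OF gcar_mem[of _ U, OF x(3)] gcar_mem[of _ V, OF x(4)] gcar_mem[of _ W, OF x(5)]]
   by (intro gtens_mem[of _ "gtens U V"] gtens_mem x)
 qed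
 then show "Assoc (Hcat p) U V W : cat_hom (Hcat p) (gtens U (gtens V W)) (gtens (gtens U V) W)" by (simp add: H_hom A)
qed

lemma H_Braid:
 assumes U: "graded U" and V: "graded V"
 shows "Braid (Hcat p) U V : cat_hom (Hcat p) (gtens U V) (gtens V U)"
  and "!!al be u v. [|u : U al; v : V be|] ==> amap (Braid (Hcat p) U V) (u <*> v) = hexp p (al * be) *\<^sub>C (v <*> u)"
proof -
 have "EX f. f : lin (tens (gcar U) (gcar V)) UNIV & (ALL al be. ALL u:U al. ALL v:V be. f (u <*> v) = hexp p (al * be) *\<^sub>C (v <*> u))"
  by (rule gtens_extend[OF U V, of "%al be u v. hexp p (al * be) *\<^sub>C (v <*> u)"]) (intro bilin_onI lin_intros)
 then obtain f where f: "f : lin (gcar (gtens U V)) UNIV"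
  "!!al be u v. u : U al ==> v : V be ==> f (u <*> v) = hexp p (al * be) *\<^sub>C (v <*> u)" unfolding gcar_gtens by blast
 have a: "Arrow (gtens U V) f (gtens V U) : Arr (Hcat p)"
 proof (rule H_ArrI[OF graded_gtens[OF U V] graded_gtens[OF V U] f(1)])
  show "gtens U V al = cvec.span {v <*> w |v w be ga. v : U be & w : V ga & be + ga = al}" for al
   by (simp add: gtens_def)
  fix al x assume "x : {v <*> w |v w be ga. v : U be & w : V ga & be + ga = al}"
  then obtain v w be ga where x: "x = v <*> w" "v : U be" "w : V ga" "al = ga + be" by (auto simp: add.commute)
  show "f x : gtens V U al"
   unfolding x(1,4) f(2)[OF x(2,3)] by (intro cvec.subspace_scale[OF subspace_gtens] gtens_mem x)
 qed
 then have fl: "f : lin (gcar (gtens U V)) (gcar (gtens V U))" by (simp add: H_Arr)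
 have "(THE f. f : lin (gcar (gtens U V)) (gcar (gtens V U)) &
          (ALL al be. ALL u:U al. ALL v:V be. f (u <*> v) = hexp p (al * be) *\<^sub>C (v <*> u))) = f"
 proof (rule the_equality)
  fix g assume g: "g : lin (gcar (gtens U V)) (gcar (gtens V U)) &
          (ALL al be. ALL u:U al. ALL v:V be. g (u <*> v) = hexp p (al * be) *\<^sub>C (v <*> u))"
  have sp: "gcar (gtens U V) = cvec.span {v <*> w |v w. v : (UN al. U al) & w : (UN al. V al)}"
   unfolding gcar_gtens by (rule tens_span) (simp_all add: gcar_def)
  show "g = f"
   by (rule lin_span_eqI[of g "{v <*> w |v w. v : (UN al. U al) & w : (UN al. V al)}" _ f, folded sp])
    (use g fl f(2) in auto)
 qed (use fl f(2) in auto)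
 then have B: "Braid (Hcat p) U V = Arrow (gtens U V) f (gtens V U)" by (simp add: Hcat_def hexp_def)
 show "Braid (Hcat p) U V : cat_hom (Hcat p) (gtens U V) (gtens V U)" using a by (simp add: H_hom B)
 show "!!al be u v. [|u : U al; v : V be|] ==> amap (Braid (Hcat p) U V) (u <*> v) = hexp p (al * be) *\<^sub>C (v <*> u)"
  using f(2) by (simp add: B)
qed

lemma H_Twist:
 assumes V: "graded V"
 shows "Twist (Hcat p) V : cat_hom (Hcat p) V V"
  and "!!al v. v : V al ==> amap (Twist (Hcat p) V) v = hexp p (al\<^sup>2) *\<^sub>C v"
proof -
 obtain f where f: "f : lin (gcar V) UNIV" "!!al v. v : V al ==> f v = hexp p (al\<^sup>2) *\<^sub>C v"
  using graded_extend[OF V lin_on_comp_scale[OF lin_on_id], of "%al. hexp p (al\<^sup>2)"] by blast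
 have a: "Arrow V f V : Arr (Hcat p)"
  by (rule H_ArrI[OF V V f(1) span_graded[OF V]]) (simp add: f(2) cvec.subspace_scale[OF graded_subspace[OF V]])
 then have fl: "f : lin (gcar V) (gcar V)" by (simp add: H_Arr)
 have "(THE f. f : lin (gcar V) (gcar V) & (ALL al. ALL v:V al. f v = hexp p (al\<^sup>2) *\<^sub>C v)) = f"
 proof (rule the_equality)
  fix g assume g: "g : lin (gcar V) (gcar V) & (ALL al. ALL v:V al. g v = hexp p (al\<^sup>2) *\<^sub>C v)"
  show "g = f" by (rule gcar_linE[of g V _ f]) (use g fl f(2) in auto)
 qed (use fl f(2) in auto)
 then have B: "Twist (Hcat p) V = Arrow V f V" by (simp add: Hcat_def hexp_def)
 show "Twist (Hcat p) V : cat_hom (Hcat p) V V" using a by (simp add: H_hom B)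
 show "!!al v. v : V al ==> amap (Twist (Hcat p) V) v = hexp p (al\<^sup>2) *\<^sub>C v"
  using f(2) by (simp add: B)
qed

lemma graded_gunit: "graded gunit"
proof (rule gradedI)
 have "gcar gunit = unit_space"
  using gcar_of_spans[of gunit "%al. if al = 0 then unit_space else {}"]
  by (auto simp: gunit_def cvec.span_eq_iff[THEN iffD2, OF subspace_unit_space])
 show "EX f. lin_on (gcar gunit) f & (ALL al. ALL x:gunit al. f x = (if al = ga then x else 0))" for ga
  by (rule exI[of _ "%x. if ga = 0 then x else 0"]) (auto simp: gunit_def lin_on_def)
qed (auto simp: gunit_def)

lemma gcar_gunit: "gcar gunit = unit_space"
 using gcar_of_spans[of gunit "%al. if al = 0 then unit_space else {}"]
 by (auto simp: gunit_def cvec.span_eq_iff[THEN iffD2, OF subspace_unit_space])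

lemma H_LUnit:
 assumes V: "graded V"
 shows "LUnit (Hcat p) V : cat_hom (Hcat p) (gtens gunit V) V"
  and "!!v. v : gcar V ==> amap (LUnit (Hcat p) V) (e0 <*> v) = v"
proof -
 let ?f = "THE f. f : lin (tens unit_space (gcar V)) (gcar V) & (ALL v:gcar V. f (e0 <*> v) = v)"
 note t = left_unit_map[OF subspace_gcar[of V]]
 have L: "LUnit (Hcat p) V = Arrow (gtens gunit V) ?f V" by (simp add: Hcat_def gcar_gtens gcar_gunit)
 show "!!v. v : gcar V ==> amap (LUnit (Hcat p) V) (e0 <*> v) = v" using t(2) by (simp add: L)
 have "Arrow (gtens gunit V) ?f V : Arr (Hcat p)"
 proof (rule H_ArrI[OF graded_gtens[OF graded_gunit V] V])
  show "?f : lin (gcar (gtens gunit V)) (gcar V)" using t(1) by (simp add: gcar_gtens gcar_gunit)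
  show "gtens gunit V al = cvec.span {a <*> b |a b be ga. a : (if be = 0 then {e0} else {}) & b : V ga & be + ga = al}" for al
   by (rule gtens_spans) (auto simp: gunit_def unit_space_def span_graded[OF V, symmetric])
  fix al x assume "x : {a <*> b |a b be ga. a : (if be = 0 then {e0} else {}) & b : V ga & be + ga = al}"
  then obtain v where "x = e0 <*> v" "v : V al" by (auto split: if_splits)
  then show "?f x : V al" using t(2)[OF gcar_mem[of _ V]] by auto
 qed
 then show "LUnit (Hcat p) V : cat_hom (Hcat p) (gtens gunit V) V" by (simp add: L H_hom)
qed

declare H_simps(2,3,6,7,8) [simp del] H.el_TensA' [simp del] H.el_TensA [simp]
declare graded_gtens [simp] graded_gunit [simp]

lemma gcar_tensor_mem [simp]: "u : gcar U ==> v : gcar V ==> u <*> v : gcar (gtens U V)"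
 by (simp add: gcar_gtens tens_mem)

lemma cat_homD: "f : cat_hom C X Y ==> f : Arr C" "f : cat_hom C X Y ==> Dom C f = X" "f : cat_hom C X Y ==> Cod C f = Y"
 by (auto simp: cat_hom_def)

lemma (in concrete_category) arr_eq_iff:
 assumes "gen X A" "f : Arr C" "g : Arr C" "Dom C f = X" "Dom C g = X" "Cod C f = Cod C g"
 shows "f = g \<longleftrightarrow> (ALL a:A. el f a = el g a)"
 using hom_eqI_gen[OF assms] by auto

section \<open>The algebra of Laurent monomials and its modules\<close>

abbreviation ldeg :: "nat => int => complex" where "ldeg p k \<equiv> of_int (2 * int p * k)"

lemma range_lam: "range lam = range basis_vec"
proof -
 have "basis_vec n = lam (int_decode n)" for n by (simp add: lam_def)
 then have "basis_vec n : range lam" for n by (metis rangeI)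
 then show ?thesis by (auto simp: lam_def)
qed

lemma span_lam: "cvec.span (range lam) = UNIV"
 by (simp add: range_lam span_basis_vec)

lemma gcar_Lam: "gcar (Lam p) = UNIV"
proof -
 have "gcar (Lam p) = cvec.span (UN al. {lam k |k. al = ldeg p k})"
  by (rule gcar_of_spans) (simp add: Lam_def)
 also have "(UN al. {lam k |k. al = ldeg p k}) = range lam" by blast
 finally show ?thesis by (simp add: span_lam)
qed

lemma lam_Lam: "lam k : Lam p (ldeg p k)"
 unfolding Lam_def by (rule cvec.span_base) blast

lemma lam_extend1: "EX f. lin_on UNIV f & (ALL k. f (lam k) = g k)"
 using basis_vec_extend[of "%n. g (int_decode n)"] by (auto simp: lam_def)

lemma graded_Lam: "graded (Lam p)"
proof (rule gradedI)
 fix ga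
 obtain f where f: "lin_on UNIV f" "!!k. f (lam k) = (if ldeg p k = ga then lam k else 0)"
  using lam_extend1[of "%k. if ldeg p k = ga then lam k else 0"] by auto
 have "f x = (if al = ga then x else 0)" if x: "x : Lam p al" for al x
  by (rule lin_on_span_eq[OF lin_on_subset[OF f(1)] _ _ x[unfolded Lam_def], of "%x. if al = ga then x else 0"])
   (cases "al = ga"; auto simp: f(2) lin_intros)+
 then show "EX f. lin_on (gcar (Lam p)) f & (ALL al. ALL x:Lam p al. f x = (if al = ga then x else 0))"
  using f(1) by (auto simp: gcar_Lam)
qed (simp add: Lam_def)

lemma tens_lam_span:
 assumes "cvec.span A = V"
 shows "tens UNIV V = cvec.span {lam k <*> v | k v. v : A}"
proof -
 have "{a <*> b |a b. a : range lam & b : A} = {lam k <*> v | k v. v : A}" by blast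
 then show ?thesis using tens_span[OF span_lam assms] by simp
qed

lemma lam_extend:
 assumes V: "cvec.subspace V" and a: "!!k. lin_on V (a k)"
 shows "EX f. f : lin (tens UNIV V) UNIV & (ALL k. ALL v:V. f (lam k <*> v) = a k v)"
proof -
 define g where "g v = (SOME f. lin_on UNIV f & (ALL k. f (lam k) = a k v))" for v
 have "lin_on UNIV (g v) & (ALL k. g v (lam k) = a k v)" for v
  unfolding g_def by (rule someI_ex[OF lam_extend1])
 then have g: "lin_on UNIV (g v)" "g v (lam k) = a k v" for v k by simp_all
 have "bilin_on V (cvec.span (range lam)) g"
  by (rule bilin_on_of_generators[OF _ _ V]) (use g a in "auto simp: span_lam")
 then have "bilin_on V UNIV g" by (simp add: span_lam)
 from tmap_ex[OF cvec.subspace_UNIV V bilin_on_flip[OF this]] g(2) show ?thesis by auto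
qed

lemma shift_ex: "EX f. lin_on UNIV f & (ALL l. f (lam l) = lam (k + l))"
 using lam_extend1[of "%l. lam (k + l)"] .

lemma gtens_Lam_span:
 assumes "!!al. V al = cvec.span (G al)"
 shows "gtens (Lam p) V ga = cvec.span {lam k <*> v | k v be. v : G be & ldeg p k + be = ga}"
proof -
 have "{a <*> b | a b al be. a : {lam k |k. al = ldeg p k} & b : G be & al + be = ga} = {lam k <*> v | k v be. v : G be & ldeg p k + be = ga}"
  by blast
 then show ?thesis using gtens_spans[of "Lam p" "%al. {lam k |k. al = ldeg p k}" V G ga] assms by (simp add: Lam_def)
qed

lemma gcar_gtens_Lam: "gcar (gtens (Lam p) V) = tens UNIV (gcar V)"
 by (simp add: gcar_gtens gcar_Lam)

lemma H_gen: "graded V ==> gcar V = cvec.span A ==> H.gen p V A"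
 by (simp add: H.gen_def)

lemma H_gen_lam: "H.gen p V A ==> H.gen p (gtens (Lam p) V) {lam k <*> v | k v. v : A}"
 using tens_lam_span[of A "gcar V"] by (simp add: H.gen_def gcar_gtens_Lam graded_gtens graded_Lam)

lemma lam_arrow_ex:
 assumes V: "graded V" and W: "graded W" and a: "!!k. lin_on (gcar V) (a k)"
  and d: "!!k al x. x : V al ==> a k x : W (al + ldeg p k)"
 shows "EX f. Arrow (gtens (Lam p) V) f W : Arr (Hcat p) & (ALL k. ALL v:gcar V. f (lam k <*> v) = a k v)"
proof -
 obtain f where f: "f : lin (gcar (gtens (Lam p) V)) UNIV" "!!k v. v : gcar V ==> f (lam k <*> v) = a k v"
  using lam_extend[of "gcar V" a, OF subspace_gcar a] unfolding gcar_gtens_Lam by blast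
 have "Arrow (gtens (Lam p) V) f W : Arr (Hcat p)"
 proof (rule H_ArrI[OF graded_gtens[OF graded_Lam V] W f(1) gtens_Lam_span[OF span_graded[OF V]]])
  fix al x assume "x : {lam k <*> v |k v be. v : V be & ldeg p k + be = al}"
  then obtain k v be where x: "x = lam k <*> v" "v : V be" "al = be + ldeg p k" by (auto simp: add.commute)
  then show "f x : W al" using f(2)[OF gcar_mem[of v V, OF x(2)]] d[OF x(2)] by simp
 qed
 with f(2) show ?thesis by blast
qed

lemma LamAlg_Obj [simp]: "algO (LamAlg p) = Lam p" by (simp add: LamAlg_def)

lemma LamAlg_Mul:
 shows "algMul (LamAlg p) : cat_hom (Hcat p) (gtens (Lam p) (Lam p)) (Lam p)"
  and "amap (algMul (LamAlg p)) (lam k <*> lam l) = lam (k + l)"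
proof -
 define a where "a k = (SOME f. lin_on UNIV f & (ALL l. f (lam l) = lam (k + l)))" for k
 have "lin_on UNIV (a k) & (ALL l. a k (lam l) = lam (k + l))" for k
  unfolding a_def by (rule someI_ex[OF shift_ex])
 then have a: "lin_on UNIV (a k)" "a k (lam l) = lam (k + l)" for k l by simp_all
 have m: "a k x : Lam p (al + ldeg p k)" if x: "x : Lam p al" for k al x
 proof (rule lin_on_span_mem[OF lin_on_subset[OF a(1)] graded_subspace[OF graded_Lam] _ x[unfolded Lam_def]])
  fix b assume "b : {lam k |k. al = ldeg p k}"
  then obtain l where "b = lam l" "al = ldeg p l" by auto
  then show "a k b : Lam p (al + ldeg p k)" using lam_Lam[of "k + l" p] by (simp add: a(2) ring_distribs add.commute)
 qed simp
 have al: "lin_on (gcar (Lam p)) (a k)" for k using a(1) by (simp add: gcar_Lam)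
 obtain f where f: "Arrow (gtens (Lam p) (Lam p)) f (Lam p) : Arr (Hcat p)" "!!k v. f (lam k <*> v) = a k v"
  using lam_arrow_ex[OF graded_Lam graded_Lam al m] unfolding gcar_Lam by blast
 have fl: "f : lin (gcar (gtens (Lam p) (Lam p))) (gcar (Lam p))" using f(1) by (simp add: H_Arr)
 have sp: "gcar (gtens (Lam p) (Lam p)) = cvec.span {lam k <*> lam l | k l. True}"
 proof -
  have "{lam k <*> v |k v. v : range lam} = {lam k <*> lam l | k l. True}" by auto
  then show ?thesis using tens_lam_span[OF span_lam] unfolding gcar_gtens_Lam gcar_Lam by simp
 qed
 have "(THE f. f : lin (gcar (gtens (Lam p) (Lam p))) (gcar (Lam p)) &
        (ALL k l. f (lam k <*> lam l) = lam (k + l))) = f"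
 proof (rule the_equality)
  fix g assume g: "g : lin (gcar (gtens (Lam p) (Lam p))) (gcar (Lam p)) & (ALL k l. g (lam k <*> lam l) = lam (k + l))"
  show "g = f"
   by (rule lin_span_eqI[of g "{lam k <*> lam l | k l. True}" _ f, folded sp]) (use g fl f(2) a(2) in auto)
 qed (use fl f(2) a(2) in auto)
 then have M: "algMul (LamAlg p) = Arrow (gtens (Lam p) (Lam p)) f (Lam p)" by (simp add: LamAlg_def)
 show "algMul (LamAlg p) : cat_hom (Hcat p) (gtens (Lam p) (Lam p)) (Lam p)" using f(1) by (simp add: M H_hom)
 show "amap (algMul (LamAlg p)) (lam k <*> lam l) = lam (k + l)" using f(2) a(2) by (simp add: M)
qed

lemma LamAlg_Unit:
 shows "algUnit (LamAlg p) : cat_hom (Hcat p) gunit (Lam p)"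
  and "amap (algUnit (LamAlg p)) (e0) = lam 0"
proof -
 let ?f = "restrict (%x. Poly_Mapping.lookup x 0 *\<^sub>C lam 0) unit_space"
 have f: "?f : lin (gcar gunit) (gcar (Lam p))" "?f (e0) = lam 0"
  unfolding gcar_gunit gcar_Lam by (auto intro!: restrict_lin lin_intros simp: lookup_basis_vec unit_space_def cvec.span_base)
 have sp: "gcar gunit = cvec.span {e0}" by (simp add: gcar_gunit unit_space_def)
 have "(THE f. f : lin (gcar gunit) (gcar (Lam p)) & f (e0) = lam 0) = ?f"
 proof (rule the_equality)
  fix g assume g: "g : lin (gcar gunit) (gcar (Lam p)) & g (e0) = lam 0"
  show "g = ?f"
   by (rule lin_span_eqI[of g "{e0}" _ ?f, folded sp]) (use g f in auto)
 qed (use f in auto)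
 then have M: "algUnit (LamAlg p) = Arrow gunit ?f (Lam p)" by (simp add: LamAlg_def)
 have "Arrow gunit ?f (Lam p) : Arr (Hcat p)"
 proof (rule H_ArrI[OF graded_gunit graded_Lam f(1)])
  show "gunit al = cvec.span (if al = 0 then {e0} else {})" for al by (simp add: gunit_def unit_space_def)
  show "x : (if al = 0 then {e0} else {}) ==> ?f x : Lam p al" for al x
   using f(2) lam_Lam[of 0 p] by (auto split: if_splits)
 qed
 then show "algUnit (LamAlg p) : cat_hom (Hcat p) gunit (Lam p)" by (simp add: M H_hom)
 show "amap (algUnit (LamAlg p)) (e0) = lam 0" using f(2) by (simp add: M)
qed

text \<open>The operator by which \<open>1\<^sub>k\<close> acts; a module structure is determined by these operators.\<close>

definition lact :: "lmod => int => cvec => cvec" where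
 "lact M k x = amap (snd M) (lam k <*> x)"

definition lambda_module :: "nat => gspace => (int => cvec => cvec) => bool" where
 "lambda_module p V a \<longleftrightarrow> graded V & (ALL k. lin_on (gcar V) (a k)) & (ALL k al. ALL x:V al. a k x : V (al + ldeg p k)) &
   (ALL k l. ALL x:gcar V. a k (a l x) = a (k + l) x) & (ALL x:gcar V. a 0 x = x)"

definition integral :: "gspace => bool" where
 "integral V \<longleftrightarrow> (ALL al. ALL x:V al. x ~= 0 \<longrightarrow> al : \<int>)"

definition lam_generated :: "gspace => (int => cvec => cvec) => bool" where
 "lam_generated V a \<longleftrightarrow> (EX Z. finite Z & Z <= (UN al. V al) & gcar V = cvec.span {a k z | k z. z : Z})"

declare graded_Lam [simp] gcar_Lam [simp] subspace_gcar [simp]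

lemma snd_hom_facts:
 assumes "r : cat_hom (Hcat p) (gtens (Lam p) V) V"
 shows "graded V" "r : Arr (Hcat p)" "Dom (Hcat p) r = gtens (Lam p) V" "Cod (Hcat p) r = V"
  "!!k. lin_on (gcar V) (%x. amap r (lam k <*> x))" "!!k x. x : gcar V ==> amap r (lam k <*> x) : gcar V"
  "!!k al x. x : V al ==> amap r (lam k <*> x) : V (al + ldeg p k)"
proof -
 have r0: "r : Arr (Hcat p)" "src r = gtens (Lam p) V" "tgt r = V" using assms by (auto simp: H_hom)
 show "r : Arr (Hcat p)" "Dom (Hcat p) r = gtens (Lam p) V" "Cod (Hcat p) r = V" by (rule cat_homD[OF assms])+
 note D = H_ArrD[OF r0(1), unfolded r0(2,3)]
 show "graded V" using D by simp
 show "!!k. lin_on (gcar V) (%x. amap r (lam k <*> x))"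
  by (rule lin_on_compose[OF lin_lin_on[OF D(3)]]) (auto intro: lin_intros)
 show "!!k x. x : gcar V ==> amap r (lam k <*> x) : gcar V"
  using lin_mem[OF D(3)] by simp
 fix k al x assume "x : V al"
 then have "lam k <*> x : gtens (Lam p) V (al + ldeg p k)"
  using gtens_mem[of "lam k" "Lam p" "ldeg p k" x V al] lam_Lam[of k p] by (simp add: add.commute)
 then show "amap r (lam k <*> x) : V (al + ldeg p k)" by (rule D(4))
qed

lemma LamAlg_Arr [simp]:
 "algMul (LamAlg p) : Arr (Hcat p)" "Dom (Hcat p) (algMul (LamAlg p)) = gtens (Lam p) (Lam p)" "Cod (Hcat p) (algMul (LamAlg p)) = Lam p"
 "algUnit (LamAlg p) : Arr (Hcat p)" "Dom (Hcat p) (algUnit (LamAlg p)) = gunit" "Cod (Hcat p) (algUnit (LamAlg p)) = Lam p"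
 using cat_homD[OF LamAlg_Mul(1)[of p]] cat_homD[OF LamAlg_Unit(1)[of p]] by simp_all

lemmas LamAlg_el [simp] = LamAlg_Mul(2) LamAlg_Unit(2)

lemma H_Assoc_Arr [simp]:
 assumes "graded U" "graded V" "graded W"
 shows "Assoc (Hcat p) U V W : Arr (Hcat p)" "Dom (Hcat p) (Assoc (Hcat p) U V W) = gtens U (gtens V W)"
  "Cod (Hcat p) (Assoc (Hcat p) U V W) = gtens (gtens U V) W"
 using cat_homD[OF H_Assoc(1)[OF assms, of p]] by simp_all

lemma H_Braid_Arr [simp]:
 assumes "graded U" "graded V"
 shows "Braid (Hcat p) U V : Arr (Hcat p)" "Dom (Hcat p) (Braid (Hcat p) U V) = gtens U V" "Cod (Hcat p) (Braid (Hcat p) U V) = gtens V U"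
 using cat_homD[OF H_Braid(1)[OF assms, of p]] by simp_all

lemma H_unary_Arr [simp]:
 assumes "graded V"
 shows "LUnit (Hcat p) V : Arr (Hcat p)" "Dom (Hcat p) (LUnit (Hcat p) V) = gtens gunit V" "Cod (Hcat p) (LUnit (Hcat p) V) = V"
  "Twist (Hcat p) V : Arr (Hcat p)" "Dom (Hcat p) (Twist (Hcat p) V) = V" "Cod (Hcat p) (Twist (Hcat p) V) = V"
 using cat_homD[OF H_LUnit(1)[OF assms, of p]] cat_homD[OF H_Twist(1)[OF assms, of p]] by simp_all

declare H_Assoc(2) [simp] H_LUnit(2) [simp]

lemma is_module_iff:
 "is_module (Hcat p) (LamAlg p) M \<longleftrightarrow>
   snd M : cat_hom (Hcat p) (gtens (Lam p) (fst M)) (fst M) & lambda_module p (fst M) (lact M)"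
proof (cases "snd M : cat_hom (Hcat p) (gtens (Lam p) (fst M)) (fst M)")
 case False then show ?thesis by (simp add: is_module_def)
next
 case True
 obtain V r where M: "M = (V, r)" by fastforce
 have r: "r : cat_hom (Hcat p) (gtens (Lam p) V) V" using True M by simp
 note f = snd_hom_facts[OF r]
 note [simp] = f(1,2,3,4,6)
 have g: "H.gen p V (gcar V)" by (rule H_gen) (simp_all add: cvec.span_eq_iff[THEN iffD2])
 have A: "Comp (Hcat p) r (TensA (Hcat p) (Id (Hcat p) (Lam p)) r)
    = Comp (Hcat p) r (Comp (Hcat p) (TensA (Hcat p) (algMul (LamAlg p)) (Id (Hcat p) V)) (Assoc (Hcat p) (Lam p) (Lam p) V)) \<longleftrightarrow>
   (ALL k l. ALL x:gcar V. amap r (lam k <*> amap r (lam l <*> x)) = amap r (lam (k + l) <*> x))"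
  by (subst H.arr_eq_iff[OF H_gen_lam[OF H_gen_lam[OF g]]]; force)
 have g1: "H.gen p (gtens gunit V) {e0 <*> v | v. v : gcar V}"
  by (simp add: H.gen_def gcar_gtens gcar_gunit tens_unit_left)
 have b0: "e0 : gcar gunit" by (simp add: gcar_gunit unit_space_def cvec.span_base)
 have B: "Comp (Hcat p) r (TensA (Hcat p) (algUnit (LamAlg p)) (Id (Hcat p) V)) = LUnit (Hcat p) V \<longleftrightarrow>
   (ALL x:gcar V. amap r (lam 0 <*> x) = x)"
 proof -
  have "Comp (Hcat p) r (TensA (Hcat p) (algUnit (LamAlg p)) (Id (Hcat p) V)) = LUnit (Hcat p) V \<longleftrightarrow>
    (ALL a:{e0 <*> v | v. v : gcar V}. amap (Comp (Hcat p) r (TensA (Hcat p) (algUnit (LamAlg p)) (Id (Hcat p) V))) a = amap (LUnit (Hcat p) V) a)"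
   by (rule H.arr_eq_iff[OF g1]) auto
  also have "... \<longleftrightarrow> (ALL x:gcar V. amap (Comp (Hcat p) r (TensA (Hcat p) (algUnit (LamAlg p)) (Id (Hcat p) V))) (e0 <*> x) = amap (LUnit (Hcat p) V) (e0 <*> x))"
   by blast
  also have "... \<longleftrightarrow> (ALL x:gcar V. amap r (lam 0 <*> x) = x)"
   by (intro ball_cong refl) (simp add: b0)
  finally show ?thesis .
 qed
 have "lact (V, r) = (%k x. amap r (lam k <*> x))" by (intro ext) (simp add: lact_def)
 then show ?thesis
  using r f(5,7) by (auto simp: M is_module_def lambda_module_def A B)
qed

lemma hexp_int:
 assumes "p > 0"
 shows "hexp p (ldeg p k * al) = exp (complex_of_real pi * \<i> * of_int k * al)"
 unfolding hexp_def by (rule arg_cong[of _ _ exp]) (use assms in "simp add: field_simps")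

lemma exp_2pi_eq_1: "exp (2 * complex_of_real pi * \<i> * al) = 1 \<longleftrightarrow> al : \<int>"
proof -
 have "exp (2 * complex_of_real pi * \<i> * al) = exp 0 \<longleftrightarrow> (EX n::int. 2 * complex_of_real pi * \<i> * al = 0 + (of_int (2 * n) * pi) * \<i>)"
  by (rule exp_eq)
 also have "... \<longleftrightarrow> (EX n::int. al = of_int n)" by (intro iff_exI) (auto simp: field_simps)
 also have "... \<longleftrightarrow> al : \<int>" by (auto simp: Ints_def)
 finally show ?thesis by simp
qed

text \<open>
  The double braiding of \<open>1\<^sub>k\<close> with a vector of degree \<open>\<alpha>\<close> is
  multiplication by \<open>exp (2\<pi>ik\<alpha>)\<close>. Since \<open>1\<^sub>1\<close> acts invertibly,
  locality forces \<open>\<alpha>\<close> to be an integer.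
\<close>

lemma is_local_iff:
 assumes p: "p > 0" and M: "is_module (Hcat p) (LamAlg p) M"
 shows "is_local (Hcat p) (LamAlg p) M \<longleftrightarrow> integral (fst M)"
proof -
 obtain V r where Vr: "M = (V, r)" by fastforce
 have r: "r : cat_hom (Hcat p) (gtens (Lam p) V) V" and L: "lambda_module p V (lact M)"
  using M by (auto simp: is_module_iff Vr)
 note f = snd_hom_facts[OF r]
 note [simp] = f(1,2,3,4,6)
 have g: "H.gen p V (UN al. V al)" by (rule H_gen) (simp_all add: gcar_def)
 let ?L = "Comp (Hcat p) r (Comp (Hcat p) (Braid (Hcat p) V (Lam p)) (Braid (Hcat p) (Lam p) V))"
 have el: "amap ?L (lam k <*> x) = exp (2 * complex_of_real pi * \<i> * (of_int k * al)) *\<^sub>C lact M k x" if x: "x : V al" for k x al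
 proof -
  have xc: "x : gcar V" using gcar_mem x by blast
  have h: "hexp p (ldeg p k * al) * hexp p (al * ldeg p k) = exp (2 * complex_of_real pi * \<i> * (of_int k * al))"
   unfolding mult.commute[of al] hexp_int[OF p] exp_add[symmetric] by (rule arg_cong[of _ _ exp]) (simp add: algebra_simps)
  have "amap ?L (lam k <*> x) = amap r (amap (Braid (Hcat p) V (Lam p)) (amap (Braid (Hcat p) (Lam p) V) (lam k <*> x)))"
   using xc by simp
  also have "amap (Braid (Hcat p) (Lam p) V) (lam k <*> x) = hexp p (ldeg p k * al) *\<^sub>C (x <*> lam k)"
   by (rule H_Braid(2)[OF graded_Lam f(1) lam_Lam x])
  also have "amap (Braid (Hcat p) V (Lam p)) (hexp p (ldeg p k * al) *\<^sub>C (x <*> lam k))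
   = hexp p (ldeg p k * al) *\<^sub>C hexp p (al * ldeg p k) *\<^sub>C (lam k <*> x)"
   using xc by (subst H.el_scale[where p = p]) (simp_all add: H_Braid(2)[OF f(1) graded_Lam x lam_Lam])
  also have "amap r ... = exp (2 * complex_of_real pi * \<i> * (of_int k * al)) *\<^sub>C lact M k x"
   unfolding cvec.scale_scale h using xc by (subst H.el_scale[where p = p]) (simp_all add: lact_def Vr)
  finally show ?thesis .
 qed
 have "is_local (Hcat p) (LamAlg p) M \<longleftrightarrow> (ALL k al. ALL x:V al. amap ?L (lam k <*> x) = amap r (lam k <*> x))"
  unfolding is_local_def Vr by (simp, subst H.arr_eq_iff[OF H_gen_lam[OF g]]) auto
 also have "... \<longleftrightarrow> (ALL k al. ALL x:V al. exp (2 * complex_of_real pi * \<i> * (of_int k * al)) *\<^sub>C lact M k x = lact M k x)"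
  using el by (simp add: lact_def Vr)
 also have "... \<longleftrightarrow> integral V"
 proof
  assume l: "ALL k al. ALL x:V al. exp (2 * complex_of_real pi * \<i> * (of_int k * al)) *\<^sub>C lact M k x = lact M k x"
  show "integral V" unfolding integral_def
  proof (intro allI ballI impI)
   fix al x assume x: "x : V al" "x ~= 0"
   have xc: "x : gcar V" using gcar_mem x by blast
   have "lact M (-1) (lact M 1 x) = x" "lact M (-1) 0 = 0"
    using L xc lin_on_zero[of "gcar V" "lact M (-1)"] cvec.subspace_0[OF subspace_gcar] by (auto simp: lambda_module_def)
   then have "lact M 1 x ~= 0" using x by auto
   moreover have "exp (2 * complex_of_real pi * \<i> * al) *\<^sub>C lact M 1 x = lact M 1 x" using l x(1) by (auto dest: spec[of _ 1])
   ultimately have "exp (2 * complex_of_real pi * \<i> * al) = 1"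
    by (metis cvec.scale_one cvec.scale_cancel_right)
   then show "al : \<int>" by (simp add: exp_2pi_eq_1)
  qed
 next
  assume i: "integral V"
  show "ALL k al. ALL x:V al. exp (2 * complex_of_real pi * \<i> * (of_int k * al)) *\<^sub>C lact M k x = lact M k x"
  proof (intro allI ballI)
   fix k al x assume x: "x : V al"
   show "exp (2 * complex_of_real pi * \<i> * (of_int k * al)) *\<^sub>C lact M k x = lact M k x"
   proof (cases "x = 0")
    case True
    then have "lact M k x = 0" using L lin_on_zero[of "gcar V" "lact M k"] cvec.subspace_0[OF subspace_gcar] by (auto simp: lambda_module_def)
    then show ?thesis by simp
   next
    case False
    then have "of_int k * al : \<int>" using i x by (auto simp: integral_def)
    then have "exp (2 * complex_of_real pi * \<i> * (of_int k * al)) = 1" by (simp only: exp_2pi_eq_1)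
    then show ?thesis by simp
   qed
  qed
 qed
 finally show ?thesis by (simp add: Vr)
qed

lemma setcompr_cong2: "(!!k v. v : B ==> F k v = G k v) ==> {F k v | k v. v : B} = {G k v | k v. v : B}"
 by (intro Collect_cong ex_cong1) auto

lemma image_setcompr2: "f ` {F k v | k v. v : B} = {f (F k v) | k v. v : B}"
 "{F k v | k v. v : g ` B} = {F k (g v) | k v. v : B}"
 by blast+

lemma lin_image_span:
 assumes f: "lin_on (cvec.span G) f"
 shows "f ` cvec.span G = cvec.span (f ` G)"
proof
 show "f ` cvec.span G <= cvec.span (f ` G)"
  by (rule image_subsetI, rule lin_on_span_mem[OF f cvec.subspace_span], rule cvec.span_base, erule imageI)
 show "cvec.span (f ` G) <= f ` cvec.span G"
  by (intro cvec.span_minimal subspace_lin_image[OF cvec.subspace_span f]) (auto intro: cvec.span_base)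
qed

text \<open>
  A finite-dimensional span of a set is spanned by finitely many of its elements; this allows generators to be
  chosen homogeneous.
\<close>

lemma finite_generators_within:
 assumes "fin_dim (cvec.span A)"
 shows "EX B. finite B & B <= A & cvec.span B = cvec.span A"
proof -
 obtain B where B: "B <= A" "cvec.independent B" "A <= cvec.span B"
  using cvec.maximal_independent_subset by blast
 obtain T where T: "finite T" "cvec.span T = cvec.span A" using assms by (auto simp: fin_dim_def)
 have "B <= cvec.span T" using B(1) T(2) cvec.span_superset by blast
 then have "finite B" using cvec.independent_span_bound[OF T(1) B(2)] by blast
 moreover have "cvec.span B = cvec.span A"
  using B(1,3) by (intro antisym cvec.span_minimal cvec.span_mono) auto
 ultimately show ?thesis using B(1) by blast
qed

lemma lambda_moduleD:
 assumes "lambda_module p V a"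
 shows "graded V" "!!k. lin_on (gcar V) (a k)" "!!k al x. x : V al ==> a k x : V (al + ldeg p k)"
   "!!k l x. x : gcar V ==> a k (a l x) = a (k + l) x" "!!x. x : gcar V ==> a 0 x = x"
 using assms by (auto simp: lambda_module_def)

lemma gcar_span: "gcar V = cvec.span (UN al. V al)" by (simp add: gcar_def)

lemma gcar_lin_mem:
 assumes "lin_on (gcar V) f" "!!al x. x : V al ==> f x : gcar W" "x : gcar V"
 shows "f x : gcar W"
 using lin_on_span_mem[OF assms(1)[unfolded gcar_span] subspace_gcar _ assms(3)[unfolded gcar_span]] assms(2) by auto

lemma lambda_module_mem: "lambda_module p V a ==> x : gcar V ==> a k x : gcar V"
 using gcar_lin_mem[of V "a k" V x] lambda_moduleD(2,3)[of p V a] gcar_mem by meson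

lemma free_module_hom:
 assumes X: "graded X"
 shows "fst (free_module (Hcat p) (LamAlg p) X) = gtens (Lam p) X"
  "snd (free_module (Hcat p) (LamAlg p) X) : cat_hom (Hcat p) (gtens (Lam p) (gtens (Lam p) X)) (gtens (Lam p) X)"
  "x : gcar X ==> lact (free_module (Hcat p) (LamAlg p) X) k (lam l <*> x) = lam (k + l) <*> x"
 using X by (auto simp: free_module_def cat_hom_def lact_def)

lemma module_homs_iff:
 assumes M: "snd M : cat_hom (Hcat p) (gtens (Lam p) (fst M)) (fst M)" and N: "snd N : cat_hom (Hcat p) (gtens (Lam p) (fst N)) (fst N)"
  and g: "H.gen p (fst M) A"
 shows "f : module_homs (Hcat p) (LamAlg p) M N \<longleftrightarrow>
  f : cat_hom (Hcat p) (fst M) (fst N) & (ALL k. ALL x:A. amap f (lact M k x) = lact N k (amap f x))"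
proof (cases "f : cat_hom (Hcat p) (fst M) (fst N)")
 case False then show ?thesis by (simp add: module_homs_def)
next
 case True
 note [simp] = cat_homD[OF True] snd_hom_facts(1,2,3,4,6)[OF M] snd_hom_facts(1,2,3,4,6)[OF N]
 have A: "x : A ==> x : gcar (fst M)" for x using H.gen_mem[OF g] .
 have fA: "x : A ==> amap f x : gcar (fst N)" for x using H.el_car[where p = p and f = f and x = x] A by simp
 have "Comp (Hcat p) f (snd M) = Comp (Hcat p) (snd N) (TensA (Hcat p) (Id (Hcat p) (Lam p)) f) \<longleftrightarrow>
   (ALL a:{lam k <*> v | k v. v : A}. amap (Comp (Hcat p) f (snd M)) a = amap (Comp (Hcat p) (snd N) (TensA (Hcat p) (Id (Hcat p) (Lam p)) f)) a)"
  by (rule H.arr_eq_iff[OF H_gen_lam[OF g]]) auto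
 also have "... \<longleftrightarrow> (ALL k. ALL x:A. amap (Comp (Hcat p) f (snd M)) (lam k <*> x) = amap (Comp (Hcat p) (snd N) (TensA (Hcat p) (Id (Hcat p) (Lam p)) f)) (lam k <*> x))"
  by blast
 also have "... \<longleftrightarrow> (ALL k. ALL x:A. amap f (lact M k x) = lact N k (amap f x))"
  by (intro all_cong1 ball_cong refl) (simp add: lact_def A fA)
 finally show ?thesis using True by (simp add: module_homs_def)
qed

lemma fin_gen_imp_generated:
 assumes M: "is_module (Hcat p) (LamAlg p) M" and fg: "fin_gen p M"
 shows "lam_generated (fst M) (lact M)"
proof -
 have r: "snd M : cat_hom (Hcat p) (gtens (Lam p) (fst M)) (fst M)" using M by (simp add: is_module_iff)
 obtain X f where X: "graded X" "fin_dim (gcar X)"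
  and f: "f : module_homs (Hcat p) (LamAlg p) (free_module (Hcat p) (LamAlg p) X) M"
  and sf: "amap f ` gcar (gtens (Lam p) X) = gcar (fst M)"
  using fg by (auto simp: fin_gen_def)
 note F = free_module_hom[OF X(1), where p = p]
 have g: "H.gen p (fst (free_module (Hcat p) (LamAlg p) X)) (gcar (gtens (Lam p) X))"
  unfolding F by (rule H_gen) (simp_all add: X cvec.span_eq_iff[THEN iffD2])
 have fh: "f : cat_hom (Hcat p) (gtens (Lam p) X) (fst M)"
  "!!k x. x : gcar (gtens (Lam p) X) ==> amap f (lact (free_module (Hcat p) (LamAlg p) X) k x) = lact M k (amap f x)"
  using f module_homs_iff[OF F(2)[folded F(1)] r g] by (auto simp: F(1))
 obtain B where B: "finite B" "B <= (UN al. X al)" "cvec.span B = gcar X"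
  using finite_generators_within[of "UN al. X al"] X(2) unfolding gcar_span by blast
 have Bc: "b : B ==> b : gcar X" for b using B(3) cvec.span_base by blast
 let ?Z = "(%x. amap f (lam 0 <*> x)) ` B"
 have sp: "gcar (gtens (Lam p) X) = cvec.span {lam k <*> v | k v. v : B}"
  using tens_lam_span[OF B(3)] by (simp add: gcar_gtens_Lam)
 have fl: "amap f : lin (gcar (gtens (Lam p) X)) (gcar (fst M))" using H.el_lin[OF cat_homD(1)[OF fh(1)]] cat_homD[OF fh(1)] by simp
 have e: "amap f (lam k <*> b) = lact M k (amap f (lam 0 <*> b))" if "b : B" for k b
  using fh(2)[of "lam 0 <*> b" k] F(3)[OF Bc[OF that], of k 0] Bc[OF that] by simp
 have "gcar (fst M) = cvec.span (amap f ` {lam k <*> v | k v. v : B})"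
  unfolding sf[symmetric] sp by (rule lin_image_span) (use lin_lin_on[OF fl] sp in simp)
 also have "amap f ` {lam k <*> v | k v. v : B} = {lact M k z | k z. z : ?Z}"
  unfolding image_setcompr2 by (rule setcompr_cong2) (rule e)
 finally have "gcar (fst M) = cvec.span {lact M k z | k z. z : ?Z}" .
 moreover have "?Z <= (UN al. fst M al)"
 proof
  fix z assume "z : ?Z"
  then obtain b where b: "b : B" "z = amap f (lam 0 <*> b)" by auto
  then obtain al where "b : X al" using B(2) by auto
  then have "lam 0 <*> b : gtens (Lam p) X (ldeg p 0 + al)" by (intro gtens_mem lam_Lam)
  then have "z : fst M (ldeg p 0 + al)"
   using H_ArrD(4)[OF cat_homD(1)[OF fh(1)]] fh(1) b by (auto simp: H_hom)
  then show "z : (UN al. fst M al)" by blast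
 qed
 ultimately show ?thesis using B(1) unfolding lam_generated_def by (intro exI[of _ ?Z]) auto
qed

text \<open>
  The span of finitely many homogeneous generators is a graded subspace \<open>X\<close>, and the action
  induces a surjection from the free module on \<open>X\<close>.
\<close>

lemma generated_imp_fin_gen:
 assumes M: "is_module (Hcat p) (LamAlg p) M" and g: "lam_generated (fst M) (lact M)"
 shows "fin_gen p M"
proof -
 have r: "snd M : cat_hom (Hcat p) (gtens (Lam p) (fst M)) (fst M)" and L: "lambda_module p (fst M) (lact M)"
  using M by (auto simp: is_module_iff)
 note f = snd_hom_facts[OF r] and Ld = lambda_moduleD[OF L]
 obtain Z where Z: "finite Z" "Z <= (UN al. fst M al)" "gcar (fst M) = cvec.span {lact M k z | k z. z : Z}"
  using g by (auto simp: lam_generated_def)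
 define X where "X al = cvec.span (Z \<inter> fst M al)" for al
 have XM: "X al <= fst M al" for al unfolding X_def by (intro cvec.span_minimal graded_subspace f) auto
 have X: "graded X" by (rule graded_subfamily[OF f(1) _ XM]) (simp add: X_def)
 have "(UN al. Z \<inter> fst M al) = Z" using Z(2) by auto
 then have gX: "gcar X = cvec.span Z" using gcar_of_spans[of X "%al. Z \<inter> fst M al"] by (simp add: X_def)
 have fd: "fin_dim (gcar X)" unfolding gX fin_dim_def using Z(1) by blast
 have XMc: "gcar X <= gcar (fst M)" by (rule gcar_mono[OF XM])
 have Zc: "z : Z ==> z : gcar X" for z unfolding gX by (rule cvec.span_base)
 obtain h where h: "Arrow (gtens (Lam p) X) h (fst M) : Arr (Hcat p)" "!!k v. v : gcar X ==> h (lam k <*> v) = lact M k v"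
  using lam_arrow_ex[OF X f(1) lin_on_subset[OF Ld(2) XMc] Ld(3)[OF subsetD[OF XM]]] by blast
 let ?h = "Arrow (gtens (Lam p) X) h (fst M)"
 note F = free_module_hom[OF X, where p = p]
 have sp: "gcar (gtens (Lam p) X) = cvec.span {lam k <*> v | k v. v : Z}"
  using tens_lam_span[of Z "gcar X"] by (simp add: gcar_gtens_Lam gX)
 have g: "H.gen p (fst (free_module (Hcat p) (LamAlg p) X)) {lam k <*> v | k v. v : Z}"
  unfolding F by (rule H_gen) (use X sp in simp_all)
 have "?h : module_homs (Hcat p) (LamAlg p) (free_module (Hcat p) (LamAlg p) X) M"
  unfolding module_homs_iff[OF F(2)[folded F(1)] r g] F(1)
  using h Zc F(3) Ld(4) subsetD[OF XMc] by (auto simp: H_hom)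
 moreover have "amap ?h ` gcar (gtens (Lam p) X) = gcar (fst M)"
 proof -
  have hl: "lin_on (gcar (gtens (Lam p) X)) h" using h(1) by (auto simp: H_Arr dest: lin_lin_on)
  have "h ` gcar (gtens (Lam p) X) = cvec.span (h ` {lam k <*> v | k v. v : Z})"
   unfolding sp by (rule lin_image_span) (use hl sp in simp)
  also have "h ` {lam k <*> v | k v. v : Z} = {lact M k z | k z. z : Z}"
   unfolding image_setcompr2 by (rule setcompr_cong2) (rule h(2)[OF Zc])
  finally show ?thesis using Z(3) by simp
 qed
 ultimately show ?thesis unfolding fin_gen_def using X fd by blast
qed

lemma Mcat_Obj_iff:
 assumes p: "p > 0"
 shows "M : Obj (Mcat p) \<longleftrightarrow> snd M : cat_hom (Hcat p) (gtens (Lam p) (fst M)) (fst M) & lambda_module p (fst M) (lact M) &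
  integral (fst M) & lam_generated (fst M) (lact M)"
proof -
 have "M : Obj (Mcat p) \<longleftrightarrow> is_module (Hcat p) (LamAlg p) M & is_local (Hcat p) (LamAlg p) M & fin_gen p M"
  by (simp add: Mcat_def local_modules_def Let_def)
 then show ?thesis
  using is_local_iff[OF p] fin_gen_imp_generated generated_imp_fin_gen by (metis is_module_iff)
qed

section \<open>Coequalizers of graded spaces\<close>

text \<open>
  A coequalizer in concrete terms: surjective in each degree, with linear maps (graded or not) factoring
  whenever they coequalize. The last clause is stronger than the universal property in the category, and is
  what maps on the relative tensor product are built from.
\<close>

definition quotient_map :: "nat => (gspace, cvec => cvec) arrow => (gspace, cvec => cvec) arrow => (gspace, cvec => cvec) arrow => bool" where
 "quotient_map p f g \<pi> \<longleftrightarrow> \<pi> : Arr (Hcat p) & src \<pi> = tgt f & (ALL ga. amap \<pi> ` src \<pi> ga = tgt \<pi> ga) &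
   (ALL x:gcar (src f). amap \<pi> (amap f x) = amap \<pi> (amap g x)) &
   (ALL h. lin_on (gcar (src \<pi>)) h \<longrightarrow> (ALL x:gcar (src f). h (amap f x) = h (amap g x)) \<longrightarrow>
    (EX k:lin (gcar (tgt \<pi>)) UNIV. ALL x:gcar (src \<pi>). k (amap \<pi> x) = h x))"

lemma quotient_map_surj:
 assumes "quotient_map p f g \<pi>"
 shows "amap \<pi> ` gcar (src \<pi>) = gcar (tgt \<pi>)"
proof -
 have l: "lin_on (gcar (src \<pi>)) (amap \<pi>)" using assms by (auto simp: quotient_map_def H_Arr dest: lin_lin_on)
 have "amap \<pi> ` gcar (src \<pi>) = cvec.span (amap \<pi> ` (UN al. src \<pi> al))"
  unfolding gcar_span by (rule lin_image_span) (use l in "simp add: gcar_span")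
 also have "amap \<pi> ` (UN al. src \<pi> al) = (UN al. tgt \<pi> al)" 
 proof -
  have "amap \<pi> ` src \<pi> ga = tgt \<pi> ga" for ga using assms unfolding quotient_map_def by blast
  then show ?thesis by (simp add: image_UN)
 qed
 finally show ?thesis by (simp add: gcar_span)
qed

text \<open>In each degree, subtract a projection onto the image of \<open>f - g\<close>.\<close>

lemma quotient_map_ex:
 assumes f: "f : cat_hom (Hcat p) U V" and g: "g : cat_hom (Hcat p) U V"
 shows "\<exists>\<pi>. quotient_map p f g \<pi>"
proof -
 have fg: "src f = U" "tgt f = V" "src g = U" "tgt g = V" "f : Arr (Hcat p)" "g : Arr (Hcat p)" using f g by (auto simp: H_hom)
 note F = H_ArrD[OF fg(5), unfolded fg] and G = H_ArrD[OF fg(6), unfolded fg]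
 have V: "graded V" and U: "graded U" using F by auto
 define d where "d x = amap f x - amap g x" for x
 have dl: "lin_on (gcar U) d" unfolding d_def by (intro lin_intros lin_lin_on[OF F(3)] lin_lin_on[OF G(3)])
 have dV: "d x : V ga" if "x : U ga" for x ga
  unfolding d_def by (intro cvec.subspace_diff[OF graded_subspace[OF V]] F(4) G(4) that)
 have Ug: "U ga <= gcar U" and Vg: "V ga <= gcar V" for ga using gcar_mem by blast+
 define I where "I ga = d ` U ga" for ga
 have Is: "cvec.subspace (I ga)" for ga
  unfolding I_def by (rule subspace_lin_image[OF graded_subspace[OF U] lin_on_subset[OF dl Ug]])
 have IV: "I ga <= V ga" for ga using dV by (auto simp: I_def)
 have "EX P. ALL ga. lin_on UNIV (P ga) & (ALL x. P ga x : I ga) & (ALL x:I ga. P ga x = x)"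
  by (intro choice allI) (rule subspace_projection[OF Is], blast)
 then obtain P where P: "!!ga. lin_on UNIV (P ga)" "!!ga x. P ga x : I ga" "!!ga x. x : I ga ==> P ga x = x" by blast
 have ql: "lin_on (V ga) (%x. x - P ga x)" for ga
  by (intro lin_intros lin_on_subset[OF P(1)]) auto
 define Q where "Q ga = (%x. x - P ga x) ` V ga" for ga
 have Qs: "cvec.subspace (Q ga)" for ga unfolding Q_def by (rule subspace_lin_image[OF graded_subspace[OF V] ql])
 have QV: "Q ga <= V ga" for ga
  unfolding Q_def using cvec.subspace_diff[OF graded_subspace[OF V]] P(2) IV by blast
 have Q: "graded Q" by (rule graded_subfamily[OF V Qs QV])
 have QVc: "gcar Q <= gcar V" by (rule gcar_mono[OF QV])
 obtain q where q: "q : lin (gcar V) UNIV" "!!ga x. x : V ga ==> q x = x - P ga x"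
  using graded_extend[OF V ql] by blast
 have qa: "Arrow V q Q : Arr (Hcat p)"
  by (rule H_ArrI[OF V Q q(1) span_graded[OF V]]) (auto simp: q(2) Q_def)
 have img: "q ` V ga = Q ga" for ga unfolding Q_def by (rule image_cong[OF refl]) (rule q(2))
 have coeq: "q (amap f x) = q (amap g x)" if x: "x : gcar U" for x
 proof -
  have l1: "lin_on (gcar U) (%x. q (amap f x))" by (rule lin_on_compose[OF lin_lin_on[OF q(1)] lin_lin_on[OF F(3)] lin_mem[OF F(3)]])
  have l2: "lin_on (gcar U) (%x. q (amap g x))" by (rule lin_on_compose[OF lin_lin_on[OF q(1)] lin_lin_on[OF G(3)] lin_mem[OF G(3)]])
  have "q (amap f y) = q (amap g y)" if y: "y : U ga" for y ga
  proof -
   have "q (amap f y) - q (amap g y) = q (d y)"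
    unfolding d_def using lin_on_diff[OF subspace_gcar lin_lin_on[OF q(1)]] F(4)[OF y] G(4)[OF y] Vg by (metis subsetD)
   also have "... = 0" using q(2)[OF dV[OF y]] P(3)[of "d y" ga] y by (simp add: I_def)
   finally show ?thesis by simp
  qed
  then show ?thesis using lin_on_span_eq[OF l1[unfolded gcar_span] l2[unfolded gcar_span] _ x[unfolded gcar_span]] by blast
 qed
 have up: "EX k:lin (gcar Q) UNIV. ALL x:gcar V. k (q x) = h x" if h: "lin_on (gcar V) h" "ALL x:gcar U. h (amap f x) = h (amap g x)" for h
 proof (intro bexI ballI)
  let ?k = "restrict h (gcar Q)"
  show "?k : lin (gcar Q) UNIV" by (intro restrict_lin subspace_gcar lin_on_subset[OF h(1) QVc]) simp
  fix x assume x: "x : gcar V"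
  have qQ: "q y : gcar Q" if "y : gcar V" for y using qa that by (auto simp: H_Arr lin_mem)
  have hq: "lin_on (gcar V) (%x. h (q x))"
   by (rule lin_on_compose[OF h(1) lin_lin_on[OF q(1)]]) (use qQ QVc in blast)
  have "h (q y) = h y" if y: "y : V ga" for y ga
  proof -
   have "P ga y : I ga" by (rule P(2))
   then obtain u where u: "u : U ga" "P ga y = d u" by (auto simp: I_def)
   have fg: "amap f u : gcar V" "amap g u : gcar V" using F(4)[OF u(1)] G(4)[OF u(1)] Vg by blast+
   have "h (d u) = 0" unfolding d_def using lin_on_diff[OF subspace_gcar h(1) fg] h(2) u(1) Ug by auto
   moreover have "h (y - d u) = h y - h (d u)"
    using y dV[OF u(1)] Vg by (intro lin_on_diff[OF subspace_gcar h(1)]) blast+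
   ultimately show ?thesis using q(2)[OF y] u(2) by simp
  qed
  then have "h (q x) = h x" using lin_on_span_eq[OF hq[unfolded gcar_span] h(1)[unfolded gcar_span] _ x[unfolded gcar_span]] by blast
  then show "?k (q x) = h x" using qQ[OF x] by simp
 qed
 show ?thesis
  by (rule exI[of _ "Arrow V q Q"]) (use qa img coeq up in "simp add: quotient_map_def fg")
qed

lemma quotient_map_coequalizer:
 assumes f: "f : cat_hom (Hcat p) U V" and g: "g : cat_hom (Hcat p) U V" and q: "quotient_map p f g \<pi>"
 shows "is_coequalizer (Hcat p) f g \<pi>"
proof -
 note F = cat_homD[OF f] and G = cat_homD[OF g]
 have \<pi>: "\<pi> : Arr (Hcat p)" "Dom (Hcat p) \<pi> = V" using q F by (auto simp: quotient_map_def H_simps(2,3))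
 have U: "U : Obj (Hcat p)" and V: "V : Obj (Hcat p)" using H.Dom_Obj[OF F(1)] H.Cod_Obj[OF F(1)] F by auto
 have eq: "Comp (Hcat p) \<pi> f = Comp (Hcat p) \<pi> g"
 proof -
  have "ALL x:gcar U. amap \<pi> (amap f x) = amap \<pi> (amap g x)" using q F by (simp add: quotient_map_def H_simps(2))
  then show ?thesis by (intro H.hom_eqI_gen[OF H.gen_car[OF U]]) (use F G \<pi> in auto)
 qed
 have "EX!k. k : cat_hom (Hcat p) (Cod (Hcat p) \<pi>) (Cod (Hcat p) h) & Comp (Hcat p) k \<pi> = h"
  if h: "h : Arr (Hcat p)" "Dom (Hcat p) h = V" "Comp (Hcat p) h f = Comp (Hcat p) h g" for h
 proof -
  have hh: "amap h (amap f x) = amap h (amap g x)" if "x : gcar U" for x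
   using that h(3) H.el_Comp[OF F(1) h(1)] H.el_Comp[OF G(1) h(1)] F G h(2) by metis
  have hl: "amap h : lin (gcar V) (gcar (Cod (Hcat p) h))" using H.el_lin[OF h(1)] h(2) by simp
  have sV: "src \<pi> = V" "src f = U" using \<pi>(2) F(2) by (simp_all add: H_simps)
  have "EX k:lin (gcar (tgt \<pi>)) UNIV. ALL x:gcar V. k (amap \<pi> x) = amap h x"
   using q lin_lin_on[OF hl] hh unfolding quotient_map_def sV by blast
  then obtain k where k: "k : lin (gcar (tgt \<pi>)) UNIV" "!!x. x : gcar V ==> k (amap \<pi> x) = amap h x" by blast
  have gt: "graded (tgt \<pi>)" "graded (tgt h)" using H_ArrD(2) \<pi>(1) h(1) by blast+
  have ka: "Arrow (tgt \<pi>) k (tgt h) : Arr (Hcat p)"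
  proof (rule H_ArrI[OF gt k(1) span_graded[OF gt(1)]])
   fix ga y assume "y : tgt \<pi> ga"
   moreover have "tgt \<pi> ga = amap \<pi> ` V ga" using q unfolding quotient_map_def sV by blast
   ultimately obtain x where x: "x : V ga" "y = amap \<pi> x" by auto
   have "k y = amap h x" using k(2)[OF gcar_mem[of _ V, OF x(1)]] x(2) by simp
   also have "... : tgt h ga" using H_ArrD(4)[OF h(1)] h(2) x(1) by (simp add: H_simps)
   finally show "k y : tgt h ga" .
  qed
  show ?thesis
  proof (rule ex1I[of _ "Arrow (tgt \<pi>) k (tgt h)"])
   have c: "Comp (Hcat p) (Arrow (tgt \<pi>) k (tgt h)) \<pi> = h"
    by (rule H.hom_eqI_gen[OF H.gen_car[OF V]])
     (use ka \<pi> h k(2) sV in "auto simp: H_simps(2,3) H.el_Comp[unfolded H_simps(2,3)] H.Comp_Arr[unfolded H_simps(2,3)]")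
   show "Arrow (tgt \<pi>) k (tgt h) : cat_hom (Hcat p) (Cod (Hcat p) \<pi>) (Cod (Hcat p) h) & Comp (Hcat p) (Arrow (tgt \<pi>) k (tgt h)) \<pi> = h"
    using ka c by (simp add: cat_hom_def H_simps(2,3))
   fix k' assume k': "k' : cat_hom (Hcat p) (Cod (Hcat p) \<pi>) (Cod (Hcat p) h) & Comp (Hcat p) k' \<pi> = h"
   note K = cat_homD[OF conjunct1[OF k']]
   have TO: "Cod (Hcat p) \<pi> : Obj (Hcat p)" using H.Cod_Obj[OF \<pi>(1)] .
   show "k' = Arrow (tgt \<pi>) k (tgt h)"
   proof (rule H.hom_eqI_gen[OF H.gen_car[OF TO]])
    fix y assume "y : gcar (Cod (Hcat p) \<pi>)"
    then obtain x where x: "x : gcar V" "y = amap \<pi> x" using quotient_map_surj[OF q] sV by (auto simp: H_simps(3))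
    have "amap k' y = amap (Comp (Hcat p) k' \<pi>) x" using x \<pi> K by simp
    also have "... = k y" using k' k(2)[OF x(1)] x(2) by simp
    finally show "amap k' y = amap (Arrow (tgt \<pi>) k (tgt h)) y" by simp
   qed (use K ka in "auto simp: H_simps(2,3)")
  qed
 qed
 then show ?thesis unfolding is_coequalizer_def using \<pi> eq F by auto
qed

text \<open>
  Coequalizers are unique up to isomorphism, so the chosen one shares the concrete description of the one
  constructed before.
\<close>

lemma coequalizer_quotient_map:
 assumes f: "f : cat_hom (Hcat p) U V" and g: "g : cat_hom (Hcat p) U V" and c: "is_coequalizer (Hcat p) f g \<pi>"
 shows "quotient_map p f g \<pi>"
proof -
 obtain \<pi>0 where q: "quotient_map p f g \<pi>0" using quotient_map_ex[OF f g] by blast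
 have c0: "is_coequalizer (Hcat p) f g \<pi>0" by (rule quotient_map_coequalizer[OF f g q])
 note F = cat_homD[OF f]
 have \<pi>: "\<pi> : Arr (Hcat p)" "Dom (Hcat p) \<pi> = V" "\<pi>0 : Arr (Hcat p)" "Dom (Hcat p) \<pi>0 = V"
   "Comp (Hcat p) \<pi> f = Comp (Hcat p) \<pi> g" "Comp (Hcat p) \<pi>0 f = Comp (Hcat p) \<pi>0 g"
  using c c0 F by (auto simp: is_coequalizer_def)
 have u: "EX!k. k : cat_hom (Hcat p) (Cod (Hcat p) \<pi>) (Cod (Hcat p) h) & Comp (Hcat p) k \<pi> = h"
  if "h : Arr (Hcat p)" "Dom (Hcat p) h = V" "Comp (Hcat p) h f = Comp (Hcat p) h g" for h
  using c that F by (auto simp: is_coequalizer_def)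
 have u0: "EX!k. k : cat_hom (Hcat p) (Cod (Hcat p) \<pi>0) (Cod (Hcat p) h) & Comp (Hcat p) k \<pi>0 = h"
  if "h : Arr (Hcat p)" "Dom (Hcat p) h = V" "Comp (Hcat p) h f = Comp (Hcat p) h g" for h
  using c0 that F by (auto simp: is_coequalizer_def)
 obtain k where k: "k : cat_hom (Hcat p) (Cod (Hcat p) \<pi>) (Cod (Hcat p) \<pi>0)" "Comp (Hcat p) k \<pi> = \<pi>0" using u[OF \<pi>(3,4,6)] by blast
 obtain k' where k': "k' : cat_hom (Hcat p) (Cod (Hcat p) \<pi>0) (Cod (Hcat p) \<pi>)" "Comp (Hcat p) k' \<pi>0 = \<pi>" using u0[OF \<pi>(1,2,5)] by blast
 have \<pi>h: "\<pi> : cat_hom (Hcat p) V (Cod (Hcat p) \<pi>)" using \<pi> by (simp add: cat_hom_def)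
 have "Comp (Hcat p) (Comp (Hcat p) k' k) \<pi> = \<pi>"
  using H.Comp_assoc[OF \<pi>h k(1) k'(1)] k(2) k'(2) by simp
 moreover have "Comp (Hcat p) (Id (Hcat p) (Cod (Hcat p) \<pi>)) \<pi> = \<pi>" using H.Id_Comp[OF \<pi>h] .
 moreover have "Comp (Hcat p) k' k : cat_hom (Hcat p) (Cod (Hcat p) \<pi>) (Cod (Hcat p) \<pi>)" using H.Comp_hom[OF k(1) k'(1)] .
 moreover have "Id (Hcat p) (Cod (Hcat p) \<pi>) : cat_hom (Hcat p) (Cod (Hcat p) \<pi>) (Cod (Hcat p) \<pi>)" using H.Id_hom[OF H.Cod_Obj[OF \<pi>(1)]] .
 ultimately have id: "Comp (Hcat p) k' k = Id (Hcat p) (Cod (Hcat p) \<pi>)" using u[OF \<pi>(1,2,5)] by blast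
 note K = cat_homD[OF k(1)] and K' = cat_homD[OF k'(1)]
 have kk: "amap k' (amap k y) = y" if "y : gcar (tgt \<pi>)" for y
  using H.el_Comp[OF K(1) K'(1)] K K' that id H.el_Id[OF H.Cod_Obj[OF \<pi>(1)]] by (simp add: H_simps(2,3))
 have kp: "amap k (amap \<pi> x) = amap \<pi>0 x" if "x : gcar V" for x
  using H.el_Comp[OF \<pi>(1) K(1)] K \<pi> that k(2) by simp
 have kp': "amap k' (amap \<pi>0 x) = amap \<pi> x" if "x : gcar V" for x
  using H.el_Comp[OF \<pi>(3) K'(1)] K' \<pi> that k'(2) by simp
 have s: "src \<pi> = V" "src \<pi>0 = V" "tgt f = V" "src f = U" "src k = tgt \<pi>" "tgt k = tgt \<pi>0" "src k' = tgt \<pi>0" "tgt k' = tgt \<pi>"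
  using \<pi> F K K' by (auto simp: H_simps(2,3))
 have img: "amap \<pi> ` V ga = tgt \<pi> ga" for ga
 proof
  show "amap \<pi> ` V ga <= tgt \<pi> ga" using H_ArrD(4)[OF \<pi>(1)] s by auto
  show "tgt \<pi> ga <= amap \<pi> ` V ga"
  proof
   fix y assume y: "y : tgt \<pi> ga"
   have "amap k y : tgt \<pi>0 ga" using H_ArrD(4)[OF K(1)] y s by simp
   moreover have "tgt \<pi>0 ga = amap \<pi>0 ` V ga" using q s by (simp add: quotient_map_def)
   ultimately obtain x where x: "x : V ga" "amap k y = amap \<pi>0 x" by auto
   have "y = amap \<pi> x" using kk[OF gcar_mem[of _ "tgt \<pi>", OF y]] x(2) kp'[OF gcar_mem[of _ V, OF x(1)]] by simp
   then show "y : amap \<pi> ` V ga" using x by blast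
  qed
 qed
 have up: "EX j:lin (gcar (tgt \<pi>)) UNIV. ALL x:gcar V. j (amap \<pi> x) = h x"
  if "lin_on (gcar V) h" "ALL x:gcar U. h (amap f x) = h (amap g x)" for h
 proof -
  have "EX j:lin (gcar (tgt \<pi>0)) UNIV. ALL x:gcar V. j (amap \<pi>0 x) = h x"
   using q that unfolding quotient_map_def s by blast
  then obtain j where j: "j : lin (gcar (tgt \<pi>0)) UNIV" "!!x. x : gcar V ==> j (amap \<pi>0 x) = h x" by blast
  have kl: "amap k : lin (gcar (tgt \<pi>)) (gcar (tgt \<pi>0))" using H_ArrD(3)[OF K(1)] s by simp
  have pm: "amap \<pi> x : gcar (tgt \<pi>)" if "x : gcar V" for x using H_ArrD(3)[OF \<pi>(1)] s that lin_mem by metis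
  have "restrict (%y. j (amap k y)) (gcar (tgt \<pi>)) : lin (gcar (tgt \<pi>)) UNIV"
   by (intro restrict_lin subspace_gcar lin_on_compose[OF lin_lin_on[OF j(1)] lin_lin_on[OF kl] lin_mem[OF kl]]) simp_all
  then show ?thesis using j(2) kp pm by (intro bexI[of _ "restrict (%y. j (amap k y)) (gcar (tgt \<pi>))"]) auto
 qed
 have coeq: "amap \<pi> (amap f x) = amap \<pi> (amap g x)" if x: "x : gcar U" for x
 proof -
  have m: "amap f x : gcar V" "amap g x : gcar V"
   using H.el_car[OF F(1)] H.el_car[OF cat_homD(1)[OF g]] F cat_homD[OF g] x by auto
  have "amap \<pi>0 (amap f x) = amap \<pi>0 (amap g x)" using q x unfolding quotient_map_def s by blast
  then show ?thesis using kp'[OF m(1)] kp'[OF m(2)] by simp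
 qed
 show ?thesis using \<pi>(1) img up coeq by (simp add: quotient_map_def s)
qed

section \<open>The relative tensor product of local modules\<close>

locale lam_data =
 fixes p :: nat
 assumes p_pos: "p > 0"
begin

abbreviation "HH \<equiv> Hcat p"
abbreviation "LA \<equiv> LamAlg p"
abbreviation "MM \<equiv> Mcat p"
abbreviation car :: "lmod => cvec set" where "car M \<equiv> gcar (fst M)"

text \<open>
  The scalar by which \<open>1\<^sub>k\<close> braids past a vector of degree \<open>al\<close>, which is a
  sign for integral \<open>al\<close>.
\<close>

definition ex :: "int => complex => complex" where "ex k al = exp (complex_of_real pi * \<i> * of_int k * al)"

lemma hexp_ldeg: "hexp p (ldeg p k * al) = ex k al" "hexp p (al * ldeg p k) = ex k al"
 using hexp_int[OF p_pos, of k al] by (simp_all only: ex_def mult.commute[of al])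

lemma ex_add: "ex k (al + be) = ex k al * ex k be"
 by (simp add: ex_def ring_distribs exp_add)

lemma ex_square: "al : \<int> ==> ex k al * ex k al = 1"
proof -
 assume "al : \<int>"
 then have "of_int k * al : \<int>" by auto
 then have "exp (2 * complex_of_real pi * \<i> * (of_int k * al)) = 1" by (simp only: exp_2pi_eq_1)
 moreover have "ex k al * ex k al = exp (2 * complex_of_real pi * \<i> * (of_int k * al))"
  unfolding ex_def exp_add[symmetric] by (rule arg_cong[of _ _ exp]) (simp add: algebra_simps)
 ultimately show ?thesis by simp
qed

lemma ex_ldeg: "ex k (ldeg p l) = 1"
proof -
 have "ex k (ldeg p l) = exp (2 * complex_of_real pi * \<i> * of_int (k * int p * l))"
  unfolding ex_def by (rule arg_cong[of _ _ exp]) (simp add: algebra_simps)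
 also have "... = 1" by (simp only: exp_2pi_eq_1 Ints_of_int)
 finally show ?thesis .
qed

lemma MM_Obj: "M : Obj MM \<longleftrightarrow> snd M : cat_hom HH (gtens (Lam p) (fst M)) (fst M) & lambda_module p (fst M) (lact M) &
  integral (fst M) & lam_generated (fst M) (lact M)"
 by (rule Mcat_Obj_iff[OF p_pos])

lemma ObjD:
 assumes "M : Obj MM"
 shows "graded (fst M)" "lin_on (car M) (lact M k)" "x : fst M al ==> lact M k x : fst M (al + ldeg p k)"
  "x : car M ==> lact M k (lact M l x) = lact M (k + l) x" "x : car M ==> lact M 0 x = x"
  "x : car M ==> lact M k x : car M" "snd M : cat_hom HH (gtens (Lam p) (fst M)) (fst M)"
  "x : fst M al ==> x = 0 \<or> al : \<int>"
proof -
 have L: "lambda_module p (fst M) (lact M)" and i: "integral (fst M)" and r: "snd M : cat_hom HH (gtens (Lam p) (fst M)) (fst M)"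
  using assms by (auto simp: MM_Obj)
 note d = lambda_moduleD[OF L]
 show "graded (fst M)" by (rule d(1))
 show "lin_on (car M) (lact M k)" by (rule d(2))
 show "x : fst M al ==> lact M k x : fst M (al + ldeg p k)" by (rule d(3))
 show "x : car M ==> lact M k (lact M l x) = lact M (k + l) x" by (rule d(4))
 show "x : car M ==> lact M 0 x = x" by (rule d(5))
 show "x : car M ==> lact M k x : car M" by (rule lambda_module_mem[OF L])
 show "snd M : cat_hom HH (gtens (Lam p) (fst M)) (fst M)" by (rule r)
 show "x : fst M al ==> x = 0 \<or> al : \<int>" using i by (auto simp: integral_def)
qed

lemma lact_commute: "M : Obj MM ==> x : car M ==> lact M k (lact M l x) = lact M l (lact M k x)"
 using ObjD(4) by (simp add: add.commute)

definition rt_left :: "lmod => lmod => (gspace, cvec => cvec) arrow" where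
 "rt_left M N = Comp HH (TensA HH (Comp HH (snd M) (Braid HH (fst M) (Lam p))) (Id HH (fst N))) (Assoc HH (fst M) (Lam p) (fst N))"

definition rt_right :: "lmod => lmod => (gspace, cvec => cvec) arrow" where
 "rt_right M N = TensA HH (Id HH (fst M)) (snd N)"

abbreviation pr :: "lmod => lmod => (gspace, cvec => cvec) arrow" where "pr M N \<equiv> rt_proj HH LA M N"
abbreviation tt :: "lmod => lmod => cvec => cvec => cvec" where "tt M N \<equiv> rt_elem p M N"
abbreviation TT :: "lmod => lmod => lmod" where "TT M N \<equiv> rt_obj HH LA M N"

context
 fixes M N assumes MN: "M : Obj MM" "N : Obj MM"
begin

lemma MN_simps [simp]:
 "graded (fst M)" "graded (fst N)" "snd M : Arr HH" "snd N : Arr HH" "Dom HH (snd M) = gtens (Lam p) (fst M)"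
 "Dom HH (snd N) = gtens (Lam p) (fst N)" "Cod HH (snd M) = fst M" "Cod HH (snd N) = fst N"
 using ObjD(1)[OF MN(1)] ObjD(1)[OF MN(2)] cat_homD[OF ObjD(7)[OF MN(1)]] cat_homD[OF ObjD(7)[OF MN(2)]] by simp_all

lemma rt_left_hom: "rt_left M N : cat_hom HH (gtens (fst M) (gtens (Lam p) (fst N))) (gtens (fst M) (fst N))"
 and rt_right_hom: "rt_right M N : cat_hom HH (gtens (fst M) (gtens (Lam p) (fst N))) (gtens (fst M) (fst N))"
 by (simp_all add: rt_left_def rt_right_def cat_hom_def)

lemma el_right_action:
 assumes x: "x : fst M al"
 shows "amap (Comp HH (snd M) (Braid HH (fst M) (Lam p))) (x <*> lam k) = ex k al *\<^sub>C lact M k x"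
proof -
 have xc: "x : car M" using gcar_mem x by blast
 have "amap (Comp HH (snd M) (Braid HH (fst M) (Lam p))) (x <*> lam k) = amap (snd M) (ex k al *\<^sub>C (lam k <*> x))"
  using xc by (simp add: H_Braid(2)[where U = "fst M" and V = "Lam p", OF MN_simps(1) graded_Lam x lam_Lam] hexp_ldeg[simplified])
 also have "... = ex k al *\<^sub>C lact M k x"
  unfolding lact_def using xc by (intro H.el_scale[where p = p]) simp_all
 finally show ?thesis .
qed

lemma el_rt_left: "x : fst M al ==> y : car N ==> amap (rt_left M N) (x <*> (lam k <*> y)) = ex k al *\<^sub>C (lact M k x <*> y)"
proof -
 assume x: "x : fst M al" and y: "y : car N"
 have xc: "x : car M" using gcar_mem x by blast
 have "amap (snd M) (amap (Braid HH (fst M) (Lam p)) (x <*> lam k)) = ex k al *\<^sub>C lact M k x"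
  using el_right_action[OF x, of k] xc by simp
 then show ?thesis using xc y by (simp add: rt_left_def tensor_scale_left)
qed

lemma el_rt_right: "x : car M ==> y : car N ==> amap (rt_right M N) (x <*> (lam k <*> y)) = x <*> lact N k y"
 by (simp add: rt_right_def lact_def)

lemma pr_coequalizer: "is_coequalizer HH (rt_left M N) (rt_right M N) (pr M N)"
proof -
 have "\<exists>\<pi>. is_coequalizer HH (rt_left M N) (rt_right M N) \<pi>"
  using quotient_map_ex[OF rt_left_hom rt_right_hom] quotient_map_coequalizer[OF rt_left_hom rt_right_hom] by blast
 from someI_ex[OF this] show ?thesis unfolding rt_proj_def rt_left_def rt_right_def by simp
qed

lemma pr_quotient: "quotient_map p (rt_left M N) (rt_right M N) (pr M N)"
 by (rule coequalizer_quotient_map[OF rt_left_hom rt_right_hom pr_coequalizer])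

lemma fst_TT: "fst (TT M N) = Cod HH (pr M N)"
 by (simp add: rt_obj_def Let_def)

lemma pr_Arr [simp]: "pr M N : Arr HH" "Dom HH (pr M N) = gtens (fst M) (fst N)" "Cod HH (pr M N) = fst (TT M N)"
 using pr_quotient cat_homD[OF rt_left_hom] by (auto simp: quotient_map_def H_simps(2,3) fst_TT)

lemma TT_graded [simp]: "graded (fst (TT M N))"
 using H.Cod_Obj[OF pr_Arr(1)] by simp

lemma pr_lin: "amap (pr M N) : lin (gcar (gtens (fst M) (fst N))) (car (TT M N))"
 using H.el_lin[OF pr_Arr(1)] by simp

lemma tt_bilin: "bilin_on (car M) (car N) (tt M N)"
 unfolding rt_elem_def by (intro bilin_onI lin_on_compose[OF lin_lin_on[OF pr_lin]] lin_intros) simp_all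

lemma tt_mem: "x : car M ==> y : car N ==> tt M N x y : car (TT M N)"
 unfolding rt_elem_def by (rule lin_mem[OF pr_lin]) simp

lemma tt_deg: "x : fst M al ==> y : fst N be ==> tt M N x y : fst (TT M N) (al + be)"
 unfolding rt_elem_def using H_ArrD(4)[OF pr_Arr(1)] pr_Arr(2,3) gtens_mem[of x "fst M" al y "fst N" be] by (simp add: H_simps(2,3))

lemma tt_span:
 assumes A: "!!al. fst M al = cvec.span (A al)" and B: "!!al. fst N al = cvec.span (B al)"
 shows "fst (TT M N) ga = cvec.span {tt M N a b | a b al be. a : A al & b : B be & al + be = ga}"
proof -
 have e: "amap (pr M N) ` gtens (fst M) (fst N) ga = fst (TT M N) ga"
  using pr_quotient pr_Arr(2,3) unfolding quotient_map_def H_simps(2,3) by metis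
 have l: "lin_on (gtens (fst M) (fst N) ga) (amap (pr M N))"
  by (rule lin_on_subset[OF lin_lin_on[OF pr_lin]]) (use gcar_mem in blast)
 have "{tt M N a b | a b al be. a : A al & b : B be & al + be = ga} = amap (pr M N) ` {a <*> b | a b al be. a : A al & b : B be & al + be = ga}"
  unfolding rt_elem_def by blast
 moreover have "fst (TT M N) ga = amap (pr M N) ` cvec.span {a <*> b | a b al be. a : A al & b : B be & al + be = ga}"
  using e unfolding gtens_spans[of "fst M" A "fst N" B, OF A B] by simp
 ultimately show ?thesis
  using lin_image_span[of "{a <*> b | a b al be. a : A al & b : B be & al + be = ga}" "amap (pr M N)"] l
  unfolding gtens_spans[of "fst M" A "fst N" B, OF A B] by simp
qed

lemma car_TT_span:
 assumes A: "car M = cvec.span A" and B: "car N = cvec.span B"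
 shows "car (TT M N) = cvec.span {tt M N a b | a b. a : A & b : B}"
proof -
 have e: "amap (pr M N) ` gcar (gtens (fst M) (fst N)) = car (TT M N)"
  using quotient_map_surj[OF pr_quotient] pr_Arr(2,3) by (simp add: H_simps(2,3))
 have s: "gcar (gtens (fst M) (fst N)) = cvec.span {a <*> b | a b. a : A & b : B}"
  unfolding gcar_gtens by (rule tens_span) (simp_all add: A B)
 have "{tt M N a b | a b. a : A & b : B} = amap (pr M N) ` {a <*> b | a b. a : A & b : B}"
  unfolding rt_elem_def by blast
 then show ?thesis
  using e lin_image_span[of "{a <*> b | a b. a : A & b : B}" "amap (pr M N)"] lin_lin_on[OF pr_lin] by (simp add: s)
qed

lemma tt_balanced:
 assumes x: "x : fst M al" and y: "y : car N"
 shows "tt M N x (lact N k y) = ex k al *\<^sub>C tt M N (lact M k x) y"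
proof -
 have xc: "x : car M" using gcar_mem x by blast
 have m: "x <*> (lam k <*> y) : gcar (src (rt_left M N))"
  using cat_homD[OF rt_left_hom] xc y by (simp add: H_simps(2,3))
 have "amap (pr M N) (amap (rt_left M N) (x <*> (lam k <*> y))) = amap (pr M N) (amap (rt_right M N) (x <*> (lam k <*> y)))"
  using pr_quotient m unfolding quotient_map_def by blast
 then have "amap (pr M N) (ex k al *\<^sub>C (lact M k x <*> y)) = tt M N x (lact N k y)"
  by (simp add: el_rt_left[OF x y] el_rt_right[OF xc y] rt_elem_def)
 moreover have "amap (pr M N) (ex k al *\<^sub>C (lact M k x <*> y)) = ex k al *\<^sub>C tt M N (lact M k x) y"
  unfolding rt_elem_def by (rule lin_on_scale[OF lin_lin_on[OF pr_lin]]) (use ObjD(6)[OF MN(1) xc] y in simp)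
 ultimately show ?thesis by simp
qed

text \<open>
  The factorization is allowed to be a bare linear map, which need not respect degrees; maps that depend on a
  further vector are treated one value of that vector at a time.
\<close>

lemma rt_extend:
 assumes b: "bilin_on (car M) (car N) be"
  and bal: "!!k al x y. x : fst M al ==> y : car N ==> be x (lact N k y) = ex k al *\<^sub>C be (lact M k x) y"
 shows "EX f:lin (car (TT M N)) UNIV. ALL x:car M. ALL y:car N. f (tt M N x y) = be x y"
proof -
 let ?h = "tmap (car M) (car N) be"
 note h = tmap_lin[OF subspace_gcar subspace_gcar b, folded gcar_gtens] tmap_tensor[OF subspace_gcar subspace_gcar b]
 have D: "src (rt_left M N) = gtens (fst M) (gtens (Lam p) (fst N))" "src (pr M N) = gtens (fst M) (fst N)" "tgt (pr M N) = fst (TT M N)"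
  using cat_homD[OF rt_left_hom] pr_Arr by (simp_all add: H_simps(2,3))
 have lr: "lin_on (gcar (gtens (fst M) (gtens (Lam p) (fst N)))) (%z. ?h (amap q z))"
  if "q : cat_hom HH (gtens (fst M) (gtens (Lam p) (fst N))) (gtens (fst M) (fst N))" for q
 proof -
  have q: "amap q : lin (gcar (gtens (fst M) (gtens (Lam p) (fst N)))) (gcar (gtens (fst M) (fst N)))"
   using H.el_lin[OF cat_homD(1)[OF that]] cat_homD[OF that] by simp
  show ?thesis by (rule lin_on_compose[OF lin_lin_on[OF h(1)] lin_lin_on[OF q] lin_mem[OF q]])
 qed
 have sp: "gcar (gtens (fst M) (gtens (Lam p) (fst N))) = cvec.span {a <*> b | a b. a : (UN al. fst M al) & b : {lam k <*> v | k v. v : car N}}"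
  unfolding gcar_gtens[of "fst M"] gcar_gtens_Lam
  by (rule tens_span) (simp_all add: gcar_span[symmetric] tens_lam_span[of "car N" "car N", symmetric] cvec.span_eq_iff[THEN iffD2])
 have "?h (amap (rt_left M N) z) = ?h (amap (rt_right M N) z)" if z: "z : gcar (gtens (fst M) (gtens (Lam p) (fst N)))" for z
 proof (rule lin_on_span_eq[OF lr[OF rt_left_hom, unfolded sp] lr[OF rt_right_hom, unfolded sp] _ z[unfolded sp]])
  fix g assume "g : {a <*> b | a b. a : (UN al. fst M al) & b : {lam k <*> v | k v. v : car N}}"
  then obtain x al k y where g: "g = x <*> (lam k <*> y)" "x : fst M al" "y : car N" by blast
  have xc: "x : car M" using gcar_mem g by blast
  have kx: "lact M k x : car M" "lact N k y : car N" using ObjD(6)[OF MN(1) xc] ObjD(6)[OF MN(2) g(3)] by simp_all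
  have "?h (amap (rt_left M N) g) = ex k al *\<^sub>C be (lact M k x) y"
   unfolding g(1) el_rt_left[OF g(2,3)] using lin_on_scale[OF lin_lin_on[OF h(1)]] kx g(3) h(2) by simp
  also have "... = ?h (amap (rt_right M N) g)"
   unfolding g(1) el_rt_right[OF xc g(3)] using kx xc h(2) bal[OF g(2,3)] by simp
  finally show "?h (amap (rt_left M N) g) = ?h (amap (rt_right M N) g)" .
 qed
 then have "EX k:lin (gcar (tgt (pr M N))) UNIV. ALL x:gcar (src (pr M N)). k (amap (pr M N) x) = ?h x"
  using pr_quotient lin_lin_on[OF h(1)] unfolding quotient_map_def D by blast
 then obtain k where "k : lin (car (TT M N)) UNIV" "!!x. x : gcar (gtens (fst M) (fst N)) ==> k (amap (pr M N) x) = ?h x"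
  unfolding D by blast
 then show ?thesis by (intro bexI[of _ k]) (auto simp: rt_elem_def h(2))
qed

lemma rt_the:
 assumes K: "K : Arr HH" "Dom HH K = gtens (fst M) (fst N)"
  and bal: "!!k al be x y. x : fst M al ==> y : fst N be ==> amap K (x <*> lact N k y) = ex k al *\<^sub>C amap K (lact M k x <*> y)"
 defines "h \<equiv> THE h. h : cat_hom HH (fst (TT M N)) (Cod HH K) & Comp HH h (pr M N) = K"
 shows "h : cat_hom HH (fst (TT M N)) (Cod HH K)" "!!x y. x : car M ==> y : car N ==> amap h (tt M N x y) = amap K (x <*> y)"
proof -
 note rl = cat_homD[OF rt_left_hom] and rr = cat_homD[OF rt_right_hom]
 have gt: "H.gen p (gtens (fst M) (gtens (Lam p) (fst N))) {a <*> b | a b. a : (UN al. fst M al) & b : {lam k <*> v | k v. v : (UN al. fst N al)}}"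
 proof (rule H_gen)
  show "gcar (gtens (fst M) (gtens (Lam p) (fst N))) = cvec.span {a <*> b | a b. a : (UN al. fst M al) & b : {lam k <*> v | k v. v : (UN al. fst N al)}}"
   unfolding gcar_gtens[of "fst M"] gcar_gtens_Lam
   by (rule tens_span) (simp_all add: gcar_span[symmetric] tens_lam_span[OF gcar_span[symmetric]])
 qed simp
 have "Comp HH K (rt_left M N) = Comp HH K (rt_right M N)"
 proof (rule H.hom_eqI_gen[OF gt])
  fix g assume "g : {a <*> b | a b. a : (UN al. fst M al) & b : {lam k <*> v | k v. v : (UN al. fst N al)}}"
  then obtain x al k y be where g: "g = x <*> (lam k <*> y)" "x : fst M al" "y : fst N be" by blast
  have xc: "x : car M" "y : car N" using gcar_mem g by blast+
  have kx: "lact M k x : car M" "lact N k y : car N" using ObjD(6)[OF MN(1) xc(1)] ObjD(6)[OF MN(2) xc(2)] by simp_all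
  have gm: "g : gcar (gtens (fst M) (gtens (Lam p) (fst N)))" using xc by (simp add: g(1))
  have "amap (Comp HH K (rt_left M N)) g = ex k al *\<^sub>C amap K (lact M k x <*> y)"
   using rl K gm xc kx by (simp add: g(1) el_rt_left[OF g(2) xc(2)] H.el_scale)
  also have "... = amap (Comp HH K (rt_right M N)) g"
   using rr K gm xc kx bal[OF g(2,3)] by (simp add: g(1) el_rt_right[OF xc])
  finally show "amap (Comp HH K (rt_left M N)) g = amap (Comp HH K (rt_right M N)) g" .
 qed (use K rl rr in auto)
 then have "EX!k. k : cat_hom HH (fst (TT M N)) (Cod HH K) & Comp HH k (pr M N) = K"
  using pr_coequalizer K rl pr_Arr by (auto simp: is_coequalizer_def)
 from theI'[OF this, folded h_def] have h: "h : cat_hom HH (fst (TT M N)) (Cod HH K)" "Comp HH h (pr M N) = K" by simp_all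
 then show "h : cat_hom HH (fst (TT M N)) (Cod HH K)" by simp
 fix x y assume xy: "x : car M" "y : car N"
 have "amap (Comp HH h (pr M N)) (x <*> y) = amap h (amap (pr M N) (x <*> y))"
  using cat_homD[OF h(1)] xy by (intro H.el_Comp) simp_all
 then show "amap h (tt M N x y) = amap K (x <*> y)" using h(2) by (simp add: rt_elem_def)
qed

text \<open>
  The action on the left factor is balanced because the operators of \<open>1\<^sub>k\<close> and
  \<open>1\<^sub>l\<close> commute and have degrees that braid trivially with each other.
\<close>

lemma TT_act:
 shows "snd (TT M N) : cat_hom HH (gtens (Lam p) (fst (TT M N))) (fst (TT M N))"
  and "!!k x y. x : car M ==> y : car N ==> lact (TT M N) k (tt M N x y) = tt M N (lact M k x) y"
proof -
 have "EX f:lin (car (TT M N)) UNIV. ALL x:car M. ALL y:car N. f (tt M N x y) = tt M N (lact M k x) y" for k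
 proof (rule rt_extend)
  show "bilin_on (car M) (car N) (%x. tt M N (lact M k x))"
   using ObjD(6)[OF MN(1)]
   by (intro bilin_onI lin_on_compose[OF bilin_onD2[OF tt_bilin] ObjD(2)[OF MN(1)]] bilin_onD1[OF tt_bilin]) auto
  fix l al x y assume x: "x : fst M al" and y: "y : car N"
  have xc: "x : car M" using gcar_mem x by blast
  show "tt M N (lact M k x) (lact N l y) = ex l al *\<^sub>C tt M N (lact M k (lact M l x)) y"
   using tt_balanced[OF ObjD(3)[OF MN(1) x] y, of k l] lact_commute[OF MN(1) xc, of l k] by (simp add: ex_add ex_ldeg[of l k, simplified])
 qed
 then obtain a where a: "!!k. a k : lin (car (TT M N)) UNIV" "!!k x y. x : car M ==> y : car N ==> a k (tt M N x y) = tt M N (lact M k x) y"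
  by metis
 have spQ: "fst (TT M N) ga = cvec.span {tt M N a b |a b al be. a : fst M al & b : fst N be & al + be = ga}" for ga
  by (rule tt_span; rule span_graded; simp)
 have ad: "a k z : fst (TT M N) (ga + ldeg p k)" if z: "z : fst (TT M N) ga" for k ga z
 proof (rule lin_on_span_mem[OF _ graded_subspace[OF TT_graded] _ z[unfolded spQ]])
  show "lin_on (cvec.span {tt M N a b |a b al be. a : fst M al & b : fst N be & al + be = ga}) (a k)"
   unfolding spQ[symmetric]
   by (rule lin_on_subset[OF lin_lin_on[OF a(1)]]) (use gcar_mem in blast)
  fix g assume "g : {tt M N a b |a b al be. a : fst M al & b : fst N be & al + be = ga}"
  then obtain x y al be where g: "g = tt M N x y" "x : fst M al" "y : fst N be" "ga = al + be" by blast
  have "tt M N (lact M k x) y : fst (TT M N) ((al + ldeg p k) + be)"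
   by (rule tt_deg[OF ObjD(3)[OF MN(1) g(2)] g(3)])
  then show "a k g : fst (TT M N) (ga + ldeg p k)"
   unfolding g(1) a(2)[OF gcar_mem[of _ "fst M", OF g(2)] gcar_mem[of _ "fst N", OF g(3)]] g(4) by (simp add: algebra_simps)
 qed
 obtain f where f: "Arrow (gtens (Lam p) (fst (TT M N))) f (fst (TT M N)) : Arr HH" "!!k v. v : car (TT M N) ==> f (lam k <*> v) = a k v"
  using lam_arrow_ex[OF TT_graded TT_graded lin_lin_on[OF a(1)] ad] by blast
 let ?f = "Arrow (gtens (Lam p) (fst (TT M N))) f (fst (TT M N))"
 have fs [simp]: "?f : Arr HH" "Dom HH ?f = gtens (Lam p) (fst (TT M N))" "Cod HH ?f = fst (TT M N)"
  using f(1) by (simp_all add: H_simps(2,3))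
 have gm: "H.gen p (gtens (Lam p) (gtens (fst M) (fst N))) {lam k <*> v | k v. v : {x <*> y | x y. x : car M & y : car N}}"
  by (rule H_gen_lam[OF H_gen]) (simp_all add: gcar_gtens tens_def)
 have gq: "H.gen p (gtens (Lam p) (fst (TT M N))) {lam k <*> v | k v. v : {tt M N x y | x y. x : car M & y : car N}}"
  by (rule H_gen_lam[OF H_gen[OF TT_graded car_TT_span]]) (simp_all add: cvec.span_eq_iff[THEN iffD2])
 let ?R = "Comp HH (pr M N) (Comp HH (TensA HH (snd M) (Id HH (fst N))) (Assoc HH (Lam p) (fst M) (fst N)))"
 have el_R: "amap ?R (lam k <*> (x <*> y)) = tt M N (lact M k x) y" if "x : car M" "y : car N" for k x y
  using that by (simp add: rt_elem_def lact_def)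
 have el_L: "amap (Comp HH r (TensA HH (Id HH (Lam p)) (pr M N))) (lam k <*> (x <*> y)) = amap r (lam k <*> tt M N x y)"
  if "x : car M" "y : car N" "r : Arr HH" "Dom HH r = gtens (Lam p) (fst (TT M N))" for k x y r
  using that by (simp add: rt_elem_def)
 have ex1: "EX!r. r : cat_hom HH (gtens (Lam p) (fst (TT M N))) (fst (TT M N)) &
   Comp HH r (TensA HH (Id HH (Lam p)) (pr M N)) = ?R"
 proof (rule ex1I[of _ ?f])
  have "Comp HH ?f (TensA HH (Id HH (Lam p)) (pr M N)) = ?R"
  proof (rule H.hom_eqI_gen[OF gm])
   fix g assume "g : {lam k <*> v | k v. v : {x <*> y | x y. x : car M & y : car N}}"
   then obtain k x y where g: "g = lam k <*> (x <*> y)" "x : car M" "y : car N" by blast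
   show "amap (Comp HH ?f (TensA HH (Id HH (Lam p)) (pr M N))) g = amap ?R g"
    unfolding g(1) el_R[OF g(2,3)] el_L[OF g(2,3) fs(1,2)] using f(2)[OF tt_mem[OF g(2,3)]] a(2)[OF g(2,3)] by simp
  qed auto
  then show "?f : cat_hom HH (gtens (Lam p) (fst (TT M N))) (fst (TT M N)) & Comp HH ?f (TensA HH (Id HH (Lam p)) (pr M N)) = ?R"
   by (simp add: cat_hom_def)
  fix r assume r: "r : cat_hom HH (gtens (Lam p) (fst (TT M N))) (fst (TT M N)) & Comp HH r (TensA HH (Id HH (Lam p)) (pr M N)) = ?R"
  note rh = cat_homD[OF conjunct1[OF r]]
  show "r = ?f"
  proof (rule H.hom_eqI_gen[OF gq])
   fix g assume "g : {lam k <*> v | k v. v : {tt M N x y | x y. x : car M & y : car N}}"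
   then obtain k x y where g: "g = lam k <*> tt M N x y" "x : car M" "y : car N" by blast
   have "amap r g = tt M N (lact M k x) y"
    unfolding g(1) el_L[OF g(2,3) rh(1,2), of k, symmetric] conjunct2[OF r] by (rule el_R[OF g(2,3)])
   then show "amap r g = amap ?f g"
    unfolding g(1) using f(2)[OF tt_mem[OF g(2,3)]] a(2)[OF g(2,3)] by simp
  qed (use rh in auto)
 qed
 have sndT: "snd (TT M N) = (THE r. r : cat_hom HH (gtens (Lam p) (fst (TT M N))) (fst (TT M N)) &
   Comp HH r (TensA HH (Id HH (Lam p)) (pr M N)) = ?R)"
  unfolding fst_TT unfolding rt_obj_def Let_def snd_conv LamAlg_Obj H_simps(4) by (rule refl)
 note r = theI'[OF ex1, folded sndT]
 show "snd (TT M N) : cat_hom HH (gtens (Lam p) (fst (TT M N))) (fst (TT M N))" using r by simp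
 fix k x y assume xy: "x : car M" "y : car N"
 note rh = cat_homD[OF conjunct1[OF r]]
 show "lact (TT M N) k (tt M N x y) = tt M N (lact M k x) y"
  unfolding lact_def[of "TT M N"] el_L[OF xy rh(1,2), of k, symmetric] conjunct2[OF r] by (rule el_R[OF xy])
qed

end

end

section \<open>The category of local modules\<close>

context lam_data
begin

lemma lambda_moduleI:
 assumes r: "snd M : cat_hom HH (gtens (Lam p) (fst M)) (fst M)" and A: "car M = cvec.span A"
  and e: "!!k l x. x : A ==> lact M k (lact M l x) = lact M (k + l) x" "!!x. x : A ==> lact M 0 x = x"
 shows "lambda_module p (fst M) (lact M)"
proof -
 note f = snd_hom_facts[OF r]
 have l: "lin_on (car M) (lact M k)" "x : car M ==> lact M k x : car M" for k x
  using f(5,6) unfolding lact_def[abs_def] by simp_all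
 have "lact M k (lact M l x) = lact M (k + l) x" if x: "x : car M" for k l x
  using lin_on_span_eq[of A "%x. lact M k (lact M l x)" "lact M (k + l)" x] lin_on_compose[OF l(1) l(1) l(2)] l(1) e(1) x
  unfolding A by blast
 moreover have "lact M 0 x = x" if x: "x : car M" for x
  using lin_on_span_eq[of A "lact M 0" "%x. x" x] l(1) lin_on_id e(2) x unfolding A by blast
 ultimately show ?thesis
  using f(1,7) l(1) unfolding lambda_module_def by (simp add: lact_def)
qed

lemma span_fst: "M : Obj MM ==> fst M al = cvec.span (fst M al)"
 by (rule span_graded[OF ObjD(1)])

lemma TT_Obj:
 assumes MN: "M : Obj MM" "N : Obj MM"
 shows "TT M N : Obj MM"
 unfolding MM_Obj
proof (intro conjI)
 show r: "snd (TT M N) : cat_hom HH (gtens (Lam p) (fst (TT M N))) (fst (TT M N))" by (rule TT_act(1)[OF MN])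
 have s: "car (TT M N) = cvec.span {tt M N x y | x y. x : car M & y : car N}"
  by (rule car_TT_span[OF MN]) (simp_all add: cvec.span_eq_iff[THEN iffD2])
 show "lambda_module p (fst (TT M N)) (lact (TT M N))"
  by (rule lambda_moduleI[OF r s]) (auto simp: TT_act(2)[OF MN] ObjD[OF MN(1)])
 show "integral (fst (TT M N))" unfolding integral_def
 proof (intro allI ballI impI)
  fix ga z assume z: "z : fst (TT M N) ga" "z ~= 0"
  show "ga : \<int>"
  proof (rule ccontr)
   assume n: "ga \<notin> \<int>"
   have "{tt M N a b |a b al be. a : fst M al & b : fst N be & al + be = ga} <= {0}"
   proof
    fix g assume "g : {tt M N a b |a b al be. a : fst M al & b : fst N be & al + be = ga}"
    then obtain a b al be where g: "g = tt M N a b" "a : fst M al" "b : fst N be" "al + be = ga" by blast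
    have ac: "a : car M" "b : car N" using gcar_mem g by blast+
    have "a = 0 \<or> b = 0" using ObjD(8)[OF MN(1) g(2)] ObjD(8)[OF MN(2) g(3)] n g(4) by auto
    then show "g : {0}"
     using lin_on_zero[OF bilin_onD1[OF tt_bilin[OF MN] ac(1)]] lin_on_zero[OF bilin_onD2[OF tt_bilin[OF MN] ac(2)]]
      cvec.subspace_0[OF subspace_gcar] g(1) by auto
   qed
   then have "fst (TT M N) ga <= {0}"
    using tt_span[OF MN span_fst[OF MN(1)] span_fst[OF MN(2)], of ga] cvec.span_mono[of _ "{0}"] by auto
   then show False using z by auto
  qed
 qed
 obtain Z where Z: "finite Z" "Z <= (UN al. fst M al)" "car M = cvec.span {lact M k z | k z. z : Z}"
  using MN(1) by (auto simp: MM_Obj lam_generated_def)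
 obtain Y where Y: "finite Y" "Y <= (UN al. fst N al)" "car N = cvec.span {lact N k z | k z. z : Y}"
  using MN(2) by (auto simp: MM_Obj lam_generated_def)
 let ?W = "(%(z, y). tt M N z y) ` (Z \<times> Y)"
 let ?G = "{lact (TT M N) k w | k w. w : ?W}"
 have "{tt M N a b | a b. a : {lact M k z | k z. z : Z} & b : {lact N k z | k z. z : Y}} <= cvec.span ?G"
 proof
  fix g assume "g : {tt M N a b | a b. a : {lact M k z | k z. z : Z} & b : {lact N k z | k z. z : Y}}"
  then obtain k z l y where g: "g = tt M N (lact M k z) (lact N l y)" "z : Z" "y : Y" by blast
  obtain al where z: "z : fst M al" using Z(2) g(2) by auto
  obtain be where y: "y : fst N be" using Y(2) g(3) by auto
  have c: "z : car M" "y : car N" using gcar_mem z y by blast+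
  have "g = ex l (al + ldeg p k) *\<^sub>C tt M N (lact M l (lact M k z)) y"
   unfolding g(1) by (rule tt_balanced[OF MN ObjD(3)[OF MN(1) z] c(2)])
  also have "tt M N (lact M l (lact M k z)) y = lact (TT M N) (l + k) (tt M N z y)"
   using TT_act(2)[OF MN c] ObjD(4)[OF MN(1) c(1)] by simp
  finally have ge: "g = ex l (al + ldeg p k) *\<^sub>C lact (TT M N) (l + k) (tt M N z y)" .
  have "tt M N z y : ?W" using g(2,3) by auto
  then show "g : cvec.span ?G" unfolding ge by (intro cvec.span_scale cvec.span_base) blast
 qed
 then have "car (TT M N) <= cvec.span ?G" unfolding car_TT_span[OF MN Z(3) Y(3)] by (intro cvec.span_minimal) auto
 moreover have "cvec.span ?G <= car (TT M N)"
 proof (intro cvec.span_minimal subspace_gcar subsetI)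
  fix g assume "g : ?G"
  then obtain k z y where g: "g = lact (TT M N) k (tt M N z y)" "z : Z" "y : Y" by auto
  have c: "z : car M" "y : car N" using gcar_mem Z(2) Y(2) g by blast+
  show "g : car (TT M N)" unfolding g(1) TT_act(2)[OF MN c] by (rule tt_mem[OF MN ObjD(6)[OF MN(1) c(1)] c(2)])
 qed
 ultimately have "car (TT M N) = cvec.span ?G" by blast
 moreover have "?W <= (UN al. fst (TT M N) al)"
 proof
  fix w assume "w : ?W"
  then obtain z y where w: "w = tt M N z y" "z : Z" "y : Y" by auto
  obtain al be where "z : fst M al" "y : fst N be" using Z(2) Y(2) w by blast
  then show "w : (UN al. fst (TT M N) al)" using tt_deg[OF MN] w(1) by blast
 qed
 moreover have "finite ?W" using Z(1) Y(1) by simp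
 ultimately show "lam_generated (fst (TT M N)) (lact (TT M N))" unfolding lam_generated_def by blast
qed

lemma MM_simps:
 "Dom MM = src" "Cod MM = tgt" "Id MM M = Arrow M (Id HH (fst M)) M"
 "Comp MM g f = Arrow (src f) (Comp HH (amap g) (amap f)) (tgt g)" "TensO MM = rt_obj HH LA" "Unit MM = unit_module LA"
 "TensA MM f g = Arrow (TT (src f) (src g)) (THE h. h : cat_hom HH (fst (TT (src f) (src g))) (fst (TT (tgt f) (tgt g))) &
   Comp HH h (pr (src f) (src g)) = Comp HH (pr (tgt f) (tgt g)) (TensA HH (amap f) (amap g))) (TT (tgt f) (tgt g))"
 by (simp_all add: Mcat_def local_modules_def Let_def)

lemma MM_Arr: "f : Arr MM \<longleftrightarrow> src f : Obj MM & tgt f : Obj MM & amap f : module_homs HH LA (src f) (tgt f)"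
 by (simp add: Mcat_def local_modules_def Let_def)

lemma MM_ArrI:
 assumes "M : Obj MM" "N : Obj MM" "h : cat_hom HH (fst M) (fst N)" "car M = cvec.span A"
  and "!!k x. x : A ==> amap h (lact M k x) = lact N k (amap h x)"
 shows "Arrow M h N : Arr MM"
 using module_homs_iff[OF ObjD(7)[OF assms(1)] ObjD(7)[OF assms(2)] H_gen[OF ObjD(1)[OF assms(1)] assms(4)], of h] assms
 by (simp add: MM_Arr)

lemma MM_ArrD:
 assumes "f : Arr MM"
 shows "src f : Obj MM" "tgt f : Obj MM" "amap f : cat_hom HH (fst (src f)) (fst (tgt f))"
  "x : car (src f) ==> amap (amap f) (lact (src f) k x) = lact (tgt f) k (amap (amap f) x)"
proof -
 show s: "src f : Obj MM" "tgt f : Obj MM" using assms by (auto simp: MM_Arr)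
 have "H.gen p (fst (src f)) (car (src f))" by (rule H_gen[OF ObjD(1)[OF s(1)]]) (simp add: cvec.span_eq_iff[THEN iffD2])
 from module_homs_iff[OF ObjD(7)[OF s(1)] ObjD(7)[OF s(2)] this, of "amap f"]
 show "amap f : cat_hom HH (fst (src f)) (fst (tgt f))"
  "x : car (src f) ==> amap (amap f) (lact (src f) k x) = lact (tgt f) k (amap (amap f) x)"
  using assms by (auto simp: MM_Arr)
qed

lemma MM_Arr_el:
 assumes "f : Arr MM"
 shows "amap (amap f) : lin (car (src f)) (car (tgt f))" "x : fst (src f) al ==> amap (amap f) x : fst (tgt f) al"
 using H_ArrD[OF cat_homD(1)[OF MM_ArrD(3)[OF assms]]] MM_ArrD(3)[OF assms] by (auto simp: H_hom)

lemma MM_category: "category MM"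
proof (unfold_locales, goal_cases)
 case (1 f) then show ?case by (simp add: MM_simps MM_ArrD)
next
 case (2 f) then show ?case by (simp add: MM_simps MM_ArrD)
next
 case (3 X)
 have "Arrow X (Id HH (fst X)) X : Arr MM"
  by (rule MM_ArrI[OF 3 3 H.Id_hom, of "car X"]) (use ObjD[OF 3] in "simp_all add: cvec.span_eq_iff[THEN iffD2]")
 then show ?case by (simp add: cat_hom_def MM_simps)
next
 case (4 f X Y g Z)
 then have f: "f : Arr MM" "g : Arr MM" "src f = X" "tgt f = Y" "src g = Y" "tgt g = Z" by (auto simp: cat_hom_def MM_simps)
 note F = MM_ArrD[OF f(1), unfolded f] and G = MM_ArrD[OF f(2), unfolded f]
 note Fh = cat_homD[OF F(3)] and Gh = cat_homD[OF G(3)]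
 have "Arrow X (Comp HH (amap g) (amap f)) Z : Arr MM"
 proof (rule MM_ArrI[OF F(1) G(2) H.Comp_hom[OF F(3) G(3)], of "car X"])
  fix k x assume x: "x : car X"
  have fx: "amap (amap f) x : car Y" using lin_mem[OF MM_Arr_el(1)[OF f(1)]] x f by simp
  show "amap (Comp HH (amap g) (amap f)) (lact X k x) = lact Z k (amap (Comp HH (amap g) (amap f)) x)"
   using x fx ObjD(6)[OF F(1) x] Fh Gh F(4) G(4) by simp
 qed (simp add: cvec.span_eq_iff[THEN iffD2])
 then show ?case using f by (simp add: cat_hom_def MM_simps)
next
 case (5 f X Y)
 then have f: "f : Arr MM" "src f = X" "tgt f = Y" by (auto simp: cat_hom_def MM_simps)
 show ?case using H.Comp_Id[OF MM_ArrD(3)[OF f(1)]] f by (cases f) (simp add: MM_simps)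
next
 case (6 f X Y)
 then have f: "f : Arr MM" "src f = X" "tgt f = Y" by (auto simp: cat_hom_def MM_simps)
 show ?case using H.Id_Comp[OF MM_ArrD(3)[OF f(1)]] f by (cases f) (simp add: MM_simps)
next
 case (7 f X Y g Z h W)
 then have f: "f : Arr MM" "g : Arr MM" "h : Arr MM" "src f = X" "tgt f = Y" "src g = Y" "tgt g = Z" "src h = Z" "tgt h = W"
  by (auto simp: cat_hom_def MM_simps)
 show ?case using H.Comp_assoc[of "amap f" p "fst X" "fst Y" "amap g" "fst Z" "amap h" "fst W"]
   MM_ArrD(3)[OF f(1)] MM_ArrD(3)[OF f(2)] MM_ArrD(3)[OF f(3)] f by (simp add: MM_simps)
qed

abbreviation el :: "(lmod, (gspace, cvec => cvec) arrow) arrow => cvec => cvec" where "el f \<equiv> amap (amap f)"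

lemma MM_concrete: "concrete_category MM car fst el \<int>"
proof (intro concrete_category.intro[OF MM_category] concrete_category_axioms.intro, goal_cases)
 case (1 X)
 show ?case
 proof
  show "cvec.span (UN al:\<int>. fst X al) <= car X"
   by (intro cvec.span_minimal subspace_gcar) (use gcar_mem in blast)
  have "x : cvec.span (UN al:\<int>. fst X al)" if x: "x : fst X al" for x al
   using ObjD(8)[OF 1 x] x by (auto intro: cvec.span_base cvec.span_zero)
  then show "car X <= cvec.span (UN al:\<int>. fst X al)" unfolding gcar_def by (intro cvec.span_minimal) auto
 qed
next
 case (2 f) then show ?case using MM_Arr_el by (simp add: MM_simps)
next
 case (3 f i x) then show ?case using MM_Arr_el by (simp add: MM_simps)
next
 case (4 f g)
 then have "amap f = amap g"
  using H.hom_inj[of "amap f" p "amap g"] cat_homD[OF MM_ArrD(3)[of f]] cat_homD[OF MM_ArrD(3)[of g]] by (simp add: MM_simps)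
 with 4 show ?case by (cases f; cases g) (simp add: MM_simps)
next
 case (5 X x) then show ?case using ObjD(1) by (simp add: MM_simps)
next
 case (6 f g x)
 then show ?case using cat_homD[OF MM_ArrD(3)[of f]] cat_homD[OF MM_ArrD(3)[of g]] by (simp add: MM_simps)
next
 case (7 f)
 note f = MM_ArrD[OF 7(1)] and fh = cat_homD[OF MM_ArrD(3)[OF 7(1)]]
 have b: "bij_betw (el f) (car (src f)) (car (tgt f))" using 7 by (simp add: MM_simps)
 obtain g where g: "g : cat_hom HH (fst (tgt f)) (fst (src f))" "!!y. y : car (tgt f) ==> el f (amap g y) = y"
  using H.inverse_hom[OF fh(1)] b fh by auto
 have gl: "amap g y : car (src f)" if "y : car (tgt f)" for y
  using H.el_car[OF cat_homD(1)[OF g(1)]] cat_homD[OF g(1)] that by simp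
 have "Arrow (tgt f) g (src f) : Arr MM"
 proof (rule MM_ArrI[OF f(2,1) g(1), of "car (tgt f)"])
  fix k y assume y: "y : car (tgt f)"
  note ky = ObjD(6)[OF f(2) y, of k]
  have "el f (amap g (lact (tgt f) k y)) = el f (lact (src f) k (amap g y))"
   using g(2)[OF ky] f(4)[OF gl[OF y]] g(2)[OF y] by simp
  then show "amap g (lact (tgt f) k y) = lact (src f) k (amap g y)"
   using b gl[OF ky] ObjD(6)[OF f(1) gl[OF y]] by (auto simp: bij_betw_def inj_on_def)
 qed (simp add: cvec.span_eq_iff[THEN iffD2])
 then show ?case using g(2) by (intro bexI[of _ "Arrow (tgt f) g (src f)"]) (auto simp: cat_hom_def MM_simps)
qed

lemma fst_TensA_hom:
 assumes f: "f : Arr MM" and g: "g : Arr MM"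
 shows "TensA MM f g : Arr MM" "!!x y. x : car (src f) ==> y : car (src g) ==> 
  el (TensA MM f g) (tt (src f) (src g) x y) = tt (tgt f) (tgt g) (el f x) (el g y)"
proof -
 note F = MM_ArrD[OF f] and G = MM_ArrD[OF g]
 note Fh = cat_homD[OF F(3)] and Gh = cat_homD[OF G(3)] and T = pr_Arr[OF F(2) G(2)]
 have fm: "el f x : car (tgt f)" if "x : car (src f)" for x using lin_mem[OF MM_Arr_el(1)[OF f]] that by simp
 have gm: "el g x : car (tgt g)" if "x : car (src g)" for x using lin_mem[OF MM_Arr_el(1)[OF g]] that by simp
 let ?K = "Comp HH (pr (tgt f) (tgt g)) (TensA HH (amap f) (amap g))"
 have K: "?K : Arr HH" "Dom HH ?K = gtens (fst (src f)) (fst (src g))" "Cod HH ?K = fst (TT (tgt f) (tgt g))"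
  using Fh Gh T by simp_all
 have Kel: "amap ?K (x <*> y) = tt (tgt f) (tgt g) (el f x) (el g y)" if "x : car (src f)" "y : car (src g)" for x y
  using Fh Gh T that by (simp add: rt_elem_def)
 have bal: "amap ?K (x <*> lact (src g) k y) = ex k al *\<^sub>C amap ?K (lact (src f) k x <*> y)"
  if x: "x : fst (src f) al" and y: "y : fst (src g) be" for k al be x y
 proof -
  have c: "x : car (src f)" "y : car (src g)" using gcar_mem x y by blast+
  show ?thesis
   unfolding Kel[OF c(1) ObjD(6)[OF G(1) c(2)]] Kel[OF ObjD(6)[OF F(1) c(1)] c(2)] G(4)[OF c(2)] F(4)[OF c(1)]
   by (rule tt_balanced[OF F(2) G(2) MM_Arr_el(2)[OF f x] gm[OF c(2)]])
 qed
 note h = rt_the[OF F(1) G(1) K(1,2) bal, unfolded K(3)]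
 have e: "TensA MM f g = Arrow (TT (src f) (src g)) (THE h. h : cat_hom HH (fst (TT (src f) (src g))) (fst (TT (tgt f) (tgt g))) &
   Comp HH h (pr (src f) (src g)) = ?K) (TT (tgt f) (tgt g))" by (simp add: MM_simps)
 show el: "!!x y. x : car (src f) ==> y : car (src g) ==> 
  el (TensA MM f g) (tt (src f) (src g) x y) = tt (tgt f) (tgt g) (el f x) (el g y)"
  unfolding e arrow.sel using h(2) Kel by simp
 show "TensA MM f g : Arr MM" unfolding e
 proof (rule MM_ArrI[OF TT_Obj[OF F(1) G(1)] TT_Obj[OF F(2) G(2)] h(1)])
  show "car (TT (src f) (src g)) = cvec.span {tt (src f) (src g) a b |a b. a : car (src f) & b : car (src g)}"
   by (rule car_TT_span[OF F(1) G(1)]) (simp_all add: cvec.span_eq_iff[THEN iffD2])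
  fix k z assume "z : {tt (src f) (src g) a b |a b. a : car (src f) & b : car (src g)}"
  then obtain x y where z: "z = tt (src f) (src g) x y" "x : car (src f)" "y : car (src g)" by blast
  note E = el[unfolded e arrow.sel]
  show "amap (THE h. h : cat_hom HH (fst (TT (src f) (src g))) (fst (TT (tgt f) (tgt g))) & Comp HH h (pr (src f) (src g)) = ?K) (lact (TT (src f) (src g)) k z)
   = lact (TT (tgt f) (tgt g)) k (amap (THE h. h : cat_hom HH (fst (TT (src f) (src g))) (fst (TT (tgt f) (tgt g))) & Comp HH h (pr (src f) (src g)) = ?K) z)"
   unfolding z(1) TT_act(2)[OF F(1) G(1) z(2,3)] E[OF ObjD(6)[OF F(1) z(2)] z(3)] E[OF z(2,3)]
    TT_act(2)[OF F(2) G(2) fm[OF z(2)] gm[OF z(3)]] F(4)[OF z(2)] ..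
 qed
qed

lemma MM_tensor: "concrete_tensor MM car fst el \<int> tt (+)"
proof (intro concrete_tensor.intro[OF MM_concrete] concrete_tensor_axioms.intro, goal_cases)
 case (1 X Y) then show ?case using TT_Obj by (simp add: MM_simps)
next
 case (3 X Y) then show ?case using tt_bilin by simp
next
 case (4 X Y a b x y) then show ?case using tt_deg by (simp add: MM_simps)
next
 case (5 X Y) then show ?case
  using car_TT_span[of X Y "car X" "car Y"] by (simp add: MM_simps cvec.span_eq_iff[THEN iffD2])
next
 case (6 f g) then show ?case using fst_TensA_hom by simp
next
 case (9 f g x y) then show ?case using fst_TensA_hom by (simp add: MM_simps(1,2))
qed (auto simp: MM_simps)

end

section \<open>The balanced structure of local modules\<close>

lemma H_Twist_bij:
 assumes V: "graded V"
 shows "bij_betw (amap (Twist (Hcat p) V)) (gcar V) (gcar V)"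
proof -
 note T = H_Twist[OF V, where p = p]
 have Tl: "amap (Twist (Hcat p) V) : lin (gcar V) (gcar V)" using H.el_lin[OF cat_homD(1)[OF T(1)]] cat_homD[OF T(1)] by simp
 obtain f where f: "f : lin (gcar V) UNIV" "!!al v. v : V al ==> f v = inverse (hexp p (al\<^sup>2)) *\<^sub>C v"
  using graded_extend[OF V lin_on_comp_scale[OF lin_on_id], of "%al. inverse (hexp p (al\<^sup>2))"] by blast
 have fl: "f : lin (gcar V) (gcar V)"
  by (rule graded_range[OF f(1)]) (simp add: f(2) cvec.subspace_scale[OF graded_subspace[OF V]])
 have 1: "f (amap (Twist (Hcat p) V) x) = x" if x: "x : gcar V" for x
 proof (rule lin_on_span_eq[of "UN al. V al" "%x. f (amap (Twist (Hcat p) V) x)" "%x. x"])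
  show "lin_on (cvec.span (UN al. V al)) (%x. f (amap (Twist (Hcat p) V) x))"
   unfolding gcar_span[symmetric] by (rule lin_on_compose[OF lin_lin_on[OF fl] lin_lin_on[OF Tl] lin_mem[OF Tl]])
  fix v assume "v : (UN al. V al)"
  then obtain al where v: "v : V al" by auto
  show "f (amap (Twist (Hcat p) V) v) = v"
   using lin_on_scale[OF lin_lin_on[OF fl] gcar_mem[of v V, OF v]] by (simp add: T(2)[OF v] f(2)[OF v])
 qed (use x in "simp_all add: gcar_span lin_intros")
 have 2: "amap (Twist (Hcat p) V) (f x) = x" if x: "x : gcar V" for x
 proof (rule lin_on_span_eq[of "UN al. V al" "%x. amap (Twist (Hcat p) V) (f x)" "%x. x"])
  show "lin_on (cvec.span (UN al. V al)) (%x. amap (Twist (Hcat p) V) (f x))"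
   unfolding gcar_span[symmetric] by (rule lin_on_compose[OF lin_lin_on[OF Tl] lin_lin_on[OF fl] lin_mem[OF fl]])
  fix v assume "v : (UN al. V al)"
  then obtain al where v: "v : V al" by auto
  show "amap (Twist (Hcat p) V) (f v) = v"
   using lin_on_scale[OF lin_lin_on[OF Tl] gcar_mem[of v V, OF v]] by (simp add: T(2)[OF v] f(2)[OF v])
 qed (use x in "simp_all add: gcar_span lin_intros")
 show ?thesis
  by (rule bij_betw_byWitness[where f' = f]) (use 1 2 lin_mem[OF fl] lin_mem[OF Tl] in auto)
qed

context lam_data
begin

definition UM :: lmod where "UM = unit_module LA"

lemma fst_UM: "fst UM = Lam p" and snd_UM: "snd UM = algMul LA"
 by (simp_all add: UM_def unit_module_def)

lemma lact_UM: "lact UM k (lam l) = lam (k + l)"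
 by (simp add: lact_def snd_UM)

lemma UM_Obj: "UM : Obj MM"
 unfolding MM_Obj
proof (intro conjI)
 show r: "snd UM : cat_hom HH (gtens (Lam p) (fst UM)) (fst UM)" unfolding fst_UM snd_UM by (rule LamAlg_Mul(1))
 have s: "car UM = cvec.span (range lam)" by (simp add: fst_UM span_lam)
 show "lambda_module p (fst UM) (lact UM)"
  by (rule lambda_moduleI[OF r s]) (auto simp: lact_UM add.assoc)
 show "integral (fst UM)" unfolding integral_def fst_UM
 proof (intro allI ballI impI)
  fix al x assume x: "x : Lam p al" "x ~= 0"
  then have "{lam k |k. al = ldeg p k} ~= {}" unfolding Lam_def by (metis cvec.span_empty singletonD)
  then obtain k where "al = ldeg p k" by auto
  then show "al : \<int>" by (simp only: Ints_of_int)
 qed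
 have "{lact UM k z | k z. z : {lam 0}} = range lam" by (auto simp: lact_UM)
 moreover have "{lam 0} <= (UN al. fst UM al)" using lam_Lam[of 0 p] by (auto simp: fst_UM)
 ultimately show "lam_generated (fst UM) (lact UM)" unfolding lam_generated_def s by (intro exI[of _ "{lam 0}"] conjI) simp_all
qed

lemma ex_int_add: "ex (k + l) al = ex k al * ex l al"
 by (simp add: ex_def ring_distribs exp_add)

lemma ex_0 [simp]: "ex 0 al = 1" "ex k 0 = 1" by (simp_all add: ex_def)

lemma lact_sum_deg: "M : Obj MM ==> x : fst M al ==> x : car M"
 using gcar_mem by blast

lemma tt_lin2: "M : Obj MM ==> N : Obj MM ==> x : car M ==> lin_on (car N) (tt M N x)"
 by (rule bilin_onD1[OF tt_bilin])
lemma tt_lin1: "M : Obj MM ==> N : Obj MM ==> y : car N ==> lin_on (car M) (%x. tt M N x y)"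
 by (rule bilin_onD2[OF tt_bilin])

text \<open>
  A morphism on \<open>M \<otimes> N\<close> that is balanced and compatible with the actions induces a module morphism on the
  relative tensor product; both conditions need to be checked on homogeneous generators only.
\<close>

lemma rt_hom:
 assumes O: "M : Obj MM" "N : Obj MM" "L : Obj MM"
  and K: "K : Arr HH" "Dom HH K = gtens (fst M) (fst N)" "Cod HH K = fst L"
  and AB: "!!al. fst M al = cvec.span (A al)" "!!be. fst N be = cvec.span (B be)"
  and e: "!!k al be x y. x : A al ==> y : B be ==> amap K (x <*> lact N k y) = ex k al *\<^sub>C lact L k (amap K (x <*> y))"
   "!!k al be x y. x : A al ==> y : B be ==> amap K (lact M k x <*> y) = lact L k (amap K (x <*> y))"
 defines "h \<equiv> THE h. h : cat_hom HH (fst (TT M N)) (fst L) & Comp HH h (pr M N) = K"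
 shows "Arrow (TT M N) h L : cat_hom MM (TT M N) L"
  and "!!x y. x : car M ==> y : car N ==> amap h (tt M N x y) = amap K (x <*> y)"
proof -
 have Kl: "amap K : lin (gcar (gtens (fst M) (fst N))) (car L)" using H.el_lin[OF K(1)] by (simp add: K)
 have Km: "amap K (x <*> y) : car L" if "x : car M" "y : car N" for x y using lin_mem[OF Kl] that by simp
 have Kb: "bilin_on (car M) (car N) (%x y. amap K (x <*> y))"
  by (intro bilin_onI lin_on_compose[OF lin_lin_on[OF Kl]] lin_intros) simp_all
 note lM = ObjD(2)[OF O(1)] ObjD(6)[OF O(1)] and lN = ObjD(2)[OF O(2)] ObjD(6)[OF O(2)] and lL = ObjD(2)[OF O(3)]
 have b: "bilin_on (car M) (car N) (%x y. amap K (x <*> lact N k y))" "bilin_on (car M) (car N) (%x y. amap K (lact M k x <*> y))"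
  "bilin_on (car M) (car N) (%x y. c *\<^sub>C lact L k (amap K (x <*> y)))" for k c
  by (intro bilin_onI lin_on_compose[OF bilin_onD1[OF Kb] lN] lin_on_compose[OF bilin_onD2[OF Kb] lM] bilin_onD1[OF Kb] bilin_onD2[OF Kb]
   lM(2) lN(2) lin_on_comp_scale lin_on_compose[OF lL bilin_onD1[OF Kb]] lin_on_compose[OF lL bilin_onD2[OF Kb]] Km; assumption)+
 have sub: "fst M al <= car M" "fst N al <= car N" for al using gcar_mem by blast+
 have r: "bilin_on (cvec.span (A al)) (cvec.span (B be)) f" if "bilin_on (car M) (car N) f" for f al be
  unfolding AB[symmetric] by (intro bilin_onI lin_on_subset[OF bilin_onD1[OF that]] lin_on_subset[OF bilin_onD2[OF that]] subsetD[OF sub(1)] subsetD[OF sub(2)] sub)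
 have e1: "amap K (x <*> lact N k y) = ex k al *\<^sub>C lact L k (amap K (x <*> y))" if "x : fst M al" "y : fst N be" for x y k al be
  by (rule bilin_on_span_eq[OF r[OF b(1)] r[OF b(3)] _ that[unfolded AB]]) (rule e(1))
 have e2: "amap K (lact M k x <*> y) = lact L k (amap K (x <*> y))" if "x : fst M al" "y : fst N be" for x y k al be
  using bilin_on_span_eq[OF r[OF b(2)[of k]] r[OF b(3)[of 1 k]] _ that[unfolded AB]] e(2) by simp
 have h: "h : cat_hom HH (fst (TT M N)) (fst L)" and he: "!!x y. x : car M ==> y : car N ==> amap h (tt M N x y) = amap K (x <*> y)"
  unfolding h_def by (rule rt_the[OF O(1,2) K(1,2), unfolded K(3)]; simp add: e1 e2; fail | assumption)+
 show "!!x y. x : car M ==> y : car N ==> amap h (tt M N x y) = amap K (x <*> y)" by (rule he)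
 have "Arrow (TT M N) h L : Arr MM"
 proof (rule MM_ArrI[OF TT_Obj[OF O(1,2)] O(3) h car_TT_span[OF O(1,2) gcar_span gcar_span]])
  fix k z assume "z : {tt M N a b |a b. a : (UN al. fst M al) & b : (UN al. fst N al)}"
  then obtain x al y be where z: "z = tt M N x y" "x : fst M al" "y : fst N be" by blast
  note c = lact_sum_deg[OF O(1) z(2)] lact_sum_deg[OF O(2) z(3)]
  show "amap h (lact (TT M N) k z) = lact L k (amap h z)"
   unfolding z(1) TT_act(2)[OF O(1,2) c] he[OF lM(2)[OF c(1)] c(2)] he[OF c] by (rule e2[OF z(2,3)])
 qed
 then show "Arrow (TT M N) h L : cat_hom MM (TT M N) L" by (simp add: cat_hom_def MM_simps)
qed

lemma lam_UM: "lam k : car UM" "lam 0 : fst UM (ldeg p 0)" unfolding fst_UM by (simp, rule lam_Lam)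

lemma span_UM: "fst UM al = cvec.span {lam k |k. al = ldeg p k}" by (simp add: fst_UM Lam_def)

lemma MM_LUnit:
 assumes M: "M : Obj MM"
 shows "LUnit MM M : cat_hom MM (TT UM M) M" "!!x. x : car M ==> el (LUnit MM M) (tt UM M (lam 0) x) = x"
  "car (TT UM M) <= tt UM M (lam 0) ` car M"
proof -
 note O = UM_Obj M
 have K: "snd M : Arr HH" "Dom HH (snd M) = gtens (fst UM) (fst M)" "Cod HH (snd M) = fst M" using MN_simps[OF O] by (simp_all add: fst_UM)
 let ?h = "THE h. h : cat_hom HH (fst (TT UM M)) (fst M) & Comp HH h (pr UM M) = snd M"
 have L: "LUnit MM M = Arrow (TT UM M) ?h M" by (simp add: Mcat_def local_modules_def Let_def UM_def)
 have e: "!!k al be x y. x : {lam k |k. al = ldeg p k} ==> y : fst M be ==> amap (snd M) (x <*> lact M k y) = ex k al *\<^sub>C lact M k (amap (snd M) (x <*> y))"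
  "!!k al be x y. x : {lam k |k. al = ldeg p k} ==> y : fst M be ==> amap (snd M) (lact UM k x <*> y) = lact M k (amap (snd M) (x <*> y))"
 proof -
  fix k al be x y assume "x : {lam k |k. al = ldeg p k}" and y: "y : fst M be"
  then obtain l where x: "x = lam l" "al = ldeg p l" by blast
  note c = lact_sum_deg[OF M y]
  show "amap (snd M) (x <*> lact M k y) = ex k al *\<^sub>C lact M k (amap (snd M) (x <*> y))"
   unfolding x ex_ldeg using lact_commute[OF M c, of l k] by (simp add: lact_def)
  show "amap (snd M) (lact UM k x <*> y) = lact M k (amap (snd M) (x <*> y))"
   unfolding x lact_UM using ObjD(4)[OF M c, of k l] by (simp add: lact_def)
 qed
 have h: "Arrow (TT UM M) ?h M : cat_hom MM (TT UM M) M"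
  "!!x y. x : car UM ==> y : car M ==> amap ?h (tt UM M x y) = amap (snd M) (x <*> y)"
  by (rule rt_hom[OF O M K span_UM span_fst[OF M]]; (erule (1) e | assumption))+
 show "LUnit MM M : cat_hom MM (TT UM M) M" unfolding L by (rule h(1))
 show "!!x. x : car M ==> el (LUnit MM M) (tt UM M (lam 0) x) = x" using h(2)[OF lam_UM(1)] ObjD(5)[OF M] by (simp add: L lact_def)
 have sp: "car (TT UM M) = cvec.span {tt UM M a b |a b. a : range lam & b : car M}"
  by (rule car_TT_span[OF O]) (simp_all add: fst_UM span_lam cvec.span_eq_iff[THEN iffD2])
 show "car (TT UM M) <= tt UM M (lam 0) ` car M"
  unfolding sp
 proof (rule cvec.span_minimal[OF subsetI subspace_lin_image[OF subspace_gcar bilin_onD1[OF tt_bilin[OF O] lam_UM(1)]]])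
  fix z assume "z : {tt UM M a b |a b. a : range lam & b : car M}"
  then obtain l y where z: "z = tt UM M (lam l) y" "y : car M" by blast
  have "z = tt UM M (lam 0) (lact M l y)" using tt_balanced[OF O lam_UM(2) z(2), of l] by (simp add: z(1) lact_UM)
  then show "z : tt UM M (lam 0) ` car M" using ObjD(6)[OF M z(2)] by blast
 qed
qed

lemma MM_RUnit:
 assumes M: "M : Obj MM"
 shows "RUnit MM M : cat_hom MM (TT M UM) M" "!!x. x : car M ==> el (RUnit MM M) (tt M UM x (lam 0)) = x"
  "car (TT M UM) <= (%x. tt M UM x (lam 0)) ` car M"
proof -
 note O = M UM_Obj
 let ?K = "Comp HH (snd M) (Braid HH (fst M) (Lam p))"
 have K: "?K : Arr HH" "Dom HH ?K = gtens (fst M) (fst UM)" "Cod HH ?K = fst M" using MN_simps[OF O] by (simp_all add: fst_UM)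
 note Kel = el_right_action[OF O]
 let ?h = "THE h. h : cat_hom HH (fst (TT M UM)) (fst M) & Comp HH h (pr M UM) = ?K"
 have L: "RUnit MM M = Arrow (TT M UM) ?h M" by (simp add: Mcat_def local_modules_def Let_def UM_def)
 have e: "!!k al be x y. x : fst M al ==> y : {lam k |k. be = ldeg p k} ==> amap ?K (x <*> lact UM k y) = ex k al *\<^sub>C lact M k (amap ?K (x <*> y))"
  "!!k al be x y. x : fst M al ==> y : {lam k |k. be = ldeg p k} ==> amap ?K (lact M k x <*> y) = lact M k (amap ?K (x <*> y))"
 proof -
  fix k al be x y assume x: "x : fst M al" and "y : {lam k |k. be = ldeg p k}"
  then obtain l where y: "y = lam l" by blast
  note c = lact_sum_deg[OF M x]
  have a: "lact M k (amap ?K (x <*> y)) = ex l al *\<^sub>C lact M (k + l) x"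
   unfolding y Kel[OF x] lin_on_scale[OF ObjD(2)[OF M] ObjD(6)[OF M c]] ObjD(4)[OF M c] ..
  show "amap ?K (x <*> lact UM k y) = ex k al *\<^sub>C lact M k (amap ?K (x <*> y))"
   unfolding a unfolding y lact_UM Kel[OF x] ex_int_add by simp
  show "amap ?K (lact M k x <*> y) = lact M k (amap ?K (x <*> y))"
   unfolding a unfolding y Kel[OF ObjD(3)[OF M x]] ex_add ex_ldeg ObjD(4)[OF M c] by (simp add: add.commute)
 qed
 have h: "Arrow (TT M UM) ?h M : cat_hom MM (TT M UM) M"
  "!!x y. x : car M ==> y : car UM ==> amap ?h (tt M UM x y) = amap ?K (x <*> y)"
  by (rule rt_hom[OF O M K span_fst[OF M] span_UM]; (erule (1) e | assumption))+
 show "RUnit MM M : cat_hom MM (TT M UM) M" unfolding L by (rule h(1))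
 show "el (RUnit MM M) (tt M UM x (lam 0)) = x" if x: "x : car M" for x
 proof -
  have "amap ?K (x <*> lam 0) = x"
  proof (rule lin_on_span_eq[OF _ lin_on_id _ x[unfolded gcar_span], of "%x. amap ?K (x <*> lam 0)"])
   show "lin_on (cvec.span (UN al. fst M al)) (%x. amap ?K (x <*> lam 0))"
    unfolding gcar_span[symmetric] by (rule lin_on_compose[OF lin_lin_on[OF H.el_lin[OF K(1)]]]) (simp_all add: lin_intros K(2) fst_UM)
   show "!!y. y : (UN al. fst M al) ==> amap ?K (y <*> lam 0) = y" using Kel[of _ _ 0] ObjD(5)[OF M lact_sum_deg[OF M]] by auto
  qed
  then show ?thesis using h(2)[OF x lam_UM(1), of 0] by (simp add: L)
 qed
 have sp: "car (TT M UM) = cvec.span {tt M UM a b |a b. a : (UN al. fst M al) & b : range lam}"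
  by (rule car_TT_span[OF O]) (rule gcar_span, simp add: fst_UM span_lam)
 show "car (TT M UM) <= (%x. tt M UM x (lam 0)) ` car M"
  unfolding sp
 proof (rule cvec.span_minimal[OF subsetI subspace_lin_image[OF subspace_gcar bilin_onD2[OF tt_bilin[OF O] lam_UM(1)]]])
  fix z assume "z : {tt M UM a b |a b. a : (UN al. fst M al) & b : range lam}"
  then obtain l x al where z: "z = tt M UM x (lam l)" "x : fst M al" by blast
  note c = ObjD(6)[OF M lact_sum_deg[OF M z(2)], of l]
  have "z = tt M UM (ex l al *\<^sub>C lact M l x) (lam 0)"
   using tt_balanced[OF O z(2) lam_UM(1), of l 0] lin_on_scale[OF bilin_onD2[OF tt_bilin[OF O] lam_UM(1)] c] by (simp add: z(1) lact_UM)
  then show "z : (%x. tt M UM x (lam 0)) ` car M" using cvec.subspace_scale[OF subspace_gcar c] by blast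
 qed
qed

text \<open>Here locality enters: the double braiding with \<open>1\<^sub>k\<close> is trivial on integral degrees.\<close>

lemma ex_square_act:
 assumes M: "M : Obj MM" and x: "x : fst M al"
 shows "(ex k al * ex k al) *\<^sub>C x = x"
 using ObjD(8)[OF M x] ex_square by auto

lemma MM_Braid:
 assumes O: "M : Obj MM" "N : Obj MM"
 shows "Braid MM M N : cat_hom MM (TT M N) (TT N M)"
  "!!al be x y. x : fst M al ==> y : fst N be ==> el (Braid MM M N) (tt M N x y) = hexp p (al * be) *\<^sub>C tt N M y x"
proof -
 note O' = O(2,1)
 note s = MN_simps[OF O] pr_Arr[OF O] pr_Arr[OF O'] TT_graded[OF O']
 let ?K = "Comp HH (pr N M) (Braid HH (fst M) (fst N))"
 have K: "?K : Arr HH" "Dom HH ?K = gtens (fst M) (fst N)" "Cod HH ?K = fst (TT N M)" using s by simp_all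
 have Kel: "amap ?K (x <*> y) = hexp p (al * be) *\<^sub>C tt N M y x" if "x : fst M al" "y : fst N be" for x y al be
 proof -
  have c: "x : car M" "y : car N" using gcar_mem that by blast+
  have "amap ?K (x <*> y) = amap (pr N M) (hexp p (al * be) *\<^sub>C (y <*> x))"
   using s c H_Braid(2)[where U = "fst M" and V = "fst N", OF s(1,2) that, of p] by simp
  also have "... = hexp p (al * be) *\<^sub>C tt N M y x"
   unfolding rt_elem_def using s c by (intro H.el_scale[where p = p]) simp_all
  finally show ?thesis .
 qed
 let ?h = "THE h. h : cat_hom HH (fst (TT M N)) (fst (TT N M)) & Comp HH h (pr M N) = ?K"
 have L: "Braid MM M N = Arrow (TT M N) ?h (TT N M)" by (simp add: Mcat_def local_modules_def Let_def)
 have e: "!!k al be x y. x : fst M al ==> y : fst N be ==> amap ?K (x <*> lact N k y) = ex k al *\<^sub>C lact (TT N M) k (amap ?K (x <*> y))"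
  "!!k al be x y. x : fst M al ==> y : fst N be ==> amap ?K (lact M k x <*> y) = lact (TT N M) k (amap ?K (x <*> y))"
 proof -
  fix k al be x y assume xy: "x : fst M al" "y : fst N be"
  note c = lact_sum_deg[OF O(1) xy(1)] lact_sum_deg[OF O(2) xy(2)] and m = tt_lin1[OF O' lact_sum_deg[OF O(1) xy(1)]]
  have a: "lact (TT N M) k (amap ?K (x <*> y)) = hexp p (al * be) *\<^sub>C tt N M (lact N k y) x"
   unfolding Kel[OF xy] lin_on_scale[OF ObjD(2)[OF TT_Obj[OF O']] tt_mem[OF O' c(2,1)]] TT_act(2)[OF O' c(2,1)] ..
  show "amap ?K (x <*> lact N k y) = ex k al *\<^sub>C lact (TT N M) k (amap ?K (x <*> y))"
   unfolding a Kel[OF xy(1) ObjD(3)[OF O(2) xy(2)]] distrib_left hexp_add hexp_ldeg by (simp add: mult.commute)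
  have w: "(ex k be * ex k be) *\<^sub>C tt N M (lact N k y) x = tt N M (lact N k y) x"
   using lin_on_scale[OF m ObjD(6)[OF O(2) c(2)], of _ k] ex_square_act[OF O(2) ObjD(3)[OF O(2) xy(2)], of k k] unfolding ex_add ex_ldeg mult_1_right by metis
  have "amap ?K (lact M k x <*> y) = hexp p (al * be) *\<^sub>C ((ex k be * ex k be) *\<^sub>C tt N M (lact N k y) x)"
   unfolding Kel[OF ObjD(3)[OF O(1) xy(1)] xy(2)] distrib_right hexp_add hexp_ldeg tt_balanced[OF O' xy(2) c(1)] cvec.scale_scale by (simp only: mult_ac)
  then show "amap ?K (lact M k x <*> y) = lact (TT N M) k (amap ?K (x <*> y))" unfolding a w .
 qed
 have h: "Arrow (TT M N) ?h (TT N M) : cat_hom MM (TT M N) (TT N M)"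
  "!!x y. x : car M ==> y : car N ==> amap ?h (tt M N x y) = amap ?K (x <*> y)"
  by (rule rt_hom[OF O TT_Obj[OF O'] K span_fst[OF O(1)] span_fst[OF O(2)]]; (erule (1) e | assumption))+
 show "Braid MM M N : cat_hom MM (TT M N) (TT N M)" unfolding L by (rule h(1))
 show "!!al be x y. x : fst M al ==> y : fst N be ==> el (Braid MM M N) (tt M N x y) = hexp p (al * be) *\<^sub>C tt N M y x"
  using h(2)[OF lact_sum_deg[OF O(1)] lact_sum_deg[OF O(2)]] Kel by (simp add: L)
qed

lemma MM_Twist:
 assumes M: "M : Obj MM"
 shows "Twist MM M : cat_iso MM M M" "!!al x. x : fst M al ==> el (Twist MM M) x = hexp p (al\<^sup>2) *\<^sub>C x"
proof -
 have T: "Twist MM M = Arrow M (Twist HH (fst M)) M" by (simp add: Mcat_def local_modules_def Let_def)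
 note H = H_Twist[OF ObjD(1)[OF M], where p = p]
 show e: "!!al x. x : fst M al ==> el (Twist MM M) x = hexp p (al\<^sup>2) *\<^sub>C x" using H(2) by (simp add: T)
 have "Twist MM M : Arr MM" unfolding T
 proof (rule MM_ArrI[OF M M H(1) gcar_span])
  fix k x assume "x : (UN al. fst M al)"
  then obtain al where x: "x : fst M al" by auto
  note xc = lact_sum_deg[OF M x]
  have "(al + ldeg p k)\<^sup>2 = al\<^sup>2 + (ldeg p k * al + (ldeg p k * al + ldeg p k * ldeg p k))" by (simp add: power2_eq_square algebra_simps)
  then have h: "hexp p ((al + ldeg p k)\<^sup>2) = hexp p (al\<^sup>2) * (ex k al * ex k al)"
   by (simp only: hexp_add hexp_ldeg ex_ldeg mult_1_right)
  have "(ex k (al + ldeg p k) * ex k (al + ldeg p k)) *\<^sub>C lact M k x = lact M k x" by (rule ex_square_act[OF M ObjD(3)[OF M x]])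
  then have "hexp p ((al + ldeg p k)\<^sup>2) *\<^sub>C lact M k x = hexp p (al\<^sup>2) *\<^sub>C lact M k x"
   unfolding h ex_add ex_ldeg by (simp flip: cvec.scale_scale)
  then show "amap (Twist HH (fst M)) (lact M k x) = lact M k (amap (Twist HH (fst M)) x)"
   unfolding H(2)[OF x] H(2)[OF ObjD(3)[OF M x]] lin_on_scale[OF ObjD(2)[OF M] xc] .
 qed
 then show "Twist MM M : cat_iso MM M M"
  using concrete_category.iso_of_bij[OF MM_concrete, of "Twist MM M"] H_Twist_bij[OF ObjD(1)[OF M], of p] by (simp add: T MM_simps(1,2))
qed

lemma rt_extend_gen:
 assumes O: "M : Obj MM" "N : Obj MM" and b: "bilin_on (car M) (car N) be"
  and AB: "!!al. fst M al = cvec.span (A al)" "car N = cvec.span B"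
  and bal: "!!k al x y. x : A al ==> y : B ==> be x (lact N k y) = ex k al *\<^sub>C be (lact M k x) y"
 shows "EX f:lin (car (TT M N)) UNIV. ALL x:car M. ALL y:car N. f (tt M N x y) = be x y"
proof (rule rt_extend[OF O b])
 fix k al x y assume x: "x : fst M al" and y: "y : car N"
 have sub: "fst M al <= car M" using gcar_mem by blast
 have r: "bilin_on (cvec.span (A al)) (cvec.span B) f" if "bilin_on (car M) (car N) f" for f
  unfolding AB[symmetric] by (intro bilin_onI lin_on_subset[OF bilin_onD2[OF that] sub] bilin_onD1[OF that] subsetD[OF sub])
 note lM = ObjD(2)[OF O(1)] ObjD(6)[OF O(1)] and lN = ObjD(2)[OF O(2)] ObjD(6)[OF O(2)]
 have "bilin_on (car M) (car N) (%x y. be x (lact N k y))" "bilin_on (car M) (car N) (%x y. ex k al *\<^sub>C be (lact M k x) y)"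
  by (intro bilin_onI lin_on_comp_scale lin_on_compose[OF bilin_onD1[OF b] lN] lin_on_compose[OF bilin_onD2[OF b] lM] bilin_onD1[OF b] bilin_onD2[OF b] lM(2) lN(2); assumption)+
 then show "be x (lact N k y) = ex k al *\<^sub>C be (lact M k x) y"
  by (rule bilin_on_span_eq[OF r r _ x[unfolded AB] y[unfolded AB]]) (rule bal)
qed

text \<open>The factorization through the relative tensor product is unique, hence linear in a parameter.\<close>

lemma rt_extend_param:
 assumes O: "M : Obj MM" "N : Obj MM" and X: "cvec.subspace X"
  and b: "!!u. u : X ==> bilin_on (car M) (car N) (be u)"
  and l: "!!x y. x : car M ==> y : car N ==> lin_on X (%u. be u x y)"
  and bal: "!!u k al x y. u : X ==> x : fst M al ==> y : car N ==> be u x (lact N k y) = ex k al *\<^sub>C be u (lact M k x) y"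
 shows "EX A. bilin_on X (car (TT M N)) A & (ALL u:X. ALL x:car M. ALL y:car N. A u (tt M N x y) = be u x y)"
proof -
 define A where "A u = (SOME f. f : lin (car (TT M N)) UNIV & (ALL x:car M. ALL y:car N. f (tt M N x y) = be u x y))" for u
 have "A u : lin (car (TT M N)) UNIV & (ALL x:car M. ALL y:car N. A u (tt M N x y) = be u x y)" if "u : X" for u
 proof -
  have "EX f:lin (car (TT M N)) UNIV. ALL x:car M. ALL y:car N. f (tt M N x y) = be u x y"
   by (rule rt_extend[OF O b[OF that]]) (erule (1) bal[OF that])
  then have "EX f. f : lin (car (TT M N)) UNIV & (ALL x:car M. ALL y:car N. f (tt M N x y) = be u x y)" by blast
  then show ?thesis unfolding A_def by (rule someI_ex)
 qed
 then have A: "u : X ==> lin_on (car (TT M N)) (A u)" "u : X ==> x : car M ==> y : car N ==> A u (tt M N x y) = be u x y" for u x y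
  using lin_lin_on by blast+
 have s: "car (TT M N) = cvec.span {tt M N x y | x y. x : car M & y : car N}"
  by (rule car_TT_span[OF O]) (simp_all add: cvec.span_eq_iff[THEN iffD2])
 have "bilin_on X (car (TT M N)) A"
  unfolding s
 proof (rule bilin_on_of_generators[OF A(1)[unfolded s] _ X])
  fix g assume "g : {tt M N x y | x y. x : car M & y : car N}"
  then obtain x y where g: "g = tt M N x y" "x : car M" "y : car N" by blast
  show "lin_on X (%u. A u g)"
   using l[OF g(2,3)] A(2)[OF _ g(2,3)] lin_on_cong[OF _ X, of "%u. A u g" "%u. be u x y"] by (simp add: g(1))
 qed
 then show ?thesis using A(2) by blast
qed

lemma tt_sub:
 assumes "M : Obj MM" "N : Obj MM"
 shows "lin_on V f ==> (!!v. v : V ==> f v : car M) ==> y : car N ==> lin_on V (%v. tt M N (f v) y)"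
  "lin_on V g ==> (!!v. v : V ==> g v : car N) ==> x : car M ==> lin_on V (%v. tt M N x (g v))"
 by (rule lin_on_compose[OF tt_lin1[OF assms]]; assumption) (rule lin_on_compose[OF tt_lin2[OF assms]]; assumption)

lemma TT3_span:
 assumes O: "L : Obj MM" "M : Obj MM" "N : Obj MM"
 shows "fst (TT L (TT M N)) ga = cvec.span {tt L (TT M N) x (tt M N y z) | x y z al be de. x : fst L al & y : fst M be & z : fst N de & al + (be + de) = ga}"
proof -
 have "fst (TT L (TT M N)) ga = cvec.span {tt L (TT M N) a b |a b al ep. a : fst L al &
   b : {tt M N a b |a b al be. a : fst M al & b : fst N be & al + be = ep} & al + ep = ga}"
  by (rule tt_span[OF O(1) TT_Obj[OF O(2,3)] span_fst[OF O(1)] tt_span[OF O(2,3) span_fst[OF O(2)] span_fst[OF O(3)]]])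
 also have "{tt L (TT M N) a b |a b al ep. a : fst L al & b : {tt M N a b |a b al be. a : fst M al & b : fst N be & al + be = ep} & al + ep = ga}
  = {tt L (TT M N) x (tt M N y z) | x y z al be de. x : fst L al & y : fst M be & z : fst N de & al + (be + de) = ga}"
  by blast
 finally show "fst (TT L (TT M N)) ga = cvec.span {tt L (TT M N) x (tt M N y z) | x y z al be de. x : fst L al & y : fst M be & z : fst N de & al + (be + de) = ga}" .
qed

lemma TT_car_span: "M : Obj MM ==> N : Obj MM ==> car (TT M N) = cvec.span {tt M N x y | x y. x : car M & y : car N}"
 by (rule car_TT_span) (simp_all add: cvec.span_eq_iff[THEN iffD2])

text \<open>
  For fixed \<open>x\<close> the right-hand side is balanced in \<open>y\<close> and \<open>z\<close>, and the
  resulting map is balanced in \<open>x\<close> and \<open>y \<otimes> z\<close>.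
\<close>

lemma assoc_map_ex:
 assumes O: "L : Obj MM" "M : Obj MM" "N : Obj MM"
 shows "EX f:lin (car (TT L (TT M N))) UNIV. ALL x:car L. ALL y:car M. ALL z:car N. f (tt L (TT M N) x (tt M N y z)) = tt (TT L M) N (tt L M x y) z"
proof -
 note LM = TT_Obj[OF O(1,2)] and MN = TT_Obj[OF O(2,3)]
 note m = tt_mem[OF O(1,2)]
 let ?be = "%x y z. tt (TT L M) N (tt L M x y) z"
 have lx: "lin_on (car L) (%x. ?be x y z)" if "y : car M" "z : car N" for y z
  using that m by (intro tt_sub(1)[OF LM O(3)] tt_lin1[OF O(1,2)]) auto
 have "EX A. bilin_on (car L) (car (TT M N)) A & (ALL x:car L. ALL y:car M. ALL z:car N. A x (tt M N y z) = ?be x y z)"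
 proof (rule rt_extend_param[OF O(2,3) subspace_gcar])
  show "bilin_on (car M) (car N) (?be x)" if "x : car L" for x
   using that m by (intro bilin_onI tt_lin2[OF LM O(3)] tt_sub(1)[OF LM O(3)] tt_lin2[OF O(1,2)]) auto
  show "lin_on (car L) (%x. ?be x y z)" if "y : car M" "z : car N" for y z by (rule lx[OF that])
  fix x k be y z assume x: "x : car L" and y: "y : fst M be" and z: "z : car N"
  note yc = lact_sum_deg[OF O(2) y]
  show "?be x y (lact N k z) = ex k be *\<^sub>C ?be x (lact M k y) z"
  proof (rule lin_on_span_eq[OF _ _ _ x[unfolded gcar_span], of "%x. ?be x y (lact N k z)" "%x. ex k be *\<^sub>C ?be x (lact M k y) z"])
   show "lin_on (cvec.span (UN al. fst L al)) (%x. ?be x y (lact N k z))"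
    unfolding gcar_span[symmetric] by (rule lx[OF yc ObjD(6)[OF O(3) z]])
   show "lin_on (cvec.span (UN al. fst L al)) (%x. ex k be *\<^sub>C ?be x (lact M k y) z)"
    unfolding gcar_span[symmetric] by (rule lin_on_comp_scale[OF lx[OF ObjD(6)[OF O(2) yc] z]])
   fix x assume "x : (UN al. fst L al)"
   then obtain al where x: "x : fst L al" by auto
   note xc = lact_sum_deg[OF O(1) x]
   have "?be x y (lact N k z) = ex k (al + be) *\<^sub>C tt (TT L M) N (tt L M (lact L k x) y) z"
    using tt_balanced[OF LM O(3) tt_deg[OF O(1,2) x y] z, of k] unfolding TT_act(2)[OF O(1,2) xc yc] .
   moreover have "?be x (lact M k y) z = ex k al *\<^sub>C tt (TT L M) N (tt L M (lact L k x) y) z"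
    unfolding tt_balanced[OF O(1,2) x yc]
    by (rule lin_on_scale[OF tt_lin1[OF LM O(3) z] m[OF ObjD(6)[OF O(1) xc] yc]])
   ultimately show "?be x y (lact N k z) = ex k be *\<^sub>C ?be x (lact M k y) z" by (simp add: ex_add mult.commute)
  qed
 qed
 then obtain A where A: "bilin_on (car L) (car (TT M N)) A"
  and Ae: "!!x y z. x : car L ==> y : car M ==> z : car N ==> A x (tt M N y z) = ?be x y z" by blast
 have "EX f:lin (car (TT L (TT M N))) UNIV. ALL x:car L. ALL w:car (TT M N). f (tt L (TT M N) x w) = A x w"
 proof (rule rt_extend_gen[OF O(1) MN A span_fst[OF O(1)] TT_car_span[OF O(2,3)]])
  fix k al x g assume x: "x : fst L al" and gg: "g : {tt M N x y |x y. x : car M & y : car N}"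
  note xc = lact_sum_deg[OF O(1) x]
  obtain y z where g: "g = tt M N y z" "y : car M" "z : car N" using gg by blast
  have "A x (lact (TT M N) k g) = tt (TT L M) N (tt L M x (lact M k y)) z"
   unfolding g(1) TT_act(2)[OF O(2,3) g(2,3)] by (rule Ae[OF xc ObjD(6)[OF O(2) g(2)] g(3)])
  also have "... = ex k al *\<^sub>C tt (TT L M) N (tt L M (lact L k x) y) z"
   unfolding tt_balanced[OF O(1,2) x g(2)]
   by (rule lin_on_scale[OF tt_lin1[OF LM O(3) g(3)] m[OF ObjD(6)[OF O(1) xc] g(2)]])
  also have "... = ex k al *\<^sub>C A (lact L k x) g"
   unfolding g(1) Ae[OF ObjD(6)[OF O(1) xc] g(2,3)] ..
  finally show "A x (lact (TT M N) k g) = ex k al *\<^sub>C A (lact L k x) g" .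
 qed
 then obtain f where f: "f : lin (car (TT L (TT M N))) UNIV" "!!x w. x : car L ==> w : car (TT M N) ==> f (tt L (TT M N) x w) = A x w" by blast
 show ?thesis by (intro bexI[of _ f] ballI f(1)) (simp add: f(2) Ae tt_mem[OF O(2,3)])
qed

lemma MM_ArrI_lin:
 assumes O: "M : Obj MM" "N : Obj MM" and f: "f : lin (car M) UNIV" and G: "!!al. fst M al = cvec.span (G al)"
  and e: "!!al x. x : G al ==> f x : fst N al" "!!k al x. x : G al ==> f (lact M k x) = lact N k (f x)"
 shows "Arrow M (Arrow (fst M) f (fst N)) N : Arr MM"
proof (rule MM_ArrI[OF O])
 show "Arrow (fst M) f (fst N) : cat_hom HH (fst M) (fst N)"
  using H_ArrI[OF ObjD(1)[OF O(1)] ObjD(1)[OF O(2)] f G e(1)] by (simp add: H_hom)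
 show "car M = cvec.span (UN al. G al)" by (rule gcar_of_spans[OF G])
 show "!!k x. x : (UN al. G al) ==> amap (Arrow (fst M) f (fst N)) (lact M k x) = lact N k (amap (Arrow (fst M) f (fst N)) x)"
  using e(2) by auto
qed

lemma MM_Assoc:
 assumes O: "L : Obj MM" "M : Obj MM" "N : Obj MM"
 shows "Assoc MM L M N : cat_hom MM (TT L (TT M N)) (TT (TT L M) N)"
  "!!x y z. x : car L ==> y : car M ==> z : car N ==> el (Assoc MM L M N) (tt L (TT M N) x (tt M N y z)) = tt (TT L M) N (tt L M x y) z"
proof -
 note LM = TT_Obj[OF O(1,2)] and MN = TT_Obj[OF O(2,3)]
 note T1 = TT_Obj[OF O(1) MN] and T2 = TT_Obj[OF LM O(3)]
 note pA = pr_Arr[OF O(1) MN] pr_Arr[OF O(2,3)] pr_Arr[OF LM O(3)] pr_Arr[OF O(1,2)]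
 note gr = ObjD(1)[OF O(1)] ObjD(1)[OF O(2)] ObjD(1)[OF O(3)] ObjD(1)[OF LM] ObjD(1)[OF MN] ObjD(1)[OF T1] ObjD(1)[OF T2]
 obtain f where f: "f : lin (car (TT L (TT M N))) UNIV"
  and fe: "!!x y z. x : car L ==> y : car M ==> z : car N ==> f (tt L (TT M N) x (tt M N y z)) = tt (TT L M) N (tt L M x y) z"
  using assoc_map_ex[OF O] by blast
 let ?F = "Arrow (fst (TT L (TT M N))) f (fst (TT (TT L M) N))"
 have FA: "Arrow (TT L (TT M N)) ?F (TT (TT L M) N) : Arr MM"
 proof (rule MM_ArrI_lin[OF T1 T2 f TT3_span[OF O]])
  fix ga w assume "w : {tt L (TT M N) x (tt M N y z) |x y z al be de. x : fst L al & y : fst M be & z : fst N de & al + (be + de) = ga}"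
  then obtain x y z al be de where w: "w = tt L (TT M N) x (tt M N y z)" "x : fst L al" "y : fst M be" "z : fst N de" "ga = al + be + de"
   by (auto simp: add.assoc)
  note c = lact_sum_deg[OF O(1) w(2)] lact_sum_deg[OF O(2) w(3)] lact_sum_deg[OF O(3) w(4)]
  show "f w : fst (TT (TT L M) N) ga" unfolding w(1) fe[OF c] w(5) by (rule tt_deg[OF LM O(3) tt_deg[OF O(1,2) w(2,3)] w(4)])
  show "f (lact (TT L (TT M N)) k w) = lact (TT (TT L M) N) k (f w)" for k
   unfolding w(1) TT_act(2)[OF O(1) MN c(1) tt_mem[OF O(2,3) c(2,3)]] fe[OF c] fe[OF ObjD(6)[OF O(1) c(1)] c(2,3)]
    TT_act(2)[OF LM O(3) tt_mem[OF O(1,2) c(1,2)] c(3)] TT_act(2)[OF O(1,2) c(1,2)] ..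
 qed
 note Fh = MM_ArrD(3)[OF FA, unfolded arrow.sel]
 have Fs: "?F : Arr HH" "Dom HH ?F = fst (TT L (TT M N))" "Cod HH ?F = fst (TT (TT L M) N)" using cat_homD[OF Fh] by simp_all
 let ?K = "Comp HH (pr (TT L M) N) (Comp HH (TensA HH (pr L M) (Id HH (fst N))) (Assoc HH (fst L) (fst M) (fst N)))"
 let ?P = "%h. Comp HH h (Comp HH (pr L (TT M N)) (TensA HH (Id HH (fst L)) (pr M N)))"
 have g1: "H.gen p (gtens (fst L) (gtens (fst M) (fst N))) {x <*> b | x b. x : car L & b : {y <*> z | y z. y : car M & z : car N}}"
 proof (rule H_gen)
  show "gcar (gtens (fst L) (gtens (fst M) (fst N))) = cvec.span {x <*> b | x b. x : car L & b : {y <*> z | y z. y : car M & z : car N}}"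
   unfolding gcar_gtens by (rule tens_span) (simp_all only: tens_def[symmetric] cvec.span_eq_iff[THEN iffD2] subspace_gcar)
 qed (use gr in simp)
 have Pel: "amap (?P h) (x <*> (y <*> z)) = amap h (tt L (TT M N) x (tt M N y z))"
  if "x : car L" "y : car M" "z : car N" "h : Arr HH" "Dom HH h = fst (TT L (TT M N))" for h x y z
 proof -
  have "amap (pr M N) (y <*> z) : car (TT M N)" using tt_mem[OF O(2,3) that(2,3)] by (simp add: rt_elem_def)
  then show ?thesis using that pA gr by (simp add: rt_elem_def)
 qed
 have Kel: "amap ?K (x <*> (y <*> z)) = tt (TT L M) N (tt L M x y) z" if "x : car L" "y : car M" "z : car N" for x y z
 proof -
  have "amap (pr L M) (x <*> y) : car (TT L M)" using tt_mem[OF O(1,2) that(1,2)] by (simp add: rt_elem_def)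
  then show ?thesis using that pA gr by (simp add: rt_elem_def)
 qed
 have "(THE h. h : cat_hom HH (fst (TT L (TT M N))) (fst (TT (TT L M) N)) & ?P h = ?K) = ?F"
 proof (rule the_equality)
  have "?P ?F = ?K"
  proof (rule H.hom_eqI_gen[OF g1])
   fix g assume "g : {x <*> b | x b. x : car L & b : {y <*> z | y z. y : car M & z : car N}}"
   then obtain x y z where g: "g = x <*> (y <*> z)" "x : car L" "y : car M" "z : car N" by blast
   show "amap (?P ?F) g = amap ?K g" unfolding g(1) Pel[OF g(2-4) Fs(1,2)] Kel[OF g(2-4)] arrow.sel by (rule fe[OF g(2-4)])
  qed (use pA gr Fs in simp_all)
  then show "?F : cat_hom HH (fst (TT L (TT M N))) (fst (TT (TT L M) N)) & ?P ?F = ?K" using Fh by simp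
  fix h assume h: "h : cat_hom HH (fst (TT L (TT M N))) (fst (TT (TT L M) N)) & ?P h = ?K"
  note hs = cat_homD[OF conjunct1[OF h]]
  have g2: "H.gen p (fst (TT L (TT M N))) {tt L (TT M N) x w | x w. x : car L & w : {tt M N y z | y z. y : car M & z : car N}}"
   by (rule H_gen[OF gr(6) car_TT_span[OF O(1) MN _ TT_car_span[OF O(2,3)]]]) (simp add: cvec.span_eq_iff[THEN iffD2])
  show "h = ?F"
  proof (rule H.hom_eqI_gen[OF g2])
   fix g assume "g : {tt L (TT M N) x w | x w. x : car L & w : {tt M N y z | y z. y : car M & z : car N}}"
   then obtain x y z where g: "g = tt L (TT M N) x (tt M N y z)" "x : car L" "y : car M" "z : car N" by blast
   have "amap h g = tt (TT L M) N (tt L M x y) z"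
    unfolding g(1) Pel[OF g(2-4) hs(1,2), symmetric] conjunct2[OF h] by (rule Kel[OF g(2-4)])
   then show "amap h g = amap ?F g" unfolding g(1) arrow.sel fe[OF g(2-4)] .
  qed (use hs Fs in simp_all)
 qed
 then have A: "Assoc MM L M N = Arrow (TT L (TT M N)) ?F (TT (TT L M) N)" by (simp add: Mcat_def local_modules_def Let_def)
 show "Assoc MM L M N : cat_hom MM (TT L (TT M N)) (TT (TT L M) N)" using FA by (simp add: A cat_hom_def MM_simps)
 show "!!x y z. x : car L ==> y : car M ==> z : car N ==> el (Assoc MM L M N) (tt L (TT M N) x (tt M N y z)) = tt (TT L M) N (tt L M x y) z"
  using fe by (simp add: A)
qed

lemma MM_balanced: "graded_balanced MM car fst el \<int> tt (+) (%_ _ _. 1) (%al be. hexp p (al * be)) (%al. hexp p (al\<^sup>2)) 0 (lam 0)"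
proof (intro graded_balanced.intro[OF MM_tensor] graded_balanced_axioms.intro, unfold MM_simps(5,6) UM_def[symmetric], goal_cases)
 case 1 then show ?case by (rule UM_Obj)
next
 case 3 then show ?case using lam_Lam[of 0 p] by (simp add: fst_UM)
next
 case (4 X Y Z) then show ?case by (rule MM_Assoc(1))
next
 case (5 X Y Z i j k x y z) then show ?case using MM_Assoc(2)[OF 5(1-3)] lact_sum_deg by simp
next
 case (6 X Y) then show ?case by (rule MM_Braid(1))
next
 case (7 X Y) then show ?case by (intro MM_Braid(2))
next
 case (8 X) then show ?case by (rule MM_Twist(1))
next
 case (9 X) then show ?case by (intro MM_Twist(2))
next
 case (10 X) then show ?case by (rule MM_LUnit(1))
next
 case (11 X) then show ?case by (rule MM_LUnit(2))
next
 case (12 X) then show ?case by (rule MM_LUnit(3))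
next
 case (13 X) then show ?case by (rule MM_RUnit(1))
next
 case (14 X) then show ?case by (rule MM_RUnit(2))
next
 case (15 X) then show ?case by (rule MM_RUnit(3))
next
 case (20 i j) show ?case by (rule add.commute)
next
 case (21 i j k) then show ?case by (simp add: ring_distribs hexp_add mult_ac)
next
 case (22 i j k) then show ?case by (simp add: ring_distribs hexp_add mult_ac)
next
 case (23 i j) then show ?case by (simp add: power2_sum mult.commute[of j i] flip: hexp_add) (simp add: power2_eq_square algebra_simps)
qed simp_all

sublocale MM: graded_balanced MM car fst el \<int> tt "(+)" "%_ _ _. 1" "%al be. hexp p (al * be)" "%al. hexp p (al\<^sup>2)" 0 "lam 0"
 by (rule MM_balanced)

end

text \<open>Bilinear maps on free modules are families of bilinear maps on the generating spaces.\<close>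

lemma lam_bilin_extend:
 assumes V: "cvec.subspace V" and W: "cvec.subspace W" and b: "!!k l. bilin_on V W (B k l)"
 shows "EX h. bilin_on (tens UNIV V) (tens UNIV W) h & (ALL k l. ALL v:V. ALL w:W. h (lam k <*> v) (lam l <*> w) = B k l v w)"
proof -
 have sV: "tens UNIV V = cvec.span {lam k <*> v | k v. v : V}" and sW: "tens UNIV W = cvec.span {lam k <*> v | k v. v : W}"
  using tens_lam_span[of V V] tens_lam_span[of W W] V W by (simp_all add: cvec.span_eq_iff[THEN iffD2])
 define g where "g l w = (SOME f. f : lin (tens UNIV V) UNIV & (ALL k. ALL v:V. f (lam k <*> v) = B k l v w))" for l w
 have "g l w : lin (tens UNIV V) UNIV & (ALL k. ALL v:V. g l w (lam k <*> v) = B k l v w)" if w: "w : W" for l w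
  unfolding g_def by (rule someI_ex[OF lam_extend[OF V, of "%k v. B k l v w", OF bilin_onD2[OF b w], unfolded Bex_def]])
 then have g: "w : W ==> lin_on (tens UNIV V) (g l w)" "w : W ==> v : V ==> g l w (lam k <*> v) = B k l v w" for k l v w
  using lin_lin_on[of "g l w" "tens UNIV V" UNIV] by auto
 have gb: "bilin_on W (tens UNIV V) (g l)" for l
  unfolding sV
 proof (rule bilin_on_of_generators[OF g(1)[unfolded sV] _ W])
  fix z assume "z : {lam k <*> v | k v. v : V}"
  then obtain k v where z: "z = lam k <*> v" "v : V" by blast
  show "lin_on W (%w. g l w z)"
   unfolding z(1) using bilin_onD1[OF b z(2), of k l] by (subst lin_on_cong[OF g(2)[OF _ z(2)] W])
 qed
 define h where "h x = (SOME f. f : lin (tens UNIV W) UNIV & (ALL l. ALL w:W. f (lam l <*> w) = g l w x))" for x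
 have "h x : lin (tens UNIV W) UNIV & (ALL l. ALL w:W. h x (lam l <*> w) = g l w x)" if x: "x : tens UNIV V" for x
  unfolding h_def by (rule someI_ex[OF lam_extend[OF W, of "%l w. g l w x", OF bilin_onD2[OF gb x], unfolded Bex_def]])
 then have h: "x : tens UNIV V ==> lin_on (tens UNIV W) (h x)" "x : tens UNIV V ==> w : W ==> h x (lam l <*> w) = g l w x" for l x w
  using lin_lin_on[of "h x" "tens UNIV W" UNIV] by auto
 have "bilin_on (tens UNIV V) (tens UNIV W) h"
  unfolding sW
 proof (rule bilin_on_of_generators[OF h(1)[unfolded sW] _ subspace_tens])
  fix z assume "z : {lam k <*> v | k v. v : W}"
  then obtain l w where z: "z = lam l <*> w" "w : W" by blast
  show "lin_on (tens UNIV V) (%x. h x z)"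
   unfolding z(1) using bilin_onD1[OF gb z(2), of l] by (subst lin_on_cong[OF h(2)[OF _ z(2)] subspace_tens])
 qed
 then show ?thesis using h(2) g(2) tens_mem[OF UNIV_I] by (intro exI[of _ h]) auto
qed

context lam_data
begin

lemma free_module_Obj:
 assumes X: "graded X" and fd: "fin_dim (gcar X)" and i: "integral X"
 shows "free_module HH LA X : Obj MM"
 unfolding MM_Obj
proof (intro conjI)
 let ?F = "free_module HH LA X"
 note F = free_module_hom[OF X, where p = p]
 show r: "snd ?F : cat_hom HH (gtens (Lam p) (fst ?F)) (fst ?F)" using F by simp
 have s: "car ?F = cvec.span {lam k <*> v | k v. v : gcar X}"
  unfolding F(1) gcar_gtens_Lam by (rule tens_lam_span) (simp add: cvec.span_eq_iff[THEN iffD2])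
 show "lambda_module p (fst ?F) (lact ?F)"
  by (rule lambda_moduleI[OF r s]) (auto simp: F(3) add.assoc)
 show "integral (fst ?F)" unfolding integral_def F(1)
 proof (intro allI ballI impI)
  fix ga x assume x: "x : gtens (Lam p) X ga" "x ~= 0"
  show "ga : \<int>"
  proof (rule ccontr)
   assume n: "ga \<notin> \<int>"
   have "{lam k <*> v |k v be. v : X be & ldeg p k + be = ga} <= {0}"
   proof
    fix g assume "g : {lam k <*> v |k v be. v : X be & ldeg p k + be = ga}"
    then obtain k v be where g: "g = lam k <*> v" "v : X be" "ldeg p k + be = ga" by blast
    have "v = 0"
    proof (rule ccontr)
     assume "v ~= 0"
     then have "be : \<int>" using i g(2) by (auto simp: integral_def)
     then have "ldeg p k + be : \<int>" by (intro Ints_add Ints_of_int)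
     then show False using n unfolding g(3) by blast
    qed
    then show "g : {0}" by (simp add: g(1))
   qed
   then have "gtens (Lam p) X ga <= {0}"
    using gtens_Lam_span[where p = p and ga = ga, OF span_graded[OF X]] cvec.span_mono[of _ "{0}"] by auto
   then show False using x by auto
  qed
 qed
 obtain B where B: "finite B" "B <= (UN al. X al)" "cvec.span B = gcar X"
  using finite_generators_within[of "UN al. X al"] fd unfolding gcar_span by blast
 let ?Z = "(%b. lam 0 <*> b) ` B"
 have Bc: "b : B ==> b : gcar X" for b using B(3) cvec.span_base by blast
 have "car ?F = cvec.span {lam k <*> v | k v. v : B}" unfolding F(1) gcar_gtens_Lam by (rule tens_lam_span[OF B(3)])
 also have "{lam k <*> v | k v. v : B} = {lact ?F k z | k z. z : ?Z}"
  unfolding image_setcompr2 by (rule setcompr_cong2) (simp add: F(3) Bc)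
 finally have "car ?F = cvec.span {lact ?F k z | k z. z : ?Z}" .
 moreover have "?Z <= (UN al. fst ?F al)"
 proof
  fix z assume "z : ?Z"
  then obtain b where b: "z = lam 0 <*> b" "b : B" by auto
  then obtain be where "b : X be" using B(2) by auto
  then have "z : gtens (Lam p) X (ldeg p 0 + be)" unfolding b(1) by (intro gtens_mem lam_Lam)
  then show "z : (UN al. fst ?F al)" unfolding F(1) by blast
 qed
 ultimately show "lam_generated (fst ?F) (lact ?F)" unfolding lam_generated_def using B(1) by blast
qed

lemma determined_lact:
 assumes M: "M : Obj MM" and A: "A <= car M" and s: "car M = cvec.span {lact M k a | k a. a : A}"
 shows "MM.determined M A"
 unfolding MM.determined_def
proof (intro conjI allI impI M A)
 fix f g assume h: "f : Arr MM" "g : Arr MM" "Dom MM f = M" "Dom MM g = M" "Cod MM f = Cod MM g" "ALL a:A. el f a = el g a"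
 show "f = g"
 proof (rule MM.hom_eqI_gen[of M "{lact M k a | k a. a : A}"])
  show "MM.gen M {lact M k a | k a. a : A}" using M s by (simp add: MM.gen_def)
  fix z assume "z : {lact M k a | k a. a : A}"
  then obtain k a where z: "z = lact M k a" "a : A" by blast
  have a: "a : car M" using A z by blast
  show "el f z = el g z"
   using MM_ArrD(4)[OF h(1), of a k] MM_ArrD(4)[OF h(2), of a k] h a z by (simp add: MM_simps(1,2))
 qed (use h in auto)
qed

lemma ex_of_int: "ex k (of_int a) = (-1) powi (a * k)"
proof -
 have e: "ex k (of_int a) = exp (complex_of_real pi * \<i> * of_int (a * k))"
  unfolding ex_def by (rule arg_cong[of _ _ exp]) (simp add: algebra_simps)
 have p1: "exp (complex_of_real pi * \<i>) = -1" by (metis exp_pi_i mult.commute)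
 have "exp (complex_of_real pi * \<i> * of_int n) = (-1) powi n" for n
  using exp_power_int[of "complex_of_real pi * \<i>" n] p1 by (simp add: mult_ac)
 then show ?thesis unfolding e .
qed

end

section \<open>The functor\<close>

sublocale rep_data \<subseteq> lam_data p by unfold_locales (rule p_pos)

context rep_data
begin

text \<open>
  The grading that turns \<open>V\<close> into an object of the category of graded spaces such that the
  functor gives the free module on it.
\<close>

definition rgr :: "kmod => gspace" where
 "rgr V al = cvec.span {v. EX a:S. al = of_int a & v : hgr V a}"

abbreviation FO :: "kmod => lmod" where "FO \<equiv> FObj p S"
abbreviation FA where "FA \<equiv> FArr p S"

lemma gcar_rgr: "is_kmod p V ==> gcar (rgr V) = kcar V"
proof -
 assume V: "is_kmod p V"
 have "gcar (rgr V) = cvec.span (UN al. {v. EX a:S. al = (of_int a :: complex) & v : hgr V a})"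
  by (rule gcar_of_spans) (simp add: rgr_def)
 also have "(UN al. {v. EX a:S. al = (of_int a :: complex) & v : hgr V a}) = (UN a:S. hgr V a)" by auto
 finally show ?thesis using kcar_span[OF V] by simp
qed

lemma graded_rgr:
 assumes V: "is_kmod p V"
 shows "graded (rgr V)"
proof (rule gradedI)
 fix ga :: complex
 define P where "P = (%v. if EX c:S. ga = of_int c then kidem p V (THE c. c : S & ga = of_int c) v else 0)"
 have l: "lin_on (gcar (rgr V)) P"
  unfolding gcar_rgr[OF V] P_def by (cases "EX c:S. ga = of_int c") (simp_all only: if_True if_False lin_on_kidem[OF V] lin_on_0)
 have "P x = (if al = ga then x else 0)" if x: "x : rgr V al" for al x
 proof (rule lin_on_span_eq[OF _ _ _ x[unfolded rgr_def], of P "%x. if al = ga then x else 0"])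
  show "lin_on (cvec.span {v. EX a:S. al = of_int a & v : hgr V a}) P"
   unfolding rgr_def[symmetric] by (rule lin_on_subset[OF l]) (use gcar_mem in blast)
  show "lin_on (cvec.span {v. EX a:S. al = of_int a & v : hgr V a}) (%x. if al = ga then x else 0)"
   by (cases "al = ga") (simp_all add: lin_intros)
  fix v assume "v : {v. EX a:S. al = of_int a & v : hgr V a}"
  then obtain a where a: "a : S" "al = of_int a" "v : hgr V a" by auto
  show "P v = (if al = ga then v else 0)"
  proof (cases "EX c:S. ga = of_int c")
   case True
   then obtain c where c: "c : S" "ga = of_int c" by auto
   have "(THE c'. c' : S & ga = of_int c') = c" using c by (intro the_equality) auto
   then have "P v = kidem p V c v" using True by (simp add: P_def)
   then show ?thesis using kidem_hgr[OF V a(3) c(1) a(1)] a(2) c(2) by auto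
  next
   case False
   then show ?thesis using a by (auto simp: P_def)
  qed
 qed
 with l show "EX f. lin_on (gcar (rgr V)) f & (ALL al. ALL x:rgr V al. f x = (if al = ga then x else 0))" by blast
qed (simp add: rgr_def)

definition FG :: "kmod => complex => cvec set" where
 "FG V al = {lam k <*> v | k v a. a : S & v : hgr V a & al = of_int (2 * int p * k + a)}"

lemma Fgr_eq:
 assumes V: "is_kmod p V"
 shows "Fgr p S V = gtens (Lam p) (rgr V)" "Fgr p S V al = cvec.span (FG V al)"
proof -
 have 1: "gtens (Lam p) (rgr V) al = cvec.span (FG V al)" for al
 proof -
  have "{lam k <*> v | k v be. v : {v. EX a:S. be = of_int a & v : hgr V a} & ldeg p k + be = al} = FG V al"
   unfolding FG_def of_int_add by blast
  then show ?thesis using gtens_Lam_span[where V = "rgr V" and p = p and ga = al, OF rgr_def] by simp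
 qed
 have 2: "Fgr p S V al = cvec.span (FG V al)" for al
 proof -
  have "{lam k <*> kidem p V a m | k a m. m : kcar V & al = of_int (2 * int p * k + rep a)} = FG V al"
  proof (intro equalityI subsetI)
   fix x assume "x : {lam k <*> kidem p V a m | k a m. m : kcar V & al = of_int (2 * int p * k + rep a)}"
   then obtain k a m where x: "x = lam k <*> kidem p V a m" "m : kcar V" "al = of_int (2 * int p * k + rep a)" by blast
   have "kidem p V a m : hgr V (rep a)" using kidem_eig[OF p_pos V x(2)] by (simp add: hgr_rep)
   then show "x : FG V al" unfolding FG_def using x rep_S[of a] by blast
  next
   fix x assume "x : FG V al"
   then obtain k v a where x: "x = lam k <*> v" "a : S" "v : hgr V a" "al = of_int (2 * int p * k + a)" unfolding FG_def by blast
   have "v = kidem p V a v" using kidem_hgr[OF V x(3) x(2,2)] by simp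
   moreover have "a = rep a" using x(2) by simp
   ultimately show "x : {lam k <*> kidem p V a m | k a m. m : kcar V & al = of_int (2 * int p * k + rep a)}"
    using x eig_kcar[OF x(3)] by (intro CollectI exI[of _ k] exI[of _ a] exI[of _ v] conjI) simp_all
  qed
  then show ?thesis unfolding Fgr_def by simp
 qed
 show "Fgr p S V = gtens (Lam p) (rgr V)" by (rule ext) (simp add: 1 2)
 show "Fgr p S V al = cvec.span (FG V al)" by (rule 2)
qed

text \<open>
  Being free, the value of the functor is a local module as soon as the degrees of its generating space are
  integers.
\<close>

lemma FObj_free:
 assumes V: "is_kmod p V"
 shows "FO V = free_module HH LA (rgr V)"
proof -
 let ?X = "rgr V" and ?F = "free_module HH LA (rgr V)"
 note F = free_module_hom[OF graded_rgr[OF V], where p = p]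
 note r = cat_homD[OF F(2)]
 have rl: "amap (snd ?F) : lin (gcar (gtens (Lam p) (Fgr p S V))) (gcar (Fgr p S V))"
  using H.el_lin[OF r(1)] r(2,3) by (simp add: Fgr_eq(1)[OF V])
 have rf: "amap (snd ?F) (lam k <*> (lam l <*> m)) = lam (k + l) <*> m" if "m : kcar V" for k l m
  using F(3)[of m k l] that gcar_rgr[OF V] by (simp add: lact_def)
 have sp: "gcar (gtens (Lam p) (Fgr p S V)) = cvec.span {lam k <*> x | k x. x : {lam k <*> v | k v. v : kcar V}}"
  unfolding gcar_gtens_Lam
  by (rule tens_lam_span, unfold Fgr_eq(1)[OF V] gcar_gtens_Lam gcar_rgr[OF V], rule tens_lam_span[symmetric])
   (use kmod_subspace[OF V] in "simp add: cvec.span_eq_iff[THEN iffD2]")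
 have "(THE f. f : lin (gcar (gtens (Lam p) (Fgr p S V))) (gcar (Fgr p S V)) &
     (ALL k l. ALL m:kcar V. f (lam k <*> (lam l <*> m)) = lam (k + l) <*> m)) = amap (snd ?F)"
 proof (rule the_equality)
  fix g assume g: "g : lin (gcar (gtens (Lam p) (Fgr p S V))) (gcar (Fgr p S V)) &
     (ALL k l. ALL m:kcar V. g (lam k <*> (lam l <*> m)) = lam (k + l) <*> m)"
  show "g = amap (snd ?F)"
   by (rule lin_span_eqI[of g "{lam k <*> x | k x. x : {lam k <*> v | k v. v : kcar V}}" _ "amap (snd ?F)", folded sp])
    (use g rl rf in auto)
 qed (use rl rf in auto)
 moreover have "snd ?F = Arrow (gtens (Lam p) (Fgr p S V)) (amap (snd ?F)) (Fgr p S V)"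
  using r(2,3) by (cases "snd ?F") (simp add: H_simps(2,3) Fgr_eq(1)[OF V])
 ultimately show ?thesis
  by (intro prod_eqI) (simp_all add: FObj_def F(1) Fgr_eq(1)[OF V])
qed

lemma fst_FO: "fst (FO V) = Fgr p S V" by (simp add: FObj_def)

lemma FO_Obj: "is_kmod p V ==> FO V : Obj MM"
proof -
 assume V: "is_kmod p V"
 have "integral (rgr V)" unfolding integral_def
 proof (intro allI ballI impI)
  fix al x assume x: "x : rgr V al" "x ~= 0"
  then have "{v. EX a:S. al = of_int a & v : hgr V a} ~= {}" unfolding rgr_def by (metis cvec.span_empty singletonD)
  then show "al : \<int>" by auto
 qed
 then show ?thesis
  unfolding FObj_free[OF V] by (intro free_module_Obj graded_rgr[OF V]) (use kmod_fin_dim[OF V] gcar_rgr[OF V] in simp)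
qed

lemma FO_span: "is_kmod p V ==> fst (FO V) al = cvec.span (FG V al)"
 by (simp add: fst_FO Fgr_eq(2))

lemma FO_car: "is_kmod p V ==> car (FO V) = tens UNIV (kcar V)"
 by (simp add: fst_FO Fgr_eq gcar_gtens_Lam gcar_rgr)

lemma FO_mem: "is_kmod p V ==> v : kcar V ==> lam k <*> v : car (FO V)"
 by (simp add: FO_car tens_mem)

lemma FO_deg: "is_kmod p V ==> a : S ==> v : hgr V a ==> lam k <*> v : fst (FO V) (of_int (2 * int p * k + a))"
 unfolding FO_span FG_def by (rule cvec.span_base) blast

lemma FO_lact: "is_kmod p V ==> v : kcar V ==> lact (FO V) k (lam l <*> v) = lam (k + l) <*> v"
 using free_module_hom(3)[OF graded_rgr, of V v p k l] by (simp add: FObj_free gcar_rgr)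

lemma FO_gen: 
 assumes V: "is_kmod p V" and A: "cvec.span A = kcar V"
 shows "MM.gen (FO V) {lam k <*> v | k v. v : A}"
 unfolding MM.gen_def using FO_Obj[OF V] FO_car[OF V] tens_lam_span[OF A] by simp

lemmas FO_gen_homog = FO_gen[OF _ kcar_span[symmetric]]

lemma FO_ArrI:
 assumes V: "is_kmod p V" and N: "N : Obj MM" and f: "f : lin (car (FO V)) UNIV"
  and e: "!!k a v. a : S ==> v : hgr V a ==> f (lam k <*> v) : fst N (of_int (2 * int p * k + a))"
   "!!k l a v. a : S ==> v : hgr V a ==> f (lam (k + l) <*> v) = lact N k (f (lam l <*> v))"
 shows "Arrow (FO V) (Arrow (fst (FO V)) f (fst N)) N : Arr MM"
proof (rule MM_ArrI_lin[OF FO_Obj[OF V] N f FO_span[OF V]])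
 fix al x assume "x : FG V al"
 then obtain k v a where x: "x = lam k <*> v" "a : S" "v : hgr V a" "al = of_int (2 * int p * k + a)" unfolding FG_def by blast
 show "f x : fst N al" unfolding x(1,4) by (rule e(1)[OF x(2,3)])
 show "f (lact (FO V) k' x) = lact N k' (f x)" for k'
  unfolding x(1) FO_lact[OF V eig_kcar[OF x(3)]] by (rule e(2)[OF x(2,3)])
qed

lemma FA_props:
 assumes f: "f : Arr RC"
 shows "FA f : Arr MM" "src (FA f) = FO (src f)" "tgt (FA f) = FO (tgt f)"
  "!!x m. m : kcar (src f) ==> el (FA f) (x <*> m) = x <*> amap f m"
proof -
 have F: "is_kmod p (src f)" "is_kmod p (tgt f)" "amap f : lin (kcar (src f)) (kcar (tgt f))" using f by (auto simp: RC_Arr)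
 let ?f = "tmap (gcar (Lam p)) (kcar (src f)) (%x m. x <*> amap f m)"
 have b: "bilin_on (gcar (Lam p)) (kcar (src f)) (%x m. x <*> amap f m)"
  by (intro bilin_onI lin_intros lin_lin_on[OF F(3)])
 note t = tmap_lin[OF subspace_gcar kmod_subspace[OF F(1)] b] tmap_tensor[OF subspace_gcar kmod_subspace[OF F(1)] b]
 show "src (FA f) = FO (src f)" "tgt (FA f) = FO (tgt f)" by (simp_all add: FArr_def)
 show e: "!!x m. m : kcar (src f) ==> el (FA f) (x <*> m) = x <*> amap f m" using t(2) by (simp add: FArr_def)
 have "Arrow (FO (src f)) (Arrow (fst (FO (src f))) ?f (fst (FO (tgt f)))) (FO (tgt f)) : Arr MM"
 proof (rule FO_ArrI[OF F(1) FO_Obj[OF F(2)]])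
  show "?f : lin (car (FO (src f))) UNIV" using t(1) by (simp add: FO_car[OF F(1)])
  fix k a v assume a: "a : S" "v : hgr (src f) a"
  have fv: "amap f v : hgr (tgt f) a" using RC_Arr_eig[OF f a(2)] .
  have e': "?f (lam k <*> v) = lam k <*> amap f v" for k using t(2)[of "lam k" v] eig_kcar[OF a(2)] by simp
  show "?f (lam k <*> v) : fst (FO (tgt f)) (of_int (2 * int p * k + a))" unfolding e' by (rule FO_deg[OF F(2) a(1) fv])
  show "?f (lam (k + l) <*> v) = lact (FO (tgt f)) k (?f (lam l <*> v))" for l
   unfolding e' FO_lact[OF F(2) eig_kcar[OF fv]] ..
 qed
 then show "FA f : Arr MM" by (simp add: FArr_def fst_FO)
qed

lemma FA_hom [simp]: "f : Arr RC ==> FA f : Arr MM" "f : Arr RC ==> Dom MM (FA f) = FO (src f)" "f : Arr RC ==> Cod MM (FA f) = FO (tgt f)"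
 using FA_props by (simp_all add: MM_simps(1,2))

lemma F_functor: "category_functor RC MM FO FA"
proof (intro category_functor.intro[OF RC_category MM_category] category_functor_axioms.intro)
 fix X assume "X : Obj RC"
 then have X: "is_kmod p X" by simp
 then show "FO X : Obj MM" by (rule FO_Obj)
 have i: "Id RC X : Arr RC" using RC.Id_Arr(1)[of X] X by simp
 show "FA (Id RC X) = Id MM (FO X)"
 proof (rule MM.hom_eqI_gen[OF FO_gen[OF X, of "kcar X"]])
  fix a assume "a : {lam k <*> v |k v. v : kcar X}"
  then obtain k v where a: "a = lam k <*> v" "v : kcar X" by blast
  show "el (FA (Id RC X)) a = el (Id MM (FO X)) a"
   using FA_props(4)[OF i, of v "lam k"] a(2) MM.el_Id[OF FO_Obj[OF X] FO_mem[OF X a(2)], of k] by (simp add: a(1))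
 qed (use i X kmod_subspace[OF X] FO_Obj[OF X] MM.Id_Arr[OF FO_Obj[OF X]] FA_hom[OF i] in "simp_all add: cvec.span_eq_iff[THEN iffD2]")
next
 fix f X Y assume "f : cat_hom RC X Y"
 then show "FA f : cat_hom MM (FO X) (FO Y)" by (simp add: cat_hom_def)
next
 fix f X Y g Z assume "f : cat_hom RC X Y" "g : cat_hom RC Y Z"
 then have h: "f : Arr RC" "g : Arr RC" "src f = X" "tgt f = Y" "src g = Y" "tgt g = Z" by (auto simp: cat_hom_def)
 have X: "is_kmod p X" using h by (auto simp: RC_Arr)
 have c: "Comp RC g f : Arr RC" using RC.Comp_Arr(1)[of f g] h by simp
 show "FA (Comp RC g f) = Comp MM (FA g) (FA f)"
 proof (rule MM.hom_eqI_gen[OF FO_gen[OF X, of "kcar X"]])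
  fix a assume "a : {lam k <*> v |k v. v : kcar X}"
  then obtain k v where a: "a = lam k <*> v" "v : kcar X" by blast
  have fv: "amap f v : kcar Y" using h a by (auto simp: RC_Arr lin_mem)
  have "el (Comp MM (FA g) (FA f)) a = el (FA g) (el (FA f) a)"
   using h FO_mem[OF X a(2)] by (intro MM.el_Comp) (simp_all add: a(1))
  then show "el (FA (Comp RC g f)) a = el (Comp MM (FA g) (FA f)) a"
   using FA_props(4)[OF c, of v "lam k"] FA_props(4)[OF h(1), of v "lam k"] FA_props(4)[OF h(2), of "amap f v" "lam k"] h a fv by (simp add: compose_def)
 qed (use h c X kmod_subspace[OF X] FA_hom[OF c] FA_hom[OF h(1)] FA_hom[OF h(2)] in "simp_all add: cvec.span_eq_iff[THEN iffD2] del: RC_simps(7)", simp_all)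
qed

section \<open>The tensor structure of the functor\<close>

definition Jc :: "int => int => int => complex" where "Jc a b l = (-1) powi (a * l) * \<zeta> a b"

lemma Jc_nz: "a : S ==> b : S ==> Jc a b l ~= 0"
 by (simp add: Jc_def zeta_nonzero sign_powi)

text \<open>
  Moving \<open>1\<^sub>k\<close> from the second factor to the first yields the sign
  \<open>(-1)\<^bsup>ak\<^esup>\<close> in the relative tensor product, and \<open>Jc a b (k + l)\<close>
  differs from \<open>Jc a b l\<close> by the same sign.
\<close>

lemma J_lin_ex:
 assumes K: "is_kmod p M" "is_kmod p N"
 shows "EX f:lin (car (TT (FO M) (FO N))) UNIV. ALL a:S. ALL b:S. ALL k l. ALL m:hgr M a. ALL n:hgr N b.
   f (tt (FO M) (FO N) (lam k <*> m) (lam l <*> n)) = Jc a b l *\<^sub>C (lam (k + l + \<kappa> a b) <*> (m <*> n))"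
proof -
 let ?B = "%k l m n. SUM a:S. SUM b:S. Jc a b l *\<^sub>C (lam (k + l + \<kappa> a b) <*> (kidem p M a m <*> kidem p N b n))"
 note O = FO_Obj[OF K(1)] FO_Obj[OF K(2)] and s = kmod_subspace[OF K(1)] kmod_subspace[OF K(2)]
 have b: "bilin_on (kcar M) (kcar N) (?B k l)" for k l
  by (intro bilin_onI lin_intros lin_on_kidem K)
 have Bh: "?B k l m n = Jc a b l *\<^sub>C (lam (k + l + \<kappa> a b) <*> (m <*> n))"
  if "a : S" "b : S" "m : hgr M a" "n : hgr N b" for a b k l m n
  using kidem_double_sum[OF K that, of "%a b m n. Jc a b l *\<^sub>C (lam (k + l + \<kappa> a b) <*> (m <*> n))"] by simp
 obtain h where h: "bilin_on (car (FO M)) (car (FO N)) h"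
  and he: "!!k l v w. v : kcar M ==> w : kcar N ==> h (lam k <*> v) (lam l <*> w) = ?B k l v w"
  using lam_bilin_extend[OF s, of ?B, OF b] unfolding FO_car[OF K(1)] FO_car[OF K(2)] by blast
 have "EX f:lin (car (TT (FO M) (FO N))) UNIV. ALL x:car (FO M). ALL y:car (FO N). f (tt (FO M) (FO N) x y) = h x y"
 proof (rule rt_extend_gen[OF O h FO_span[OF K(1)] FO_gen_homog[OF K(2) K(2), unfolded MM.gen_def, THEN conjunct2]])
  fix k al g z assume "g : FG M al" and zz: "z : {lam k <*> v | k v. v : (UN b:S. hgr N b)}"
  then obtain j v a where g: "g = lam j <*> v" "a : S" "v : hgr M a" "al = of_int (2 * int p * j + a)" unfolding FG_def by blast
  obtain l w b where z: "z = lam l <*> w" "b : S" "w : hgr N b" using zz by blast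
  note vk = eig_kcar[OF g(3)]
  note wk = eig_kcar[OF z(3)]
  have e: "ex k al = (-1) powi (a * k)"
   using ex_add[of k "ldeg p j" "of_int a"] ex_ldeg[of k j] ex_of_int[of k a] unfolding g(4) of_int_add by simp
  have i: "k + j + l = j + (k + l)" by simp
  have "a * (k + l) = a * k + a * l" by (simp add: algebra_simps)
  then have Jk: "Jc a b (k + l) = ex k al * Jc a b l"
   unfolding Jc_def e by (simp only: sign_add mult.assoc)
  show "h g (lact (FO N) k z) = ex k al *\<^sub>C h (lact (FO M) k g) z"
   unfolding g(1) z(1) FO_lact[OF K(1) vk] FO_lact[OF K(2) wk] he[OF vk wk] Bh[OF g(2) z(2) g(3) z(3)] Jk cvec.scale_scale
   by (simp only: i)
 qed
 then obtain f where f: "f : lin (car (TT (FO M) (FO N))) UNIV" "!!x y. x : car (FO M) ==> y : car (FO N) ==> f (tt (FO M) (FO N) x y) = h x y" by blast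
 show ?thesis
 proof (intro bexI[of _ f] ballI allI f(1))
  fix a b k l m n assume h: "a : S" "b : S" "m : hgr M a" "n : hgr N b"
  note mk = eig_kcar[OF h(3)] eig_kcar[OF h(4)]
  show "f (tt (FO M) (FO N) (lam k <*> m) (lam l <*> n)) = Jc a b l *\<^sub>C (lam (k + l + \<kappa> a b) <*> (m <*> n))"
   unfolding f(2)[OF FO_mem[OF K(1) mk(1)] FO_mem[OF K(2) mk(2)]] he[OF mk] by (rule Bh[OF h])
 qed
qed

definition Jmap :: "kmod => kmod => cvec => cvec" where
 "Jmap M N = (SOME f. f : lin (car (TT (FO M) (FO N))) UNIV & (ALL a:S. ALL b:S. ALL k l. ALL m:hgr M a. ALL n:hgr N b.
   f (tt (FO M) (FO N) (lam k <*> m) (lam l <*> n)) = Jc a b l *\<^sub>C (lam (k + l + \<kappa> a b) <*> (m <*> n))))"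

definition J :: "kmod => kmod => (lmod, (gspace, cvec => cvec) arrow) arrow" where
 "J M N = Arrow (TT (FO M) (FO N)) (Arrow (fst (TT (FO M) (FO N))) (Jmap M N) (fst (FO (ktens M N)))) (FO (ktens M N))"

lemma Jmap:
 assumes K: "is_kmod p M" "is_kmod p N"
 shows "Jmap M N : lin (car (TT (FO M) (FO N))) UNIV"
  "!!a b k l m n. [|a : S; b : S; m : hgr M a; n : hgr N b|] ==> 
   Jmap M N (tt (FO M) (FO N) (lam k <*> m) (lam l <*> n)) = Jc a b l *\<^sub>C (lam (k + l + \<kappa> a b) <*> (m <*> n))"
proof -
 have "EX f. f : lin (car (TT (FO M) (FO N))) UNIV & (ALL a:S. ALL b:S. ALL k l. ALL m:hgr M a. ALL n:hgr N b.
   f (tt (FO M) (FO N) (lam k <*> m) (lam l <*> n)) = Jc a b l *\<^sub>C (lam (k + l + \<kappa> a b) <*> (m <*> n)))"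
  using J_lin_ex[OF K] by blast
 note J = someI_ex[OF this, folded Jmap_def]
 show "Jmap M N : lin (car (TT (FO M) (FO N))) UNIV"
  "!!a b k l m n. [|a : S; b : S; m : hgr M a; n : hgr N b|] ==> 
   Jmap M N (tt (FO M) (FO N) (lam k <*> m) (lam l <*> n)) = Jc a b l *\<^sub>C (lam (k + l + \<kappa> a b) <*> (m <*> n))"
  using J by blast+
qed

lemma el_J:
 assumes K: "is_kmod p M" "is_kmod p N" and h: "a : S" "b : S" "m : hgr M a" "n : hgr N b"
 shows "el (J M N) (tt (FO M) (FO N) (lam k <*> m) (lam l <*> n)) = Jc a b l *\<^sub>C (lam (k + l + \<kappa> a b) <*> (m <*> n))"
 using Jmap(2)[OF K h] by (simp add: J_def)

lemma J_Arr:
 assumes K: "is_kmod p M" "is_kmod p N"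
 shows "J M N : Arr MM" "Dom MM (J M N) = TT (FO M) (FO N)" "Cod MM (J M N) = FO (ktens M N)"
proof -
 note O = FO_Obj[OF K(1)] FO_Obj[OF K(2)] and T = is_kmod_ktens(1)[OF K]
 show "J M N : Arr MM" unfolding J_def
 proof (rule MM_ArrI_lin[OF TT_Obj[OF O] FO_Obj[OF T] Jmap(1)[OF K] tt_span[OF O FO_span[OF K(1)] FO_span[OF K(2)]]])
  fix ga z assume "z : {tt (FO M) (FO N) x y |x y al be. x : FG M al & y : FG N be & al + be = ga}"
  then obtain k m a l n b where z: "z = tt (FO M) (FO N) (lam k <*> m) (lam l <*> n)" "a : S" "b : S" "m : hgr M a" "n : hgr N b"
   "ga = of_int (2 * int p * k + a) + of_int (2 * int p * l + b)" unfolding FG_def by blast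
  note mk = eig_kcar[OF z(4)] eig_kcar[OF z(5)]
  have mn: "m <*> n : hgr (ktens M N) (rep (a + b))" unfolding hgr_rep by (rule eig_ktens[OF K z(4,5)])
  have "(2 * int p * k + a) + (2 * int p * l + b) = 2 * int p * (k + l + \<kappa> a b) + rep (a + b)"
   using kappa_eq[of a b] by (simp add: algebra_simps)
  then have g: "ga = of_int (2 * int p * (k + l + \<kappa> a b) + rep (a + b))" unfolding z(6) of_int_add[symmetric] by (simp only:)
  show "Jmap M N z : fst (FO (ktens M N)) ga"
   unfolding z(1) Jmap(2)[OF K z(2-5)] g
   by (intro cvec.subspace_scale[OF graded_subspace[OF ObjD(1)[OF FO_Obj[OF T]]]] FO_deg[OF T rep_S mn])
  fix k'
  have i: "k' + (k + l + \<kappa> a b) = k' + k + l + \<kappa> a b" by simp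
  show "Jmap M N (lact (TT (FO M) (FO N)) k' z) = lact (FO (ktens M N)) k' (Jmap M N z)"
   unfolding z(1) TT_act(2)[OF O FO_mem[OF K(1) mk(1)] FO_mem[OF K(2) mk(2)]] FO_lact[OF K(1) mk(1)] Jmap(2)[OF K z(2-5)]
    lin_on_scale[OF ObjD(2)[OF FO_Obj[OF T]] FO_mem[OF T eig_kcar[OF mn]]] FO_lact[OF T eig_kcar[OF mn]] i ..
 qed
 show "Dom MM (J M N) = TT (FO M) (FO N)" "Cod MM (J M N) = FO (ktens M N)" by (simp_all add: J_def MM_simps)
qed

lemma J_gen:
 assumes K: "is_kmod p M" "is_kmod p N"
 shows "MM.gen (TT (FO M) (FO N)) {tt (FO M) (FO N) x y | x y. x : {lam k <*> v | k v. v : homog M} & y : {lam k <*> v | k v. v : homog N}}"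
 using MM.gen_tens[OF FO_gen_homog[OF K(1) K(1)] FO_gen_homog[OF K(2) K(2)]] by (simp add: homog_def MM_simps(5))

text \<open>
  Every element of the relative tensor product can be normalized so that the second factor starts with
  \<open>1\<^sub>0\<close>.
\<close>

lemma z_balance:
 assumes K: "is_kmod p M" "is_kmod p N" and h: "a : S" "m : hgr M a" "n : kcar N"
 shows "tt (FO M) (FO N) (lam k <*> m) (lam l <*> n) = (-1) powi (a * l) *\<^sub>C tt (FO M) (FO N) (lam (l + k) <*> m) (lam 0 <*> n)"
proof -
 have "tt (FO M) (FO N) (lam k <*> m) (lact (FO N) l (lam 0 <*> n)) = ex l (of_int (2 * int p * k + a)) *\<^sub>C tt (FO M) (FO N) (lact (FO M) l (lam k <*> m)) (lam 0 <*> n)"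
  by (rule tt_balanced[OF FO_Obj[OF K(1)] FO_Obj[OF K(2)] FO_deg[OF K(1) h(1,2)] FO_mem[OF K(2) h(3)]])
 moreover have "ex l (of_int (2 * int p * k + a)) = (-1) powi (a * l)"
  unfolding of_int_add ex_add ex_ldeg ex_of_int by simp
 ultimately show ?thesis unfolding FO_lact[OF K(1) eig_kcar[OF h(2)]] FO_lact[OF K(2) h(3)] by simp
qed

text \<open>
  An inverse linear map sends \<open>1\<^sub>k \<otimes> (m \<otimes> n)\<close> to a multiple of
  \<open>(1\<^bsub>k - \<kappa>\<^esub> \<otimes> m) \<otimes>\<^sub>\<Lambda> (1\<^sub>0 \<otimes>
  n)\<close>.
\<close>

lemma J_iso':
 assumes K: "is_kmod p M" "is_kmod p N"
 shows "J M N : cat_iso MM (TT (FO M) (FO N)) (FO (ktens M N))"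
proof -
 note O = FO_Obj[OF K(1)] FO_Obj[OF K(2)] and T = is_kmod_ktens(1)[OF K]
 note s = kmod_subspace[OF K(1)] kmod_subspace[OF K(2)]
 have 1: "lin_on (kcar N) (%n. tt (FO M) (FO N) (lam k <*> m) (lam l <*> kidem p N b n))" if "m : kcar M" for k l m b
  by (rule tt_sub(2)[OF O]) (auto intro!: lin_intros lin_on_kidem K FO_mem kidem_kcar that)
 have 2: "lin_on (kcar M) (%m. tt (FO M) (FO N) (lam k <*> kidem p M a m) (lam l <*> n))" if "n : kcar N" for k l n a
  by (rule tt_sub(1)[OF O]) (auto intro!: lin_intros lin_on_kidem K FO_mem kidem_kcar that)
 let ?c = "%k a b m n. inverse (\<zeta> a b) *\<^sub>C tt (FO M) (FO N) (lam (k - \<kappa> a b) <*> m) (lam 0 <*> n)"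
 let ?B = "%k m n. SUM a:S. SUM b:S. ?c k a b (kidem p M a m) (kidem p N b n)"
 have b: "bilin_on (kcar M) (kcar N) (?B k)" for k
  by (intro bilin_onI lin_on_comp_sum lin_on_comp_scale 1 2 kidem_kcar K)
 have z: "tt (FO M) (FO N) 0 y = 0" if "y : car (FO N)" for y
  by (rule lin_on_zero[OF tt_lin1[OF O that] cvec.subspace_0[OF subspace_gcar]])
 have z': "tt (FO M) (FO N) x 0 = 0" if "x : car (FO M)" for x
  by (rule lin_on_zero[OF tt_lin2[OF O that] cvec.subspace_0[OF subspace_gcar]])
 note t = tmap_lin[OF s b] tmap_tensor[OF s b]
 obtain f where f: "f : lin (car (FO (ktens M N))) UNIV" "!!k x. x : kcar (ktens M N) ==> f (lam k <*> x) = tmap (kcar M) (kcar N) (?B k) x"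
  using lam_extend[where a = "%k. tmap (kcar M) (kcar N) (?B k)", OF subspace_tens lin_lin_on[OF t(1)]] unfolding FO_car[OF T] kcar_ktens by auto
 have fh: "f (lam k <*> (m <*> n)) = ?c k a b m n"
  if h: "a : S" "b : S" "m : hgr M a" "n : hgr N b" for a b k m n
 proof -
  note mk = eig_kcar[OF h(3)] eig_kcar[OF h(4)]
  have "f (lam k <*> (m <*> n)) = ?B k m n"
   using f(2)[of "m <*> n" k] t(2)[OF mk, of k] tens_mem[OF mk] by simp
  also have "... = (SUM a':S. SUM b':S. if b' = b then if a' = a then ?c k a b m n else 0 else 0)"
   by (intro sum.cong refl) (auto simp: kidem_hgr[OF K(1) h(3) _ h(1)] kidem_hgr[OF K(2) h(4) _ h(2)] z z' FO_mem[OF K(1) mk(1)] FO_mem[OF K(2) mk(2)] FO_mem[OF K(2) cvec.subspace_0[OF s(2)], simplified])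
  also have "... = ?c k a b m n" using h finite_S by (simp add: sum.delta)
  finally show ?thesis .
 qed
 have sp: "cvec.span {m <*> n | m n. m : homog M & n : homog N} = kcar (ktens M N)"
  using tens_span[OF kcar_span[OF K(1), symmetric] kcar_span[OF K(2), symmetric]] by (simp add: homog_def)
 show ?thesis
 proof (rule MM.iso_of_generators[OF J_Arr(1)[OF K], unfolded J_Arr[OF K], OF J_gen[OF K] FO_gen[OF T sp] lin_lin_on[OF f(1)]])
  fix z assume "z : {tt (FO M) (FO N) x y | x y. x : {lam k <*> v | k v. v : homog M} & y : {lam k <*> v | k v. v : homog N}}"
  then obtain k m a l n b where z: "z = tt (FO M) (FO N) (lam k <*> m) (lam l <*> n)" and h: "a : S" "b : S" "m : hgr M a" "n : hgr N b"
   by (auto simp: homog_def)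
  note mk = eig_kcar[OF h(3)] eig_kcar[OF h(4)]
  have i: "k + l + \<kappa> a b - \<kappa> a b = l + k" by simp
  have c: "Jc a b l * inverse (\<zeta> a b) = (-1) powi (a * l)" using zeta_nonzero[OF h(1,2)] by (simp add: Jc_def)
  show "f (el (J M N) z) = z"
   unfolding z el_J[OF K h] lin_on_scale[OF lin_lin_on[OF f(1)] FO_mem[OF T tens_mem[OF mk, folded kcar_ktens]]] fh[OF h] i cvec.scale_scale c
   by (rule z_balance[OF K h(1,3) mk(2), of k l, symmetric])
 next
  fix z assume "z : {lam k <*> v | k v. v : {m <*> n | m n. m : homog M & n : homog N}}"
  then obtain k m n a b where z: "z = lam k <*> (m <*> n)" and h: "a : S" "b : S" "m : hgr M a" "n : hgr N b"
   by (auto simp: homog_def)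
  note mk = FO_mem[OF K(1) eig_kcar[OF h(3)]] FO_mem[OF K(2) eig_kcar[OF h(4)]]
  have "el (J M N) (?c k a b m n) = z"
   using MM.el_scale[OF J_Arr(1)[OF K], unfolded J_Arr[OF K], OF tt_mem[OF O mk]] el_J[OF K h] zeta_nonzero[OF h(1,2)] by (simp add: z Jc_def)
  moreover have "?c k a b m n : car (TT (FO M) (FO N))"
   by (intro cvec.subspace_scale subspace_gcar tt_mem[OF O mk])
  ultimately show "z : el (J M N) ` car (TT (FO M) (FO N))" by force
 qed
qed

lemma J_cases:
 assumes "z : {tt (FO M) (FO N) x y | x y. x : {lam k <*> v | k v. v : homog M} & y : {lam k <*> v | k v. v : homog N}}"
 obtains k m a l n b where "z = tt (FO M) (FO N) (lam k <*> m) (lam l <*> n)" "a : S" "b : S" "m : hgr M a" "n : hgr N b"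
 using assms by (auto simp: homog_def)

lemma J_nat:
 assumes f: "f : Arr RC" and g: "g : Arr RC"
 shows "Comp MM (J (tgt f) (tgt g)) (TensA MM (FA f) (FA g)) = Comp MM (FA (TensA RC f g)) (J (src f) (src g))"
proof -
 have K: "is_kmod p (src f)" "is_kmod p (tgt f)" "is_kmod p (src g)" "is_kmod p (tgt g)" using f g by (auto simp: RC_Arr)
 have fg: "TensA RC f g : Arr RC" "src (TensA RC f g) = ktens (src f) (src g)" "tgt (TensA RC f g) = ktens (tgt f) (tgt g)"
  using RC.TensA_Arr[OF f g] by simp_all
 note A = FA_hom[OF f] FA_hom[OF g] FA_hom[OF fg(1)] J_Arr[OF K(1,3)] J_Arr[OF K(2,4)] MM.TensA_Arr[OF FA_hom(1)[OF f] FA_hom(1)[OF g]]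
 show ?thesis
 proof (rule MM.hom_eqI_gen[OF J_gen[OF K(1,3)]])
  fix z assume "z : {tt (FO (src f)) (FO (src g)) x y | x y. x : {lam k <*> v | k v. v : homog (src f)} & y : {lam k <*> v | k v. v : homog (src g)}}"
  then obtain k m a l n b where z: "z = tt (FO (src f)) (FO (src g)) (lam k <*> m) (lam l <*> n)" and h: "a : S" "b : S" "m : hgr (src f) a" "n : hgr (src g) b"
   by (rule J_cases)
  note mk = eig_kcar[OF h(3)] eig_kcar[OF h(4)]
  note h' = h(1,2) RC_Arr_eig[OF f h(3)] RC_Arr_eig[OF g h(4)]
  note e = RC.el_TensA[OF f g] FA_props(4)[OF f mk(1)] FA_props(4)[OF g mk(2)] FA_props(4)[OF fg(1), unfolded fg(2)]
  have mm: "lam k <*> m : car (FO (src f))" "lam l <*> n : car (FO (src g))" using FO_mem K mk by auto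
  have "el (TensA MM (FA f) (FA g)) z = tt (FO (tgt f)) (FO (tgt g)) (lam k <*> amap f m) (lam l <*> amap g n)"
   using MM.el_TensA[OF A(1,4)] mm e unfolding z by (simp add: A)
  then have "el (Comp MM (J (tgt f) (tgt g)) (TensA MM (FA f) (FA g))) z = Jc a b l *\<^sub>C (lam (k + l + \<kappa> a b) <*> (amap f m <*> amap g n))"
   using el_J[OF K(2,4) h'] tt_mem[OF FO_Obj[OF K(1)] FO_Obj[OF K(3)] mm] A unfolding z by (simp add: MM_simps(5))
  moreover have "el (Comp MM (FA (TensA RC f g)) (J (src f) (src g))) z = Jc a b l *\<^sub>C (lam (k + l + \<kappa> a b) <*> (amap f m <*> amap g n))"
   using el_J[OF K(1,3) h] tt_mem[OF FO_Obj[OF K(1)] FO_Obj[OF K(3)] mm] A e(1) mk e(4)[OF tens_mem[OF mk, folded kcar_ktens]]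
    MM.el_scale[OF FA_hom(1)[OF fg(1)], unfolded FA_hom[OF fg(1)] fg, OF FO_mem[OF is_kmod_ktens(1)[OF K(1,3)] tens_mem[OF mk, folded kcar_ktens]]]
   unfolding z by (simp add: fg del: RC_simps(8))
  ultimately show "el (Comp MM (J (tgt f) (tgt g)) (TensA MM (FA f) (FA g))) z = el (Comp MM (FA (TensA RC f g)) (J (src f) (src g))) z" by simp
 qed (use A fg in "simp_all add: MM_simps(5) del: RC_simps(8)")
qed

end

context lam_data
begin

text \<open>
  Homogeneous generators of a module. Unlike spanning families they may be finite, and they reduce all
  equations between arrows to the vectors \<open>1\<^sub>0 \<otimes> m\<close>.
\<close>

definition lgen :: "lmod => cvec set => bool" where
 "lgen M A \<longleftrightarrow> M : Obj MM & A <= (UN al. fst M al) & car M = cvec.span {lact M k a | k a. a : A}"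

lemma lgen_mem: "lgen M A ==> a : A ==> a : car M"
 using gcar_mem[of a "fst M"] by (auto simp: lgen_def)

lemma lgen_determined: "lgen M A ==> MM.determined M A"
 by (rule determined_lact[OF _ subsetI]) (erule (1) lgen_mem | simp add: lgen_def)+

lemma lgen_UM: "lgen UM {lam 0}"
proof -
 have "{lact UM k z | k z. z : {lam 0}} = range lam" by (auto simp: lact_UM)
 then show ?thesis using lam_Lam[of 0 p] UM_Obj by (auto simp: lgen_def fst_UM span_lam)
qed

lemma lgen_TT:
 assumes A: "lgen M A" and B: "lgen N B"
 shows "lgen (TT M N) {tt M N a b | a b. a : A & b : B}" (is "lgen _ ?T")
 unfolding lgen_def
proof (intro conjI)
 have O: "M : Obj MM" "N : Obj MM" using A B by (auto simp: lgen_def)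
 show "TT M N : Obj MM" by (rule TT_Obj[OF O])
 show "?T <= (UN al. fst (TT M N) al)"
 proof
  fix z assume "z : ?T"
  then obtain a b where z: "z = tt M N a b" "a : A" "b : B" by blast
  then obtain al be where "a : fst M al" "b : fst N be" using A B unfolding lgen_def by blast
  then show "z : (UN al. fst (TT M N) al)" unfolding z(1) using tt_deg[OF O] by blast
 qed
 let ?G = "{tt M N x y | x y. x : {lact M k a | k a. a : A} & y : {lact N l b | l b. b : B}}"
 have "car (TT M N) = cvec.span ?G"
  using MM.gen_tens[of M "{lact M k a | k a. a : A}" N "{lact N l b | l b. b : B}"] A B by (simp add: MM.gen_def lgen_def MM_simps(5))
 moreover have "?G <= cvec.span {lact (TT M N) k z | k z. z : ?T}"
 proof
  fix g assume "g : ?G"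
  then obtain k l a b where g: "g = tt M N (lact M k a) (lact N l b)" and ab: "a : A" "b : B" by blast
  note c = lgen_mem[OF A ab(1)] lgen_mem[OF B ab(2)]
  obtain al where "a : fst M al" using A ab by (auto simp: lgen_def)
  then have g': "g = ex l (al + ldeg p k) *\<^sub>C lact (TT M N) (l + k) (tt M N a b)"
   unfolding g using tt_balanced[OF O ObjD(3)[OF O(1)] c(2), of a al k l] by (simp add: TT_act(2)[OF O c] ObjD(4)[OF O(1) c(1)])
  have "lact (TT M N) (l + k) (tt M N a b) : {lact (TT M N) k z | k z. z : ?T}" using ab by blast
  then show "g : cvec.span {lact (TT M N) k z | k z. z : ?T}" unfolding g' by (intro cvec.span_scale cvec.span_base)
 qed
 moreover have "lact (TT M N) k z : car (TT M N)" if "z : ?T" for k z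
  using that lgen_mem[OF A] lgen_mem[OF B] by (auto intro!: ObjD(6)[OF TT_Obj[OF O]] tt_mem[OF O])
 then have "cvec.span {lact (TT M N) k z | k z. z : ?T} <= car (TT M N)" by (intro cvec.span_minimal subspace_gcar) auto
 ultimately show "car (TT M N) = cvec.span {lact (TT M N) k z | k z. z : ?T}"
  using cvec.span_minimal[OF _ cvec.subspace_span, of ?G] by (intro antisym) simp_all
qed

end

context rep_data
begin

definition hom0 :: "kmod => cvec set" where "hom0 V = {lam 0 <*> v | v. v : homog V}"

lemma FO_lact_gens:
 assumes V: "is_kmod p V" and x: "kcar V = cvec.span (x ` N)"
 shows "{lact (FO V) k a | k a. a : (%n. lam (s n) <*> x n) ` N} = {lam k <*> v | k v. v : x ` N}"
proof -
 have e: "lact (FO V) k (lam (s n) <*> x n) = lam (k + s n) <*> x n" if "n : N" for k n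
  by (rule FO_lact[OF V]) (use that x in "auto intro: cvec.span_base")
 have "{lact (FO V) k a | k a. a : (%n. lam (s n) <*> x n) ` N} = {lact (FO V) k (lam (s n) <*> x n) | k n. n : N}" by blast
 also have "... = {lam (k + s n) <*> x n | k n. n : N}" by (rule setcompr_cong2) (rule e)
 also have "... = {lam k <*> v | k v. v : x ` N}"
 proof (intro equalityI subsetI)
  fix z assume "z : {lam k <*> v | k v. v : x ` N}"
  then obtain k n where "z = lam (k - s n + s n) <*> x n" "n : N" by auto
  then show "z : {lam (k + s n) <*> x n | k n. n : N}" by blast
 qed blast
 finally show ?thesis .
qed

lemma lgen_FO: "is_kmod p V ==> lgen (FO V) (hom0 V)"
proof -
 assume V: "is_kmod p V"
 have h: "hom0 V = (%v. lam 0 <*> v) ` homog V" by (auto simp: hom0_def)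
 moreover have "hom0 V <= (UN al. fst (FO V) al)"
  using FO_deg[OF V, of _ _ 0] by (fastforce simp: hom0_def homog_def)
 ultimately show ?thesis
  using FO_gen_homog[OF V V] FO_Obj[OF V] FO_lact_gens[OF V, of "%v. v" "homog V" "%_. 0"] kcar_span[OF V] by (simp add: lgen_def MM.gen_def homog_def)
qed

lemma FO_Arr_eqI:
 assumes "lgen M A" "f : Arr MM" "g : Arr MM" "Dom MM f = M" "Dom MM g = M" "Cod MM f = Cod MM g" "!!a. a : A ==> el f a = el g a"
 shows "f = g"
 using MM.hom_eqI[OF lgen_determined] assms by blast

lemma Jc_0 [simp]: "Jc a b 0 = \<zeta> a b" by (simp add: Jc_def)

text \<open>
  On generators with index \<open>0\<close> the braiding of local modules is the factor
  \<open>q\<^bsup>ab/2\<^esup>\<close> of \<open>R\<close>; the quotient of the two \<open>\<zeta>\<close>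
  comes from \<open>J\<close>.
\<close>

lemma J_braid:
 assumes K: "is_kmod p M" "is_kmod p N"
 shows "Comp MM (FA (Braid RC M N)) (J M N) = Comp MM (J N M) (Braid MM (FO M) (FO N))"
proof (rule FO_Arr_eqI[OF lgen_TT[OF lgen_FO[OF K(1)] lgen_FO[OF K(2)]]])
 note O = FO_Obj[OF K(1)] FO_Obj[OF K(2)] and Bs = RC.structure_Arr(4-6)[of M N]
 have B: "Braid RC M N : Arr RC" "src (Braid RC M N) = ktens M N" "tgt (Braid RC M N) = ktens N M" using Bs K by simp_all
 note A = FA_hom[OF B(1), unfolded B] J_Arr[OF K] J_Arr[OF K(2,1)] MM.structure_Arr(4-6)[OF O] MM_simps(5)
 show "Comp MM (FA (Braid RC M N)) (J M N) : Arr MM" "Comp MM (J N M) (Braid MM (FO M) (FO N)) : Arr MM"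
  "Dom MM (Comp MM (FA (Braid RC M N)) (J M N)) = TT (FO M) (FO N)" "Dom MM (Comp MM (J N M) (Braid MM (FO M) (FO N))) = TT (FO M) (FO N)"
  "Cod MM (Comp MM (FA (Braid RC M N)) (J M N)) = Cod MM (Comp MM (J N M) (Braid MM (FO M) (FO N)))"
  using A by simp_all
 fix z assume "z : {tt (FO M) (FO N) a b | a b. a : hom0 M & b : hom0 N}"
 then obtain m a n b where z: "z = tt (FO M) (FO N) (lam 0 <*> m) (lam 0 <*> n)" and h: "a : S" "b : S" "m : hgr M a" "n : hgr N b"
  by (auto simp: hom0_def homog_def)
 note mk = eig_kcar[OF h(3)] eig_kcar[OF h(4)] and h' = h(2,1,4,3)
 note mm = FO_mem[OF K(1) mk(1)] FO_mem[OF K(2) mk(2)]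
 note d = FO_deg[OF K(1) h(1,3), of 0, simplified] FO_deg[OF K(2) h(2,4), of 0, simplified]
 have mn: "m <*> n : kcar (ktens M N)" "n <*> m : kcar (ktens N M)" using mk by (auto simp: tens_mem)
 have e1: "el (FA (Braid RC M N)) (lam k <*> (m <*> n)) = R a b *\<^sub>C (lam k <*> (n <*> m))" for k
  using FA_props(4)[OF B(1), unfolded B, OF mn(1)] RC.el_Braid[of M N a b m n] K h by (simp add: tensor_scale_right)
 have e2: "el (Braid MM (FO M) (FO N)) z = hexp p (of_int a * of_int b) *\<^sub>C tt (FO N) (FO M) (lam 0 <*> n) (lam 0 <*> m)"
  unfolding z by (rule MM.el_Braid[OF O Ints_of_int Ints_of_int d])
 have q: "hexp p (of_int a * of_int b) = qpow p (of_int (a * b) / 2)" by (simp add: hexp_def qpow_def field_simps)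
 have c: "\<zeta> a b * R a b = qpow p (of_int (a * b) / 2) * \<zeta> b a" using zeta_nonzero[OF h(1,2)] by (simp add: R_coeff_def)
 have "el (Comp MM (FA (Braid RC M N)) (J M N)) z = (\<zeta> a b * R a b) *\<^sub>C (lam (\<kappa> a b) <*> (n <*> m))"
  using el_J[OF K h, of 0 0] e1 tt_mem[OF O mm] MM.el_scale[OF A(1), unfolded A(2), OF FO_mem[OF is_kmod_ktens(1)[OF K] mn(1)]] A(1-7)
  by (simp add: z)
 moreover have "el (Comp MM (J N M) (Braid MM (FO M) (FO N))) z = (qpow p (of_int (a * b) / 2) * \<zeta> b a) *\<^sub>C (lam (\<kappa> b a) <*> (n <*> m))"
  using el_J[OF K(2,1) h', of 0 0] e2 tt_mem[OF O mm] MM.el_scale[OF A(7), unfolded A(8), OF tt_mem[OF O(2,1) mm(2,1)]] A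
  by (simp add: z q)
 ultimately show "el (Comp MM (FA (Braid RC M N)) (J M N)) z = el (Comp MM (J N M) (Braid MM (FO M) (FO N))) z"
  by (simp add: c kappa_commute[of b a])
qed

lemma F_twist:
 assumes V: "is_kmod p V"
 shows "FA (Twist RC V) = Twist MM (FO V)"
proof (rule FO_Arr_eqI[OF lgen_FO[OF V]])
 have B: "Twist RC V : Arr RC" "src (Twist RC V) = V" "tgt (Twist RC V) = V" using RC.structure_Arr(13-15)[of V] V by simp_all
 note A = FA_hom[OF B(1), unfolded B] MM.structure_Arr(13-15)[OF FO_Obj[OF V]]
 show "FA (Twist RC V) : Arr MM" "Twist MM (FO V) : Arr MM" "Dom MM (FA (Twist RC V)) = FO V" "Dom MM (Twist MM (FO V)) = FO V"
  "Cod MM (FA (Twist RC V)) = Cod MM (Twist MM (FO V))" using A by simp_all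
 fix z assume "z : hom0 V"
 then obtain a m where z: "z = lam 0 <*> m" and h: "a : S" "m : hgr V a" by (auto simp: hom0_def homog_def)
 have "el (FA (Twist RC V)) z = \<theta> a *\<^sub>C z"
  unfolding z using FA_props(4)[OF B(1), unfolded B, OF eig_kcar[OF h(2)]] RC.el_Twist[of V a m] V h by (simp add: tensor_scale_right)
 moreover have "el (Twist MM (FO V)) z = hexp p ((of_int a)\<^sup>2) *\<^sub>C z"
  unfolding z by (rule MM.el_Twist[OF FO_Obj[OF V] Ints_of_int FO_deg[OF V h, of 0, simplified]])
 moreover have "hexp p ((of_int a)\<^sup>2) = \<theta> a" by (simp add: hexp_def \<theta>_def qpow_def field_simps)
 ultimately show "el (FA (Twist RC V)) z = el (Twist MM (FO V)) z" by simp
qed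

text \<open>
  Both sides send \<open>(1\<^sub>0 \<otimes> u) \<otimes> ((1\<^sub>0 \<otimes> v) \<otimes> (1\<^sub>0
  \<otimes> w))\<close> to multiples of \<open>1\<^sub>k \<otimes> ((u \<otimes> v) \<otimes> w)\<close> with
  the same \<open>k\<close> by \<open>kappa_assoc\<close>. On the left the second factor acquires an index
  \<open>\<kappa>(b, c)\<close>, whence the sign in \<open>\<Phi>\<close>.
\<close>

lemma J_assoc:
 assumes K: "is_kmod p L" "is_kmod p M" "is_kmod p N"
 shows "Comp MM (FA (Assoc RC L M N)) (Comp MM (J L (ktens M N)) (TensA MM (Id MM (FO L)) (J M N)))
  = Comp MM (J (ktens L M) N) (Comp MM (TensA MM (J L M) (Id MM (FO N))) (Assoc MM (FO L) (FO M) (FO N)))" (is "?l = ?r")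
proof (rule FO_Arr_eqI[OF lgen_TT[OF lgen_FO[OF K(1)] lgen_TT[OF lgen_FO[OF K(2)] lgen_FO[OF K(3)]]]])
 let ?L = "FO L" and ?M = "FO M" and ?N = "FO N"
 note O [simp] = FO_Obj[OF K(1)] FO_Obj[OF K(2)] FO_Obj[OF K(3)]
 note T = is_kmod_ktens(1)[OF K(1,2)] is_kmod_ktens(1)[OF K(2,3)]
 note TO [simp] = TT_Obj[OF O(1,2)] TT_Obj[OF O(2,3)] FO_Obj[OF T(1)] FO_Obj[OF T(2)]
 have B: "Assoc RC L M N : Arr RC" "src (Assoc RC L M N) = ktens L (ktens M N)" "tgt (Assoc RC L M N) = ktens (ktens L M) N"
  using RC.structure_Arr(1-3)[of L M N] K by simp_all
 note A [simp] = FA_hom[OF B(1), unfolded B] J_Arr[OF K(1,2)] J_Arr[OF K(2,3)] J_Arr[OF K(1) T(2)] J_Arr[OF T(1) K(3)] MM.structure_Arr(1-3)[OF O]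
  MM.Id_Arr[OF O(1)] MM.Id_Arr[OF O(3)] MM_simps(5)
 show "?l : Arr MM" "?r : Arr MM" "Dom MM ?l = TT ?L (TT ?M ?N)" "Dom MM ?r = TT ?L (TT ?M ?N)" "Cod MM ?l = Cod MM ?r" by simp_all
 fix z assume "z : {tt ?L (TT ?M ?N) a b | a b. a : hom0 L & b : {tt ?M ?N a b | a b. a : hom0 M & b : hom0 N}}"
 then obtain u a v b w c where z: "z = tt ?L (TT ?M ?N) (lam 0 <*> u) (tt ?M ?N (lam 0 <*> v) (lam 0 <*> w))"
  and h: "a : S" "b : S" "c : S" "u : hgr L a" "v : hgr M b" "w : hgr N c"
  by (auto simp: hom0_def homog_def)
 note mk = eig_kcar[OF h(4)] eig_kcar[OF h(5)] eig_kcar[OF h(6)]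
 note mm [simp] = FO_mem[OF K(1) mk(1)] FO_mem[OF K(2) mk(2)] FO_mem[OF K(3) mk(3)] tt_mem[OF O(2,3)] tt_mem[OF O(1,2)]
 have hb: "v <*> w : hgr (ktens M N) (rep (b + c))" "u <*> v : hgr (ktens L M) (rep (a + b))"
  unfolding hgr_rep by (intro eig_ktens K h)+
 note m2 [simp] = FO_mem[OF T(2) eig_kcar[OF hb(1)]] FO_mem[OF T(1) eig_kcar[OF hb(2)]]
 have m3: "u <*> (v <*> w) : kcar (ktens L (ktens M N))" using mk by (simp add: tens_mem)
 have J1: "el (J M N) (tt ?M ?N (lam 0 <*> v) (lam 0 <*> w)) = \<zeta> b c *\<^sub>C (lam (\<kappa> b c) <*> (v <*> w))" using el_J[OF K(2,3) h(2,3,5,6), of 0 0] by simp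
 have J2: "el (J L M) (tt ?L ?M (lam 0 <*> u) (lam 0 <*> v)) = \<zeta> a b *\<^sub>C (lam (\<kappa> a b) <*> (u <*> v))" using el_J[OF K(1,2) h(1,2,4,5), of 0 0] by simp
 let ?k = "\<kappa> b c + \<kappa> a (rep (b + c))"
 have "el (TensA MM (Id MM ?L) (J M N)) z = \<zeta> b c *\<^sub>C tt ?L (FO (ktens M N)) (lam 0 <*> u) (lam (\<kappa> b c) <*> (v <*> w))"
  unfolding z using MM.t_scale_right[OF O(1) TO(4) mm(1) m2(1)] by (simp add: J1)
 moreover have "el (J L (ktens M N)) (\<zeta> b c *\<^sub>C tt ?L (FO (ktens M N)) (lam 0 <*> u) (lam (\<kappa> b c) <*> (v <*> w)))
   = (\<zeta> b c * Jc a (rep (b + c)) (\<kappa> b c)) *\<^sub>C (lam ?k <*> (u <*> (v <*> w)))"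
  using MM.el_scale[OF J_Arr(1)[OF K(1) T(2)]] el_J[OF K(1) T(2) h(1) rep_S h(4) hb(1), of 0 "\<kappa> b c"] tt_mem[OF O(1) TO(4) mm(1) m2(1)] by simp
 moreover have "el (FA (Assoc RC L M N)) (lam ?k <*> (u <*> (v <*> w))) = \<Phi> a b c *\<^sub>C (lam ?k <*> ((u <*> v) <*> w))"
  using FA_props(4)[OF B(1), unfolded B, OF m3] RC.el_Assoc[of L M N a b c u v w] K h by (simp add: tensor_scale_right)
 ultimately have l: "el ?l z = (\<zeta> b c * Jc a (rep (b + c)) (\<kappa> b c) * \<Phi> a b c) *\<^sub>C (lam ?k <*> ((u <*> v) <*> w))"
  using MM.el_scale[OF A(1), unfolded A(2), OF FO_mem[OF is_kmod_ktens(1)[OF K(1) T(2)] m3]] tt_mem[OF O(1) TO(4) mm(1) m2(1)]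
   cvec.subspace_scale[OF subspace_gcar tt_mem[OF O(1) TO(4) mm(1) m2(1)]] tt_mem[OF O(1) TO(2) mm(1) mm(4)[OF mm(2,3)]] by (simp add: z)
 have "el (Assoc MM ?L ?M ?N) z = tt (TT ?L ?M) ?N (tt ?L ?M (lam 0 <*> u) (lam 0 <*> v)) (lam 0 <*> w)"
  unfolding z using MM_Assoc(2)[OF O mm(1-3)] .
 moreover have "el (TensA MM (J L M) (Id MM ?N)) (tt (TT ?L ?M) ?N (tt ?L ?M (lam 0 <*> u) (lam 0 <*> v)) (lam 0 <*> w))
   = \<zeta> a b *\<^sub>C tt (FO (ktens L M)) ?N (lam (\<kappa> a b) <*> (u <*> v)) (lam 0 <*> w)"
  using MM.t_scale_left[OF TO(3) O(3) m2(2) mm(3)] by (simp add: J2)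
 moreover have "el (J (ktens L M) N) (\<zeta> a b *\<^sub>C tt (FO (ktens L M)) ?N (lam (\<kappa> a b) <*> (u <*> v)) (lam 0 <*> w))
   = (\<zeta> a b * \<zeta> (rep (a + b)) c) *\<^sub>C (lam (\<kappa> a b + \<kappa> (rep (a + b)) c) <*> ((u <*> v) <*> w))"
  using MM.el_scale[OF J_Arr(1)[OF T(1) K(3)]] el_J[OF T(1) K(3) rep_S h(3) hb(2) h(6), of "\<kappa> a b" 0] tt_mem[OF TO(3) O(3) m2(2) mm(3)] by simp
 ultimately have r: "el ?r z = (\<zeta> a b * \<zeta> (rep (a + b)) c) *\<^sub>C (lam (\<kappa> a b + \<kappa> (rep (a + b)) c) <*> ((u <*> v) <*> w))"
  using tt_mem[OF TO(1) O(3) mm(5)[OF mm(1,2)] mm(3)] tt_mem[OF O(1) TO(2) mm(1) mm(4)[OF mm(2,3)]] by (simp add: z)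
 have "\<zeta> b c * Jc a (rep (b + c)) (\<kappa> b c) * \<Phi> a b c = \<zeta> a b * \<zeta> (rep (a + b)) c"
  using zeta_nonzero[OF h(2,3)] zeta_nonzero[OF h(1) rep_S, of "b + c"] sign_sq[of "a * \<kappa> b c"] unfolding Jc_def Phi_coeff_def by (simp add: field_simps)
 then show "el ?l z = el ?r z" unfolding l r kappa_assoc by simp
qed

text \<open>
  The representative of \<open>0\<close> need not be \<open>0\<close>, so the unit of the functor has to shift
  the index by \<open>tz\<close> in order to preserve degrees.
\<close>

lemma unit_iso_ex:
 "EX f:cat_iso MM UM (FO kunit). ALL k. el f (lam k) = lam (k - tz) <*> e0"
proof -
 note K = kunit_kmod[OF p_pos] and U = kunit_hgr[OF basis0_unit]
 obtain f0 where f0: "lin_on UNIV f0" "!!k. f0 (lam k) = lam (k - tz) <*> e0"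
  using lam_extend1[of "%k. lam (k - tz) <*> e0"] by auto
 let ?f = "restrict f0 (car UM)"
 have fl: "?f : lin (car UM) UNIV" by (rule restrict_lin) (use lin_on_subset[OF f0(1)] in auto)
 have f: "?f (lam k) = lam (k - tz) <*> e0" for k using f0(2) by (simp add: fst_UM)
 let ?F = "Arrow UM (Arrow (fst UM) ?f (fst (FO kunit))) (FO kunit)"
 have F: "?F : Arr MM"
 proof (rule MM_ArrI_lin[OF UM_Obj FO_Obj[OF K] fl])
  show "fst UM al = cvec.span {lam k | k. al = of_int (2 * int p * k)}" for al by (simp add: fst_UM Lam_def)
  fix al :: complex and x assume "x : {lam k | k. al = of_int (2 * int p * k)}"
  then obtain k where x: "x = lam k" "al = of_int (2 * int p * k)" by blast
  have e: "2 * int p * k = 2 * int p * (k - tz) + rep 0" using tz(1) by (simp add: algebra_simps)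
  show "?f x : fst (FO kunit) al" unfolding x f e by (rule FO_deg[OF K rep_S U])
  have i: "k' + (k - tz) = k' + k - tz" for k' by simp
  show "?f (lact UM k' x) = lact (FO kunit) k' (?f x)" for k' unfolding x lact_UM f FO_lact[OF K eig_kcar[OF U]] i ..
 qed
 have s: "cvec.span {e0} = kcar kunit" by (simp add: kunit_def unit_space_def)
 obtain g where g: "g : lin (tens UNIV (kcar kunit)) UNIV" "!!k v. v : kcar kunit ==> g (lam k <*> v) = Poly_Mapping.lookup v 0 *\<^sub>C lam (k + tz)"
  using lam_extend[where a = "%k v. Poly_Mapping.lookup v 0 *\<^sub>C lam (k + tz)", OF kmod_subspace[OF K]]
  by (auto simp: lin_on_def lookup_add lookup_vscale cvec.scale_left_distrib)
 have "?F : cat_iso MM UM (FO kunit)"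
 proof (rule MM.iso_of_generators[OF F, unfolded MM_simps(1,2) arrow.sel, of "range lam" "{lam k <*> v | k v. v : {e0}}" g])
  show "MM.gen UM (range lam)" using UM_Obj by (simp add: MM.gen_def fst_UM span_lam)
  show "MM.gen (FO kunit) {lam k <*> v | k v. v : {e0}}" by (rule FO_gen[OF K s])
  show "lin_on (car (FO kunit)) g" using lin_lin_on[OF g(1)] by (simp add: FO_car[OF K])
  fix a assume "a : range lam"
  then obtain k where a: "a = lam k" by blast
  have "Poly_Mapping.lookup (e0) 0 = 1" by (simp add: basis_vec_def lookup_single del: single_one)
  then show "g (?f a) = a" unfolding a f using g(2)[OF eig_kcar[OF U], of "k - tz"] by simp
 next
  fix b assume "b : {lam k <*> v | k v. v : {e0}}"
  then obtain k where "b = lam (k + tz - tz) <*> e0" by auto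
  then show "b : ?f ` car UM" unfolding f[symmetric] by (rule image_eqI) (simp add: fst_UM)
 qed
 then show ?thesis using f by (intro bexI[of _ ?F]) simp_all
qed

lemma J_unit:
 assumes f: "f : cat_iso MM UM (FO kunit)" and e: "!!k. el f (lam k) = lam (k - tz) <*> e0" and X: "is_kmod p X"
 shows "Comp MM (FA (LUnit RC X)) (Comp MM (J kunit X) (TensA MM f (Id MM (FO X)))) = LUnit MM (FO X)" (is "?l = _")
  "Comp MM (FA (RUnit RC X)) (Comp MM (J X kunit) (TensA MM (Id MM (FO X)) f)) = RUnit MM (FO X)" (is "?r = _")
proof -
 note K = kunit_kmod[OF p_pos] and U = kunit_hgr[OF basis0_unit] and O = FO_Obj[OF X]
 note Lu = RC.structure_Arr(7-9)[of X] and Ru = RC.structure_Arr(10-12)[of X]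
 have L: "LUnit RC X : Arr RC" "src (LUnit RC X) = ktens kunit X" "tgt (LUnit RC X) = X"
  and R: "RUnit RC X : Arr RC" "src (RUnit RC X) = ktens X kunit" "tgt (RUnit RC X) = X" using Lu Ru X by simp_all
 have Un: "Unit MM = UM" by (simp add: MM_simps UM_def)
 note A [simp] = FA_hom[OF L(1), unfolded L] FA_hom[OF R(1), unfolded R] J_Arr[OF K X] J_Arr[OF X K] MM.Id_Arr[OF O]
  MM.structure_Arr(7-12)[OF O, unfolded Un] MM.cat_iso_inv(1-3)[OF f] MM_simps(5) O FO_Obj[OF K] UM_Obj
 have l1: "lam k : car UM" for k by (simp add: fst_UM)
 note b = FO_mem[OF K eig_kcar[OF U]]
 have D: "MM.determined (TT UM (FO X)) {tt UM (FO X) (lam 0) a | a. a : hom0 X}" "MM.determined (TT (FO X) UM) {tt (FO X) UM a (lam 0) | a. a : hom0 X}"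
  using MM.determined_LUnit[OF lgen_determined[OF lgen_FO[OF X]]] MM.determined_RUnit[OF lgen_determined[OF lgen_FO[OF X]]]
  by (simp_all add: Un)
 have x0: "lam 0 <*> m : car (FO X)" "e0 <*> m : kcar (ktens kunit X)" "m <*> e0 : kcar (ktens X kunit)" "m : kcar X" if "m : hgr X a" for a m
  using that FO_mem[OF X] eig_kcar[OF that] eig_kcar[OF U] by (auto simp: tens_mem)
 show "?l = LUnit MM (FO X)"
 proof (rule MM.hom_eqI[OF D(1)])
  fix z assume "z : {tt UM (FO X) (lam 0) a | a. a : hom0 X}"
  then obtain m a where z: "z = tt UM (FO X) (lam 0) (lam 0 <*> m)" and h: "a : S" "m : hgr X a" by (auto simp: hom0_def homog_def)
  note x = x0[OF h(2)]
  have "el (J kunit X) (tt (FO kunit) (FO X) (lam (0 - tz) <*> e0) (lam 0 <*> m)) = lam 0 <*> (e0 <*> m)"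
   using el_J[OF K X rep_S h(1) U h(2), of "0 - tz" 0] kappa_zero(1)[OF h(1)] zeta_normalized[OF h(1)] by simp
  moreover have "el (FA (LUnit RC X)) (lam 0 <*> (e0 <*> m)) = lam 0 <*> m"
   using FA_props(4)[OF L(1), unfolded L, OF x(2)] RC.el_LUnit[of X m] X x(4) by simp
  moreover have "el (TensA MM f (Id MM (FO X))) z = tt (FO kunit) (FO X) (lam (0 - tz) <*> e0) (lam 0 <*> m)"
   unfolding z using MM.el_TensA'[of f "Id MM (FO X)" UM "FO X" "lam 0" "lam 0 <*> m"] l1 x(1) e[of 0] by simp
  ultimately have "el ?l z = lam 0 <*> m"
   using tt_mem[OF UM_Obj O l1 x(1)] tt_mem[OF FO_Obj[OF K] O b x(1)] by (simp add: z)
  then show "el ?l z = el (LUnit MM (FO X)) z" unfolding z using MM.el_LUnit[OF O x(1)] by (simp add: Un)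
 qed simp_all
 show "?r = RUnit MM (FO X)"
 proof (rule MM.hom_eqI[OF D(2)])
  fix z assume "z : {tt (FO X) UM a (lam 0) | a. a : hom0 X}"
  then obtain m a where z: "z = tt (FO X) UM (lam 0 <*> m) (lam 0)" and h: "a : S" "m : hgr X a" by (auto simp: hom0_def homog_def)
  note x = x0[OF h(2)]
  have "el (J X kunit) (tt (FO X) (FO kunit) (lam 0 <*> m) (lam (0 - tz) <*> e0)) = lam 0 <*> (m <*> e0)"
   using el_J[OF X K h(1) rep_S h(2) U, of 0 "0 - tz"] kappa_zero(2)[OF h(1)] zeta_normalized[OF h(1)] tz(2) by (simp add: Jc_def sign_powi)
  moreover have "el (FA (RUnit RC X)) (lam 0 <*> (m <*> e0)) = lam 0 <*> m"
   using FA_props(4)[OF R(1), unfolded R, OF x(3)] RC.el_RUnit[of X m] X x(4) by simp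
  moreover have "el (TensA MM (Id MM (FO X)) f) z = tt (FO X) (FO kunit) (lam 0 <*> m) (lam (0 - tz) <*> e0)"
   unfolding z using MM.el_TensA'[of "Id MM (FO X)" f "FO X" UM "lam 0 <*> m" "lam 0"] l1 x(1) e[of 0] by simp
  ultimately have "el ?r z = lam 0 <*> m"
   using tt_mem[OF O UM_Obj x(1) l1] tt_mem[OF O FO_Obj[OF K] x(1) b] by (simp add: z)
  then show "el ?r z = el (RUnit MM (FO X)) z" unfolding z using MM.el_RUnit[OF O x(1)] by (simp add: Un)
 qed simp_all
qed

lemma F_monoidal: "monoidal_functor RC MM FO FA J"
proof (intro monoidal_functor.intro RC.monoidal_category_axioms MM.monoidal_category_axioms F_functor monoidal_functor_axioms.intro,
  unfold MM_simps(5,6) UM_def[symmetric] RC_simps(1,4,5) mem_Collect_eq, goal_cases)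
 case (1 X Y) then show ?case by (rule J_iso')
next
 case (2 f X X' g Y Y')
 then have "f : Arr RC" "g : Arr RC" "src f = X" "tgt f = X'" "src g = Y" "tgt g = Y'" by (auto simp: cat_hom_def)
 then show ?case using J_nat by blast
next
 case (3 X Y Z) then show ?case by (rule J_assoc)
next
 case 4
 obtain f where f: "f : cat_iso MM UM (FO kunit)" "!!k. el f (lam k) = lam (k - tz) <*> e0" using unit_iso_ex by blast
 show ?case by (rule bexI[OF _ f(1)]) (use J_unit[OF f] in blast)
qed

end

section \<open>The quasi-inverse\<close>

context rep_data
begin

text \<open>
  The components in degrees outside \<open>S\<close> are redundant, since \<open>1\<^sub>k\<close> identifies
  the degrees \<open>\<alpha>\<close> and \<open>\<alpha> + 2pk\<close>.
\<close>

definition trunc :: "lmod => gspace" where "trunc M al = (if al : of_int ` S then fst M al else {0})"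

definition GO :: "lmod => kmod" where
 "GO M = \<lparr> kcar = gcar (trunc M), kact = (SOME f. f : lin (gcar (trunc M)) UNIV & (ALL al. ALL x:trunc M al. f x = qpow p al *\<^sub>C x)) \<rparr>"

definition GA where
 "GA f = Arrow (GO (src f)) (restrict (el f) (kcar (GO (src f)))) (GO (tgt f))"

lemma kcar_GO: "kcar (GO M) = gcar (trunc M)" by (simp add: GO_def)

lemma graded_trunc: "M : Obj MM ==> graded (trunc M)"
proof -
 assume M: "M : Obj MM"
 have s: "ALL al. cvec.subspace (fst M al)" using ObjD(1)[OF M] by (simp add: graded_def)
 then have sub: "trunc M al <= fst M al" for al by (simp add: trunc_def cvec.subspace_0)
 show "graded (trunc M)"
  unfolding graded_def
 proof (intro conjI allI impI)
  show "cvec.subspace (trunc M al)" for al using s by (simp add: trunc_def)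
  fix x al assume h: "(ALL al. x al : trunc M al) & finite {al. x al ~= 0} & (SUM al | x al ~= 0. x al) = 0"
  then have "(ALL al. x al : fst M al) & finite {al. x al ~= 0} & (SUM al | x al ~= 0. x al) = 0" using subsetD[OF sub] by simp
  from mp[OF spec[OF conjunct2[OF ObjD(1)[OF M, unfolded graded_def]], of x] this] show "x al = 0" ..
 qed
qed

lemma trunc_S: "a : S ==> trunc M (of_int a) = fst M (of_int a)" by (simp add: trunc_def)

lemma kcar_GO_car: "M : Obj MM ==> kcar (GO M) <= car M"
 unfolding kcar_GO gcar_def[of "trunc M"]
 by (rule cvec.span_minimal) (auto simp: trunc_def cvec.subspace_0[OF subspace_gcar] dest: gcar_mem split: if_splits)

lemma GO_act:
 assumes M: "M : Obj MM"
 shows "kact (GO M) : lin (kcar (GO M)) (kcar (GO M))" "x : trunc M al ==> kact (GO M) x = qpow p al *\<^sub>C x"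
proof -
 have f: "kact (GO M) : lin (gcar (trunc M)) UNIV & (ALL al. ALL x:trunc M al. kact (GO M) x = qpow p al *\<^sub>C x)"
  unfolding GO_def kmod.simps
  by (rule someI_ex[OF graded_extend[OF graded_trunc[OF M], of "%al x. qpow p al *\<^sub>C x", OF lin_on_comp_scale[OF lin_on_id]]])
 then show e: "x : trunc M al ==> kact (GO M) x = qpow p al *\<^sub>C x" for al x by blast
 show "kact (GO M) : lin (kcar (GO M)) (kcar (GO M))" unfolding kcar_GO
 proof (rule lin_range[OF conjunct1[OF f]])
  fix x assume x: "x : gcar (trunc M)"
  show "kact (GO M) x : gcar (trunc M)"
   by (rule lin_on_span_mem[OF _ subspace_gcar _ x[unfolded gcar_def]])
    (use lin_lin_on[OF conjunct1[OF f]] e gcar_mem in "auto simp: gcar_def[symmetric] intro!: cvec.subspace_scale")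
 qed
qed

text \<open>Each generator has only finitely many translates in degrees from \<open>S\<close>.\<close>

lemma GO_fin_dim:
 assumes M: "M : Obj MM"
 shows "fin_dim (kcar (GO M))"
proof -
 have "lam_generated (fst M) (lact M)" using M by (simp add: MM_Obj)
 then obtain Z where Z: "finite Z" "Z <= (UN al. fst M al)" "car M = cvec.span {lact M k z | k z. z : Z}" unfolding lam_generated_def by blast
 have "ALL z:Z. EX al. z : fst M al" using Z(2) by blast
 then obtain d where d: "!!z. z : Z ==> z : fst M (d z)" by metis
 have "EX Q. Q : lin (car M) UNIV & (ALL al. ALL x:fst M al. Q x = (if al : of_int ` S then x else 0))"
  by (rule graded_extend[OF ObjD(1)[OF M], of "%al x. if al : of_int ` S then x else 0"]) (auto simp: lin_on_def)
 then obtain Q where Q: "lin_on (car M) Q" "!!al x. x : fst M al ==> Q x = (if al : of_int ` S then x else 0)" using lin_lin_on by blast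
 let ?L = "{lact M k z | k z. z : Z}"
 define B where "B = insert 0 (UN z:Z. (%k. lact M k z) ` {k. d z + ldeg p k : of_int ` S})"
 have "finite {k. d z + ldeg p k : of_int ` S}" for z
  using finite_vimageI[of "of_int ` S" "%k. d z + ldeg p k"] finite_S p_pos by (simp add: inj_on_def vimage_def)
 then have fB: "finite B" using Z(1) by (simp add: B_def)
 have QB: "Q y : B" if y: "y : ?L" for y
 proof -
  obtain k z where kz: "y = lact M k z" "z : Z" using y by blast
  show ?thesis using Q(2)[OF ObjD(3)[OF M d[OF kz(2)]], of k] kz by (auto simp: B_def)
 qed
 have Bm: "b : gcar (trunc M)" if bB: "b : B" for b
 proof (cases "b = 0")
  case False
  then obtain k z where b: "b = lact M k z" "z : Z" "d z + ldeg p k : of_int ` S" using bB False unfolding B_def by blast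
  then have "b : trunc M (d z + ldeg p k)" using ObjD(3)[OF M d[OF b(2)], of k] by (simp add: trunc_def)
  then show ?thesis using gcar_mem by blast
 qed (simp add: cvec.subspace_0[OF subspace_gcar])
 have "gcar (trunc M) = cvec.span B"
 proof
  show "cvec.span B <= gcar (trunc M)" by (rule cvec.span_minimal[OF _ subspace_gcar]) (use Bm in blast)
  have "x : cvec.span B" if x: "x : trunc M al" for al x
  proof (cases "al : of_int ` S")
   case True
   then have xM: "x : fst M al" using x by (simp add: trunc_def)
   have "Q x : cvec.span B"
    by (rule lin_on_span_mem[OF Q(1)[unfolded Z(3)] cvec.subspace_span]) (use QB gcar_mem[of x "fst M", OF xM] in "auto intro: cvec.span_base simp: Z(3)")
   then show ?thesis using Q(2)[OF xM] True by simp
  qed (use x in "simp add: trunc_def cvec.span_zero")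
  then show "gcar (trunc M) <= cvec.span B" unfolding gcar_def by (intro cvec.span_minimal) auto
 qed
 then show ?thesis unfolding kcar_GO fin_dim_def using fB by blast
qed

lemma GO_kmod:
 assumes M: "M : Obj MM"
 shows "is_kmod p (GO M)"
 unfolding is_kmod_def
proof (intro conjI ballI GO_fin_dim[OF M] GO_act(1)[OF M])
 show "cvec.subspace (kcar (GO M))" by (simp add: kcar_GO)
 let ?K = "kact (GO M)"
 note l = lin_lin_on[OF GO_act(1)[OF M]]
 have m: "(?K ^^ n) x : kcar (GO M)" if "x : kcar (GO M)" for n x
  by (induction n) (use that lin_mem[OF GO_act(1)[OF M]] in auto)
 have ln: "lin_on (kcar (GO M)) (?K ^^ n)" for n
  by (induction n) (use m l in "auto simp: lin_on_def")
 fix v assume v: "v : kcar (GO M)"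
 show "(?K ^^ (2 * p)) v = v"
 proof (rule lin_on_span_eq[OF _ _ _ v[unfolded kcar_GO gcar_def], of "?K ^^ (2 * p)" "%x. x"])
  fix x assume "x : (UN al. trunc M al)"
  then obtain al where x: "x : trunc M al" by blast
  have xk: "x : kcar (GO M)" unfolding kcar_GO by (rule gcar_mem[of x "trunc M", OF x])
  have pw: "(?K ^^ n) x = qpow p (of_nat n * al) *\<^sub>C x" for n
  proof (induction n)
   case (Suc n)
   then show ?case using lin_on_scale[OF l xk] GO_act(2)[OF M x] by (simp add: qpow_add[symmetric] algebra_simps)
  qed (simp add: qpow_def)
  show "(?K ^^ (2 * p)) x = x"
  proof (cases "al : of_int ` S")
   case True
   then obtain a where a: "al = of_int a" by blast
   have "qpow p (of_nat (2 * p) * al) = 1" using qpow_1_iff[OF p_pos, of "2 * int p * a"] by (simp add: a)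
   then show ?thesis by (simp add: pw)
  next
   case False
   then have "x = 0" using x by (simp add: trunc_def)
   then show ?thesis unfolding pw by simp
  qed
 qed (use ln[of "2 * p"] in "simp_all add: kcar_GO gcar_def lin_intros")
qed

lemma hgr_GO:
 assumes M: "M : Obj MM" and a: "a : S"
 shows "hgr (GO M) a = fst M (of_int a)"
proof -
 have sup: "fst M (of_int b) <= hgr (GO M) b" if "b : S" for b
  using gcar_mem[of _ "trunc M" "of_int b"] GO_act(2)[OF M, of _ "of_int b"] that by (auto simp: eig_def kcar_GO trunc_S)
 have "v : fst M (of_int a)" if v: "v : hgr (GO M) a" for v
 proof -
  note s = graded_subspace[OF ObjD(1)[OF M]]
  have "kidem p (GO M) a v : fst M (of_int a)"
  proof (rule lin_on_span_mem[OF _ s _ eig_kcar[OF v, unfolded kcar_GO gcar_def]])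
   show "lin_on (cvec.span (UN al. trunc M al)) (kidem p (GO M) a)" using kidem_lin[OF GO_kmod[OF M]] by (simp add: kcar_GO gcar_def)
   fix x assume "x : (UN al. trunc M al)"
   then obtain al where x: "x : trunc M al" by blast
   show "kidem p (GO M) a x : fst M (of_int a)"
   proof (cases "al : of_int ` S")
    case True
    then obtain b where b: "al = of_int b" "b : S" by blast
    then have "x : fst M (of_int b)" using x by (simp add: trunc_def)
    then show ?thesis using kidem_hgr[OF GO_kmod[OF M] subsetD[OF sup[OF b(2)]] a b(2)] cvec.subspace_0[OF s] by auto
   next
    case False
    then have "x = 0" using x by (simp add: trunc_def)
    then show ?thesis using lin_on_zero[OF kidem_lin[OF GO_kmod[OF M]]] cvec.subspace_0[OF kmod_subspace[OF GO_kmod[OF M]]] cvec.subspace_0[OF s] by simp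
   qed
  qed
  then show ?thesis using kidem_hgr[OF GO_kmod[OF M] v a a] by simp
 qed
 with sup[OF a] show ?thesis by blast
qed

lemma GA_props:
 assumes f: "f : Arr MM"
 shows "GA f : Arr RC" "src (GA f) = GO (src f)" "tgt (GA f) = GO (tgt f)" "!!x. x : kcar (GO (src f)) ==> amap (GA f) x = el f x"
proof -
 note O = MM_ArrD(1,2)[OF f]
 have e: "el f x : hgr (GO (tgt f)) a" if "x : hgr (GO (src f)) a" "a : S" for x a
  using that MM_Arr_el(2)[OF f] by (simp add: hgr_GO O)
 have sub: "kcar (GO (src f)) <= car (src f)" by (rule kcar_GO_car[OF O(1)])
 note l = lin_on_subset[OF lin_lin_on[OF MM_Arr_el(1)[OF f]] sub]
 have r: "restrict (el f) (kcar (GO (src f))) : lin (kcar (GO (src f))) (kcar (GO (tgt f)))"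
 proof (rule restrict_lin[OF kmod_subspace[OF GO_kmod[OF O(1)]] l])
  fix x assume x: "x : kcar (GO (src f))"
  show "el f x : kcar (GO (tgt f))"
   by (rule lin_on_span_mem[OF l[unfolded kcar_span[OF GO_kmod[OF O(1)]]] kmod_subspace[OF GO_kmod[OF O(2)]] _ x[unfolded kcar_span[OF GO_kmod[OF O(1)]]]])
    (use e eig_kcar in blast)
 qed
 show "GA f : Arr RC" unfolding GA_def
  by (rule RC_ArrI[OF GO_kmod[OF O(1)] GO_kmod[OF O(2)] r kcar_span[OF GO_kmod[OF O(1)]]]) (use e eig_kcar in fastforce)
qed (simp_all add: GA_def)

lemma G_functor: "category_functor MM RC GO GA"
proof (intro category_functor.intro[OF MM_category RC_category] category_functor_axioms.intro, goal_cases)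
 case (1 X) then show ?case using GO_kmod by simp
next
 case (2 f X Y) then show ?case using GA_props[of f] by (auto simp: cat_hom_def MM_simps(1,2))
next
 case (3 X)
 then show ?case using kcar_GO_car[OF 3] MM.el_Id[OF 3] by (auto simp: GA_def MM_simps(3) restrict_def fun_eq_iff)
next
 case (4 f X Y g Z)
 then have h: "f : Arr MM" "g : Arr MM" "src f = X" "tgt f = Y" "src g = Y" "tgt g = Z" by (auto simp: cat_hom_def MM_simps(1,2))
 have "el (Comp MM g f) x = amap (GA g) (amap (GA f) x)" if x: "x : kcar (GO X)" for x
  using MM.el_Comp[OF h(1,2), of x] subsetD[OF kcar_GO_car[OF MM_ArrD(1)[OF h(1)]]] lin_mem[of "amap (GA f)" "kcar (GO X)" "kcar (GO Y)" x]
   GA_props[OF h(1)] GA_props(4)[OF h(2), of "amap (GA f) x"] h x by (simp add: MM_simps(1,2) RC_Arr)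
 moreover have "GA (Comp MM g f) = Arrow (GO X) (restrict (el (Comp MM g f)) (kcar (GO X))) (GO Z)" by (simp add: GA_def MM_simps(4) h)
 ultimately show ?case using GA_props[OF h(1)] GA_props[OF h(2)] h by (simp add: compose_def restrict_def fun_eq_iff)
qed

definition eta where "eta V = Arrow V (restrict (%v. lam 0 <*> v) (kcar V)) (GO (FO V))"

lemma eta_iso:
 assumes V: "is_kmod p V"
 shows "eta V : cat_iso RC V (GO (FO V))"
proof -
 note G = GO_kmod[OF FO_Obj[OF V]]
 have e: "lam 0 <*> v : hgr (GO (FO V)) a" if "v : hgr V a" "a : S" for v a
  using FO_deg[OF V that(2,1), of 0] by (simp add: hgr_GO[OF FO_Obj[OF V] that(2)])
 have m: "lam 0 <*> v : kcar (GO (FO V))" if v: "v : kcar V" for v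
  by (rule lin_on_span_mem[OF lin_on_tensor_right[OF lin_on_id] kmod_subspace[OF G] _ v[unfolded kcar_span[OF V]]]) (use e eig_kcar in blast)
 have r: "restrict (%v. lam 0 <*> v) (kcar V) : lin (kcar V) (kcar (GO (FO V)))"
  by (rule restrict_lin[OF kmod_subspace[OF V] lin_on_tensor_right[OF lin_on_id] m])
 have A: "eta V : Arr RC" unfolding eta_def
  by (rule RC_ArrI[OF V G r kcar_span[OF V]]) (use e eig_kcar in fastforce)
 obtain g where g: "g : lin (tens UNIV (kcar V)) UNIV" "!!k v. v : kcar V ==> g (lam k <*> v) = v"
  using lam_extend[OF kmod_subspace[OF V], of "%k v. v", OF lin_on_id] by blast
 have im: "restrict (%v. lam 0 <*> v) (kcar V) ` kcar V = (%v. lam 0 <*> v) ` kcar V" by auto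
 show ?thesis
 proof (rule RC.iso_of_generators[OF A, unfolded eta_def RC_simps(2,3) arrow.sel, folded eta_def, of "kcar V" "UN a:S. hgr (GO (FO V)) a" g])
  show "RC.gen V (kcar V)" using RC.gen_car[of V] V by simp
  show "RC.gen (GO (FO V)) (UN a:S. hgr (GO (FO V)) a)" using RC.gen_hg[of "GO (FO V)"] G by simp
  show "lin_on (kcar (GO (FO V))) g"
   by (rule lin_on_subset[OF lin_lin_on[OF g(1)]]) (use kcar_GO_car[OF FO_Obj[OF V]] in "simp add: FO_car[OF V]")
  show "g (restrict (%v. lam 0 <*> v) (kcar V) a) = a" if "a : kcar V" for a using g(2)[OF that] that by simp
  fix b assume "b : (UN a:S. hgr (GO (FO V)) a)"
  then obtain a where a: "a : S" "b : fst (FO V) (of_int a)" using hgr_GO[OF FO_Obj[OF V]] by auto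
  have "FG V (of_int a) <= (%v. lam 0 <*> v) ` kcar V"
  proof
   fix x assume "x : FG V (of_int a)"
   then obtain k v c where x: "x = lam k <*> v" "c : S" "v : hgr V c" "a = 2 * int p * k + c" unfolding FG_def of_int_eq_iff by blast
   then have "a = c" using rep_uniq[OF a(1) x(2)] by simp
   then have "k = 0" using x(4) p_pos by simp
   then show "x : (%v. lam 0 <*> v) ` kcar V" using x(1) eig_kcar[OF x(3)] by blast
  qed
  then have "cvec.span (FG V (of_int a)) <= (%v. lam 0 <*> v) ` kcar V"
   by (rule cvec.span_minimal) (rule subspace_lin_image[OF kmod_subspace[OF V] lin_on_tensor_right[OF lin_on_id]])
  then show "b : restrict (%v. lam 0 <*> v) (kcar V) ` kcar V" using a(2) unfolding FO_span[OF V] im by blast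
 qed
qed

text \<open>
  The inverse shifts a vector of degree \<open>n\<close> to degree \<open>[n]\<close> and remembers the shift
  \<open>(n - [n]) / 2p\<close>, computed by \<open>kk\<close>, in the factor \<open>\<Lambda>\<close>.
\<close>

lemma eps_ex:
 assumes M: "M : Obj MM"
 shows "EX f:cat_iso MM (FO (GO M)) M. ALL k. ALL v:kcar (GO M). el f (lam k <*> v) = lact M k v"
proof -
 note G = GO_kmod[OF M] and sub = kcar_GO_car[OF M]
 obtain f where f: "f : lin (car (FO (GO M))) UNIV" "!!k v. v : kcar (GO M) ==> f (lam k <*> v) = lact M k v"
  using lam_extend[OF kmod_subspace[OF G], of "lact M", OF lin_on_subset[OF ObjD(2)[OF M] sub]] unfolding FO_car[OF G] by blast
 let ?F = "Arrow (FO (GO M)) (Arrow (fst (FO (GO M))) f (fst M)) M"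
 have F: "?F : Arr MM"
 proof (rule FO_ArrI[OF G M f(1)])
  fix k l a v assume a: "a : S" "v : hgr (GO M) a"
  note v = f(2)[OF eig_kcar[OF a(2)]] and c = subsetD[OF sub eig_kcar[OF a(2)]]
  show "f (lam k <*> v) : fst M (of_int (2 * int p * k + a))"
   using ObjD(3)[OF M a(2)[unfolded hgr_GO[OF M a(1)]], of k] by (simp add: v add.commute)
  show "f (lam (k + l) <*> v) = lact M k (f (lam l <*> v))" by (simp add: v ObjD(4)[OF M c])
 qed
 define kk :: "complex => int" where "kk al = (\<lfloor>Re al\<rfloor> - rep \<lfloor>Re al\<rfloor>) div (2 * int p)" for al
 have kk: "2 * int p * kk (of_int n) = n - rep n" for n using rep_dvd[of n] by (simp add: kk_def)
 have "EX g. g : lin (car M) UNIV & (ALL al. ALL x:fst M al. g x = lam (kk al) <*> lact M (- kk al) x)"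
  by (rule graded_extend[OF ObjD(1)[OF M], of "%al x. lam (kk al) <*> lact M (- kk al) x"])
   (rule lin_on_tensor_right, rule lin_on_subset[OF ObjD(2)[OF M]], use gcar_mem in blast)
 then obtain g where g: "lin_on (car M) g" "!!al x. x : fst M al ==> g x = lam (kk al) <*> lact M (- kk al) x" using lin_lin_on by blast
 have "?F : cat_iso MM (FO (GO M)) M"
 proof (rule MM.iso_of_generators[OF F, unfolded MM_simps(1,2) arrow.sel, OF FO_gen_homog[OF G G] MM.gen_hg[OF M] g(1)])
  fix z assume "z : {lam k <*> v | k v. v : (UN a:S. hgr (GO M) a)}"
  then obtain k v a where z: "z = lam k <*> v" "a : S" "v : hgr (GO M) a" by blast
  note c = subsetD[OF sub eig_kcar[OF z(3)]]
  have "lact M k v : fst M (of_int (a + 2 * int p * k))"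
   using ObjD(3)[OF M z(3)[unfolded hgr_GO[OF M z(2)]], of k] by simp
  moreover have "rep (a + 2 * int p * k) = a" by (rule rep_eqI[OF z(2)]) simp
  then have "2 * int p * kk (of_int (a + 2 * int p * k)) = 2 * int p * k" using kk[of "a + 2 * int p * k"] by simp
  then have "kk (of_int (a + 2 * int p * k)) = k" using p_pos by simp
  ultimately have "g (lact M k v) = lam k <*> v" using g(2) ObjD(4,5)[OF M c] by (metis add.left_inverse)
  then show "g (f z) = z" using f(2)[OF eig_kcar[OF z(3)]] by (simp add: z(1))
 next
  fix b assume "b : (UN i:\<int>. fst M i)"
  then obtain n where b: "b : fst M (of_int n)" by (auto elim: Ints_cases)
  let ?k = "kk (of_int n)"
  have bc: "b : car M" by (rule gcar_mem[of b "fst M", OF b])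
  have "of_int n + ldeg p (- ?k) = of_int (n - 2 * int p * ?k)" by simp
  then have "lact M (- ?k) b : fst M (of_int (n - 2 * int p * ?k))" using ObjD(3)[OF M b, of "- ?k"] by (simp only:)
  moreover have "n - 2 * int p * ?k = rep n" using kk[of n] by simp
  ultimately have "lact M (- ?k) b : hgr (GO M) (rep n)" by (simp only: hgr_GO[OF M rep_S])
  then have h: "lact M (- ?k) b : kcar (GO M)" by (rule eig_kcar)
  have "f (lam ?k <*> lact M (- ?k) b) = b" using f(2)[OF h, of ?k] ObjD(4)[OF M bc, of ?k "- ?k"] ObjD(5)[OF M bc] by simp
  then show "b : f ` car (FO (GO M))" using FO_mem[OF G h, of ?k] by (metis imageI)
 qed
 then show ?thesis using f(2) by (intro bexI[of _ ?F]) simp_all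
qed

definition eps where
 "eps M = (SOME f. f : cat_iso MM (FO (GO M)) M & (ALL k. ALL v:kcar (GO M). el f (lam k <*> v) = lact M k v))"

lemma eps:
 assumes M: "M : Obj MM"
 shows "eps M : cat_iso MM (FO (GO M)) M" "v : kcar (GO M) ==> el (eps M) (lam k <*> v) = lact M k v"
 using someI_ex[OF eps_ex[OF M, unfolded Bex_def]] unfolding eps_def[symmetric] by auto

lemma F_equivalence: "category_equivalence RC MM FO FA"
proof (intro category_equivalence.intro F_functor category_equivalence_axioms.intro exI conjI G_functor)
 show "natural_iso RC RC (%X. X) (%f. f) (%X. GO (FO X)) (%f. GA (FA f)) eta"
  unfolding natural_iso_def
 proof (intro conjI ballI allI)
  show "eta X : cat_iso RC X (GO (FO X))" if "X : Obj RC" for X using eta_iso that by simp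
  fix X Y f assume "f : cat_hom RC X Y"
  then have f: "f : Arr RC" "src f = X" "tgt f = Y" by (auto simp: cat_hom_def)
  then have K: "is_kmod p X" "is_kmod p Y" by (auto simp: RC_Arr)
  note e1 = RC.cat_iso_inv(1-3)[OF eta_iso[OF K(1)]] RC.cat_iso_inv(1-3)[OF eta_iso[OF K(2)]]
  note G = GA_props[OF FA_hom(1)[OF f(1)]] and FAp = FA_props(2-4)[OF f(1)]
  show "Comp RC (eta Y) f = Comp RC (GA (FA f)) (eta X)"
  proof (rule RC.hom_eqI_gen[OF RC.gen_car[of X]])
   fix v assume v: "v : kcar X"
   have fv: "amap f v : kcar Y" using f v by (auto simp: RC_Arr lin_mem)
   have "lam 0 <*> v : kcar (GO (FO X))" using RC.el_car[OF e1(1), of v] e1 v by (simp add: eta_def)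
   then show "amap (Comp RC (eta Y) f) v = amap (Comp RC (GA (FA f)) (eta X)) v"
    using v fv f G(4) FAp by (simp add: eta_def compose_def)
  qed (use f K e1 G FAp in "simp_all del: RC_simps(7)", simp_all)
 qed
 show "natural_iso MM MM (%X. FO (GO X)) (%f. FA (GA f)) (%X. X) (%f. f) eps"
  unfolding natural_iso_def
 proof (intro conjI ballI allI)
  show "eps X : cat_iso MM (FO (GO X)) X" if "X : Obj MM" for X by (rule eps(1)[OF that])
  fix X Y f assume "f : cat_hom MM X Y"
  then have f: "f : Arr MM" "src f = X" "tgt f = Y" and fD: "Dom MM f = X" "Cod MM f = Y" by (auto simp: cat_hom_def MM_simps(1,2))
  have O: "X : Obj MM" "Y : Obj MM" using MM_ArrD(1,2)[OF f(1)] f by auto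
  note G = GA_props[OF f(1)] and e = MM.cat_iso_inv(1-3)[OF eps(1)[OF O(1)]] MM.cat_iso_inv(1-3)[OF eps(1)[OF O(2)]]
  note FG = FA_hom[OF G(1)] FA_props(4)[OF G(1)]
  show "Comp MM (eps Y) (FA (GA f)) = Comp MM f (eps X)"
  proof (rule FO_Arr_eqI[OF lgen_FO[OF GO_kmod[OF O(1)]]])
   fix z assume "z : hom0 (GO X)"
   then obtain v where z: "z = lam 0 <*> v" "v : kcar (GO X)" using eig_kcar by (auto simp: hom0_def homog_def)
   note zc = FO_mem[OF GO_kmod[OF O(1)] z(2), of 0] and vc = subsetD[OF kcar_GO_car[OF O(1)] z(2)]
   have fv: "el f v : kcar (GO Y)" using lin_mem[of "amap (GA f)" "kcar (GO X)" "kcar (GO Y)" v] G f z(2) by (simp add: RC_Arr)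
   have fc: "el f v : car Y" by (rule subsetD[OF kcar_GO_car[OF O(2)] fv])
   have "el (Comp MM (eps Y) (FA (GA f))) z = el (eps Y) (el (FA (GA f)) z)"
    by (rule MM.el_Comp) (use FG G e f zc in "simp_all add: z(1)")
   also have "... = el f v" using FG(4)[of v "lam 0"] G f z eps(2)[OF O(2) fv] ObjD(5)[OF O(2) fc] by simp
   also have "... = el (Comp MM f (eps X)) z" 
    using MM.el_Comp[OF e(1) f(1), of z] e f zc eps(2)[OF O(1) z(2), of 0] ObjD(5)[OF O(1) vc] by (simp add: z(1) MM_simps(1,2))
   finally show "el (Comp MM (eps Y) (FA (GA f))) z = el (Comp MM f (eps X)) z" .
  qed (use f fD e FG(1-3) G(2,3) in simp_all)
 qed
qed (rule G_functor)

end

section \<open>Duals of local modules\<close>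

context rep_data
begin

lemma FO_determined:
 assumes V: "is_kmod p V" and x: "kcar V = cvec.span (x ` N)"
 shows "MM.determined (FO V) ((%n. lam (s n) <*> x n) ` N)"
proof (rule determined_lact[OF FO_Obj[OF V]])
 show "(%n. lam (s n) <*> x n) ` N <= car (FO V)" using x FO_mem[OF V] by (auto intro: cvec.span_base)
 show "car (FO V) = cvec.span {lact (FO V) k a | k a. a : (%n. lam (s n) <*> x n) ` N}"
  using FO_gen[OF V x[symmetric]] unfolding FO_lact_gens[OF V x] by (simp add: MM.gen_def)
qed

text \<open>
  Evaluation and coevaluation are those of \<open>G(M)\<close>, transported along \<open>F\<close>,
  \<open>J\<close> and the isomorphism \<open>f\<close>. The vectors \<open>d k\<close> are shifted by
  \<open>s k\<close>, so that their degrees become opposite to those of the \<open>x k\<close> on the nose.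
\<close>

lemma MM_rigid:
 assumes M: "M : Obj MM"
 shows "EX D ev coev. is_dual MM M D ev coev & Comp MM (TensA MM (Twist MM M) (Id MM D)) coev = Comp MM (TensA MM (Id MM M) (Twist MM D)) coev"
proof -
 let ?V = "GO M"
 note V = GO_kmod[OF M] and K = kunit_kmod[OF p_pos]
 obtain n i x d D ev coev where D: "is_kmod p D" and x: "!!k. k < n ==> i k : S & x k : hgr ?V (i k)" and d: "!!k. k < n ==> d k : hgr D (rep (- i k))"
  and sx: "kcar ?V = cvec.span (x ` {..<n :: nat})" and sd: "kcar D = cvec.span (d ` {..<n})"
  and ev: "ev : cat_hom RC (ktens D ?V) kunit" and coev: "coev : cat_hom RC kunit (ktens ?V D)"
  and el_ev: "!!k l. [|k < n; l < n|] ==> amap ev (d k <*> x l) = (if k = l then \<Phi> (i k) (rep (- i k)) (i k) *\<^sub>C e0 else 0)"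
  and el_coev: "amap coev (e0) = (SUM k<n. x k <*> d k)"
  by (rule RC_dual_data[OF V]) (rule that)
 define f g where "f = eps M" and "g = inv_arrow MM f"
 have fi: "f : cat_iso MM (FO ?V) M" unfolding f_def by (rule eps(1)[OF M])
 obtain u where u: "u : cat_iso MM UM (FO kunit)" and el_u: "!!k. el u (lam k) = lam (k - tz) <*> e0" using unit_iso_ex by blast
 define w where "w = inv_arrow MM u"
 have Un: "Unit MM = UM" by (simp add: MM_simps UM_def)
 have evA: "ev : Arr RC" "src ev = ktens D ?V" "tgt ev = kunit" and coevA: "coev : Arr RC" "src coev = kunit" "tgt coev = ktens ?V D"
  using ev coev by (auto simp: cat_hom_def)
 note JI = J_iso'[OF V D]
 define j where "j = inv_arrow MM (J ?V D)"
 note O [simp] = M FO_Obj[OF V] FO_Obj[OF D] FO_Obj[OF K] UM_Obj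
 note T = is_kmod_ktens(1)[OF V D] is_kmod_ktens(1)[OF D V]
 note A [simp] = MM.cat_iso_inv(1-6)[OF fi, folded g_def] MM.cat_iso_inv(1-6)[OF u, folded w_def] MM.cat_iso_inv(4-6)[OF JI, folded j_def]
  FA_hom[OF evA(1), unfolded evA] FA_hom[OF coevA(1), unfolded coevA] J_Arr[OF V D] J_Arr[OF D V] MM.Id_Arr[OF O(3)] MM_simps(5)
 define s where "s k = (i k + rep (- i k)) div (2 * int p)" for k
 have s: "2 * int p * s k = i k + rep (- i k)" for k
 proof -
  obtain m where "- i k - rep (- i k) = 2 * int p * m" using rep_dvd[of "- i k"] by (auto simp: dvd_def)
  then have "i k + rep (- i k) = 2 * int p * - m" by simp
  then show ?thesis by (simp only: s_def) (use p_pos in simp)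
 qed
 define d' where "d' k = lam (- s k) <*> d k" for k
 have k1: "\<kappa> (rep (- i k)) (i k) = s k - tz" for k
 proof -
  have "2 * int p * \<kappa> (rep (- i k)) (i k) = 2 * int p * (s k - tz)"
   unfolding kappa_eq rep_add_left using s[of k] tz(1) by (simp add: algebra_simps)
  then show ?thesis using p_pos by simp
 qed
 have k2: "\<kappa> (i k) (rep (- i k)) = s k - tz" for k using k1[of k] kappa_commute by simp
 have xc: "x k : kcar ?V" "x k : car M" "lam l <*> x k : car (FO ?V)" and dc: "d k : kcar D" "d' k : car (FO D)" if "k < n" for k l
  using x[OF that] d[OF that] eig_kcar subsetD[OF kcar_GO_car[OF M]] FO_mem[OF V] FO_mem[OF D] unfolding d'_def by blast+
 have fx: "el f (lam 0 <*> x k) = x k" if "k < n" for k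
  using eps(2)[OF M xc(1)[OF that], of 0] ObjD(5)[OF M xc(2)[OF that]] by (simp add: f_def)
 have gx: "el g (x k) = lam 0 <*> x k" if "k < n" for k
  using MM.el_inv[OF fi xc(3)[OF that, of 0]] fx[OF that] by (simp add: g_def)
 have wk: "el w (lam (- tz) <*> e0) = lam 0"
  using MM.el_inv[OF u, of "lam 0"] el_u[of 0] by (simp add: w_def fst_UM)
 let ?ev = "Comp MM w (Comp MM (FA ev) (Comp MM (J D ?V) (TensA MM (Id MM (FO D)) g)))"
 let ?co = "Comp MM (TensA MM f (Id MM (FO D))) (Comp MM j (Comp MM (FA coev) u))"
 let ?e = "%k. \<zeta> (rep (- i k)) (i k) * \<Phi> (i k) (rep (- i k)) (i k)"
 let ?c = "%k. inverse (Jc (i k) (rep (- i k)) (- s k))"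
 have ce: "?c k * ?e k = 1" if k: "k < n" for k
 proof -
  have "even (i k * - s k) \<longleftrightarrow> even (i k * (s k - tz))" using tz(2) by simp
  then have "(-1 :: complex) powi (i k * - s k) = (-1) powi (i k * (s k - tz))" by (simp add: sign_powi)
  moreover have "rep (rep (- i k) + i k) = rep 0" "rep (i k + rep (- i k)) = rep 0" by (simp_all add: rep_add_left rep_add_right)
  ultimately show ?thesis
   using x[OF k] zeta_nonzero[of "i k" "rep (- i k)"] zeta_nonzero[of "rep (- i k)" "i k"] zeta_normalized[of "i k"] unfolding Jc_def Phi_coeff_def k1
   by (simp add: sign_powi)
 qed
 have 1: "el ?ev (tt (FO D) M (d' k) (x l)) = (if k = l then ?e k *\<^sub>C lam 0 else 0)" if kl: "k < n" "l < n" for k l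
 proof -
  let ?z = "tt (FO D) M (d' k) (x l)" and ?k = "- s k + \<kappa> (rep (- i k)) (i l)"
  note z = tt_mem[OF O(3) M dc(2)[OF kl(1)] xc(2)[OF kl(2)]] and z' = tt_mem[OF O(3,2) dc(2)[OF kl(1)] xc(3)[OF kl(2)]]
  have dx: "d k <*> x l : kcar (ktens D ?V)" using dc(1)[OF kl(1)] xc(1)[OF kl(2)] by (simp add: tens_mem)
  note bU = FO_mem[OF K eig_kcar[OF kunit_hgr[OF basis0_unit]]]
  have "el (TensA MM (Id MM (FO D)) g) ?z = tt (FO D) (FO ?V) (d' k) (lam 0 <*> x l)"
   using dc(2)[OF kl(1)] xc(2)[OF kl(2)] gx[OF kl(2)] by simp
  moreover have "el (J D ?V) (tt (FO D) (FO ?V) (d' k) (lam 0 <*> x l)) = \<zeta> (rep (- i k)) (i l) *\<^sub>C (lam ?k <*> (d k <*> x l))"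
   unfolding d'_def using el_J[OF D V rep_S _ d[OF kl(1)], of "i l" "x l" "- s k" 0] x[OF kl(2)] by simp
  ultimately have "el ?ev ?z = el w (\<zeta> (rep (- i k)) (i l) *\<^sub>C (lam ?k <*> amap ev (d k <*> x l)))"
   using z z'[of 0] FA_props(4)[OF evA(1), unfolded evA, OF dx] MM.el_scale[OF FA_hom(1)[OF evA(1)], unfolded FA_hom[OF evA(1)] evA, OF FO_mem[OF T(2) dx]] by simp
  also have "... = (if k = l then ?e k *\<^sub>C lam 0 else 0)"
   unfolding el_ev[OF kl] using MM.el_scale[OF A(10), unfolded A(11), OF bU] wk MM.el_zero[OF A(10)] by (simp add: k1 tensor_scale_right)
  finally show ?thesis .
 qed
 have 2: "el ?co (lam 0) = (SUM k<n. ?c k *\<^sub>C tt M (FO D) (x k) (d' k))"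
 proof -
  have U0: "lam 0 : car UM" by (simp add: fst_UM)
  have xd: "x k <*> d k : kcar (ktens ?V D)" if "k < n" for k using xc(1)[OF that] dc(1)[OF that] by (simp add: tens_mem)
  note m = FO_mem[OF T(1) xd]
  have t1: "tt (FO ?V) (FO D) (lam 0 <*> x k) (d' k) : car (TT (FO ?V) (FO D))" if "k < n" for k using tt_mem[OF O(2,3) xc(3)[OF that] dc(2)[OF that]] .
  have jk: "el j (lam (- tz) <*> (x k <*> d k)) = ?c k *\<^sub>C tt (FO ?V) (FO D) (lam 0 <*> x k) (d' k)" if k: "k < n" for k
  proof -
   have "el (J ?V D) (tt (FO ?V) (FO D) (lam 0 <*> x k) (d' k)) = Jc (i k) (rep (- i k)) (- s k) *\<^sub>C (lam (- tz) <*> (x k <*> d k))"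
    unfolding d'_def using el_J[OF V D _ rep_S _ d[OF k], of "i k" "x k" 0 "- s k"] x[OF k] by (simp add: k2)
   then have "tt (FO ?V) (FO D) (lam 0 <*> x k) (d' k) = Jc (i k) (rep (- i k)) (- s k) *\<^sub>C el j (lam (- tz) <*> (x k <*> d k))"
    using MM.el_inv[OF JI t1[OF k]] MM.el_scale[of j] m[OF k] by (simp add: j_def[symmetric])
   then show ?thesis using Jc_nz[of "i k" "rep (- i k)" "- s k"] x[OF k] by simp
  qed
  have fk: "el (TensA MM f (Id MM (FO D))) (tt (FO ?V) (FO D) (lam 0 <*> x k) (d' k)) = tt M (FO D) (x k) (d' k)" if "k < n" for k
   using xc(3)[OF that, of 0] dc(2)[OF that] fx[OF that] by simp
  have c1: "el (Comp MM (FA coev) u) (lam 0) = (SUM k<n. lam (- tz) <*> (x k <*> d k))"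
   using U0 el_u[of 0] FA_props(4)[OF coevA(1), of "e0"] eig_kcar[OF kunit_hgr[OF basis0_unit]] by (simp add: coevA el_coev tensor_sum_right)
  have "el (Comp MM j (Comp MM (FA coev) u)) (lam 0) = el j (el (Comp MM (FA coev) u) (lam 0))" using U0 by (intro MM.el_Comp) simp_all
  also have "... = (SUM k<n. el j (lam (- tz) <*> (x k <*> d k)))" unfolding c1 by (rule MM.el_sum) (use m in simp_all)
  also have "... = (SUM k<n. ?c k *\<^sub>C tt (FO ?V) (FO D) (lam 0 <*> x k) (d' k))" by (rule sum.cong) (simp_all add: jk)
  finally have c2: "el (Comp MM j (Comp MM (FA coev) u)) (lam 0) = (SUM k<n. ?c k *\<^sub>C tt (FO ?V) (FO D) (lam 0 <*> x k) (d' k))" .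
  have "el ?co (lam 0) = el (TensA MM f (Id MM (FO D))) (el (Comp MM j (Comp MM (FA coev) u)) (lam 0))" using U0 by (intro MM.el_Comp) simp_all
  also have "... = (SUM k<n. el (TensA MM f (Id MM (FO D))) (?c k *\<^sub>C tt (FO ?V) (FO D) (lam 0 <*> x k) (d' k)))"
   unfolding c2 by (rule MM.el_sum) (use t1 in "simp_all add: cvec.subspace_scale")
  also have "... = (SUM k<n. ?c k *\<^sub>C tt M (FO D) (x k) (d' k))"
   by (rule sum.cong[OF refl]) (use MM.el_scale[of "TensA MM f (Id MM (FO D))"] t1 fk in simp)
  finally show ?thesis .
 qed
 have dM: "MM.determined M (x ` {..<n})"
 proof -
  have "(%y. el f y) ` ((%k. lam 0 <*> x k) ` {..<n}) = x ` {..<n}" unfolding image_image using fx by (intro image_cong) auto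
  then show ?thesis using MM.determined_iso[OF fi FO_determined[OF V sx, of "%_. 0"]] by simp
 qed
 have "is_dual MM M (FO D) ?ev ?co & Comp MM (TensA MM (Twist MM M) (Id MM (FO D))) ?co = Comp MM (TensA MM (Id MM M) (Twist MM (FO D))) ?co"
 proof (rule MM.dual_criterion[where N = "{..<n}" and i = "%k. of_int (i k)" and j = "%k. - of_int (i k)" and x = x and d = d' and e = ?e and c = ?c])
  show "k : {..<n} ==> of_int (i k) : \<int> & x k : fst M (of_int (i k))" for k using x[of k] hgr_GO[OF M] by auto
  show "- of_int (i k) : \<int> & d' k : fst (FO D) (- of_int (i k))" if "k : {..<n}" for k
  proof -
   have "2 * int p * - s k + rep (- i k) = - i k" using s[of k] by simp
   then show ?thesis using FO_deg[OF D rep_S d, of k "- s k"] that unfolding d'_def by (metis Ints_minus Ints_of_int lessThan_iff of_int_minus)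
  qed
  show "MM.determined (FO D) (d' ` {..<n})" unfolding d'_def by (rule FO_determined[OF D sd])
  show "MM.determined (Unit MM) {lam 0}" unfolding Un by (rule lgen_determined[OF lgen_UM])
  show "?ev : cat_hom MM (TensO MM (FO D) M) (Unit MM)" "?co : cat_hom MM (Unit MM) (TensO MM M (FO D))" unfolding cat_hom_def Un by simp_all
  show "el ?ev (tt (FO D) M (d' k) (x l)) = (if k = l then ?e k *\<^sub>C lam 0 else 0)" if "k : {..<n}" "l : {..<n}" for k l using 1 that by simp
  show "el ?co (lam 0) = (SUM k<n. ?c k *\<^sub>C tt M (FO D) (x k) (d' k))" by (rule 2)
 qed (use ce dM in simp_all)
 then show ?thesis by blast
qed

lemma MM_ribbon: "ribbon_category MM"
 by (intro ribbon_category.intro MM.balanced_category_axioms ribbon_category_axioms.intro MM_rigid)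

lemma F_ribbon: "ribbon_equivalence RC MM FO FA J"
proof (intro ribbon_equivalence.intro ribbon_functor.intro RC_ribbon MM_ribbon F_monoidal F_equivalence ribbon_functor_axioms.intro)
 show "X : Obj RC ==> Y : Obj RC ==> Comp MM (FA (Braid RC X Y)) (J X Y) = Comp MM (J Y X) (Braid MM (FO X) (FO Y))" for X Y
  using J_braid by simp
 show "X : Obj RC ==> FA (Twist RC X) = Twist MM (FO X)" for X using F_twist by simp
qed

end

theorem theorem2p25:
  fixes p :: nat and S :: "int set" and \<zeta> :: "int \<Rightarrow> int \<Rightarrow> complex"
  assumes p_pos: "p > 0"
    and S_bij: "bij_betw (\<lambda>s. s mod (2 * int p)) S {0..<2 * int p}"
    and S_zero: "4 * int p dvd rep_mod p S 0"
    and zeta_nonzero: "\<And>a b. \<lbrakk>a \<in> S; b \<in> S\<rbrakk> \<Longrightarrow> \<zeta> a b \<noteq> 0"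
    and zeta_normalized: "\<And>a. a \<in> S \<Longrightarrow> \<zeta> a (rep_mod p S 0) = 1 \<and> \<zeta> (rep_mod p S 0) a = 1"
  shows "\<exists>J. (\<forall>M \<in> Obj (RepCat p S \<zeta>). \<forall>N \<in> Obj (RepCat p S \<zeta>). \<forall>a \<in> S. \<forall>b \<in> S. \<forall>k l.
                \<forall>m \<in> kcar M. \<forall>n \<in> kcar N.
                amap (amap (J M N)) (rt_elem p (FObj p S M) (FObj p S N)
                    (\<one>\<^sub>\<Lambda> k \<boxtimes> kidem p M a m) (\<one>\<^sub>\<Lambda> l \<boxtimes> kidem p N b n))
                  = ((- 1) powi (a * l) * \<zeta> a b) *\<^sub>C
                      (\<one>\<^sub>\<Lambda> (k + l + kappa p S a b) \<boxtimes> (kidem p M a m \<boxtimes> kidem p N b n)))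
           \<and> ribbon_equivalence (RepCat p S \<zeta>) (Mcat p) (FObj p S) (FArr p S) J"
proof -
 interpret rep_data p S \<zeta> using assms by unfold_locales auto
 show ?thesis
 proof (intro exI[of _ J] conjI ballI allI F_ribbon)
  fix M N a b k l m n
  assume "M : Obj RC" "N : Obj RC" and S: "a : S" "b : S" and mn: "m : kcar M" "n : kcar N"
  then have K: "is_kmod p M" "is_kmod p N" by simp_all
  show "el (J M N) (tt (FO M) (FO N) (lam k <*> kidem p M a m) (lam l <*> kidem p N b n))
    = ((- 1) powi (a * l) * \<zeta> a b) *\<^sub>C (lam (k + l + \<kappa> a b) <*> (kidem p M a m <*> kidem p N b n))"
   using el_J[OF K S kidem_eig[OF p_pos K(1) mn(1)] kidem_eig[OF p_pos K(2) mn(2)]] by (simp add: Jc_def)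
 qed
qed

end
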